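(* Let $\varepsilon>0$, $T>0$, $U_0>0$, $V_0>0$. The unique weak solution $w$ of the problem $$w_t=\mathcal{D}(w)_{xx}\ \text{ in }(0,\infty)\times(0,T),\qquad w(x,0)=-V_0\ \text{ for }x>0,\qquad w(0,t)=U_0\ \text{ for }t\in(0,T)$$ has a self-similar form: there exist a function $f:[0,\infty)\to\mathbb{R}$ and a constant $a>0$ such that $w(x,t)=f\left(\frac{x}{\sqrt t}\right)$ for $(x,t)\in S_T$, and the free boundary is $\beta(t)=a\sqrt t$, $t\in[0,T]$ (that is, $w(x,t)>0$ if $x<\beta(t)$ and $w(x,t)<0$ if $x>\beta(t)$). Writing $\eta=x/\sqrt t$, $f$ satisfies the system $$\begin{aligned} &-\tfrac12\eta f'(\eta)=[\phi'(f(\eta))f'(\eta)]' &&\text{if }0<\eta<a,\\ &-\tfrac12\eta f'(\eta)=[\varepsilon\phi'(-f(\eta))f'(\eta)]' &&\text{if }\eta>a,\\ &f(0)=U_0,\qquad \lim_{\eta\to\infty}f(\eta)=-V_0,\\ &\lim_{\eta\nearrow a}f(\eta)=0=-\lim_{\eta\searrow a}f(\eta),\\ &\lim_{\eta\nearrow a}\phi'(f(\eta))f'(\eta)=\varepsilon\lim_{\eta\searrow a}\phi'(-f(\eta))f'(\eta), \end{aligned}$$ where a prime on $f$ or on a bracket denotes differentiation with respect to $\eta$.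
   Context: $\phi\in C^2(\mathbb{R})$ is such that $\phi$ and $\phi'$ are strictly increasing on $[0,\infty)$, $\phi(s)>0$ for $s>0$, $\phi(0)=\phi'(0)=0$, and $\int_0^1\frac{\phi'(s)}{s}\,ds<\infty$, $\int_1^\infty\frac{\phi'(s)}{s}\,ds=\infty$. The function $\mathcal{D}$ is $\mathcal{D}(s)=\phi(s)$ for $s\ge0$ and $\mathcal{D}(s)=-\varepsilon\phi(-s)$ for $s<0$. $\mathbb{R}^+=(0,\infty)$ and $S_T=\{(x,t):0\le x<\infty,\ 0<t<T\}$. Weak solution: with $w_0(x)=-V_0$, a function $w$ is a weak solution if (i) $w\in L^\infty(S_T)$; (ii) $\mathcal{D}(w)\in\mathcal{D}(\hat w)+L^2(0,T;W^{1,2}_0(\mathbb{R}^+))$, where $\hat w\in C^\infty([0,\infty))$ is a fixed smooth function of $x$ with $\hat w(0)=U_0$ and $\hat w(x)=-V_0$ for $x>1$; (iii) $\int_{\mathbb{R}^+}w_0(x)\xi(x,0)\,dx+\iint_{S_T}w\,\xi_t\,dx\,dt=\iint_{S_T}\mathcal{D}(w)_x\,\xi_x\,dx\,dt$ for all $\xi\in C^1([0,\infty)\times[0,T])$ with $\xi(0,t)=0$ for $t\in(0,T)$, $\xi(\cdot,T)=0$ and $\operatorname{supp}\xi\subset[0,J]\times[0,T]$ for some $J>0$. Solutions $f$ of the system are understood classically: $f$ is continuous, $f>0$ on $[0,a)$, $f<0$ on $(a,\infty)$, and $f$ is $C^2$ on $(0,a)$ and on $(a,\infty)$. *)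

theory Defs
  imports "HOL-Analysis.Analysis"
begin

section \<open>Function classes\<close>

text \<open>
  \<open>F i\<close> is the \<open>i\<close>-th derivative, taken relative to \<open>S\<close>; it is one-sided at an endpoint
  of a closed interval, so \<open>Ck_on k {0..}\<close> is C^k([0,\<infinity>)) including the boundary point.
\<close>
definition Ck_on :: "nat \<Rightarrow> real set \<Rightarrow> (real \<Rightarrow> real) \<Rightarrow> bool" where
  "Ck_on k S f \<longleftrightarrow>
     (\<exists>F. (\<forall>x\<in>S. F 0 x = f x) \<and>
          (\<forall>i<k. \<forall>x\<in>S. (F i has_real_derivative F (Suc i) x) (at x within S)) \<and>
          (\<forall>i\<le>k. continuous_on S (F i)))"

definition smooth_on :: "real set \<Rightarrow> (real \<Rightarrow> real) \<Rightarrow> bool" where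
  "smooth_on S f \<longleftrightarrow> (\<forall>k. Ck_on k S f)"

text \<open>
  Elements of Lebesgue and Sobolev spaces are represented by functions, identified when they
  agree almost everywhere. Every such class has a Borel measurable representative, so it
  suffices to work with \<open>lborel\<close>.
\<close>
definition L2_on :: "'a::euclidean_space set \<Rightarrow> ('a \<Rightarrow> real) \<Rightarrow> bool" where
  "L2_on A u \<longleftrightarrow>
     set_borel_measurable lborel A u \<and> set_integrable lborel A (\<lambda>x. (u x)\<^sup>2)"

definition Linf_on :: "'a::euclidean_space set \<Rightarrow> ('a \<Rightarrow> real) \<Rightarrow> bool" where
  "Linf_on A u \<longleftrightarrow>
     set_borel_measurable lborel A u \<and> (\<exists>C. AE x in lborel. x \<in> A \<longrightarrow> \<bar>u x\<bar> \<le> C)"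

section \<open>Sobolev spaces on the half-line\<close>

definition C1c_halfline :: "(real \<Rightarrow> real) \<Rightarrow> bool" where
  "C1c_halfline \<psi> \<longleftrightarrow>
     Ck_on 1 {0<..} \<psi> \<and> (\<exists>K. compact K \<and> K \<subseteq> {0<..} \<and> (\<forall>x\<in>{0<..} - K. \<psi> x = 0))"

definition loc_integrable_halfline :: "(real \<Rightarrow> real) \<Rightarrow> bool" where
  "loc_integrable_halfline u \<longleftrightarrow>
     (\<forall>K. compact K \<and> K \<subseteq> {0<..} \<longrightarrow> set_integrable lborel K u)"

definition weak_deriv_halfline :: "(real \<Rightarrow> real) \<Rightarrow> (real \<Rightarrow> real) \<Rightarrow> bool" where
  "weak_deriv_halfline u g \<longleftrightarrow>
     loc_integrable_halfline u \<and> loc_integrable_halfline g \<and>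
     (\<forall>\<psi>. C1c_halfline \<psi> \<longrightarrow>
        (LINT x:{0<..}|lborel. u x * deriv \<psi> x) = - (LINT x:{0<..}|lborel. g x * \<psi> x))"

text \<open>
  The space W_0^{1,2} of the half-line: the closure in W^{1,2} of the compactly supported C^1
  functions (as in Brezis' book; the smooth ones have the same closure).
\<close>
definition W12_0_halfline :: "(real \<Rightarrow> real) set" where
  "W12_0_halfline =
     {u. \<exists>g. L2_on {0<..} u \<and> L2_on {0<..} g \<and> weak_deriv_halfline u g \<and>
          (\<exists>\<psi>. (\<forall>n. C1c_halfline (\<psi> n)) \<and>
               (\<lambda>n::nat. LINT x:{0<..}|lborel. (\<psi> n x - u x)\<^sup>2 + (deriv (\<psi> n) x - g x)\<^sup>2)
                 \<longlonglongrightarrow> 0)}"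

section \<open>Functions on the strip\<close>

definition strip :: "real \<Rightarrow> (real \<times> real) set" where
  "strip T = {0..} \<times> {0<..<T}"

definition weak_dx :: "real \<Rightarrow> (real \<Rightarrow> real \<Rightarrow> real) \<Rightarrow> (real \<Rightarrow> real \<Rightarrow> real) \<Rightarrow> bool" where
  "weak_dx T v g \<longleftrightarrow>
     set_borel_measurable lborel (strip T) (\<lambda>(x, t). g x t) \<and>
     (AE t in lborel. t \<in> {0<..<T} \<longrightarrow> weak_deriv_halfline (\<lambda>x. v x t) (\<lambda>x. g x t))"

text \<open>
  The Bochner space L^2(0,T; W_0^{1,2}), with its elements viewed as functions of \<open>(x, t)\<close>:
  the squared norm is the integral over the strip of the squares of the function and of its
  x-derivative.
\<close>
definition L2_W12_0 :: "real \<Rightarrow> (real \<Rightarrow> real \<Rightarrow> real) \<Rightarrow> bool" where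
  "L2_W12_0 T u \<longleftrightarrow>
     (AE t in lborel. t \<in> {0<..<T} \<longrightarrow> (\<lambda>x. u x t) \<in> W12_0_halfline) \<and>
     L2_on (strip T) (\<lambda>(x, t). u x t) \<and>
     (\<exists>g. weak_dx T u g \<and> L2_on (strip T) (\<lambda>(x, t). g x t))"

section \<open>The weak formulation\<close>

definition diffusivity :: "(real \<Rightarrow> real) \<Rightarrow> real \<Rightarrow> real \<Rightarrow> real" where
  "diffusivity \<phi> \<epsilon> s = (if s \<ge> 0 then \<phi> s else - \<epsilon> * \<phi> (- s))"

text \<open>
  \<open>\<xi>x\<close> and \<open>\<xi>t\<close> are the partial derivatives of \<open>\<xi>\<close>, one-sided on the boundary of
  \<open>{0..} \<times> {0..T}\<close>.
\<close>
definition test_function ::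
  "real \<Rightarrow> (real \<Rightarrow> real \<Rightarrow> real) \<Rightarrow> (real \<Rightarrow> real \<Rightarrow> real) \<Rightarrow> (real \<Rightarrow> real \<Rightarrow> real) \<Rightarrow> bool" where
  "test_function T \<xi> \<xi>x \<xi>t \<longleftrightarrow>
     (\<forall>x\<ge>0. \<forall>t\<in>{0..T}. ((\<lambda>y. \<xi> y t) has_real_derivative \<xi>x x t) (at x within {0..})) \<and>
     (\<forall>x\<ge>0. \<forall>t\<in>{0..T}. ((\<lambda>s. \<xi> x s) has_real_derivative \<xi>t x t) (at t within {0..T})) \<and>
     continuous_on ({0..} \<times> {0..T}) (\<lambda>(x, t). \<xi>x x t) \<and>
     continuous_on ({0..} \<times> {0..T}) (\<lambda>(x, t). \<xi>t x t) \<and>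
     (\<forall>t\<in>{0<..<T}. \<xi> 0 t = 0) \<and>
     (\<forall>x\<ge>0. \<xi> x T = 0) \<and>
     (\<exists>J>0. \<forall>x>J. \<forall>t\<in>{0..T}. \<xi> x t = 0)"

definition weak_solution ::
  "(real \<Rightarrow> real) \<Rightarrow> real \<Rightarrow> real \<Rightarrow> real \<Rightarrow> (real \<Rightarrow> real) \<Rightarrow> (real \<Rightarrow> real \<Rightarrow> real) \<Rightarrow> bool" where
  "weak_solution \<phi> \<epsilon> T V\<^sub>0 what w \<longleftrightarrow>
     Linf_on (strip T) (\<lambda>(x, t). w x t) \<and>
     L2_W12_0 T (\<lambda>x t. diffusivity \<phi> \<epsilon> (w x t) - diffusivity \<phi> \<epsilon> (what x)) \<and>
     (\<exists>g. weak_dx T (\<lambda>x t. diffusivity \<phi> \<epsilon> (w x t)) g \<and>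
        (\<forall>\<xi> \<xi>x \<xi>t. test_function T \<xi> \<xi>x \<xi>t \<longrightarrow>
           (LINT x:{0<..}|lborel. (- V\<^sub>0) * \<xi> x 0)
             + (LINT (x, t):strip T|lborel. w x t * \<xi>t x t)
           = (LINT (x, t):strip T|lborel. g x t * \<xi>x x t)))"

section \<open>The self-similar profile\<close>

definition free_boundary ::
  "real \<Rightarrow> (real \<Rightarrow> real \<Rightarrow> real) \<Rightarrow> (real \<Rightarrow> real) \<Rightarrow> bool" where
  "free_boundary T w \<beta> \<longleftrightarrow>
     (\<forall>(x, t)\<in>strip T. (x < \<beta> t \<longrightarrow> w x t > 0) \<and> (x > \<beta> t \<longrightarrow> w x t < 0))"

definition profile_solution ::
  "(real \<Rightarrow> real) \<Rightarrow> real \<Rightarrow> real \<Rightarrow> real \<Rightarrow> real \<Rightarrow> (real \<Rightarrow> real) \<Rightarrow> bool" where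
  "profile_solution \<phi> \<epsilon> U\<^sub>0 V\<^sub>0 a f \<longleftrightarrow>
     continuous_on {0..} f \<and>
     (\<forall>\<eta>\<in>{0..<a}. f \<eta> > 0) \<and> (\<forall>\<eta>\<in>{a<..}. f \<eta> < 0) \<and>
     Ck_on 2 {0<..<a} f \<and> Ck_on 2 {a<..} f \<and>
     (\<forall>\<eta>\<in>{0<..<a}. ((\<lambda>y. deriv \<phi> (f y) * deriv f y)
        has_real_derivative (- (1/2) * \<eta> * deriv f \<eta>)) (at \<eta>)) \<and>
     (\<forall>\<eta>\<in>{a<..}. ((\<lambda>y. \<epsilon> * deriv \<phi> (- f y) * deriv f y)
        has_real_derivative (- (1/2) * \<eta> * deriv f \<eta>)) (at \<eta>)) \<and>
     f 0 = U\<^sub>0 \<and> (f \<longlongrightarrow> - V\<^sub>0) at_top \<and>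
     (f \<longlongrightarrow> 0) (at_left a) \<and> (f \<longlongrightarrow> 0) (at_right a) \<and>
     (\<exists>l r. ((\<lambda>\<eta>. deriv \<phi> (f \<eta>) * deriv f \<eta>) \<longlongrightarrow> l) (at_left a) \<and>
            ((\<lambda>\<eta>. deriv \<phi> (- f \<eta>) * deriv f \<eta>) \<longlongrightarrow> r) (at_right a) \<and> l = \<epsilon> * r)"

end

theory Submission
  imports Defs
begin

text \<open>
  With \<open>y = f + V\<^sub>0\<close> as independent variable, the flux \<open>q = - D' (f) f'\<close> of a decreasing profile satisfies
  \<open>q' = \<eta> / 2\<close>, and the whole two-phase system with its matching conditions becomes the single singular
  problem \<open>q q'' = - D' (y - V\<^sub>0) / 2\<close>, \<open>q (0) = 0\<close>, \<open>q' (U\<^sub>0 + V\<^sub>0) = 0\<close>. For the boundary value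
  \<open>q (0) = \<delta> > 0\<close> the antitone integral operator has a 2-cycle, which a Wronskian argument shows to be a
  fixed point, and a comparison argument allows \<open>\<delta> \<rightarrow> 0\<close>. The profile is the inverse of \<open>2 q'\<close>, and the free
  boundary is at \<open>a = 2 q' (V\<^sub>0)\<close>.

  The function \<open>f (x / sqrt t)\<close> is a weak solution because it is the \<open>x\<close>-derivative of a \<open>C\<^sup>1\<close> potential
  whose \<open>t\<close>-derivative is \<open>D (w)\<^sub>x\<close>. Uniqueness is Oleinik's argument: the difference of two solutions is
  tested with \<open>\<integral>\<^sub>t\<^sup>T D (v) - D (w)\<close>.
\<close>

section \<open>A singular boundary value problem\<close>

text \<open>The change of variable turns the unknown interface into the known point
  \<open>y = V\<^sub>0\<close>. The degeneracy \<open>D' 0 = 0\<close>, which makes the slope of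
  \<open>f\<close> unbounded there, becomes a mere zero of the right-hand side, and the flux
  condition becomes continuity of \<open>q\<close>. The price is the singular endpoint
  \<open>y = 0\<close>, which must not be reached at a finite \<eta>; it is not, because
  \<open>q'\<close> is unbounded near it.

  Since \<open>f\<close> has no finite derivative at \<open>a\<close>, everything on the strip is
  derived from \<open>D (f)\<close> and \<open>Q - \<eta> f / 2\<close>, with \<open>Q\<close> the
  flux as a function of \<eta>; both are C^1 on (0, \<infinity>).

  Uniqueness meets two obstacles. Oleinik's function is not C^1, so it cannot be inserted into the
  weak identity itself; it is replaced by an identity that holds on almost every time slice against
  all functions of x at once. Moreover a weak solution is not square integrable on the unbounded
  strip. Only \<open>w + V\<^sub>0\<close> is, and this has to be extracted from the square
  integrability of \<open>D (w) - D (what)\<close>, using that \<open>D'\<close> is positive near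
  \<open>- V\<^sub>0\<close>.\<close>

lemma DERIV_transform_on:
  assumes "x \<in> S" "\<And>y. y \<in> S \<Longrightarrow> g y = f y" "(f has_real_derivative D) (at x within S)"
  shows "(g has_real_derivative D) (at x within S)"
  by (rule has_field_derivative_transform_within[OF assms(3) zero_less_one assms(1)]) (use assms(2) in auto)

text \<open>In the application \<open>k y\<close> is half of \<open>D' (y - V)\<close>, so
  \<open>V\<close> is its only zero. The end \<open>y = L\<close> stands for \<eta> = 0, and
  \<open>y = 0\<close> for \<eta> = \<infinity>.\<close>

locale singular_bvp =
  fixes k :: "real \<Rightarrow> real" and L V :: real
  assumes cont_k: "continuous_on {0..L} k"
    and k_zero_or_pos: "\<And>y. y \<in> {0..L} \<Longrightarrow> y \<noteq> V \<Longrightarrow> 0 < k y"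
    and k_V: "k V \<ge> 0" and V_pos: "0 < V" and V_less: "V < L"
begin

lemma k_nonneg: "y \<in> {0..L} \<Longrightarrow> 0 \<le> k y"
  using k_zero_or_pos[of y] k_V by (cases "y = V") auto

lemma L_pos: "0 < L"
  using V_pos V_less by simp

section \<open>The antitone integral operator and its fixed points\<close>

definition admissible :: "(real \<Rightarrow> real) \<Rightarrow> bool" where
  "admissible u \<longleftrightarrow> continuous_on {0..L} u \<and> (\<forall>y\<in>{0..L}. 0 < u y)"

definition slope :: "(real \<Rightarrow> real) \<Rightarrow> real \<Rightarrow> real" where
  "slope u s = integral {s..L} (\<lambda>r. k r / u r)"

text \<open>The solution \<open>v\<close> of \<open>v'' = - k / u\<close> with
  \<open>v 0 = d\<close> and \<open>v' L = 0\<close>, whose derivative is \<open>slope u\<close>. A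
  fixed point solves \<open>u u'' = - k\<close> with these boundary values.\<close>

definition picard :: "real \<Rightarrow> (real \<Rightarrow> real) \<Rightarrow> real \<Rightarrow> real" where
  "picard d u y = d + integral {0..y} (slope u)"

lemma quot_cont: "admissible u \<Longrightarrow> continuous_on {0..L} (\<lambda>r. k r / u r)"
  unfolding admissible_def by (intro continuous_on_divide cont_k) force+

lemma quot_nonneg: "admissible u \<Longrightarrow> y \<in> {0..L} \<Longrightarrow> 0 \<le> k y / u y"
  using k_nonneg[of y] unfolding admissible_def by (simp add: less_imp_le)

lemma quot_integrable: "admissible u \<Longrightarrow> 0 \<le> s \<Longrightarrow> (\<lambda>r. k r / u r) integrable_on {s..L}"
  by (rule integrable_continuous_interval, rule continuous_on_subset[OF quot_cont]) auto

lemma slope_deriv: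
  "admissible u \<Longrightarrow> y \<in> {0..L} \<Longrightarrow> (slope u has_real_derivative - (k y / u y)) (at y within {0..L})"
  unfolding slope_def using integral_has_real_derivative'[OF quot_cont] by simp

lemma slope_cont: "admissible u \<Longrightarrow> continuous_on {0..L} (slope u)"
  by (rule DERIV_continuous_on[OF slope_deriv])

lemma slope_L [simp]: "slope u L = 0"
  unfolding slope_def by simp

lemma slope_nonneg: "admissible u \<Longrightarrow> 0 \<le> s \<Longrightarrow> 0 \<le> slope u s"
  unfolding slope_def by (rule integral_nonneg[OF quot_integrable]) (auto intro!: quot_nonneg)

lemma slope_decreasing:
  "admissible u \<Longrightarrow> 0 \<le> s \<Longrightarrow> s \<le> t \<Longrightarrow> slope u t \<le> slope u s"
  unfolding slope_def
  by (rule integral_subset_le) (auto intro!: quot_integrable quot_nonneg)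

lemma slope_antimono:
  assumes "admissible u" "admissible v" "0 \<le> s" "\<And>y. y \<in> {0..L} \<Longrightarrow> u y \<le> v y"
  shows "slope v s \<le> slope u s"
  unfolding slope_def
proof (rule integral_le)
  fix x assume "x \<in> {s..L}"
  then have x: "x \<in> {0..L}" using assms by auto
  then show "k x / v x \<le> k x / u x"
    using assms k_nonneg[OF x] unfolding admissible_def by (intro divide_left_mono) auto
qed (use assms quot_integrable in auto)

lemma slope_pos:
  assumes "admissible u" "0 \<le> s" "s < L" shows "0 < slope u s"
proof (rule ccontr)
  assume "\<not> 0 < slope u s"
  moreover have "0 \<le> slope u s" using assms slope_nonneg by auto
  ultimately have 0: "integral {s..L} (\<lambda>r. k r / u r) = 0" unfolding slope_def by auto
  \<comment> \<open>Any point of \<open>{s..L}\<close> other than \<open>V\<close> serves: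
    \<open>k\<close> is positive there.\<close>
  define z where "z = (if V \<le> s then L else (s + V)/2)"
  have z: "z \<in> {s..L}" "z \<noteq> V" using assms V_less unfolding z_def by (auto simp: field_simps)
  have "continuous_on {s..L} (\<lambda>r. k r / u r)"
    by (rule continuous_on_subset[OF quot_cont[OF assms(1)]]) (use assms in auto)
  then have "\<forall>r\<in>{s..L}. k r / u r = 0"
    using 0 quot_nonneg[OF assms(1)] assms(2,3) integral_eq_0_iff[of s L "\<lambda>r. k r / u r"] by auto
  then have "k z / u z = 0" using z by auto
  moreover have "0 < k z" "0 < u z" using z assms k_zero_or_pos[of z] unfolding admissible_def by auto
  ultimately show False by simp
qed

lemma picard_deriv:
  "admissible u \<Longrightarrow> y \<in> {0..L} \<Longrightarrow> (picard d u has_real_derivative slope u y) (at y within {0..L})"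
  unfolding picard_def
  by (rule DERIV_cong[OF DERIV_add[OF DERIV_const integral_has_real_derivative[OF slope_cont]]]) auto

lemma slope_integrable: "admissible u \<Longrightarrow> y \<le> L \<Longrightarrow> slope u integrable_on {0..y}"
  by (rule integrable_continuous_interval, rule continuous_on_subset[OF slope_cont]) auto

lemma picard_cont: "admissible u \<Longrightarrow> continuous_on {0..L} (picard d u)"
  by (rule DERIV_continuous_on[OF picard_deriv])

lemma picard_ge: "admissible u \<Longrightarrow> y \<in> {0..L} \<Longrightarrow> d \<le> picard d u y"
  unfolding picard_def using integral_nonneg[OF slope_integrable[of u y]] slope_nonneg[of u] by auto

lemma picard_0 [simp]: "picard d u 0 = d"
  unfolding picard_def by simp

lemma picard_admissible: "admissible u \<Longrightarrow> d > 0 \<Longrightarrow> admissible (picard d u)"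
  using picard_cont picard_ge[of u _ d] unfolding admissible_def by force

lemma const_admissible: "d > 0 \<Longrightarrow> admissible (\<lambda>_. d)"
  unfolding admissible_def by auto

lemma picard_antimono:
  assumes "admissible u" "admissible v" "y \<in> {0..L}" "\<And>y. y \<in> {0..L} \<Longrightarrow> u y \<le> v y"
  shows "picard d v y \<le> picard d u y"
  unfolding picard_def
  using integral_le[OF slope_integrable slope_integrable, of v y u] slope_antimono[of u v] assms by auto

text \<open>The constant depends on \<open>u\<close> only through the lower bound \<open>d\<close>.
  It is therefore common to all iterates and survives pointwise limits, which is how the limits of
  the iteration turn out to be continuous.\<close>

lemma picard_lipschitz:
  assumes "admissible u" "d > 0" "\<And>y. y \<in> {0..L} \<Longrightarrow> d \<le> u y" "x \<in> {0..L}" "y \<in> {0..L}"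
  shows "\<bar>picard c u x - picard c u y\<bar> \<le> slope (\<lambda>_. d) 0 * \<bar>x - y\<bar>"
proof -
  have "norm (picard c u x - picard c u y) \<le> slope (\<lambda>_. d) 0 * norm (x - y)"
  proof (rule field_differentiable_bound[of "{0..L}"])
    fix z assume z: "z \<in> {0..L}"
    have "slope u z \<le> slope u 0" using slope_decreasing[of u 0 z] z assms(1) by auto
    also have "\<dots> \<le> slope (\<lambda>_. d) 0" using slope_antimono[of "\<lambda>_. d" u 0] const_admissible assms by auto
    finally show "norm (slope u z) \<le> slope (\<lambda>_. d) 0" using slope_nonneg[of u z] z assms by auto
  qed (use assms picard_deriv in auto)
  then show ?thesis by simp
qed

text \<open>Dominated convergence with majorant \<open>k / c\<close>. Continuity of \<open>v\<close>
  is not presupposed, since it is unknown for a pointwise limit, and only \<open>{s..L}\<close> is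
  involved, so that limits degenerating at \<open>0\<close> are covered for positive
  \<open>s\<close>.\<close>

lemma slope_tendsto:
  assumes "\<And>n. admissible (u n)" "c > 0" "0 \<le> s"
    and "\<And>n y. y \<in> {s..L} \<Longrightarrow> c \<le> u n y"
    and "\<And>y. y \<in> {s..L} \<Longrightarrow> (\<lambda>n. u n y) \<longlonglongrightarrow> v y"
  shows "(\<lambda>n. slope (u n) s) \<longlonglongrightarrow> slope v s"
  unfolding slope_def
proof (rule dominated_convergence(2)[where h="\<lambda>r. k r / c"])
  show "(\<lambda>r. k r / u n r) integrable_on {s..L}" for n by (rule quot_integrable[OF assms(1,3)])
  show "(\<lambda>r. k r / c) integrable_on {s..L}" by (rule quot_integrable[OF const_admissible[OF assms(2)] assms(3)])
next
  fix n x assume x: "x \<in> {s..L}"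
  then have "0 \<le> k x" using k_nonneg[of x] assms(3) by auto
  moreover have "c \<le> u n x" using x assms(4) by auto
  ultimately show "norm (k x / u n x) \<le> k x / c" using assms(2) by (auto intro!: divide_left_mono)
next
  fix x assume x: "x \<in> {s..L}"
  have "c \<le> v x" by (rule LIMSEQ_le_const[OF assms(5)[OF x]]) (use assms(4) x in auto)
  then show "(\<lambda>n. k x / u n x) \<longlonglongrightarrow> k x / v x"
    using assms(2) assms(5)[OF x] by (intro tendsto_intros) auto
qed

lemma picard_tendsto:
  assumes "\<And>n. admissible (u n)" "c > 0" "y \<in> {0..L}"
    and "\<And>n y. y \<in> {0..L} \<Longrightarrow> c \<le> u n y"
    and "\<And>y. y \<in> {0..L} \<Longrightarrow> (\<lambda>n. u n y) \<longlonglongrightarrow> v y"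
  shows "(\<lambda>n. picard d (u n) y) \<longlonglongrightarrow> picard d v y"
  unfolding picard_def
proof (intro tendsto_add tendsto_const dominated_convergence(2)[where h="slope (\<lambda>_. c)"])
  show "slope (u n) integrable_on {0..y}" for n using assms(1,3) slope_integrable by auto
  show "slope (\<lambda>_. c) integrable_on {0..y}" using slope_integrable const_admissible assms(2,3) by auto
next
  fix n x assume x: "x \<in> {0..y}"
  then show "norm (slope (u n) x) \<le> slope (\<lambda>_. c) x"
    using slope_antimono[of "\<lambda>_. c" "u n" x] slope_nonneg[of "u n" x] assms(1-4) const_admissible by auto
next
  fix x assume x: "x \<in> {0..y}"
  show "(\<lambda>n. slope (u n) x) \<longlonglongrightarrow> slope v x"
    by (rule slope_tendsto[OF assms(1,2)]) (use assms(3-5) x in auto)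
qed

text \<open>The iteration starts at the constant \<open>d\<close>, which lies below every value of
  the operator. For an antitone operator the even iterates then increase, the odd ones decrease, and
  all stay between \<open>d\<close> and the first iterate. Monotonicity yields the two limits, but
  no reason why they should coincide.\<close>

lemma picard_2_cycle:
  assumes d: "d > 0"
  obtains al be where "admissible al" "admissible be"
    "\<And>y. y \<in> {0..L} \<Longrightarrow> be y = picard d al y" "\<And>y. y \<in> {0..L} \<Longrightarrow> al y = picard d be y"
proof -
  define U where "U n = (picard d ^^ n) (\<lambda>_. d)" for n
  have U0: "U 0 = (\<lambda>_. d)" and US: "U (Suc n) = picard d (U n)" for n unfolding U_def by auto
  have adm: "admissible (U n)" for n
    by (induction n) (simp_all add: U0 US const_admissible picard_admissible d)
  have ge: "d \<le> U n y" if "y \<in> {0..L}" for n y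
    using that by (cases n) (simp_all add: U0 US picard_ge adm)
  define C where "C y = picard d (\<lambda>_. d) y" for y
  have le: "U n y \<le> C y" if y: "y \<in> {0..L}" for n y
  proof (cases n)
    case 0 then show ?thesis unfolding C_def using picard_ge const_admissible y d by (simp add: U0)
  next
    case (Suc m) then show ?thesis unfolding C_def
      using picard_antimono[of "\<lambda>_. d" "U m"] ge adm d const_admissible y by (simp add: US)
  qed
  \<comment> \<open>Each application of the operator reverses an inequality, so the comparison of
    even iterates gives that of odd ones and conversely; one induction carries both.\<close>
  have step: "\<forall>y\<in>{0..L}. U (2*n) y \<le> U (2*n+2) y \<and> U (2*n+3) y \<le> U (2*n+1) y" for n
  proof (induction n)
    case 0
    have a: "\<forall>y\<in>{0..L}. U 0 y \<le> U 2 y" using ge by (simp add: U0)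
    moreover have "U 3 y \<le> U 1 y" if "y \<in> {0..L}" for y
      using picard_antimono[of "U 0" "U 2" y d] a adm that US[of 0] US[of 2] by (simp add: eval_nat_numeral)
    ultimately show ?case by (simp add: eval_nat_numeral)
  next
    case (Suc n)
    have a: "U (2*n+2) y \<le> U (2*n+4) y" if "y \<in> {0..L}" for y
      using picard_antimono[of "U (2*n+3)" "U (2*n+1)" y d] Suc adm that US[of "2*n+1"] US[of "2*n+3"]
      by (simp add: eval_nat_numeral)
    moreover have "U (2*n+5) y \<le> U (2*n+3) y" if "y \<in> {0..L}" for y
      using picard_antimono[of "U (2*n+2)" "U (2*n+4)" y d] a adm that US[of "2*n+2"] US[of "2*n+4"]
      by (simp add: eval_nat_numeral)
    ultimately show ?case by (simp add: eval_nat_numeral)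
  qed
  define al where "al y = lim (\<lambda>n. U (2*n) y)" for y
  define be where "be y = lim (\<lambda>n. U (2*n+1) y)" for y
  have al: "(\<lambda>n. U (2*n) y) \<longlonglongrightarrow> al y" if y: "y \<in> {0..L}" for y
    unfolding al_def convergent_LIMSEQ_iff[symmetric]
  proof (rule Bseq_mono_convergent)
    show "Bseq (\<lambda>n. U (2*n) y)" using le[OF y] ge[OF y] d
      by (intro BseqI'[of _ "C y"]) (metis abs_of_nonneg less_imp_le order_trans real_norm_def)
    have "incseq (\<lambda>n. U (2*n) y)" using step y by (intro incseq_SucI) auto
    then show "\<forall>m n. m \<le> n \<longrightarrow> U (2*m) y \<le> U (2*n) y" by (auto simp: incseq_def)
  qed
  have be: "(\<lambda>n. U (2*n+1) y) \<longlonglongrightarrow> be y" if y: "y \<in> {0..L}" for y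
  proof -
    have "decseq (\<lambda>n. U (2*n+1) y)" using step y by (intro decseq_SucI) (auto simp: eval_nat_numeral)
    then obtain l where "(\<lambda>n. U (2*n+1) y) \<longlonglongrightarrow> l" using decseq_convergent[of _ d] ge[OF y] by metis
    then show ?thesis unfolding be_def by (simp add: limI)
  qed
  have bee: "be y = picard d al y" if y: "y \<in> {0..L}" for y
  proof (rule LIMSEQ_unique[OF be[OF y]])
    show "(\<lambda>n. U (2*n+1) y) \<longlonglongrightarrow> picard d al y"
      using picard_tendsto[of "\<lambda>n. U (2*n)" d y al d] adm d ge al y by (simp add: US)
  qed
  have all: "al y = picard d be y" if y: "y \<in> {0..L}" for y
  proof (rule LIMSEQ_unique)
    show "(\<lambda>n. U (2*n+2) y) \<longlonglongrightarrow> al y" using LIMSEQ_Suc[OF al[OF y]] by simp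
    show "(\<lambda>n. U (2*n+2) y) \<longlonglongrightarrow> picard d be y"
      using picard_tendsto[of "\<lambda>n. U (2*n+1)" d y be d, OF adm d y ge be] US by simp
  qed
  have lip: "\<bar>U (Suc n) x - U (Suc n) y\<bar> \<le> slope (\<lambda>_. d) 0 * \<bar>x - y\<bar>" if "x \<in> {0..L}" "y \<in> {0..L}" for n x y
    using picard_lipschitz[OF adm d ge that] by (simp add: US)
  \<comment> \<open>The index \<open>Suc (g n)\<close> restricts attention to values of the
    operator, for which the common Lipschitz bound is available.\<close>
  have cont: "continuous_on {0..L} w"
    if w: "\<And>y. y \<in> {0..L} \<Longrightarrow> (\<lambda>n. U (Suc (g n)) y) \<longlonglongrightarrow> w y" for w g
  proof (rule continuous_on_subset[OF lipschitz_on_continuous_on, of "slope (\<lambda>_. d) 0" "{0..L}"])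
    show "(slope (\<lambda>_. d) 0)-lipschitz_on {0..L} w"
    proof (rule lipschitz_onI)
      fix x y assume xy: "x \<in> {0..L}" "y \<in> {0..L}"
      have "(\<lambda>n. \<bar>U (Suc (g n)) x - U (Suc (g n)) y\<bar>) \<longlonglongrightarrow> \<bar>w x - w y\<bar>"
        using w xy by (intro tendsto_intros) auto
      then show "dist (w x) (w y) \<le> slope (\<lambda>_. d) 0 * dist x y"
        unfolding dist_real_def by (rule LIMSEQ_le_const2) (use lip xy in auto)
    qed (use slope_nonneg const_admissible d in auto)
  qed auto
  have geal: "d \<le> al y" "d \<le> be y" if "y \<in> {0..L}" for y
    using LIMSEQ_le_const[OF al[OF that]] LIMSEQ_le_const[OF be[OF that]] ge[OF that] by auto
  have "continuous_on {0..L} al" 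
    by (rule cont[where g="\<lambda>n. 2*n+1"]) (use LIMSEQ_Suc[OF al] in auto)
  then have "admissible al" unfolding admissible_def using geal d by force
  moreover have "admissible be" unfolding admissible_def
    using geal d cont[where g="\<lambda>n. 2*n" and w=be] be by force
  ultimately show ?thesis using that bee all by blast
qed

text \<open>Both members of a 2-cycle \<open>al\<close>, \<open>be\<close> satisfy \<open>al'' be = - k = be'' al\<close>, so their Wronskian
  is constant; it vanishes at \<open>L\<close>, hence \<open>al / be\<close> is constant.\<close>
lemma picard_fixpoint:
  assumes d: "d > 0"
  obtains u where "admissible u" "\<And>y. y \<in> {0..L} \<Longrightarrow> u y = picard d u y"
proof -
  obtain al be where ab: "admissible al" "admissible be"
    "\<And>y. y \<in> {0..L} \<Longrightarrow> be y = picard d al y" "\<And>y. y \<in> {0..L} \<Longrightarrow> al y = picard d be y"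
    using picard_2_cycle[OF d] by metis
  have pos: "0 < al y" "0 < be y" if "y \<in> {0..L}" for y using ab that unfolding admissible_def by auto
  have dal: "(al has_real_derivative slope be y) (at y within {0..L})" if "y \<in> {0..L}" for y
    by (rule DERIV_transform_on[OF that _ picard_deriv[OF ab(2) that, of d]]) (use ab in auto)
  have dbe: "(be has_real_derivative slope al y) (at y within {0..L})" if "y \<in> {0..L}" for y
    by (rule DERIV_transform_on[OF that _ picard_deriv[OF ab(1) that, of d]]) (use ab in auto)
  have "\<exists>c. \<forall>y\<in>{0..L}. slope be y * be y - slope al y * al y = c"
  proof (rule has_field_derivative_zero_constant)
    fix y assume y: "y \<in> {0..L}"
    show "((\<lambda>y. slope be y * be y - slope al y * al y) has_real_derivative 0) (at y within {0..L})"
      by (rule DERIV_cong[OF DERIV_diff[OF DERIV_mult[OF slope_deriv[OF ab(2) y] dbe[OF y]]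
               DERIV_mult[OF slope_deriv[OF ab(1) y] dal[OF y]]]])
         (use pos[OF y] in \<open>simp add: field_simps\<close>)
  qed auto
  then have W: "slope be y * be y = slope al y * al y" if "y \<in> {0..L}" for y
    using that L_pos by (metis atLeastAtMost_iff diff_self eq_iff_diff_eq_0 less_imp_le mult_zero_left order_refl slope_L)
  have "\<exists>c. \<forall>y\<in>{0..L}. al y / be y = c"
  proof (rule has_field_derivative_zero_constant)
    fix y assume y: "y \<in> {0..L}"
    show "((\<lambda>y. al y / be y) has_real_derivative 0) (at y within {0..L})"
      by (rule DERIV_cong[OF DERIV_divide[OF dal[OF y] dbe[OF y]]])
         (use pos[OF y] W[OF y] in \<open>auto simp: field_simps\<close>)
  qed auto
  \<comment> \<open>Both functions have the value \<open>d\<close> at \<open>0\<close>, so the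
    constant ratio is 1.\<close>
  moreover have "al 0 = be 0" using ab(3)[of 0] ab(4)[of 0] L_pos by simp
  ultimately have "al y = be y" if "y \<in> {0..L}" for y
    using pos that L_pos by (metis atLeastAtMost_iff div_self divide_eq_1_iff less_imp_le order_less_irrefl order_refl)
  then have "slope be y = slope al y" if "y \<in> {0..L}" for y
    unfolding slope_def using that by (intro integral_cong) auto
  then have "picard d be y = picard d al y" if "y \<in> {0..L}" for y
    unfolding picard_def using that by (auto intro!: integral_cong)
  then show ?thesis using that[of al] ab by simp
qed

lemma fixpoint_deriv:
  assumes "admissible u" "\<And>y. y \<in> {0..L} \<Longrightarrow> u y = picard d u y" "y \<in> {0..L}"
  shows "(u has_real_derivative slope u y) (at y within {0..L})"
  by (rule DERIV_transform_on[OF assms(3) _ picard_deriv[OF assms(1,3), of d]]) (use assms in auto)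

text \<open>Where \<open>v - u\<close> is negative it is concave; a negative minimum would therefore propagate to the
  left up to \<open>0\<close>, where \<open>v - u\<close> is nonnegative.\<close>
lemma fixpoint_mono:
  assumes u: "admissible u" "\<And>y. y \<in> {0..L} \<Longrightarrow> u y = picard d u y"
    and v: "admissible v" "\<And>y. y \<in> {0..L} \<Longrightarrow> v y = picard e v y"
    and de: "d \<le> e" and y: "y \<in> {0..L}"
  shows "u y \<le> v y"
proof (rule ccontr)
  assume neg: "\<not> u y \<le> v y"
  define g where "g x = v x - u x" for x
  define g' where "g' x = slope v x - slope u x" for x
  have dg: "(g has_real_derivative g' x) (at x within {0..L})" if "x \<in> {0..L}" for x
    unfolding g_def g'_def using fixpoint_deriv[OF u that] fixpoint_deriv[OF v that] by (rule DERIV_diff[rotated])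
  have dg': "(g' has_real_derivative (k x / u x - k x / v x)) (at x within {0..L})" if "x \<in> {0..L}" for x
    unfolding g'_def
    by (rule DERIV_cong[OF DERIV_diff[OF slope_deriv[OF v(1) that] slope_deriv[OF u(1) that]]]) auto
  have cg: "continuous_on {0..L} g" by (rule DERIV_continuous_on[OF dg])
  have cg': "continuous_on {0..L} g'" by (rule DERIV_continuous_on[OF dg'])
  obtain m where m: "m \<in> {0..L}" "\<And>x. x \<in> {0..L} \<Longrightarrow> g m \<le> g x"
    using continuous_attains_inf[OF _ _ cg] y by (metis compact_Icc empty_iff)
  have gm: "g m < 0" using m(2)[OF y] neg unfolding g_def by simp
  have g0: "g 0 \<ge> 0" using u(2)[of 0] v(2)[of 0] L_pos de unfolding g_def by simp
  then have m0: "0 < m" using gm m(1) by (cases "m = 0") auto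
  have at: "at x within {0..L} = at x" if "0 < x" "x < L" for x
    using that at_within_Icc_at by blast
  \<comment> \<open>At \<open>m = L\<close> the boundary condition \<open>slope u L = 0\<close>
    takes the place of the first-order condition at an interior minimum.\<close>
  have g'm: "g' m = 0"
  proof (cases "m = L")
    case True then show ?thesis unfolding g'_def by simp
  next
    case False
    then have "m < L" using m by auto
    then show ?thesis
      using DERIV_local_min[of g "g' m" m "min m (L - m)"] dg[OF m(1)] at[OF m0] m0 m(2)
      by (auto simp: abs_if split: if_splits)
  qed
  define S where "S = {x\<in>{0..m}. g x \<ge> 0}"
  have Scl: "closed S"
  proof -
    have "S = {0..m} \<inter> g -` {0..}" unfolding S_def by auto
    moreover have "closed ({0..m} \<inter> g -` {0..})"
      by (rule continuous_closed_preimage) (use m continuous_on_subset[OF cg] in auto)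
    ultimately show ?thesis by simp
  qed
  have Sne: "0 \<in> S" using g0 m0 unfolding S_def by auto
  \<comment> \<open>The last point before \<open>m\<close> where \<open>g\<close> is nonnegative.
    Between \<open>z\<close> and \<open>m\<close> the derivative \<open>g'\<close> decreases to 0,
    hence is nonnegative, and \<open>g\<close> cannot fall to the negative value at
    \<open>m\<close>.\<close>
  define z where "z = Sup S"
  have bdd: "bdd_above S" unfolding S_def by auto
  have "z \<in> S" unfolding z_def using closed_contains_Sup[OF _ bdd Scl] Sne by auto
  then have z: "0 \<le> z" "z \<le> m" "g z \<ge> 0" unfolding S_def by auto
  then have zm: "z < m" using gm by (cases "z = m") auto
  have gneg: "g x < 0" if "z < x" "x \<le> m" for x
  proof (rule ccontr)
    assume "\<not> g x < 0"
    then have "x \<in> S" unfolding S_def using that z by auto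
    then show False using cSup_upper[OF _ bdd, of x] that unfolding z_def by auto
  qed
  have g'pos: "0 \<le> g' x" if x: "z < x" "x < m" for x
  proof -
    have "g' m \<le> g' x"
    proof (rule DERIV_nonpos_imp_decreasing_open[of x m g'])
      fix s assume s: "x < s" "s < m"
      then have sL: "s \<in> {0..L}" "0 < s" "s < L" using x z m by auto
      have "v s < u s" using gneg[of s] s x unfolding g_def by auto
      then have "k s / u s \<le> k s / v s"
        using k_nonneg[OF sL(1)] u(1) v(1) sL unfolding admissible_def by (intro divide_left_mono) auto
      then show "\<exists>y. (g' has_real_derivative y) (at s) \<and> y \<le> 0"
        using dg'[OF sL(1)] at[OF sL(2,3)] by auto
    next
      show "continuous_on {x..m} g'" by (rule continuous_on_subset[OF cg']) (use x z m in auto)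
    qed (use x in auto)
    then show ?thesis using g'm by simp
  qed
  have "g z \<le> g m"
  proof (rule DERIV_nonneg_imp_increasing_open[of z m g])
    fix s assume s: "z < s" "s < m"
    then have sL: "s \<in> {0..L}" "0 < s" "s < L" using z m by auto
    show "\<exists>y. (g has_real_derivative y) (at s) \<and> 0 \<le> y"
      using dg[OF sL(1)] at[OF sL(2,3)] g'pos[OF s] by auto
  next
    show "continuous_on {z..m} g" by (rule continuous_on_subset[OF cg]) (use z m in auto)
  qed (use zm in auto)
  then show False using z gm by simp
qed

text \<open>By comparison the fixed points \<open>v n\<close> decrease as \<open>d n\<close> tends
  to 0, while antitonicity makes \<open>v n - d n\<close> increase. The limit is thus trapped within
  \<open>d n\<close> of \<open>v n\<close>: convergence is uniform, and \<open>v 0 - d 0\<close>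
  keeps the limit positive away from \<open>0\<close>.\<close>

theorem singular_solution:
  obtains q p where "continuous_on {0..L} q" "q 0 = 0" "\<And>y. 0 < y \<Longrightarrow> y \<le> L \<Longrightarrow> 0 < q y"
    "\<And>y. 0 < y \<Longrightarrow> y < L \<Longrightarrow> (q has_real_derivative p y) (at y)"
    "\<And>y. 0 < y \<Longrightarrow> y < L \<Longrightarrow> (p has_real_derivative - (k y / q y)) (at y)"
    "continuous_on {0<..L} p" "p L = 0" "\<And>y. 0 < y \<Longrightarrow> y < L \<Longrightarrow> 0 < p y"
    "\<And>B. \<exists>y. 0 < y \<and> y < V \<and> B < p y"
proof -
  define d where "d n = 1 / real (Suc n)" for n
  have d: "0 < d n" for n unfolding d_def by simp
  have dmono: "d m \<le> d n" if "n \<le> m" for m n using that unfolding d_def by (simp add: frac_le)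
  have d0: "d \<longlonglongrightarrow> 0" using LIMSEQ_inverse_real_of_nat unfolding d_def by (simp add: inverse_eq_divide)
  have "\<exists>u. admissible u \<and> (\<forall>y\<in>{0..L}. u y = picard (d n) u y)" for n
    using picard_fixpoint[OF d[of n]] by metis
  then obtain v where v: "\<And>n. admissible (v n)" "\<And>n y. y \<in> {0..L} \<Longrightarrow> v n y = picard (d n) (v n) y"
    by metis
  have vmono: "v m y \<le> v n y" if "n \<le> m" "y \<in> {0..L}" for m n y
    by (rule fixpoint_mono[OF v v dmono[OF that(1)] that(2)])
  have vdiff: "v n y - d n \<le> v m y - d m" if "n \<le> m" "y \<in> {0..L}" for m n y
    using picard_antimono[OF v(1) v(1) that(2) vmono[OF that(1)], of 0] v(2)[OF that(2)]
    unfolding picard_def by (smt (verit))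
  have vpos: "0 < v n y" if "y \<in> {0..L}" for n y using v(1)[of n] that unfolding admissible_def by auto
  define q where "q y = lim (\<lambda>n. v n y)" for y
  have q: "(\<lambda>n. v n y) \<longlonglongrightarrow> q y" if y: "y \<in> {0..L}" for y
  proof -
    have "decseq (\<lambda>n. v n y)" using vmono y by (auto simp: decseq_def)
    then obtain l where "(\<lambda>n. v n y) \<longlonglongrightarrow> l" using decseq_convergent[of _ 0] vpos[OF y] by (metis less_imp_le)
    then show ?thesis unfolding q_def by (simp add: limI)
  qed
  have qle: "q y \<le> v n y" if "y \<in> {0..L}" for n y
    by (rule LIMSEQ_le_const2[OF q[OF that]]) (use vmono that in auto)
  have qge: "v n y - d n \<le> q y" if "y \<in> {0..L}" for n y
  proof (rule LIMSEQ_le_const)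
    show "(\<lambda>m. v m y - d m) \<longlonglongrightarrow> q y" using tendsto_diff[OF q[OF that] d0] by simp
  qed (use vdiff that in auto)
  have qc: "continuous_on {0..L} q"
  proof (rule uniform_limit_theorem[of _ v])
    show "\<forall>\<^sub>F n in sequentially. continuous_on {0..L} (v n)" using v(1) unfolding admissible_def by auto
    show "uniform_limit {0..L} v q sequentially"
    proof (rule uniform_limitI)
      fix e :: real assume "e > 0"
      then have "\<forall>\<^sub>F n in sequentially. d n < e" using d0 order_tendstoD(2) by blast
      then show "\<forall>\<^sub>F n in sequentially. \<forall>x\<in>{0..L}. dist (v n x) (q x) < e"
      proof eventually_elim
        case (elim n)
        show ?case using qle[of _ n] qge[of _ n] elim by (force simp: dist_real_def abs_if)
      qed
    qed
  qed auto
  have q0: "q 0 = 0"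
  proof (rule LIMSEQ_unique[OF q])
    show "(\<lambda>n. v n 0) \<longlonglongrightarrow> 0" using d0 v(2)[of 0] L_pos by simp
  qed (use L_pos in auto)
  have lowerinc: "v 0 x - d 0 \<le> v 0 y - d 0" if "0 \<le> x" "x \<le> y" "y \<le> L" for x y
  proof -
    have "integral {0..x} (slope (v 0)) \<le> integral {0..y} (slope (v 0))"
      by (rule integral_subset_le) (use slope_integrable v(1) slope_nonneg that in auto)
    then show ?thesis using v(2)[of x 0] v(2)[of y 0] that unfolding picard_def by simp
  qed
  have vd0: "0 < v 0 y - d 0" if y: "0 < y" "y \<le> L" for y
  proof -
    \<comment> \<open>The midpoint stays away from \<open>L\<close>, where the slope vanishes, so
      the estimate includes \<open>y = L\<close>.\<close>
    have "0 < slope (v 0) (y/2) * (y/2)" using slope_pos[OF v(1), of "y/2" 0] y by auto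
    also have "\<dots> \<le> v 0 (y/2) - d 0"
    proof -
      have "integral {0..y/2} (\<lambda>_. slope (v 0) (y/2)) \<le> integral {0..y/2} (slope (v 0))"
        by (rule integral_le) (use slope_integrable v(1) y slope_decreasing in auto)
      then show ?thesis using v(2)[of "y/2" 0] y unfolding picard_def by (simp add: mult.commute)
    qed
    also have "\<dots> \<le> v 0 y - d 0" using lowerinc[of "y/2" y] y by auto
    finally show ?thesis .
  qed
  have qpos: "0 < q y" if y: "0 < y" "y \<le> L" for y
    using vd0[OF y] qge[of y 0] y by auto
  \<comment> \<open>As \<open>q\<close> vanishes at \<open>0\<close> it is not admissible, and the
    facts about \<open>slope\<close> do not apply to it. Hence \<open>p\<close> is studied on
    \<open>{c..L}\<close> with \<open>0 < c\<close>, or as the limit of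
    \<open>slope (v n)\<close>.\<close>
  define p where "p = slope q"
  have slim: "(\<lambda>n. slope (v n) s) \<longlonglongrightarrow> p s" if s: "0 < s" "s \<le> L" for s
    unfolding p_def
  proof (rule slope_tendsto[OF v(1) vd0[OF s]])
    fix n y assume y: "y \<in> {s..L}"
    then have "v 0 s - d 0 \<le> v 0 y - d 0" using lowerinc[of s y] s by auto
    also have "\<dots> \<le> q y" using qge y s by auto
    also have "\<dots> \<le> v n y" using qle y s by auto
    finally show "v 0 s - d 0 \<le> v n y" .
  qed (use s q in auto)
  have slope_le_p: "slope (v n) s \<le> p s" if s: "0 < s" "s \<le> L" for n s
  proof (rule LIMSEQ_le_const[OF slim[OF s]], intro exI allI impI)
    fix m assume nm: "n \<le> m"
    show "slope (v n) s \<le> slope (v m) s"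
      by (rule slope_antimono[OF v(1) v(1) _ vmono[OF nm]]) (use s in auto)
  qed
  have kq: "continuous_on {c..L} (\<lambda>r. k r / q r)" if "0 < c" for c
  proof (intro continuous_on_divide continuous_on_subset[OF cont_k] continuous_on_subset[OF qc] ballI)
    show "q r \<noteq> 0" if "r \<in> {c..L}" for r using qpos[of r] that \<open>0 < c\<close> by auto
  qed (use that in auto)
  have pd: "(p has_real_derivative - (k y / q y)) (at y within {c..L})" if "0 < c" "y \<in> {c..L}" for c y
    unfolding p_def slope_def using integral_has_real_derivative'[OF kq[OF that(1)] that(2)] .
  have pcc: "continuous_on {c..L} p" if "0 < c" for c
    by (rule DERIV_continuous_on[OF pd[OF that]])
  have pnn: "0 < p y" if y: "0 < y" "y < L" for y
  proof -
    have "slope (v 0) y \<le> p y"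
      by (rule slope_le_p) (use y in auto)
    then show ?thesis using slope_pos[OF v(1) _ y(2), of 0] y by simp
  qed
  have qint: "q b - q a = integral {a..b} p" if ab: "0 < a" "a \<le> b" "b \<le> L" for a b
  proof (rule LIMSEQ_unique)
    show "(\<lambda>n. v n b - v n a) \<longlonglongrightarrow> q b - q a" using ab q by (intro tendsto_intros) auto
    have "v n b - v n a = integral {a..b} (slope (v n))" for n
    proof -
      have "(slope (v n) has_integral (v n b - v n a)) {a..b}"
      proof (rule fundamental_theorem_of_calculus[OF ab(2)])
        fix x assume x: "x \<in> {a..b}"
        then have "(v n has_real_derivative slope (v n) x) (at x within {0..L})"
          by (intro fixpoint_deriv[OF v]) (use ab in auto)
        then have "(v n has_real_derivative slope (v n) x) (at x within {a..b})"
          by (rule DERIV_subset) (use ab in auto)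
        then show "(v n has_vector_derivative slope (v n) x) (at x within {a..b})"
          by (simp add: has_real_derivative_iff_has_vector_derivative)
      qed
      then show ?thesis by (simp add: integral_unique)
    qed
    moreover have "(\<lambda>n. integral {a..b} (slope (v n))) \<longlonglongrightarrow> integral {a..b} p"
    \<comment> \<open>The slopes decrease in the variable and increase with \<open>n\<close> towards
      \<open>p\<close>, so \<open>p a\<close> bounds all of them on \<open>{a..b}\<close>.\<close>
    proof (rule dominated_convergence(2)[where h="\<lambda>_. p a"])
      show "slope (v n) integrable_on {a..b}" for n
        by (rule integrable_continuous_interval[OF continuous_on_subset[OF slope_cont[OF v(1)]]]) (use ab in auto)
      fix n x assume x: "x \<in> {a..b}"
      have "slope (v n) x \<le> slope (v n) a" using slope_decreasing[OF v(1)] ab x by auto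
      also have "\<dots> \<le> p a"
        by (rule slope_le_p) (use ab in auto)
      finally show "norm (slope (v n) x) \<le> p a" using slope_nonneg[OF v(1), of x n] x ab by auto
    qed (use slim ab in auto)
    ultimately show "(\<lambda>n. v n b - v n a) \<longlonglongrightarrow> integral {a..b} p" by simp
  qed
  have qd: "(q has_real_derivative p y) (at y)" if y: "0 < y" "y < L" for y
  proof -
    have 1: "((\<lambda>x. q (y/2) + integral {y/2..x} p) has_real_derivative p y) (at y within {y/2..L})"
      using integral_has_real_derivative[OF pcc[of "y/2"], of y] y by (auto intro!: derivative_eq_intros)
    have 2: "q x = q (y/2) + integral {y/2..x} p" if "x \<in> {y/2..L}" for x
      using qint[of "y/2" x] that y by simp
    have "(q has_real_derivative p y) (at y within {y/2..L})"
      by (rule DERIV_transform_on[OF _ 2 1]) (use y in auto)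
    then show ?thesis using at_within_Icc_at[of "y/2" y L] y by auto
  qed
  have pd': "(p has_real_derivative - (k y / q y)) (at y)" if y: "0 < y" "y < L" for y
    using pd[of "y/2" y] at_within_Icc_at[of "y/2" y L] y by auto
  have pcont: "continuous_on {0<..L} p"
  proof (rule continuous_on_eq_continuous_within[THEN iffD2, rule_format])
    fix y assume y: "y \<in> {0<..L}"
    have "continuous (at y within {y/2..L}) p" 
      using pcc[of "y/2"] y unfolding continuous_on_eq_continuous_within by auto
    moreover have "at y within {0<..L} = at y within {y/2..L}"
      by (rule at_within_nhd[of _ "{y/2<..}"]) (use y in auto)
    ultimately show "continuous (at y within {0<..L}) p" by simp
  qed
  \<comment> \<open>If \<open>p\<close> were bounded by \<open>B\<close>, then
    \<open>q y \<le> B y\<close>, so \<open>- p' = k / q\<close> would be at least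
    \<open>m / (B y)\<close> near \<open>0\<close>, and integration would make \<open>p\<close>
    larger than an unbounded logarithm.\<close>
  have unb: "\<exists>y. 0 < y \<and> y < V \<and> B < p y" for B
  proof (rule ccontr)
    assume "\<not> ?thesis"
    then have B: "p y \<le> B" if "0 < y" "y < V" for y using that by force
    \<comment> \<open>Strictly below \<open>V\<close>, so that \<open>k\<close> has a positive
      minimum on \<open>{0..c}\<close>.\<close>
    define c where "c = V/2"
    have c: "0 < c" "c < V" "c < L" using V_pos V_less unfolding c_def by auto
    have Bp: "0 < B" using B[OF c(1,2)] pnn[of c] c by auto
    have qB: "q y \<le> B * y" if y: "0 < y" "y \<le> c" for y
    proof -
      have "B * 0 - q 0 \<le> B * y - q y"
      proof (rule DERIV_nonneg_imp_increasing_open[of 0 y "\<lambda>x. B * x - q x"])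
        fix x assume "0 < x" "x < y"
        then show "\<exists>z. ((\<lambda>x. B * x - q x) has_real_derivative z) (at x) \<and> 0 \<le> z"
          using qd[of x] B[of x] y c by (intro exI[of _ "B - p x"]) (auto intro!: derivative_eq_intros)
      next
        show "continuous_on {0..y} (\<lambda>x. B * x - q x)"
          by (intro continuous_intros continuous_on_subset[OF qc]) (use y c in auto)
      qed (use y in auto)
      then show ?thesis using q0 by simp
    qed
    obtain x0 where x0: "x0 \<in> {0..c}" "\<And>x. x \<in> {0..c} \<Longrightarrow> k x0 \<le> k x"
      using continuous_attains_inf[of "{0..c}" k] continuous_on_subset[OF cont_k, of "{0..c}"] c
      by (auto simp: Ball_def) 
    define m where "m = k x0"
    have m: "0 < m" unfolding m_def using k_zero_or_pos[of x0] x0(1) c by auto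
    \<comment> \<open>Chosen so that \<open>m / B * ln (c / y)\<close> equals
      \<open>B + m / B\<close>, which exceeds the supposed bound.\<close>
    define y where "y = c * exp (- (B * B / m) - 1)"
    have y: "0 < y" "y < c"
    proof -
      have "0 < B * B / m" using m Bp by simp
      then have "- (B * B / m) - 1 < 0" by linarith
      then show "0 < y" "y < c" using c unfolding y_def by auto
    qed
    have "p c + m / B * ln c \<le> p y + m / B * ln y"
    proof (rule DERIV_nonpos_imp_nonincreasing[of y c "\<lambda>x. p x + m / B * ln x"])
      fix x assume x: "y \<le> x" "x \<le> c"
      have "m / B / x \<le> k x / q x"
      proof -
        have "m / (B * x) \<le> k x / q x"
          by (rule frac_le) (use x y x0 c m qB[of x] qpos[of x] k_nonneg[of x] in \<open>auto simp: m_def\<close>)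
        then show ?thesis by simp
      qed
      then show "\<exists>z. ((\<lambda>x. p x + m / B * ln x) has_real_derivative z) (at x) \<and> z \<le> 0"
        using x y c Bp pd'[of x]
        by (intro exI[of _ "- (k x / q x) + m / B / x"]) (auto intro!: derivative_eq_intros)
    qed (use y in auto)
    moreover have "ln y = ln c - B * B / m - 1" unfolding y_def using c by (simp add: ln_mult)
    ultimately have "p c + m / B * (B * B / m + 1) \<le> p y" by (simp add: algebra_simps)
    moreover have "m / B * (B * B / m + 1) = B + m / B" using m Bp by (simp add: field_simps)
    moreover have "m / B > 0" using m Bp by simp
    ultimately have "B < p y" using pnn[of c] c by linarith
    then show False using B[of y] y c by auto
  qed
  show ?thesis
    by (rule that[of q p]) (use qc q0 qpos qd pd' pcont pnn unb in \<open>auto simp: p_def\<close>)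
qed

end

section \<open>The self-similar profile\<close>

lemma MVT_real:
  fixes f f' :: "real \<Rightarrow> real"
  assumes "a < b" "continuous_on {a..b} f"
    and "\<And>x. a < x \<Longrightarrow> x < b \<Longrightarrow> (f has_real_derivative f' x) (at x)"
  obtains z where "a < z" "z < b" "f b - f a = (b - a) * f' z"
proof -
  have "f differentiable (at x)" if "a < x" "x < b" for x
    using assms(3)[OF that] real_differentiable_def by blast
  then obtain l z where "a < z" "z < b" "(f has_real_derivative l) (at z)" "f b - f a = (b - a) * l"
    using MVT[OF assms(1,2)] by blast
  then show ?thesis using that DERIV_unique[OF assms(3)[of z]] by metis
qed

text \<open>By continuity \<open>h\<close> is the integral of \<open>r\<close> across the
  exceptional point. This carries derivatives across the free boundary, where the formula
  \<open>- Q / D' (f)\<close> for the slope of \<open>f\<close> would divide by zero.\<close>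

lemma derivative_at_removable_point:
  fixes h r :: "real \<Rightarrow> real"
  assumes h: "continuous_on {0<..} h" and r: "continuous_on {0<..} r"
    and d: "\<And>x. 0 < x \<Longrightarrow> x \<noteq> a \<Longrightarrow> (h has_real_derivative r x) (at x)" and x: "0 < x"
  shows "(h has_real_derivative r x) (at x)"
proof -
  have 1: "((\<lambda>y. h (x/2) + integral {x/2..y} r) has_real_derivative r x) (at x within {x/2..2*x})"
  proof (rule DERIV_cong[OF DERIV_add[OF DERIV_const integral_has_real_derivative]])
    show "continuous_on {x/2..2*x} r" by (rule continuous_on_subset[OF r]) (use x in auto)
  qed (use x in auto)
  have 2: "h y = h (x/2) + integral {x/2..y} r" if y: "y \<in> {x/2..2*x}" for y
  proof -
    have "(r has_integral (h y - h (x/2))) {x/2..y}"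
    proof (rule fundamental_theorem_of_calculus_interior_strong[of "{a}"])
      show "continuous_on {x/2..y} h" by (rule continuous_on_subset[OF h]) (use x y in auto)
      show "(h has_vector_derivative r z) (at z)" if "z \<in> {x/2<..<y} - {a}" for z
        using d[of z] that x by (auto simp: has_real_derivative_iff_has_vector_derivative)
    qed (use y in auto)
    then show ?thesis by (simp add: integral_unique)
  qed
  have "(h has_real_derivative r x) (at x within {x/2..2*x})"
    by (rule DERIV_transform_on[OF _ 2 1]) (use x in auto)
  then show ?thesis using at_within_Icc_at[of "x/2" x "2*x"] x by simp
qed

text \<open>The second derivative is asked for only off \<open>0\<close>: with different
  coefficients in the two phases, \<open>D'\<close> has in general a corner there.\<close>

locale two_phase =
  fixes D D' D'' :: "real \<Rightarrow> real" and U V :: real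
  assumes D_deriv: "\<And>s. (D has_real_derivative D' s) (at s)"
    and D'_cont: "continuous_on UNIV D'"
    and D'_0: "D' 0 = 0" and D'_pos: "\<And>s. s \<noteq> 0 \<Longrightarrow> 0 < D' s"
    and D'_deriv: "\<And>s. s \<noteq> 0 \<Longrightarrow> (D' has_real_derivative D'' s) (at s)"
    and D''_cont: "continuous_on (- {0}) D''"
    and U_pos: "0 < U" and V_pos: "0 < V"
begin

lemma D_cont: "continuous_on S D"
  by (rule DERIV_continuous_on[OF has_field_derivative_at_within[OF D_deriv]])

text \<open>Three of the conclusions carry the analysis on the strip. The derivatives of
  \<open>D (f)\<close> and of \<open>Q - \<eta> f / 2\<close> hold at \<open>a\<close> as well,
  although those of \<open>f\<close> and \<open>Q\<close> are given only off \<open>a\<close>. The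
  bound of \<open>\<eta> * (f \<eta> + V) / 2\<close> by \<open>Q\<close> is the inequality
  \<open>y * q' y \<le> q y\<close> for the concave function \<open>q\<close> with
  \<open>q 0 = 0\<close>, and it controls the decay of \<open>f + V\<close>.\<close>

theorem profile_exists:
  obtains f Q a where "0 < a" "f 0 = U" "continuous_on {0..} f" "continuous_on {0..} Q"
    "(f \<longlongrightarrow> - V) at_top" "\<And>\<eta>. 0 \<le> \<eta> \<Longrightarrow> \<eta> < a \<Longrightarrow> 0 < f \<eta>" "f a = 0" "\<And>\<eta>. a < \<eta> \<Longrightarrow> f \<eta> < 0"
    "\<And>\<eta>. 0 \<le> \<eta> \<Longrightarrow> - V < f \<eta>" "\<And>\<eta>. 0 \<le> \<eta> \<Longrightarrow> f \<eta> \<le> U"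
    "\<And>\<eta>. 0 \<le> \<eta> \<Longrightarrow> 0 < Q \<eta>" "\<And>\<eta>. 0 \<le> \<eta> \<Longrightarrow> Q \<eta> \<le> Q 0"
    "\<And>\<eta>. 0 \<le> \<eta> \<Longrightarrow> \<eta> * (f \<eta> + V) / 2 \<le> Q \<eta>"
    "\<And>\<eta>. 0 < \<eta> \<Longrightarrow> \<eta> \<noteq> a \<Longrightarrow> (f has_real_derivative - Q \<eta> / D' (f \<eta>)) (at \<eta>)"
    "\<And>\<eta>. 0 < \<eta> \<Longrightarrow> \<eta> \<noteq> a \<Longrightarrow> (Q has_real_derivative - \<eta> * Q \<eta> / (2 * D' (f \<eta>))) (at \<eta>)"
    "\<And>\<eta>. 0 < \<eta> \<Longrightarrow> ((\<lambda>\<eta>. D (f \<eta>)) has_real_derivative - Q \<eta>) (at \<eta>)"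
    "\<And>\<eta>. 0 < \<eta> \<Longrightarrow> ((\<lambda>\<eta>. Q \<eta> - \<eta> * f \<eta> / 2) has_real_derivative - f \<eta> / 2) (at \<eta>)"
proof -
  define k where "k y = D' (y - V) / 2" for y
  define L where "L = U + V"
  have VL: "0 < V" "V < L" using U_pos V_pos unfolding L_def by auto
  have kc: "continuous_on UNIV k" unfolding k_def
    by (intro continuous_intros continuous_on_compose2[OF D'_cont]) auto
  have kpos: "0 < k y" if "y \<noteq> V" for y using D'_pos[of "y - V"] that unfolding k_def by simp
  interpret singular_bvp k L V
    by unfold_locales (use VL kpos D'_0 continuous_on_subset[OF kc] in \<open>auto simp: k_def\<close>)
  obtain q p where qc: "continuous_on {0..L} q" and q0: "q 0 = 0"
    and qpos: "\<And>y. 0 < y \<Longrightarrow> y \<le> L \<Longrightarrow> 0 < q y"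
    and qd: "\<And>y. 0 < y \<Longrightarrow> y < L \<Longrightarrow> (q has_real_derivative p y) (at y)"
    and pd: "\<And>y. 0 < y \<Longrightarrow> y < L \<Longrightarrow> (p has_real_derivative - (k y / q y)) (at y)"
    and pc: "continuous_on {0<..L} p" and pL: "p L = 0"
    and ppos: "\<And>y. 0 < y \<Longrightarrow> y < L \<Longrightarrow> 0 < p y"
    and unb: "\<And>B. \<exists>y. 0 < y \<and> y < V \<and> B < p y"
    by (rule singular_solution) blast
  \<comment> \<open>The derivative of \<open>p\<close> vanishes at \<open>V\<close>, so strict
    decrease is shown on each side of \<open>V\<close> and then combined.\<close>
  have pdec1: "p y < p x" if xy: "0 < x" "x < y" "y \<le> L" and V: "V \<le> x \<or> y \<le> V" for x y
  proof (rule DERIV_neg_imp_decreasing_open[OF xy(2)])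
    fix z assume z: "x < z" "z < y"
    then show "\<exists>w. (p has_real_derivative w) (at z) \<and> w < 0"
      using pd[of z] kpos[of z] qpos[of z] xy V by (intro exI[of _ "- (k z / q z)"]) auto
  next
    show "continuous_on {x..y} p" by (rule continuous_on_subset[OF pc]) (use xy in auto)
  qed
  have pdec: "p y < p x" if xy: "0 < x" "x < y" "y \<le> L" for x y
    using pdec1[of x V] pdec1[of V y] pdec1[OF xy] xy by (cases "V \<le> x \<or> y \<le> V") auto
  \<comment> \<open>\<open>2 * p\<close> is continued beyond \<open>L\<close> so that it has a continuous inverse on the whole line.\<close>
  define P where "P y = 2 * p (min y L) - (max y L - L)" for y
  have Pc: "continuous_on {0<..} P" unfolding P_def
    by (intro continuous_intros continuous_on_compose2[OF pc]) (use VL in auto)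
  have Pdec: "P y < P x" if "0 < x" "x < y" for x y
    using pdec[of x y] pdec[of x L] that unfolding P_def by (cases "x = L") (auto simp: min_def max_def)
  have PL: "P y = 2 * p y" if "y \<le> L" for y using that unfolding P_def by auto
  have Pinj: "inj_on P {0<..}"
    by (rule inj_onI) (metis Pdec greaterThan_iff less_irrefl linorder_neqE_linordered_idom)
  have Psurj: "\<exists>y>0. P y = \<eta>" for \<eta>
  proof -
    obtain y1 where y1: "0 < y1" "y1 < V" "\<bar>\<eta>\<bar> < p y1" using unb by blast
    define y2 where "y2 = L + \<bar>\<eta>\<bar>"
    have "P y2 \<le> \<eta>" unfolding P_def y2_def using pL by auto
    moreover have "\<eta> \<le> P y1" using y1 VL PL[of y1] by auto
    moreover have "y1 \<le> y2" using y1 VL unfolding y2_def by auto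
    moreover have "continuous_on {y1..y2} P" by (rule continuous_on_subset[OF Pc]) (use y1 in auto)
    ultimately obtain y where "y1 \<le> y" "y \<le> y2" "P y = \<eta>"
      using IVT2'[of P y2 \<eta> y1] by blast
    then show ?thesis using y1 by (intro exI[of _ y]) auto
  qed
  define Y where "Y = inv_into {0<..} P"
  have Ypos: "0 < Y \<eta>" and PY: "P (Y \<eta>) = \<eta>" for \<eta>
    using Psurj[of \<eta>] inv_into_into[of \<eta> P "{0<..}"] f_inv_into_f[of \<eta> P "{0<..}"] unfolding Y_def by auto
  have YP: "Y (P y) = y" if "0 < y" for y
    unfolding Y_def using that by (intro inv_into_f_f[OF Pinj]) auto
  have Ydec: "Y \<eta>' < Y \<eta>" if "\<eta> < \<eta>'" for \<eta> \<eta>'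
    using Pdec[OF Ypos[of \<eta>], of "Y \<eta>'"] PY that
    by (metis linorder_neqE_linordered_idom order_less_asym)
  have Yc: "continuous_on UNIV Y"
  proof -
    \<comment> \<open>A monotone function with open range is continuous; the minus sign makes it
      increasing.\<close>
    have "range (\<lambda>\<eta>. - Y \<eta>) = {..<0}"
    proof (intro equalityI subsetI)
      fix y :: real assume "y \<in> {..<0}"
      then show "y \<in> range (\<lambda>\<eta>. - Y \<eta>)" using YP[of "- y"] by (intro range_eqI[of _ _ "P (- y)"]) auto
    qed (use Ypos in auto)
    then have "continuous_on UNIV (\<lambda>\<eta>. - Y \<eta>)"
      using Ydec by (intro continuous_onI_mono) (auto simp: le_less)
    then show ?thesis using continuous_on_minus[of UNIV "\<lambda>\<eta>. - Y \<eta>"] by simp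
  qed
  have Y0: "Y 0 = L" using YP[of L] PL[of L] pL VL by simp
  have YL: "Y \<eta> \<le> L" if "0 \<le> \<eta>" for \<eta> using Ydec[of 0 \<eta>] Y0 that by (cases "\<eta> = 0") auto
  have YL': "Y \<eta> < L" if "0 < \<eta>" for \<eta> using Ydec[of 0 \<eta>] Y0 that by auto
  have pY: "p (Y \<eta>) = \<eta> / 2" if "0 \<le> \<eta>" for \<eta> using PL[OF YL[OF that]] PY[of \<eta>] by simp
  define a where "a = P V"
  have apos: "0 < a" using ppos[of V] VL PL[of V] unfolding a_def by simp
  have Ya: "Y a = V" unfolding a_def using YP VL by simp
  define f where "f \<eta> = Y \<eta> - V" for \<eta>
  define Q where "Q \<eta> = q (Y \<eta>)" for \<eta>
  have fc: "continuous_on UNIV f" unfolding f_def by (intro continuous_intros Yc)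
  have Qc: "continuous_on {0..} Q" unfolding Q_def
    by (intro continuous_on_compose2[OF qc] continuous_on_subset[OF Yc]) (use YL less_imp_le[OF Ypos] in auto)
  have Qpos: "0 < Q \<eta>" if "0 \<le> \<eta>" for \<eta> unfolding Q_def using qpos Ypos YL that by auto
  have Qle: "Q \<eta> \<le> Q 0" if \<eta>: "0 \<le> \<eta>" for \<eta>
    unfolding Q_def Y0
  proof (rule DERIV_nonneg_imp_increasing_open[OF YL[OF \<eta>]])
    fix z assume "Y \<eta> < z" "z < L"
    then show "\<exists>d. (q has_real_derivative d) (at z) \<and> 0 \<le> d"
      using qd[of z] ppos[of z] Ypos[of \<eta>] by (intro exI[of _ "p z"]) auto
  next
    show "continuous_on {Y \<eta>..L} q"
      by (rule continuous_on_subset[OF qc]) (use Ypos[of \<eta>] in auto)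
  qed
  have fa: "f \<eta> = 0 \<longleftrightarrow> \<eta> = a" for \<eta> unfolding f_def using Ya Ydec[of \<eta> a] Ydec[of a \<eta>]
    by (cases \<eta> a rule: linorder_cases) auto
  have Dfpos: "0 < D' (f \<eta>)" if "\<eta> \<noteq> a" for \<eta> using D'_pos fa that by auto
  have k2: "k (Y \<eta>) = D' (f \<eta>) / 2" for \<eta> unfolding k_def f_def by simp
  have Yd: "(Y has_real_derivative - Q \<eta> / D' (f \<eta>)) (at \<eta>)" if \<eta>: "0 < \<eta>" "\<eta> \<noteq> a" for \<eta>
  proof -
    have Pd: "(P has_real_derivative - 2 * (k (Y \<eta>) / q (Y \<eta>))) (at (Y \<eta>))"
    proof (rule has_field_derivative_transform_within_open[where S="{0<..<L}" and f="\<lambda>y. 2 * p y"])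
      show "((\<lambda>y. 2 * p y) has_real_derivative - 2 * (k (Y \<eta>) / q (Y \<eta>))) (at (Y \<eta>))"
        using pd[OF Ypos YL'[OF \<eta>(1)]] by (auto intro!: derivative_eq_intros)
    qed (use Ypos YL' PL \<eta> in auto)
    have q: "0 < q (Y \<eta>)" using Qpos[of \<eta>] \<eta> unfolding Q_def by simp
    have "(Y has_real_derivative inverse (- 2 * (k (Y \<eta>) / q (Y \<eta>)))) (at \<eta>)"
    proof (rule DERIV_inverse_function[where f=P and g=Y and a="\<eta> - 1" and b="\<eta> + 1", OF Pd])
      show "isCont Y \<eta>" using Yc by (simp add: continuous_on_eq_continuous_at)
      show "- 2 * (k (Y \<eta>) / q (Y \<eta>)) \<noteq> 0" using q Dfpos[OF \<eta>(2)] k2[of \<eta>] by simp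
    qed (use PY in auto)
    moreover have "inverse (- 2 * (k (Y \<eta>) / q (Y \<eta>))) = - Q \<eta> / D' (f \<eta>)"
      unfolding k2 Q_def using q Dfpos[OF \<eta>(2)] by (simp add: field_simps)
    ultimately show ?thesis by simp
  qed
  have fd: "(f has_real_derivative - Q \<eta> / D' (f \<eta>)) (at \<eta>)" if \<eta>: "0 < \<eta>" "\<eta> \<noteq> a" for \<eta>
    unfolding f_def using Yd[OF \<eta>] unfolding f_def by (auto intro!: derivative_eq_intros)
  have Qd: "(Q has_real_derivative - \<eta> * Q \<eta> / (2 * D' (f \<eta>))) (at \<eta>)" if \<eta>: "0 < \<eta>" "\<eta> \<noteq> a" for \<eta>
    using DERIV_chain2[OF qd[OF Ypos YL'[OF \<eta>(1)]] Yd[OF \<eta>]] pY[of \<eta>] \<eta> unfolding Q_def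
    by (simp add: mult.commute)
  have Q0c: "continuous_on {0<..} Q" by (rule continuous_on_subset[OF Qc]) auto
  have Dfd: "((\<lambda>\<eta>. D (f \<eta>)) has_real_derivative - Q \<eta>) (at \<eta>)" if \<eta>: "0 < \<eta>" for \<eta>
  proof (rule derivative_at_removable_point[where a=a, OF _ _ _ \<eta>])
    show "continuous_on {0<..} (\<lambda>\<eta>. D (f \<eta>))"
      by (rule continuous_on_compose2[OF D_cont continuous_on_subset[OF fc]]) auto
    show "continuous_on {0<..} (\<lambda>\<eta>. - Q \<eta>)" by (intro continuous_intros Q0c)
    show "((\<lambda>\<eta>. D (f \<eta>)) has_real_derivative - Q x) (at x)" if "0 < x" "x \<noteq> a" for x
      by (rule DERIV_cong[OF DERIV_chain2[OF D_deriv fd[OF that]]]) (use Dfpos[OF that(2)] in simp)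
  qed
  have Md: "((\<lambda>\<eta>. Q \<eta> - \<eta> * f \<eta> / 2) has_real_derivative - f \<eta> / 2) (at \<eta>)" if \<eta>: "0 < \<eta>" for \<eta>
  proof (rule derivative_at_removable_point[where a=a, OF _ _ _ \<eta>])
    show "continuous_on {0<..} (\<lambda>\<eta>. Q \<eta> - \<eta> * f \<eta> / 2)"
      by (intro continuous_intros Q0c continuous_on_subset[OF fc]) auto
    show "continuous_on {0<..} (\<lambda>\<eta>. - f \<eta> / 2)"
      by (intro continuous_intros continuous_on_subset[OF fc]) auto
    show "((\<lambda>\<eta>. Q \<eta> - \<eta> * f \<eta> / 2) has_real_derivative - f x / 2) (at x)" if x: "0 < x" "x \<noteq> a" for x
      using Qd[OF x] fd[OF x] Dfpos[OF x(2)]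
      by (auto intro!: derivative_eq_intros simp: field_simps)
  qed
  have lim: "(f \<longlongrightarrow> - V) at_top"
  proof (rule tendstoI)
    fix e :: real assume e: "0 < e"
    define y where "y = min e L / 2"
    have y: "0 < y" "y < e" using e VL unfolding y_def by auto
    show "\<forall>\<^sub>F \<eta> in at_top. dist (f \<eta>) (- V) < e"
      using eventually_gt_at_top[of "P y"]
    proof eventually_elim
      case (elim \<eta>)
      then have "Y \<eta> < y" using Ydec YP[OF y(1)] by metis
      then show ?case using Ypos[of \<eta>] y unfolding f_def dist_real_def by auto
    qed
  qed
  have conc: "\<eta> * (f \<eta> + V) / 2 \<le> Q \<eta>" if \<eta>: "0 \<le> \<eta>" for \<eta>
  proof -
    have "continuous_on {0..Y \<eta>} q" by (rule continuous_on_subset[OF qc]) (use YL[OF \<eta>] in auto)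
    then obtain z where z: "0 < z" "z < Y \<eta>" "q (Y \<eta>) = Y \<eta> * p z"
      using MVT_real[OF Ypos[of \<eta>], of q p] qd YL[OF \<eta>] q0 by (metis diff_zero less_le_trans)
    have "p (Y \<eta>) \<le> p z" using pdec[of z "Y \<eta>"] z YL[OF \<eta>] by simp
    then have "Y \<eta> * p (Y \<eta>) \<le> q (Y \<eta>)" using z(3) Ypos[of \<eta>] by simp
    then show ?thesis unfolding Q_def f_def using pY[OF \<eta>] by (simp add: mult.commute)
  qed
  show ?thesis
  proof (rule that[of a f Q])
    show "f 0 = U" unfolding f_def using Y0 L_def by simp
    show "continuous_on {0..} f" by (rule continuous_on_subset[OF fc]) auto
    show "0 < f \<eta>" if "\<eta> < a" for \<eta> unfolding f_def using Ydec[OF that] Ya by simp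
    show "f \<eta> < 0" if "a < \<eta>" for \<eta> unfolding f_def using Ydec[OF that] Ya by simp
    show "f a = 0" using fa by simp
    show "- V < f \<eta>" for \<eta> unfolding f_def using Ypos[of \<eta>] by simp
    show "f \<eta> \<le> U" if "0 \<le> \<eta>" for \<eta> unfolding f_def using YL[OF that] L_def by simp
  qed (use apos Qc lim Qpos Qle conc fd Qd Dfd Md in auto)
qed

end

section \<open>Test functions on the half-line\<close>

definition ramp_sq :: "real \<Rightarrow> real" where
  "ramp_sq x = (max 0 x)\<^sup>2"

lemma ramp_sq_deriv: "(ramp_sq has_real_derivative 2 * max 0 x) (at x)"
proof (cases x "0::real" rule: linorder_cases)
  case less
  have "(ramp_sq has_real_derivative 0) (at x)"
    by (rule has_field_derivative_transform_within_open[where S="{..<0}" and f="\<lambda>_. 0"])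
       (use less in \<open>auto simp: ramp_sq_def\<close>)
  then show ?thesis using less by simp
next
  case equal
  have "((\<lambda>h. (ramp_sq (0 + h) - ramp_sq 0) / h) \<longlongrightarrow> 0) (at 0)"
  proof (rule Lim_null_comparison)
    show "\<forall>\<^sub>F h in at 0. norm ((ramp_sq (0 + h) - ramp_sq 0) / h) \<le> \<bar>h\<bar>"
      by (rule always_eventually) (auto simp: ramp_sq_def max_def power2_eq_square)
    show "((\<lambda>h::real. \<bar>h\<bar>) \<longlongrightarrow> 0) (at 0)" using tendsto_rabs_zero[OF tendsto_ident_at] .
  qed
  then show ?thesis using equal by (simp add: DERIV_def)
next
  case greater
  have "(ramp_sq has_real_derivative 2 * x) (at x)"
    by (rule has_field_derivative_transform_within_open[where S="{0<..}" and f="\<lambda>x. x\<^sup>2"])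
       (use greater in \<open>auto simp: ramp_sq_def max_def intro!: derivative_eq_intros\<close>)
  then show ?thesis using greater by simp
qed

text \<open>The usual construction of a transition from 0 to 1, with \<open>ramp_sq\<close> in the
  role of \<open>exp (- 1 / x)\<close>: the test functions here are C^1, and the derivative stays
  explicit.\<close>

definition smoothstep :: "real \<Rightarrow> real" where
  "smoothstep x = ramp_sq x / (ramp_sq x + ramp_sq (1 - x))"

lemma smoothstep_denom: "0 < ramp_sq x + ramp_sq (1 - x)"
proof -
  have "0 < ramp_sq x \<or> 0 < ramp_sq (1 - x)" unfolding ramp_sq_def by (auto simp: max_def)
  moreover have "0 \<le> ramp_sq x" "0 \<le> ramp_sq (1 - x)" unfolding ramp_sq_def by auto
  ultimately show ?thesis by linarith
qed

lemma smoothstep_0: "x \<le> 0 \<Longrightarrow> smoothstep x = 0"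
  unfolding smoothstep_def ramp_sq_def by simp

lemma smoothstep_1: "1 \<le> x \<Longrightarrow> smoothstep x = 1"
  unfolding smoothstep_def ramp_sq_def by simp

lemma smoothstep_nonneg: "0 \<le> smoothstep x"
  unfolding smoothstep_def using smoothstep_denom[of x] by (simp add: ramp_sq_def)

lemma smoothstep_le_1: "smoothstep x \<le> 1"
  unfolding smoothstep_def using smoothstep_denom[of x] by (simp add: ramp_sq_def)

definition smoothstep' :: "real \<Rightarrow> real" where
  "smoothstep' x = (2 * max 0 x * (ramp_sq x + ramp_sq (1 - x))
     - ramp_sq x * (2 * max 0 x - 2 * max 0 (1 - x))) / (ramp_sq x + ramp_sq (1 - x))\<^sup>2"

lemma smoothstep_deriv: "(smoothstep has_real_derivative smoothstep' x) (at x)"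
  unfolding smoothstep_def[abs_def] smoothstep'_def
  using smoothstep_denom[of x]
  by (auto intro!: derivative_eq_intros ramp_sq_deriv DERIV_chain2[OF ramp_sq_deriv] simp: power2_eq_square)

lemma smoothstep'_cont: "continuous_on UNIV smoothstep'"
  unfolding smoothstep'_def ramp_sq_def[abs_def]
  using smoothstep_denom unfolding ramp_sq_def
  by (intro continuous_intros) (auto simp: less_imp_neq[symmetric])

lemma smoothstep_cont: "continuous_on S smoothstep"
  by (rule DERIV_continuous_on[OF has_field_derivative_at_within[OF smoothstep_deriv]])

lemma smoothstep'_outside: "x \<le> 0 \<or> 1 \<le> x \<Longrightarrow> smoothstep' x = 0"
  unfolding smoothstep'_def ramp_sq_def by (auto simp: max_def power2_eq_square)

lemma smoothstep'_bounded: obtains C where "0 < C" "\<And>x. \<bar>smoothstep' x\<bar> \<le> C"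
proof -
  have "bounded (smoothstep' ` {0..1})"
    by (intro compact_imp_bounded compact_continuous_image continuous_on_subset[OF smoothstep'_cont]) auto
  then obtain C where C: "\<And>x. x \<in> {0..1} \<Longrightarrow> \<bar>smoothstep' x\<bar> \<le> C"
    unfolding bounded_iff by (metis imageI real_norm_def)
  have "\<bar>smoothstep' x\<bar> \<le> max C 1" for x
    using C[of x] smoothstep'_outside[of x] by (cases "x \<in> {0..1}") auto
  then show ?thesis using that[of "max C 1"] by simp
qed

lemma C1c_halflineI:
  assumes d: "\<And>x. 0 < x \<Longrightarrow> (\<psi> has_real_derivative \<psi>' x) (at x)"
    and c: "continuous_on {0<..} \<psi>'" and "0 < a" and z: "\<And>x. 0 < x \<Longrightarrow> x \<notin> {a..b} \<Longrightarrow> \<psi> x = 0"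
  shows "C1c_halfline \<psi>"
  unfolding C1c_halfline_def Ck_on_def
proof (intro conjI exI[of _ "\<lambda>i. if i = 0 then \<psi> else \<psi>'"] exI[of _ "{a..b}"])
  have "continuous_on {0<..} \<psi>"
    using has_field_derivative_at_within[OF d] by (intro DERIV_continuous_on) auto
  then show "\<forall>i\<le>1. continuous_on {0<..} (if i = 0 then \<psi> else \<psi>')" using c by auto
qed (use assms has_field_derivative_at_within[OF d] in auto)

lemma C1c_halflineE:
  assumes "C1c_halfline \<psi>"
  obtains a b where "0 < a" "a < b" "\<And>x. 0 < x \<Longrightarrow> (\<psi> has_real_derivative deriv \<psi> x) (at x)"
    "continuous_on {0<..} \<psi>" "continuous_on {0<..} (deriv \<psi>)"
    "\<And>x. 0 < x \<Longrightarrow> x \<notin> {a..b} \<Longrightarrow> \<psi> x = 0" "\<And>x. 0 < x \<Longrightarrow> x \<notin> {a..b} \<Longrightarrow> deriv \<psi> x = 0"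
proof -
  obtain F where F: "\<forall>x\<in>{0<..}. F 0 x = \<psi> x"
    "\<forall>x\<in>{0<..}. (F 0 has_real_derivative F (Suc 0) x) (at x within {0<..})"
    "continuous_on {0<..} (F 0)" "continuous_on {0<..} (F (Suc 0))"
    using assms unfolding C1c_halfline_def Ck_on_def by (metis One_nat_def le_refl less_one zero_le)
  obtain K where K: "compact K" "K \<subseteq> {0<..}" "\<forall>x\<in>{0<..} - K. \<psi> x = 0"
    using assms unfolding C1c_halfline_def by auto
  have d: "(\<psi> has_real_derivative F (Suc 0) x) (at x)" if "0 < x" for x
  proof (rule has_field_derivative_transform_within_open[where S="{0<..}" and f="F 0"])
    show "(F 0 has_real_derivative F (Suc 0) x) (at x)"
      using F(2) that at_within_open[of x "{0<..}"] by (metis greaterThan_iff open_greaterThan)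
  qed (use that F in auto)
  have dd: "deriv \<psi> x = F (Suc 0) x" if "0 < x" for x using DERIV_imp_deriv[OF d[OF that]] .
  obtain a where a: "0 < a" "\<And>x. x \<in> K \<Longrightarrow> a \<le> x"
  proof (cases "K = {}")
    case True then show ?thesis using that[of 1] by auto
  next
    case False
    then obtain m where "m \<in> K" "\<And>x. x \<in> K \<Longrightarrow> m \<le> x"
      using continuous_attains_inf[OF K(1) False, of "\<lambda>x. x"] by auto
    then show ?thesis using that[of m] K(2) by auto
  qed
  obtain B where B: "\<And>x. x \<in> K \<Longrightarrow> \<bar>x\<bar> \<le> B"
    using compact_imp_bounded[OF K(1)] unfolding bounded_iff by auto
  define b where "b = max B a + 1"
  have K': "K \<subseteq> {a..b}" using a B unfolding b_def by (force simp: abs_le_iff)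
  have z: "\<psi> x = 0" if "0 < x" "x \<notin> {a..b}" for x using K(3) K' that by auto
  have z': "deriv \<psi> x = 0" if x: "0 < x" "x \<notin> {a..b}" for x
  proof -
    have "(\<psi> has_real_derivative 0) (at x)"
    proof (rule has_field_derivative_transform_within_open[where S="{0<..} - {a..b}" and f="\<lambda>_. 0"])
      show "open ({0<..} - {a..b})" by (intro open_Diff) auto
    qed (use x z in auto)
    then show ?thesis by (rule DERIV_imp_deriv)
  qed
  show ?thesis
  proof (rule that[of a b])
    show "continuous_on {0<..} \<psi>" using F(1,3) continuous_on_cong by (metis (no_types, lifting))
    show "continuous_on {0<..} (deriv \<psi>)" using F(4) dd continuous_on_cong[of "{0<..}" "{0<..}" "deriv \<psi>"] by simp
  qed (use a z z' d dd in \<open>auto simp: b_def\<close>)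
qed

lemma C1c_halfline_diff:
  assumes "C1c_halfline \<psi>" "C1c_halfline \<theta>"
  shows "C1c_halfline (\<lambda>x. \<psi> x - \<theta> x)" "\<And>x. 0 < x \<Longrightarrow> deriv (\<lambda>x. \<psi> x - \<theta> x) x = deriv \<psi> x - deriv \<theta> x"
proof -
  obtain a b where 1: "0 < a" "a < b" "\<And>x. 0 < x \<Longrightarrow> (\<psi> has_real_derivative deriv \<psi> x) (at x)"
    "continuous_on {0<..} (deriv \<psi>)" "\<And>x. 0 < x \<Longrightarrow> x \<notin> {a..b} \<Longrightarrow> \<psi> x = 0"
    using C1c_halflineE[OF assms(1)] by metis
  obtain c d where 2: "0 < c" "c < d" "\<And>x. 0 < x \<Longrightarrow> (\<theta> has_real_derivative deriv \<theta> x) (at x)"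
    "continuous_on {0<..} (deriv \<theta>)" "\<And>x. 0 < x \<Longrightarrow> x \<notin> {c..d} \<Longrightarrow> \<theta> x = 0"
    using C1c_halflineE[OF assms(2)] by metis
  have D: "((\<lambda>x. \<psi> x - \<theta> x) has_real_derivative deriv \<psi> x - deriv \<theta> x) (at x)" if "0 < x" for x
    using 1(3)[OF that] 2(3)[OF that] by (rule DERIV_diff)
  show "deriv (\<lambda>x. \<psi> x - \<theta> x) x = deriv \<psi> x - deriv \<theta> x" if "0 < x" for x
    by (rule DERIV_imp_deriv[OF D[OF that]])
  show "C1c_halfline (\<lambda>x. \<psi> x - \<theta> x)"
  proof (rule C1c_halflineI[OF D, where a="min a c" and b="max b d"])
    fix x :: real assume "0 < x" "x \<notin> {min a c..max b d}"
    then show "\<psi> x - \<theta> x = 0" using 1(5)[of x] 2(5)[of x] by force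
  qed (use 1 2 in \<open>auto intro!: continuous_intros\<close>)
qed

section \<open>Local integrability and the fundamental lemma\<close>

lemma loc_integrable_Icc:
  "loc_integrable_halfline u \<Longrightarrow> 0 < a \<Longrightarrow> set_integrable lborel {a..b} u"
  unfolding loc_integrable_halfline_def
  by (drule spec[of _ "{a..b}"]) (auto simp: subset_iff)

lemma loc_integrable_mult_compact:
  assumes u: "loc_integrable_halfline u" and c: "continuous_on {0<..} \<psi>"
    and a: "0 < a" and z: "\<And>x. 0 < x \<Longrightarrow> x \<notin> {a..b} \<Longrightarrow> \<psi> x = 0"
  shows "set_integrable lborel {0<..} (\<lambda>x. u x * \<psi> x)"
proof -
  have ui: "set_integrable lborel {a..b} u"
    by (rule loc_integrable_Icc[OF u a])
  have cab: "continuous_on {a..b} \<psi>" by (rule continuous_on_subset[OF c]) (use a in auto)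
  then have "bounded (\<psi> ` {a..b})" by (intro compact_imp_bounded compact_continuous_image) auto
  then obtain C where C: "\<And>x. x \<in> {a..b} \<Longrightarrow> \<bar>\<psi> x\<bar> \<le> C"
    unfolding bounded_iff by (metis imageI real_norm_def)
  have m: "(\<lambda>x. indicator {a..b} x *\<^sub>R \<psi> x) \<in> borel_measurable lborel"
    using borel_measurable_continuous_on_indicator[OF _ cab] by simp
  have eq: "indicator {0<..} x *\<^sub>R (u x * \<psi> x) = (indicator {a..b} x *\<^sub>R u x) * (indicator {a..b} x *\<^sub>R \<psi> x)" for x
    using a z[of x] by (auto simp: indicator_def)
  show ?thesis unfolding set_integrable_def eq
  proof (rule Bochner_Integration.integrable_bound)
    show "integrable lborel (\<lambda>x. C * (indicator {a..b} x *\<^sub>R u x))"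
      using ui unfolding set_integrable_def by simp
    show "(\<lambda>x. indicator {a..b} x *\<^sub>R u x * indicator {a..b} x *\<^sub>R \<psi> x) \<in> borel_measurable lborel"
      using m ui unfolding set_integrable_def by (intro borel_measurable_times) auto
    show "AE x in lborel. norm (indicator {a..b} x *\<^sub>R u x * indicator {a..b} x *\<^sub>R \<psi> x)
        \<le> norm (C * (indicator {a..b} x *\<^sub>R u x))"
    proof (rule AE_I2)
      fix x
      show "norm (indicator {a..b} x *\<^sub>R u x * indicator {a..b} x *\<^sub>R \<psi> x) \<le> norm (C * (indicator {a..b} x *\<^sub>R u x))"
      proof (cases "x \<in> {a..b}")
        case True
        then have "\<bar>u x\<bar> * \<bar>\<psi> x\<bar> \<le> \<bar>u x\<bar> * \<bar>C\<bar>" using C[OF True] by (intro mult_left_mono) auto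
        then show ?thesis using True by (simp add: abs_mult mult.commute)
      qed simp
    qed
  qed
qed

text \<open>The positive and the negative part of \<open>h\<close>, taken as densities, define
  measures that agree on all half-lines and therefore coincide. So do the densities almost
  everywhere; as \<open>ennreal\<close> sends negative numbers to 0, one of
  \<open>ennreal (h x)\<close> and \<open>ennreal (- h x)\<close> is always 0, hence both
  are.\<close>

lemma AE_eq_0_if_tail_integrals:
  fixes h :: "real \<Rightarrow> real"
  assumes h: "integrable lborel h" and z: "\<And>x. (LINT y|lborel. indicator {x<..} y * h y) = 0"
  shows "AE x in lborel. h x = 0"
proof -
  let ?M = "density lborel (\<lambda>x. ennreal (h x))" and ?N = "density lborel (\<lambda>x. ennreal (- h x))"
  have [measurable]: "h \<in> borel_measurable borel" using borel_measurable_integrable[OF h] by simp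
  have int: "integrable lborel (\<lambda>y. indicator {x<..} y * h y)" for x :: real
    using integrable_mult_indicator[OF _ h, of "{x<..}"] by simp
  have fin: "(\<integral>\<^sup>+ y. ennreal (c * h y) * indicator {x<..} y \<partial>lborel) < \<infinity>" if "c = 1 \<or> c = -1" for c x
  proof -
    have "(\<integral>\<^sup>+ y. ennreal (c * h y) * indicator {x<..} y \<partial>lborel) \<le> (\<integral>\<^sup>+ y. ennreal (norm (h y)) \<partial>lborel)"
      by (rule nn_integral_mono) (use that in \<open>auto simp: indicator_def intro!: ennreal_leI\<close>)
    also have "\<dots> < \<infinity>" using h by (simp add: integrable_iff_bounded)
    finally show ?thesis .
  qed
  have "?M = ?N"
  proof (rule measure_eqI_lessThan)
    fix x :: real
    show "emeasure ?M {x<..} < \<infinity>" using fin[of 1 x] by (simp add: emeasure_density)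
    have e: "ennreal (c * (indicator {x<..} y * h y)) = ennreal (c * h y) * indicator {x<..} y" for c y
      by (simp add: indicator_def)
    have "enn2real (\<integral>\<^sup>+ y. ennreal (1 * h y) * indicator {x<..} y \<partial>lborel)
        = enn2real (\<integral>\<^sup>+ y. ennreal (-1 * h y) * indicator {x<..} y \<partial>lborel)"
      using real_lebesgue_integral_def[OF int[of x]] z[of x] e[of 1] e[of "-1"] by simp
    then show "emeasure ?M {x<..} = emeasure ?N {x<..}"
      using fin[of 1 x] fin[of "-1" x] by (simp add: emeasure_density) (metis ennreal_enn2real less_top)
  qed auto
  then have "AE x in lborel. ennreal (h x) = ennreal (- h x)"
    by (intro sigma_finite_measure.density_unique[OF sigma_finite_lborel]) auto
  then show ?thesis
  proof eventually_elim
    case (elim x)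
    show ?case
    proof (cases "0 \<le> h x")
      case True
      then have "ennreal (h x) = 0" using elim ennreal_neg[of "- h x"] by simp
      then show ?thesis using True by (simp add: ennreal_eq_0_iff)
    next
      case False
      then have "ennreal (- h x) = 0" using elim ennreal_neg[of "h x"] by simp
      then show ?thesis using False by (simp add: ennreal_eq_0_iff)
    qed
  qed
qed

text \<open>Compactly supported C^1 functions approximate indicators of intervals boundedly and
  pointwise, so the restrictions of \<open>H\<close> to an exhausting sequence of compact intervals
  have vanishing tail integrals.\<close>

lemma fundamental_lemma:
  assumes H: "loc_integrable_halfline H"
    and z: "\<And>\<psi>. C1c_halfline \<psi> \<Longrightarrow> (LINT x:{0<..}|lborel. H x * \<psi> x) = 0"
  shows "AE x in lborel. 0 < x \<longrightarrow> H x = 0"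
proof -
  have main: "AE x in lborel. indicator {1 / real (Suc N)..real (Suc N)} x * H x = 0" for N
  proof (rule AE_eq_0_if_tail_integrals)
    define \<alpha> where "\<alpha> = 1 / real (Suc N)"
    define \<beta> where "\<beta> = real (Suc N)"
    have \<alpha>: "0 < \<alpha>" unfolding \<alpha>_def by simp
    have \<alpha>\<beta>: "\<alpha> \<le> \<beta>" unfolding \<alpha>_def \<beta>_def by (simp add: divide_le_eq mult_ge1_I)
    have Hi: "set_integrable lborel {\<alpha>..\<beta>+1} H" and Hi2: "set_integrable lborel {\<alpha>..\<beta>} H"
      by (rule loc_integrable_Icc[OF H \<alpha>])+
    then show "integrable lborel (\<lambda>x. indicator {1 / real (Suc N)..real (Suc N)} x * H x)"
      unfolding set_integrable_def \<alpha>_def \<beta>_def by simp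
    fix x :: real
    \<comment> \<open>Starting at \<open>\<alpha>\<close> at the earliest keeps the supports inside
      (0, \<infinity>).\<close>
    define s where "s = max x \<alpha>"
    \<comment> \<open>These tend to the indicator of \<open>{s<..\<beta>}\<close>. The added 1 keeps
      the second factor equal to 1 up to and including \<open>\<beta>\<close>; its support then ends
      at \<open>\<beta> + 1 / n\<close>, whence the interval up to
      \<open>\<beta> + 1\<close>.\<close>
    define \<psi> where "\<psi> n y = smoothstep (real n * (y - s)) * smoothstep (real n * (\<beta> - y) + 1)" for n y
    have zero: "\<psi> n y = 0" if "1 \<le> n" "0 < y" "y \<notin> {\<alpha>..\<beta>+1}" for n y
    proof (cases "y < \<alpha>")
      case True
      then have "real n * (y - s) \<le> 0" unfolding s_def by (auto simp: mult_le_0_iff)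
      then show ?thesis unfolding \<psi>_def by (simp add: smoothstep_0)
    next
      case False
      then have "1 * 1 \<le> real n * (y - \<beta>)" using that by (intro mult_mono) auto
      then have "real n * (\<beta> - y) + 1 \<le> 0" by (simp add: algebra_simps)
      then show ?thesis unfolding \<psi>_def by (simp add: smoothstep_0)
    qed
    have C: "C1c_halfline (\<psi> n)" if n: "1 \<le> n" for n
    proof (rule C1c_halflineI[where a=\<alpha> and b="\<beta>+1"])
      show "(\<psi> n has_real_derivative (smoothstep' (real n * (y - s)) * real n * smoothstep (real n * (\<beta> - y) + 1)
          + smoothstep (real n * (y - s)) * (smoothstep' (real n * (\<beta> - y) + 1) * - real n))) (at y)" for y
        unfolding \<psi>_def[abs_def]
        by (auto intro!: derivative_eq_intros DERIV_chain2[OF smoothstep_deriv])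
      show "continuous_on {0<..} (\<lambda>y. smoothstep' (real n * (y - s)) * real n * smoothstep (real n * (\<beta> - y) + 1)
          + smoothstep (real n * (y - s)) * (smoothstep' (real n * (\<beta> - y) + 1) * - real n))"
        by (intro continuous_intros continuous_on_compose2[OF smoothstep'_cont]
              continuous_on_compose2[OF smoothstep_cont[of UNIV]]) auto
    qed (use \<alpha> zero n in auto)
    have lim: "(\<lambda>n. LINT y|lborel. indicator {\<alpha>..\<beta>+1} y * (H y * \<psi> (Suc n) y))
        \<longlonglongrightarrow> (LINT y|lborel. indicator {x<..} y * (indicator {\<alpha>..\<beta>} y * H y))"
    proof (rule integral_dominated_convergence[where w="\<lambda>y. norm (indicator {\<alpha>..\<beta>+1} y * H y)"])
      have Hm[measurable]: "(\<lambda>y. indicator {\<alpha>..\<beta>+1} y * H y) \<in> borel_measurable lborel"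
        "(\<lambda>y. indicator {\<alpha>..\<beta>} y * H y) \<in> borel_measurable lborel"
        using Hi Hi2 unfolding set_integrable_def by auto
      have [measurable]: "\<psi> n \<in> borel_measurable borel" for n
        unfolding \<psi>_def by (intro borel_measurable_continuous_onI continuous_intros
              continuous_on_compose2[OF smoothstep_cont[of UNIV]]) auto
      show "(\<lambda>y. indicator {x<..} y * (indicator {\<alpha>..\<beta>} y * H y)) \<in> borel_measurable lborel"
        using Hm(2) by measurable
      have "(\<lambda>y. (indicator {\<alpha>..\<beta>+1} y * H y) * \<psi> (Suc n) y) \<in> borel_measurable lborel" for n
        using Hm(1) by measurable
      then show "(\<lambda>y. indicator {\<alpha>..\<beta>+1} y * (H y * \<psi> (Suc n) y)) \<in> borel_measurable lborel" for n
        by (simp add: mult.assoc)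
      show "integrable lborel (\<lambda>y. norm (indicator {\<alpha>..\<beta>+1} y * H y))"
        using Hi unfolding set_integrable_def by (intro integrable_norm) simp
      show "AE y in lborel. norm (indicator {\<alpha>..\<beta>+1} y * (H y * \<psi> (Suc n) y)) \<le> norm (indicator {\<alpha>..\<beta>+1} y * H y)" for n
      proof (rule AE_I2)
        fix y
        have "\<bar>\<psi> (Suc n) y\<bar> \<le> 1" unfolding \<psi>_def abs_mult
          using smoothstep_nonneg smoothstep_le_1 by (intro mult_le_one) auto
        then show "norm (indicator {\<alpha>..\<beta>+1} y * (H y * \<psi> (Suc n) y)) \<le> norm (indicator {\<alpha>..\<beta>+1} y * H y)"
          by (auto simp: abs_mult indicator_def mult_left_le)
      qed
      show "AE y in lborel. (\<lambda>n. indicator {\<alpha>..\<beta>+1} y * (H y * \<psi> (Suc n) y))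
          \<longlonglongrightarrow> indicator {x<..} y * (indicator {\<alpha>..\<beta>} y * H y)"
      \<comment> \<open>For \<open>x < \<alpha>\<close> the approximations vanish at
        \<open>\<alpha>\<close> while the limit need not; this single point is discarded.\<close>
      proof (rule AE_mp[OF AE_lborel_singleton[of \<alpha>] AE_I2], intro impI)
        fix y assume y\<alpha>: "y \<noteq> \<alpha>"
        consider "y \<le> s" | "s < y" "y \<le> \<beta>" | "s < y" "\<beta> < y" by linarith
        then show "(\<lambda>n. indicator {\<alpha>..\<beta>+1} y * (H y * \<psi> (Suc n) y))
          \<longlonglongrightarrow> indicator {x<..} y * (indicator {\<alpha>..\<beta>} y * H y)"
        proof cases
          case 1
          then have "\<psi> (Suc n) y = 0" for n unfolding \<psi>_def by (simp add: smoothstep_0 mult_le_0_iff)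
          moreover have "indicator {x<..} y * (indicator {\<alpha>..\<beta>} y * H y) = 0"
            using 1 y\<alpha> unfolding s_def by (auto simp: indicator_def)
          ultimately show ?thesis by (simp only: mult_zero_right tendsto_const)
        next
          case 2
          obtain N0 where N0: "1 / (y - s) < real N0" using reals_Archimedean2 by blast
          have "\<psi> (Suc n) y = 1" if "N0 \<le> n" for n
          proof -
            have "1 \<le> real (Suc n) * (y - s)" using N0 that 2
              by (smt (verit, best) mult.commute of_nat_Suc of_nat_mono pos_divide_less_eq mult_left_mono)
            then show ?thesis unfolding \<psi>_def using 2 by (simp add: smoothstep_1)
          qed
          then have "\<forall>\<^sub>F n in sequentially. indicator {\<alpha>..\<beta>+1} y * (H y * \<psi> (Suc n) y) = H y"
            using 2 unfolding s_def eventually_sequentially by (intro exI[of _ N0]) (auto simp: indicator_def)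
          then show ?thesis using 2 unfolding s_def by (simp add: tendsto_eventually)
        next
          case 3
          obtain N0 where N0: "1 / (y - \<beta>) < real N0" using reals_Archimedean2 by blast
          have "\<psi> (Suc n) y = 0" if "N0 \<le> n" for n
          proof -
            have "1 \<le> real (Suc n) * (y - \<beta>)" using N0 that 3
              by (smt (verit, best) mult.commute of_nat_Suc of_nat_mono pos_divide_less_eq mult_left_mono)
            then have "real (Suc n) * (\<beta> - y) + 1 \<le> 0" by (simp add: algebra_simps)
            then show ?thesis unfolding \<psi>_def by (simp add: smoothstep_0)
          qed
          then have "\<forall>\<^sub>F n in sequentially. indicator {\<alpha>..\<beta>+1} y * (H y * \<psi> (Suc n) y) = 0"
            unfolding eventually_sequentially by (intro exI[of _ N0]) auto
          then show ?thesis using 3 by (simp add: tendsto_eventually)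
        qed
      qed
    qed
    have "(LINT y|lborel. indicator {\<alpha>..\<beta>+1} y * (H y * \<psi> (Suc n) y)) = 0" for n
    proof -
      have "(LINT y|lborel. indicator {\<alpha>..\<beta>+1} y * (H y * \<psi> (Suc n) y)) = (LINT y:{0<..}|lborel. H y * \<psi> (Suc n) y)"
        unfolding set_lebesgue_integral_def
        by (rule Bochner_Integration.integral_cong) (use \<alpha> zero[of "Suc n"] in \<open>auto simp: indicator_def\<close>)
      then show ?thesis using z[OF C[of "Suc n"]] by simp
    qed
    then have "(LINT y|lborel. indicator {x<..} y * (indicator {\<alpha>..\<beta>} y * H y)) = 0"
      using lim by (simp add: LIMSEQ_const_iff)
    then show "(LINT y|lborel. indicator {x<..} y * (indicator {1 / real (Suc N)..real (Suc N)} y * H y)) = 0"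
      unfolding \<alpha>_def \<beta>_def .
  qed
  have "AE x in lborel. \<forall>N. indicator {1 / real (Suc N)..real (Suc N)} x * H x = 0"
    unfolding AE_all_countable using main by blast
  then show ?thesis
  proof eventually_elim
    case (elim x)
    show ?case
    proof
      assume x: "0 < x"
      obtain N where N: "max x (1/x) < real N" using reals_Archimedean2 by blast
      then have "1 / real (Suc N) \<le> x" using x by (simp add: field_simps)
      then have "x \<in> {1 / real (Suc N)..real (Suc N)}" using N by auto
      then show "H x = 0" using elim[rule_format, of N] by simp
    qed
  qed
qed

section \<open>Weak derivatives\<close>

lemma loc_integrable_continuous:
  assumes "continuous_on {0<..} u"
  shows "loc_integrable_halfline u"
  unfolding loc_integrable_halfline_def
proof (intro allI impI)
  fix K :: "real set" assume K: "compact K \<and> K \<subseteq> {0<..}"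
  show "set_integrable lborel K u"
    unfolding set_integrable_def
    using borel_integrable_compact[of K u] K continuous_on_subset[OF assms] by auto
qed

lemma loc_integrable_diff:
  "loc_integrable_halfline u \<Longrightarrow> loc_integrable_halfline v \<Longrightarrow> loc_integrable_halfline (\<lambda>x. u x - v x)"
  unfolding loc_integrable_halfline_def by (auto intro: set_integral_diff(1))

lemma weak_derivative_C1:
  assumes d: "\<And>x. 0 < x \<Longrightarrow> (u has_real_derivative u' x) (at x)"
    and c: "continuous_on {0<..} u'"
  shows "weak_deriv_halfline u u'"
  unfolding weak_deriv_halfline_def
proof (intro conjI allI impI)
  have cu: "continuous_on {0<..} u"
    using has_field_derivative_at_within[OF d] by (intro DERIV_continuous_on) auto
  show lu: "loc_integrable_halfline u" by (rule loc_integrable_continuous[OF cu])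
  show lu': "loc_integrable_halfline u'" by (rule loc_integrable_continuous[OF c])
  fix \<psi> assume "C1c_halfline \<psi>"
  then obtain a b where ab: "0 < a" "a < b" and d\<psi>: "\<And>x. 0 < x \<Longrightarrow> (\<psi> has_real_derivative deriv \<psi> x) (at x)"
    and c\<psi>: "continuous_on {0<..} \<psi>" "continuous_on {0<..} (deriv \<psi>)"
    and z: "\<And>x. 0 < x \<Longrightarrow> x \<notin> {a..b} \<Longrightarrow> \<psi> x = 0" "\<And>x. 0 < x \<Longrightarrow> x \<notin> {a..b} \<Longrightarrow> deriv \<psi> x = 0"
    by (rule C1c_halflineE) blast
  have "(LINT x:{0<..}|lborel. u x * deriv \<psi> x) + (LINT x:{0<..}|lborel. u' x * \<psi> x)
      = (LINT x:{0<..}|lborel. u x * deriv \<psi> x + u' x * \<psi> x)"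
    using loc_integrable_mult_compact[OF lu c\<psi>(2) ab(1) z(2)] loc_integrable_mult_compact[OF lu' c\<psi>(1) ab(1) z(1)]
    by (simp add: set_integral_add)
  \<comment> \<open>The interval exceeds the support on both sides, so the boundary terms
    vanish.\<close>
  also have "\<dots> = (LINT x:{a/2..b+1}|lborel. u x * deriv \<psi> x + u' x * \<psi> x)"
    unfolding set_lebesgue_integral_def
    by (rule Bochner_Integration.integral_cong) (use ab z in \<open>auto simp: indicator_def\<close>)
  also have "\<dots> = integral {a/2..b+1} (\<lambda>x. u x * deriv \<psi> x + u' x * \<psi> x)"
  proof (rule set_borel_integral_eq_integral(2))
    have "continuous_on {a/2..b+1} (\<lambda>x. u x * deriv \<psi> x + u' x * \<psi> x)"
      by (intro continuous_intros continuous_on_subset[OF cu] continuous_on_subset[OF c]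
           continuous_on_subset[OF c\<psi>(1)] continuous_on_subset[OF c\<psi>(2)]) (use ab in auto)
    then show "set_integrable lborel {a/2..b+1} (\<lambda>x. u x * deriv \<psi> x + u' x * \<psi> x)"
      by (rule borel_integrable_atLeastAtMost')
  qed
  also have "\<dots> = u (b+1) * \<psi> (b+1) - u (a/2) * \<psi> (a/2)"
  proof (rule integral_unique, rule fundamental_theorem_of_calculus)
    fix x assume x: "x \<in> {a/2..b+1}"
    then have x0: "0 < x" using ab by auto
    have "((\<lambda>x. u x * \<psi> x) has_real_derivative u x * deriv \<psi> x + u' x * \<psi> x) (at x)"
      using d[OF x0] d\<psi>[OF x0] by (auto intro!: derivative_eq_intros)
    then show "((\<lambda>x. u x * \<psi> x) has_vector_derivative u x * deriv \<psi> x + u' x * \<psi> x) (at x within {a/2..b+1})"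
      by (simp add: has_real_derivative_iff_has_vector_derivative has_vector_derivative_at_within)
  qed (use ab in auto)
  also have "\<dots> = 0" using z(1)[of "b+1"] z(1)[of "a/2"] ab by simp
  finally show "(LINT x:{0<..}|lborel. u x * deriv \<psi> x) = - (LINT x:{0<..}|lborel. u' x * \<psi> x)" by simp
qed

lemma weak_deriv_diff:
  assumes "weak_deriv_halfline u g" "weak_deriv_halfline v h"
  shows "weak_deriv_halfline (\<lambda>x. u x - v x) (\<lambda>x. g x - h x)"
  unfolding weak_deriv_halfline_def
proof (intro conjI allI impI)
  have l: "loc_integrable_halfline u" "loc_integrable_halfline g"
    "loc_integrable_halfline v" "loc_integrable_halfline h"
    using assms unfolding weak_deriv_halfline_def by auto
  then show "loc_integrable_halfline (\<lambda>x. u x - v x)" "loc_integrable_halfline (\<lambda>x. g x - h x)"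
    by (auto intro: loc_integrable_diff)
  fix \<psi> assume C: "C1c_halfline \<psi>"
  then obtain a b where ab: "0 < a" 
    and c\<psi>: "continuous_on {0<..} \<psi>" "continuous_on {0<..} (deriv \<psi>)"
    and z: "\<And>x. 0 < x \<Longrightarrow> x \<notin> {a..b} \<Longrightarrow> \<psi> x = 0" "\<And>x. 0 < x \<Longrightarrow> x \<notin> {a..b} \<Longrightarrow> deriv \<psi> x = 0"
    by (rule C1c_halflineE) blast
  have "(LINT x:{0<..}|lborel. (u x - v x) * deriv \<psi> x)
      = (LINT x:{0<..}|lborel. u x * deriv \<psi> x) - (LINT x:{0<..}|lborel. v x * deriv \<psi> x)"
    using set_integral_diff(2)[OF loc_integrable_mult_compact[OF l(1) c\<psi>(2) ab z(2)]
        loc_integrable_mult_compact[OF l(3) c\<psi>(2) ab z(2)]] by (simp add: left_diff_distrib)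
  moreover have "(LINT x:{0<..}|lborel. (g x - h x) * \<psi> x)
      = (LINT x:{0<..}|lborel. g x * \<psi> x) - (LINT x:{0<..}|lborel. h x * \<psi> x)"
    using set_integral_diff(2)[OF loc_integrable_mult_compact[OF l(2) c\<psi>(1) ab z(1)]
        loc_integrable_mult_compact[OF l(4) c\<psi>(1) ab z(1)]] by (simp add: left_diff_distrib)
  ultimately show "(LINT x:{0<..}|lborel. (u x - v x) * deriv \<psi> x) = - (LINT x:{0<..}|lborel. (g x - h x) * \<psi> x)"
    using assms C unfolding weak_deriv_halfline_def by simp
qed

lemma weak_deriv_unique:
  assumes "weak_deriv_halfline u g" "weak_deriv_halfline u h"
  shows "AE x in lborel. 0 < x \<longrightarrow> g x = h x"
proof -
  have w: "weak_deriv_halfline (\<lambda>x. u x - u x) (\<lambda>x. g x - h x)" by (rule weak_deriv_diff[OF assms])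
  have "AE x in lborel. 0 < x \<longrightarrow> g x - h x = 0"
  proof (rule fundamental_lemma)
    show "loc_integrable_halfline (\<lambda>x. g x - h x)" using w unfolding weak_deriv_halfline_def by auto
    show "(LINT x:{0<..}|lborel. (g x - h x) * \<psi> x) = 0" if "C1c_halfline \<psi>" for \<psi>
      using w that unfolding weak_deriv_halfline_def by simp
  qed
  then show ?thesis by auto
qed

text \<open>The approximations are \<open>u\<close> times cutoffs at \<open>0\<close> and at
  \<infinity>. The only dangerous term is \<open>u\<close> times the derivative of the cutoff at
  \<open>0\<close>: that derivative has size \<open>n\<close>, but only for
  \<open>n * x \<le> 2\<close>, where the linear bound makes \<open>n * \<bar>u x\<bar>\<close> at
  most \<open>2 * \<bar>K\<bar>\<close>. This bound expresses the zero boundary value and makes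
  dominated convergence applicable.\<close>

lemma W12_0_halflineI:
  assumes d: "\<And>x. 0 < x \<Longrightarrow> (u has_real_derivative u' x) (at x)"
    and c: "continuous_on {0<..} u'"
    and K: "\<And>x. 0 < x \<Longrightarrow> x \<le> 2 \<Longrightarrow> \<bar>u x\<bar> \<le> K * x"
    and i: "set_integrable lborel {0<..} (\<lambda>x. (u x)\<^sup>2)" "set_integrable lborel {0<..} (\<lambda>x. (u' x)\<^sup>2)"
  shows "u \<in> W12_0_halfline"
proof -
  have cu: "continuous_on {0<..} u"
    using has_field_derivative_at_within[OF d] by (intro DERIV_continuous_on) auto
  have m: "set_borel_measurable lborel {0<..} u" "set_borel_measurable lborel {0<..} u'"
    using borel_measurable_continuous_on_indicator[OF _ cu] borel_measurable_continuous_on_indicator[OF _ c]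
    unfolding set_borel_measurable_def by auto
  obtain C where C: "0 < C" "\<And>x. \<bar>smoothstep' x\<bar> \<le> C" by (rule smoothstep'_bounded) blast
  \<comment> \<open>Equal to 1 on \<open>{2 / n..n}\<close> and to 0 outside
    \<open>{1 / n..2 * n}\<close>. The outer transition has slope of order \<open>1 / n\<close> and
    is harmless.\<close>
  define A where "A n x = smoothstep (real n * x - 1) * smoothstep (2 - x / real n)" for n x
  define A' where "A' n x = smoothstep' (real n * x - 1) * real n * smoothstep (2 - x / real n)
     - smoothstep (real n * x - 1) * smoothstep' (2 - x / real n) / real n" for n x
  have dA: "(A n has_real_derivative A' n x) (at x)" if "1 \<le> n" for n x
    unfolding A_def[abs_def] A'_def using that
    by (auto intro!: derivative_eq_intros DERIV_chain2[OF smoothstep_deriv])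
  have cA': "continuous_on {0<..} (A' n)" if "1 \<le> n" for n
    unfolding A'_def using that
    by (intro continuous_intros continuous_on_compose2[OF smoothstep'_cont]
              continuous_on_compose2[OF smoothstep_cont[of UNIV]]) auto
  have cA: "continuous_on {0<..} (A n)" if "1 \<le> n" for n
    by (rule DERIV_continuous_on[OF has_field_derivative_at_within[OF dA[OF that]]])
  have A01: "0 \<le> A n x" "A n x \<le> 1" for n x
    unfolding A_def using smoothstep_nonneg smoothstep_le_1 by (auto intro: mult_le_one)
  define \<psi> where "\<psi> n x = u x * A (Suc n) x" for n x
  have d\<psi>: "(\<psi> n has_real_derivative u' x * A (Suc n) x + u x * A' (Suc n) x) (at x)" if "0 < x" for n x
    unfolding \<psi>_def[abs_def] using d[OF that] dA[of "Suc n" x]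
    by (auto intro!: derivative_eq_intros simp: mult.commute)
  have C1: "C1c_halfline (\<psi> n)" for n
  proof (rule C1c_halflineI[OF d\<psi>, where a="1 / real (Suc n)" and b="2 * real (Suc n)"])
    show "continuous_on {0<..} (\<lambda>x. u' x * A (Suc n) x + u x * A' (Suc n) x)"
      by (intro continuous_intros c cu cA cA') auto
  next
    fix x :: real assume x: "0 < x" "x \<notin> {1 / real (Suc n)..2 * real (Suc n)}"
    show "\<psi> n x = 0"
    proof (cases "x < 1 / real (Suc n)")
      case True
      then have "real (Suc n) * x - 1 \<le> 0" by (simp add: field_simps)
      then show ?thesis unfolding \<psi>_def A_def by (simp only: smoothstep_0 mult_zero_left mult_zero_right)
    next
      case False
      then have "2 - x / real (Suc n) \<le> 0" using x by (simp add: field_simps)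
      then show ?thesis unfolding \<psi>_def A_def by (simp only: smoothstep_0 mult_zero_left mult_zero_right)
    qed
  qed auto
  have ev: "\<forall>\<^sub>F n in sequentially. A (Suc n) x = 1 \<and> A' (Suc n) x = 0" if x: "0 < x" for x
  proof -
    obtain N where N: "max x (2 / x) < real N" using reals_Archimedean2 by blast
    have "A (Suc n) x = 1 \<and> A' (Suc n) x = 0" if n: "N \<le> n" for n
    proof -
      have n': "real N \<le> real (Suc n)" using n by simp
      have "2 / x \<le> real (Suc n)" using N n' by linarith
      then have 1: "1 \<le> real (Suc n) * x - 1" using x by (simp add: field_simps)
      have "x \<le> real (Suc n)" using N n' by linarith
      then have 2: "1 \<le> 2 - x / real (Suc n)" by (simp add: field_simps)
      show ?thesis unfolding A_def A'_def
        using smoothstep_1[OF 1] smoothstep_1[OF 2] smoothstep'_outside 1 2 by simp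
    qed
    then show ?thesis unfolding eventually_sequentially by blast
  qed
  have bound: "\<bar>u x * A' (Suc n) x\<bar> \<le> 2 * C * \<bar>K\<bar> * indicator {0<..2} x + C * \<bar>u x\<bar>" if x: "0 < x" for n x
  proof -
    define N where "N = real (Suc n)"
    have N: "1 \<le> N" unfolding N_def by simp
    have s01: "0 \<le> smoothstep y" "smoothstep y \<le> 1" for y using smoothstep_nonneg smoothstep_le_1 by auto
    have 1: "\<bar>u x * (smoothstep' (N * x - 1) * N * smoothstep (2 - x / N))\<bar> \<le> 2 * C * \<bar>K\<bar> * indicator {0<..2} x"
    proof (cases "N * x - 1 < 1")
      case True
      then have Nx: "N * x \<le> 2" by simp
      have x2: "x \<le> 2" using mult_right_mono[OF N less_imp_le[OF x]] Nx by simp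
      have "\<bar>u x\<bar> * N \<le> K * x * N" using K[OF x x2] N by (intro mult_right_mono) auto
      also have "\<dots> \<le> \<bar>K\<bar> * (N * x)" using x N by (simp add: mult.commute mult.left_commute mult_left_mono)
      also have "\<dots> \<le> \<bar>K\<bar> * 2" using Nx by (intro mult_left_mono) auto
      finally have uN: "\<bar>u x\<bar> * N \<le> \<bar>K\<bar> * 2" .
      have "\<bar>u x * (smoothstep' (N * x - 1) * N * smoothstep (2 - x / N))\<bar>
          = (\<bar>u x\<bar> * N) * \<bar>smoothstep' (N * x - 1)\<bar> * smoothstep (2 - x / N)"
        using N s01 by (simp add: abs_mult)
      also have "\<dots> \<le> (\<bar>K\<bar> * 2) * C * 1"
        by (rule mult_mono[OF mult_mono[OF uN C(2)]]) (use C s01 N in auto)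
      finally show ?thesis using x x2 by (simp add: mult.commute mult.left_commute)
    next
      case False
      then show ?thesis using C smoothstep'_outside[of "N * x - 1"] by (simp add: indicator_def)
    qed
    have 2: "\<bar>u x * (smoothstep (N * x - 1) * smoothstep' (2 - x / N) / N)\<bar> \<le> C * \<bar>u x\<bar>"
    proof -
      have "\<bar>smoothstep (N * x - 1) * smoothstep' (2 - x / N)\<bar> \<le> 1 * C"
        unfolding abs_mult using s01 C by (intro mult_mono) auto
      also have "\<dots> \<le> C * N" using C N by simp
      finally have "\<bar>smoothstep (N * x - 1) * smoothstep' (2 - x / N) / N\<bar> \<le> C"
        using N by (simp add: field_simps)
      then show ?thesis unfolding abs_mult[of "u x"] mult.commute[of C] by (intro mult_left_mono) auto
    qed
    have "u x * A' (Suc n) x = u x * (smoothstep' (N * x - 1) * N * smoothstep (2 - x / N))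
        - u x * (smoothstep (N * x - 1) * smoothstep' (2 - x / N) / N)"
      unfolding A'_def N_def by (simp add: algebra_simps)
    then show ?thesis using 1 2 by linarith
  qed
  have conv: "(\<lambda>n. LINT x:{0<..}|lborel. (\<psi> n x - u x)\<^sup>2 + (deriv (\<psi> n) x - u' x)\<^sup>2) \<longlonglongrightarrow> 0"
  proof -
    define F where "F n x = indicator {0<..} x * ((\<psi> n x - u x)\<^sup>2 + (u' x * A (Suc n) x + u x * A' (Suc n) x - u' x)\<^sup>2)" for n x
    have "(\<lambda>n. LINT x|lborel. F n x) \<longlonglongrightarrow> integral\<^sup>L lborel (\<lambda>x::real. 0 :: real)"
    proof (rule integral_dominated_convergence[where w="\<lambda>x. indicator {0<..} x * (u x)\<^sup>2
         + 3 * (4 * C\<^sup>2 * K\<^sup>2 * indicator {0<..2} x + C\<^sup>2 * (indicator {0<..} x * (u x)\<^sup>2) + indicator {0<..} x * (u' x)\<^sup>2)"])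
      show "integrable lborel (\<lambda>x. indicator {0<..} x * (u x)\<^sup>2
         + 3 * (4 * C\<^sup>2 * K\<^sup>2 * indicator {0<..2} x + C\<^sup>2 * (indicator {0<..} x * (u x)\<^sup>2) + indicator {0<..} x * (u' x)\<^sup>2))"
        using i unfolding set_integrable_def
        by (intro Bochner_Integration.integrable_add integrable_mult_right) auto
      show "F n \<in> borel_measurable lborel" for n
      proof -
        have "continuous_on {0<..} (\<lambda>x. (\<psi> n x - u x)\<^sup>2 + (u' x * A (Suc n) x + u x * A' (Suc n) x - u' x)\<^sup>2)"
          unfolding \<psi>_def by (intro continuous_intros c cu cA cA') auto
        from borel_measurable_continuous_on_indicator[OF _ this] show ?thesis unfolding F_def by simp
      qed
      show "AE x in lborel. norm (F n x) \<le> indicator {0<..} x * (u x)\<^sup>2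
         + 3 * (4 * C\<^sup>2 * K\<^sup>2 * indicator {0<..2} x + C\<^sup>2 * (indicator {0<..} x * (u x)\<^sup>2) + indicator {0<..} x * (u' x)\<^sup>2)" for n
      proof (rule AE_I2)
        fix x :: real
        show "norm (F n x) \<le> indicator {0<..} x * (u x)\<^sup>2
         + 3 * (4 * C\<^sup>2 * K\<^sup>2 * indicator {0<..2} x + C\<^sup>2 * (indicator {0<..} x * (u x)\<^sup>2) + indicator {0<..} x * (u' x)\<^sup>2)"
        proof (cases "0 < x")
          case x: True
          define p where "p = 2 * C * \<bar>K\<bar> * indicator {0<..2} x"
          define r where "r = C * \<bar>u x\<bar>"
          have p2: "p\<^sup>2 = 4 * C\<^sup>2 * K\<^sup>2 * indicator {0<..2} x"
            unfolding p_def by (simp add: power_mult_distrib indicator_def)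
          have r2: "r\<^sup>2 = C\<^sup>2 * (u x)\<^sup>2" unfolding r_def by (simp add: power_mult_distrib)
          have "\<bar>\<psi> n x - u x\<bar> \<le> \<bar>u x\<bar>"
          proof -
            have "\<psi> n x - u x = u x * (A (Suc n) x - 1)" unfolding \<psi>_def by (simp add: algebra_simps)
            moreover have "\<bar>A (Suc n) x - 1\<bar> \<le> 1" using A01[of "Suc n" x] by auto
            ultimately show ?thesis by (simp add: abs_mult mult_left_le)
          qed
          then have a: "(\<psi> n x - u x)\<^sup>2 \<le> (u x)\<^sup>2" by (simp add: abs_le_square_iff)
          have "\<bar>u' x * A (Suc n) x + u x * A' (Suc n) x - u' x\<bar> \<le> p + r + \<bar>u' x\<bar>"
          proof -
            have "u' x * A (Suc n) x + u x * A' (Suc n) x - u' x = u' x * (A (Suc n) x - 1) + u x * A' (Suc n) x"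
              by (simp add: algebra_simps)
            moreover have "\<bar>A (Suc n) x - 1\<bar> \<le> 1" using A01[of "Suc n" x] by auto
            then have "\<bar>u' x * (A (Suc n) x - 1)\<bar> \<le> \<bar>u' x\<bar>" by (simp add: abs_mult mult_left_le)
            ultimately show ?thesis using bound[OF x, of n] unfolding p_def r_def by linarith
          qed
          then have "(u' x * A (Suc n) x + u x * A' (Suc n) x - u' x)\<^sup>2 \<le> (p + r + \<bar>u' x\<bar>)\<^sup>2"
            by (metis abs_ge_zero order_trans power2_abs power_mono)
          also have "\<dots> \<le> 3 * (p\<^sup>2 + r\<^sup>2 + (u' x)\<^sup>2)"
            using zero_le_power2[of "p - r"] zero_le_power2[of "p - \<bar>u' x\<bar>"] zero_le_power2[of "r - \<bar>u' x\<bar>"]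
            by (simp add: power2_eq_square algebra_simps)
          finally have b: "(u' x * A (Suc n) x + u x * A' (Suc n) x - u' x)\<^sup>2 \<le> 3 * (p\<^sup>2 + r\<^sup>2 + (u' x)\<^sup>2)" .
          show ?thesis using a b x unfolding F_def p2 r2 by simp
        qed (simp add: F_def)
      qed
      show "AE x in lborel. (\<lambda>n. F n x) \<longlonglongrightarrow> 0"
      proof (rule AE_I2)
        fix x :: real
        show "(\<lambda>n. F n x) \<longlonglongrightarrow> 0"
        proof (cases "0 < x")
          case True
          have "\<forall>\<^sub>F n in sequentially. F n x = 0"
            using ev[OF True] by eventually_elim (simp add: F_def \<psi>_def)
          then show ?thesis by (rule tendsto_eventually)
        qed (simp add: F_def)
      qed
    qed auto
    moreover have "(LINT x|lborel. F n x) = (LINT x:{0<..}|lborel. (\<psi> n x - u x)\<^sup>2 + (deriv (\<psi> n) x - u' x)\<^sup>2)" for n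
      unfolding set_lebesgue_integral_def F_def
      by (rule Bochner_Integration.integral_cong) (auto simp: indicator_def DERIV_imp_deriv[OF d\<psi>])
    ultimately show ?thesis by simp
  qed
  show ?thesis unfolding W12_0_halfline_def
    using weak_derivative_C1[OF d c] m i C1 conv unfolding L2_on_def by blast
qed

section \<open>Integrability of the profile on the strip\<close>

lemma integral_fst_lborel:
  fixes F :: "real \<Rightarrow> real \<Rightarrow> real"
  assumes "integrable lborel (\<lambda>(x, t). F x t)"
  shows "(LINT x|lborel. LINT t|lborel. F x t) = (LINT (x, t)|lborel. F x t)"
    and "integrable lborel (\<lambda>x. LINT t|lborel. F x t)"
    and "AE x in lborel. integrable lborel (F x)"
  using lborel_pair.integral_fst[of F] lborel_pair.integrable_fst[of F] lborel_pair.AE_integrable_fst[of F] assms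
  unfolding lborel_prod by (simp_all add: case_prod_unfold)

lemma integral_snd_lborel:
  fixes F :: "real \<Rightarrow> real \<Rightarrow> real"
  assumes "integrable lborel (\<lambda>(x, t). F x t)"
  shows "(LINT t|lborel. LINT x|lborel. F x t) = (LINT (x, t)|lborel. F x t)"
    and "integrable lborel (\<lambda>t. LINT x|lborel. F x t)"
    and "AE t in lborel. integrable lborel (\<lambda>x. F x t)"
  using lborel_pair.integral_snd[of F] lborel_pair.integrable_snd[of F] lborel_pair.AE_integrable_snd[of F] assms
  unfolding lborel_prod by (simp_all add: case_prod_unfold)

lemma strip_sets [measurable]: "strip T \<in> sets borel"
  unfolding strip_def by (intro borel_Times) auto

lemma indicator_strip: "indicator (strip T) (x, t) = indicator {0..} x * (indicator {0<..<T} t :: real)"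
  unfolding strip_def by (auto simp: indicator_def)

lemma AE_fst_nonzero: "AE (x, t) in (lborel :: (real \<times> real) measure). x \<noteq> 0"
proof -
  have "{0::real} \<times> (UNIV :: real set) \<in> null_sets (lborel \<Otimes>\<^sub>M lborel)"
    by (intro null_setsI) (simp_all add: lborel.emeasure_pair_measure_Times)
  then have "{0::real} \<times> (UNIV :: real set) \<in> null_sets lborel" unfolding lborel_prod .
  then show ?thesis by (rule AE_I') auto
qed

lemma strip_measurable_continuous:
  fixes F :: "real \<Rightarrow> real \<Rightarrow> real"
  assumes "continuous_on (strip T) (\<lambda>(x, t). F x t)"
  shows "set_borel_measurable lborel (strip T) (\<lambda>(x, t). F x t)"
  unfolding set_borel_measurable_def
  using borel_measurable_continuous_on_indicator[OF _ assms] by simp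

lemma integrable_on_strip_box:
  "integrable lborel (\<lambda>(x :: real, t :: real). indicator {0..J} x * indicator {0<..<T} t :: real)"
proof -
  have "integrable lborel (indicator ({0..J} \<times> {0<..<T}) :: real \<times> real \<Rightarrow> real)"
  proof (rule integrable_real_indicator)
    show "emeasure lborel ({0..J} \<times> {0<..<T}) < \<infinity>"
      by (intro emeasure_bounded_finite bounded_Times) auto
    show "{0..J} \<times> {0<..<T} \<in> sets lborel" by (simp add: borel_Times)
  qed
  moreover have "indicator ({0..J} \<times> {0<..<T}) = (\<lambda>(x, t). indicator {0..J} x * indicator {0<..<T} t :: real)"
    by (auto simp: indicator_def fun_eq_iff)
  ultimately show ?thesis by simp
qed

text \<open>Both the flux at fixed \<open>x\<close> and the integral over \<open>x\<close> of
  \<open>Q (x / sqrt t) / t\<close> are of order \<open>1 / sqrt t\<close>. This is what makes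
  integrals down to \<open>t = 0\<close> finite.\<close>

lemma inverse_sqrt_integrable:
  "set_integrable lborel {0<..<T} (\<lambda>t. 1 / sqrt t)"
proof (cases "0 \<le> T")
  case True
  have eq: "t powr (-(1/2)) = 1 / sqrt t" if "t \<in> {0<..<T}" for t
    using that by (simp add: powr_minus_divide powr_half_sqrt)
  have "(\<lambda>t. t powr (-(1/2))) integrable_on {0<..T}"
    by (rule integrable_on_powr_from_0') (use True in auto)
  then have "(\<lambda>t. t powr (-(1/2))) integrable_on {0<..<T}"
    by (rule integrable_spike_set) (auto intro: negligible_subset[of "{T}"])
  then have "(\<lambda>t. t powr (-(1/2))) absolutely_integrable_on {0<..<T}"
    by (intro nonnegative_absolutely_integrable_1) auto
  then have a: "integrable lebesgue (\<lambda>t. indicator {0<..<T} t *\<^sub>R (1 / sqrt t))"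
    unfolding set_integrable_def
    by (rule Bochner_Integration.integrable_cong[THEN iffD1, rotated 2]) (auto simp: indicator_def eq)
  have "(\<lambda>t. indicator {0<..<T} t *\<^sub>R (1 / sqrt t)) \<in> borel_measurable lborel" by measurable
  then show ?thesis unfolding set_integrable_def using a integrable_completion by blast
qed (simp add: set_integrable_def)

text \<open>The free boundary \<open>a\<close> does not occur: in terms of \<open>D (f)\<close> and
  \<open>Q - \<eta> f / 2\<close> the profile is differentiable throughout (0, \<infinity>), and no
  separation of phases is required.\<close>

locale similarity_profile = two_phase +
  fixes f Q :: "real \<Rightarrow> real"
  assumes f_0: "f 0 = U" and f_cont: "continuous_on {0..} f" and Q_cont: "continuous_on {0..} Q"
    and f_lim: "(f \<longlongrightarrow> - V) at_top"
    and f_gt: "\<And>\<eta>. 0 \<le> \<eta> \<Longrightarrow> - V < f \<eta>" and f_le: "\<And>\<eta>. 0 \<le> \<eta> \<Longrightarrow> f \<eta> \<le> U"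
    and Q_pos: "\<And>\<eta>. 0 \<le> \<eta> \<Longrightarrow> 0 < Q \<eta>" and Q_le: "\<And>\<eta>. 0 \<le> \<eta> \<Longrightarrow> Q \<eta> \<le> Q 0"
    and f_tail: "\<And>\<eta>. 0 \<le> \<eta> \<Longrightarrow> \<eta> * (f \<eta> + V) / 2 \<le> Q \<eta>"
    and Df_deriv: "\<And>\<eta>. 0 < \<eta> \<Longrightarrow> ((\<lambda>\<eta>. D (f \<eta>)) has_real_derivative - Q \<eta>) (at \<eta>)"
    and M_deriv: "\<And>\<eta>. 0 < \<eta> \<Longrightarrow> ((\<lambda>\<eta>. Q \<eta> - \<eta> * f \<eta> / 2) has_real_derivative - f \<eta> / 2) (at \<eta>)"
begin

text \<open>\<open>Q\<close> is minus the derivative of \<open>D (f)\<close>, which has a finite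
  limit at \<infinity>.\<close>

lemma Q_integrable: "set_integrable lborel {0..} Q"
proof -
  define R where "R \<eta> = Q (max 0 \<eta>)" for \<eta>
  have "continuous_on UNIV R" unfolding R_def
    by (intro continuous_on_compose2[OF Q_cont] continuous_intros) auto
  then have Rm[measurable]: "R \<in> borel_measurable borel" by (rule borel_measurable_continuous_onI)
  have lim: "((\<lambda>\<eta>. - D (f \<eta>)) \<longlongrightarrow> - D (- V)) at_top"
    by (intro tendsto_minus continuous_on_tendsto_compose[OF D_cont[of UNIV] f_lim]) auto
  \<comment> \<open>The integration starts at 1 because the derivative of \<open>D (f)\<close> is
    known for positive arguments only; continuity takes care of \<open>{0..1}\<close>.\<close>
  have "(\<integral>\<^sup>+x. ennreal (R x) * indicator {1..} x \<partial>lborel) = ennreal (- D (- V) - (- D (f 1)))"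
  proof (rule nn_integral_FTC_atLeast[OF Rm _ _ lim])
    fix x :: real assume x: "1 \<le> x"
    then show "((\<lambda>\<eta>. - D (f \<eta>)) has_real_derivative R x) (at x)"
      using DERIV_minus[OF Df_deriv[of x]] unfolding R_def by simp
    show "0 \<le> R x" using Q_pos[of x] x unfolding R_def by simp
  qed
  then have "(\<integral>\<^sup>+x. ennreal (norm (indicator {1..} x *\<^sub>R R x)) \<partial>lborel) < \<infinity>"
  proof -
    have "(\<integral>\<^sup>+x. ennreal (norm (indicator {1..} x *\<^sub>R R x)) \<partial>lborel)
        = (\<integral>\<^sup>+x. ennreal (R x) * indicator {1..} x \<partial>lborel)"
      using Q_pos unfolding R_def by (intro nn_integral_cong) (auto simp: indicator_def abs_of_pos)
    then show ?thesis using \<open>_ = ennreal (- D (- V) - (- D (f 1)))\<close> by simp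
  qed
  then have "set_integrable lborel {1..} R"
    unfolding set_integrable_def by (intro integrableI_bounded) auto
  moreover have "set_integrable lborel {0..1} R"
    by (rule borel_integrable_atLeastAtMost') (use \<open>continuous_on UNIV R\<close> continuous_on_subset in blast)
  ultimately have "set_integrable lborel ({0..1} \<union> {1..}) R"
    by (intro set_integrable_Un) auto
  moreover have "{0..1} \<union> {1..} = {0::real..}" by auto
  ultimately have "set_integrable lborel {0..} R" by simp
  then show ?thesis unfolding set_integrable_def
    by (rule Bochner_Integration.integrable_cong[THEN iffD1, rotated 2]) (auto simp: R_def indicator_def max_def)
qed

lemma Q_scaled:
  assumes t: "0 < t"
  shows "set_integrable lborel {0..} (\<lambda>x. Q (x / sqrt t))"
    and "(LINT x:{0..}|lborel. Q (x / sqrt t)) = sqrt t * (LINT x:{0..}|lborel. Q x)"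
proof -
  have eq: "indicator {0..} (0 + 1 / sqrt t * x) *\<^sub>R Q (0 + 1 / sqrt t * x)
      = indicator {0..} x *\<^sub>R Q (x / sqrt t)" for x
    using t by (auto simp: indicator_def zero_le_divide_iff)
  show "set_integrable lborel {0..} (\<lambda>x. Q (x / sqrt t))"
    using lborel_integrable_real_affine[of "\<lambda>x. indicator {0..} x *\<^sub>R Q x" "1 / sqrt t" 0] Q_integrable t
    unfolding set_integrable_def eq by simp
  show "(LINT x:{0..}|lborel. Q (x / sqrt t)) = sqrt t * (LINT x:{0..}|lborel. Q x)"
    using lborel_integral_real_affine[of "1 / sqrt t" "\<lambda>x. indicator {0..} x *\<^sub>R Q x" 0] t
    unfolding set_lebesgue_integral_def eq by simp
qed

lemma continuous_on_similarity:
  assumes "continuous_on {0..} (F :: real \<Rightarrow> real)"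
  shows "continuous_on (strip T) (\<lambda>(x, t). F (x / sqrt t))"
  unfolding case_prod_unfold
  by (rule continuous_on_compose2[OF assms])
     (auto simp: strip_def intro!: continuous_intros divide_nonneg_pos)

text \<open>Scaling gives \<open>sqrt t\<close> times a constant for the integral of
  \<open>Q (x / sqrt t)\<close> over \<open>x\<close>; division by \<open>t\<close> leaves
  \<open>1 / sqrt t\<close>. This function dominates the flux, which is \<open>sqrt t\<close> times
  it in absolute value, and also the square of the flux, which is at most \<open>Q 0\<close> times
  it.\<close>

lemma Q_strip_integrable:
  "integrable lborel (\<lambda>(x, t). indicator (strip T) (x, t) * (Q (x / sqrt t) / t))"
proof -
  define F where "F x t = indicator (strip T) (x, t) * (Q (x / sqrt t) / t)" for x t
  have c: "continuous_on (strip T) (\<lambda>(x, t). Q (x / sqrt t) / t)"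
    unfolding case_prod_unfold using continuous_on_similarity[OF Q_cont, of T] unfolding case_prod_unfold
    by (intro continuous_on_divide continuous_intros) (auto simp: strip_def)
  have m: "(\<lambda>(x, t). F x t) \<in> borel_measurable (lborel \<Otimes>\<^sub>M lborel)"
    using strip_measurable_continuous[OF c] unfolding lborel_prod F_def set_borel_measurable_def case_prod_unfold by simp
  have nn: "0 \<le> F x t" for x t unfolding F_def using Q_pos[of "x / sqrt t"]
    by (auto simp: strip_def indicator_def intro: less_imp_le)
  define I where "I = (LINT x:{0..}|lborel. Q x)"
  have inner: "(\<integral>\<^sup>+x. ennreal (F x t) \<partial>lborel) = ennreal (I * (indicator {0<..<T} t *\<^sub>R (1 / sqrt t)))" for t
  proof (cases "t \<in> {0<..<T}")
    case True
    then have t: "0 < t" by simp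
    have "F x t = (indicator {0..} x *\<^sub>R Q (x / sqrt t)) / t" for x
      unfolding F_def using True by (simp add: indicator_strip)
    then have "(\<integral>\<^sup>+x. ennreal (F x t) \<partial>lborel) = ennreal (LINT x|lborel. (indicator {0..} x *\<^sub>R Q (x / sqrt t)) / t)"
      using Q_scaled(1)[OF t] nn[of _ t] unfolding set_integrable_def
      by (subst nn_integral_eq_integral[symmetric]) auto
    also have "(LINT x|lborel. (indicator {0..} x *\<^sub>R Q (x / sqrt t)) / t) = sqrt t * I / t"
      using Q_scaled(2)[OF t] unfolding set_lebesgue_integral_def I_def by simp
    also have "sqrt t * I / t = I * (indicator {0<..<T} t *\<^sub>R (1 / sqrt t))"
      using True by (simp add: field_simps)
    finally show ?thesis .
  next
    case False then show ?thesis unfolding F_def by (simp add: indicator_strip)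
  qed
  have "(\<integral>\<^sup>+z. ennreal (norm (case z of (x, t) \<Rightarrow> F x t)) \<partial>(lborel \<Otimes>\<^sub>M lborel))
      = (\<integral>\<^sup>+t. (\<integral>\<^sup>+x. ennreal (F x t) \<partial>lborel) \<partial>lborel)"
    using m nn by (subst lborel_pair.nn_integral_snd[symmetric]) auto
  also have "\<dots> = (\<integral>\<^sup>+t. ennreal (I * (indicator {0<..<T} t *\<^sub>R (1 / sqrt t))) \<partial>lborel)"
    unfolding inner ..
  also have "\<dots> < \<infinity>"
  proof -
    have "integrable lborel (\<lambda>t. I * (indicator {0<..<T} t *\<^sub>R (1 / sqrt t)))"
      using inverse_sqrt_integrable[of T] unfolding set_integrable_def by (intro integrable_mult_right)
    then have "(\<integral>\<^sup>+t. ennreal (norm (I * (indicator {0<..<T} t *\<^sub>R (1 / sqrt t)))) \<partial>lborel) < \<infinity>"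
      unfolding integrable_iff_bounded by blast
    moreover have "(\<integral>\<^sup>+t. ennreal (I * (indicator {0<..<T} t *\<^sub>R (1 / sqrt t))) \<partial>lborel)
       \<le> (\<integral>\<^sup>+t. ennreal (norm (I * (indicator {0<..<T} t *\<^sub>R (1 / sqrt t)))) \<partial>lborel)"
      by (intro nn_integral_mono ennreal_leI) (simp only: real_norm_def abs_ge_self)
    ultimately show ?thesis by (rule le_less_trans[rotated])
  qed
  finally show ?thesis using m unfolding F_def lborel_prod by (intro integrableI_bounded) auto
qed

text \<open>\<open>D\<close> is Lipschitz on the range of \<open>f\<close>, so \<open>f + V\<close>
  has to be bounded by a multiple of \<open>Q\<close>. For \<eta> > 1 this is the tail bound; on
  [0,1] the function \<open>Q\<close> has a positive minimum.\<close>

lemma D_f_decay: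
  obtains C where "0 < C" "\<And>\<eta>. 0 \<le> \<eta> \<Longrightarrow> \<bar>D (f \<eta>) - D (- V)\<bar> \<le> C * Q \<eta>"
proof -
  have "bounded (D' ` {-V..U})"
    by (intro compact_imp_bounded compact_continuous_image continuous_on_subset[OF D'_cont]) auto
  then obtain K where K: "\<And>s. s \<in> {-V..U} \<Longrightarrow> \<bar>D' s\<bar> \<le> K"
    unfolding bounded_iff by (metis imageI real_norm_def)
  have K0: "0 \<le> K" using K[of 0] U_pos V_pos by force
  obtain m where m: "m \<in> {0..1}" "\<And>x. x \<in> {0..1} \<Longrightarrow> Q m \<le> Q x"
    using continuous_attains_inf[of "{0..1::real}" Q] continuous_on_subset[OF Q_cont, of "{0..1}"] by auto
  have Qm: "0 < Q m" using Q_pos[of m] m by simp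
  \<comment> \<open>The summand 2 serves \<eta> > 1, the quotient serves \<eta> \<le> 1.\<close>
  define B where "B = 2 + (U + V) / Q m"
  have B: "0 < B" unfolding B_def using Qm U_pos V_pos by (simp add: add_pos_pos)
  have fB: "f \<eta> + V \<le> B * Q \<eta>" if \<eta>: "0 \<le> \<eta>" for \<eta>
  proof (cases "\<eta> \<le> 1")
    case True
    have "f \<eta> + V \<le> (U + V) / Q m * Q m" using f_le[OF \<eta>] Qm by simp
    also have "\<dots> \<le> (U + V) / Q m * Q \<eta>" using m(2)[of \<eta>] True \<eta> Qm U_pos V_pos by (intro mult_left_mono) auto
    also have "\<dots> \<le> B * Q \<eta>" unfolding B_def using Q_pos[OF \<eta>] by (simp add: distrib_right)
    finally show ?thesis .
  next
    case False
    have "1 * (f \<eta> + V) \<le> \<eta> * (f \<eta> + V)" using f_gt[OF \<eta>] False by (intro mult_right_mono) auto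
    also have "\<dots> \<le> 2 * Q \<eta>" using f_tail[OF \<eta>] by simp
    also have "\<dots> \<le> B * Q \<eta>" unfolding B_def using Q_pos[OF \<eta>] Qm U_pos V_pos by (simp add: distrib_right)
    finally show ?thesis by simp
  qed
  have "\<bar>D (f \<eta>) - D (- V)\<bar> \<le> (K * B + 1) * Q \<eta>" if \<eta>: "0 \<le> \<eta>" for \<eta>
  proof -
    have "norm (D (f \<eta>) - D (- V)) \<le> K * norm (f \<eta> - (- V))"
    proof (rule field_differentiable_bound[of "{-V..U}" D D'])
      show "norm (D' s) \<le> K" if "s \<in> {-V..U}" for s using K[OF that] by simp
    qed (use has_field_derivative_at_within[OF D_deriv] f_gt[OF \<eta>] f_le[OF \<eta>] U_pos V_pos in auto)
    also have "\<dots> = K * (f \<eta> + V)" using f_gt[OF \<eta>] by simp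
    also have "\<dots> \<le> K * (B * Q \<eta>)" by (rule mult_left_mono[OF fB[OF \<eta>] K0])
    also have "\<dots> \<le> (K * B + 1) * Q \<eta>" using Q_pos[OF \<eta>] by (simp add: algebra_simps)
    finally show ?thesis by simp
  qed
  moreover have "0 < K * B + 1" using K0 B by (simp add: add_nonneg_pos)
  ultimately show ?thesis using that by blast
qed

end

section \<open>The self-similar function is a weak solution\<close>

context similarity_profile
begin

definition sol :: "real \<Rightarrow> real \<Rightarrow> real" where "sol x t = f (x / sqrt t)"

definition flux :: "real \<Rightarrow> real \<Rightarrow> real" where "flux x t = - Q (x / sqrt t) / sqrt t"

text \<open>The potential satisfies \<open>pot\<^sub>x = sol\<close> and \<open>pot\<^sub>t = flux = D(sol)\<^sub>x\<close>. At \<open>t = 0\<close>, where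
  division by zero would give a wrong value, it is continued by its limit.\<close>
definition pot :: "real \<Rightarrow> real \<Rightarrow> real" where
  "pot x t = (if t = 0 then - V * x else x * f (x / sqrt t) - 2 * sqrt t * Q (x / sqrt t))"

lemma sol_bound: "0 \<le> x \<Longrightarrow> 0 \<le> t \<Longrightarrow> \<bar>sol x t\<bar> \<le> U + V"
  using f_gt[of "x / sqrt t"] f_le[of "x / sqrt t"] U_pos V_pos unfolding sol_def by auto

lemma flux_bound: "0 \<le> x \<Longrightarrow> 0 < t \<Longrightarrow> \<bar>flux x t\<bar> \<le> Q 0 / sqrt t"
  using Q_pos[of "x / sqrt t"] Q_le[of "x / sqrt t"] unfolding flux_def by (simp add: divide_right_mono)

lemma sol_cont: "continuous_on (strip T) (\<lambda>(x, t). sol x t)"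
  unfolding sol_def by (rule continuous_on_similarity[OF f_cont])

lemma flux_cont: "continuous_on (strip T) (\<lambda>(x, t). flux x t)"
  unfolding flux_def case_prod_unfold
  using continuous_on_similarity[OF Q_cont, of T] unfolding case_prod_unfold
  by (intro continuous_on_divide continuous_on_minus continuous_intros) (auto simp: strip_def)

text \<open>For positive \<open>t\<close> the potential is \<open>- 2 sqrt t\<close> times
  \<open>Q - \<eta> f / 2\<close> at \<open>\<eta> = x / sqrt t\<close>, so \<open>M_deriv\<close>
  suffices and \<open>f\<close> itself is not differentiated.\<close>

lemma pot_deriv_x:
  assumes "0 < x" "0 < t"
  shows "((\<lambda>x. pot x t) has_real_derivative sol x t) (at x)"
proof -
  have 1: "((\<lambda>x. - 2 * sqrt t * (Q (x / sqrt t) - x / sqrt t * f (x / sqrt t) / 2)) has_real_derivative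
      - 2 * sqrt t * (- f (x / sqrt t) / 2 * (1 / sqrt t))) (at x)"
    by (rule DERIV_cmult[OF DERIV_chain2[OF M_deriv]])
       (use assms in \<open>auto intro!: derivative_eq_intros simp: sqrt_divide_self_eq inverse_eq_divide\<close>)
  have "(\<lambda>x. pot x t) = (\<lambda>x. - 2 * sqrt t * (Q (x / sqrt t) - x / sqrt t * f (x / sqrt t) / 2))"
    unfolding pot_def using assms by (auto simp: fun_eq_iff algebra_simps)
  then show ?thesis using 1 assms unfolding sol_def by (simp add: sqrt_divide_self_eq inverse_eq_divide)
qed

text \<open>The contributions containing \<open>f\<close> from the two factors cancel, leaving
  \<open>- Q / sqrt t\<close>.\<close>

lemma pot_deriv_t:
  assumes "0 < x" "0 < t"
  shows "((\<lambda>t. pot x t) has_real_derivative flux x t) (at t)"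
proof -
  have 1: "((\<lambda>t. - 2 * sqrt t * (Q (x / sqrt t) - x / sqrt t * f (x / sqrt t) / 2)) has_real_derivative
      - 2 * (inverse (sqrt t) / 2) * (Q (x / sqrt t) - x / sqrt t * f (x / sqrt t) / 2)
      + (- f (x / sqrt t) / 2 * (- (x * (inverse (sqrt t) / 2)) / (sqrt t * sqrt t))) * (- 2 * sqrt t)) (at t)"
    by (rule DERIV_mult[OF DERIV_cmult[OF DERIV_real_sqrt] DERIV_chain2[OF M_deriv]])
       (use assms in \<open>auto intro!: derivative_eq_intros\<close>)
  have "((\<lambda>t. pot x t) has_real_derivative
      - 2 * (inverse (sqrt t) / 2) * (Q (x / sqrt t) - x / sqrt t * f (x / sqrt t) / 2)
      + (- f (x / sqrt t) / 2 * (- (x * (inverse (sqrt t) / 2)) / (sqrt t * sqrt t))) * (- 2 * sqrt t)) (at t)"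
    by (rule has_field_derivative_transform_within_open[OF 1, where S="{0<..}"])
       (use assms in \<open>auto simp: pot_def algebra_simps\<close>)
  moreover have "- 2 * (inverse (sqrt t) / 2) * (Q (x / sqrt t) - x / sqrt t * f (x / sqrt t) / 2)
      + (- f (x / sqrt t) / 2 * (- (x * (inverse (sqrt t) / 2)) / (sqrt t * sqrt t))) * (- 2 * sqrt t) = flux x t"
    unfolding flux_def using assms by (simp add: field_simps)
  ultimately show ?thesis by simp
qed

text \<open>The initial condition enters here: as \<open>t\<close> tends to 0 with \<open>x\<close>
  fixed and positive, \<open>x / sqrt t\<close> tends to \<infinity>, so \<open>f\<close> tends to
  \<open>- V\<close>, while the other term is at most \<open>2 sqrt t * Q 0\<close>.\<close>

lemma pot_cont_t:
  assumes x: "0 < x"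
  shows "continuous_on {0..T} (pot x)"
proof (rule continuous_on_eq_continuous_within[THEN iffD2, rule_format])
  fix t assume t: "t \<in> {0..T}"
  show "continuous (at t within {0..T}) (pot x)"
  proof (cases "t = 0")
    case False
    then have "isCont (pot x) t" using DERIV_isCont[OF pot_deriv_t[OF x]] t by simp
    then show ?thesis by (rule continuous_at_imp_continuous_at_within)
  next
    case True
    let ?F = "at 0 within {0..T}"
    have small: "\<forall>\<^sub>F t in ?F. 0 < t \<and> t < d" if "0 < d" for d
      unfolding eventually_at using that by (intro exI[of _ d]) auto
    have "filterlim (\<lambda>t. x / sqrt t) at_top ?F"
      unfolding filterlim_at_top
    proof
      fix Z :: real
      have "\<forall>\<^sub>F t in ?F. 0 < t \<and> t < (x / (\<bar>Z\<bar> + 1))\<^sup>2"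
        by (rule small) (use x in \<open>simp add: add_nonneg_pos\<close>)
      then show "\<forall>\<^sub>F t in ?F. Z \<le> x / sqrt t"
      proof eventually_elim
        case (elim t)
        then have "sqrt t < x / (\<bar>Z\<bar> + 1)" using real_less_lsqrt[of "x / (\<bar>Z\<bar> + 1)" t] x by simp
        then have "\<bar>Z\<bar> + 1 < x / sqrt t" using elim by (simp add: field_simps)
        then show ?case by linarith
      qed
    qed
    then have "((\<lambda>t. f (x / sqrt t)) \<longlongrightarrow> - V) ?F" by (rule filterlim_compose[OF f_lim])
    moreover have "((\<lambda>t. 2 * sqrt t * Q (x / sqrt t)) \<longlongrightarrow> 0) ?F"
    proof (rule Lim_null_comparison)
      show "\<forall>\<^sub>F t in ?F. norm (2 * sqrt t * Q (x / sqrt t)) \<le> 2 * sqrt t * Q 0"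
        using small[OF zero_less_one]
      proof eventually_elim
        case (elim t)
        have "\<bar>Q (x / sqrt t)\<bar> \<le> Q 0" using Q_pos[of "x / sqrt t"] Q_le[of "x / sqrt t"] elim x by simp
        then show ?case using elim by (simp add: abs_mult mult_left_mono)
      qed
      show "((\<lambda>t. 2 * sqrt t * Q 0) \<longlongrightarrow> 0) ?F" by (auto intro!: tendsto_eq_intros)
    qed
    ultimately have "((\<lambda>t. x * f (x / sqrt t) - 2 * sqrt t * Q (x / sqrt t)) \<longlongrightarrow> x * - V - 0) ?F"
      by (intro tendsto_diff tendsto_mult tendsto_const)
    moreover have "\<forall>\<^sub>F t in ?F. x * f (x / sqrt t) - 2 * sqrt t * Q (x / sqrt t) = pot x t"
      using small[OF zero_less_one] by eventually_elim (simp add: pot_def)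
    ultimately have "(pot x \<longlongrightarrow> x * - V - 0) ?F" by (rule Lim_transform_eventually)
    then show ?thesis using True unfolding continuous_within by (simp add: pot_def mult.commute)
  qed
qed


lemma pot_diff_quot_bound:
  assumes x: "0 < x" and t: "0 < t" and h: "0 < h"
  shows "\<bar>(pot (x + h) t - pot x t) / h\<bar> \<le> U + V"
proof -
  obtain z where z: "x < z" "z < x + h" "pot (x + h) t - pot x t = (x + h - x) * sol z t"
  proof (rule MVT_real[of x "x + h" "\<lambda>x. pot x t" "\<lambda>x. sol x t"])
    show "continuous_on {x..x + h} (\<lambda>x. pot x t)"
      by (rule DERIV_continuous_on[OF has_field_derivative_at_within[OF pot_deriv_x]]) (use x t in auto)
  qed (use x t h pot_deriv_x in auto)
  then show ?thesis using sol_bound[of z t] x t h by simp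
qed

text \<open>The function \<open>sol\<close> cannot be integrated by parts in time, because it may
  fail to be differentiable across the free boundary; differences of the potential can. The flux is
  unbounded as \<open>t\<close> tends to 0, hence the separate claim of integrability. In use,
  \<open>\<zeta>\<close> is a test function at fixed \<open>x\<close>.\<close>

lemma pot_by_parts:
  assumes x: "0 < x" and h: "0 < h" and T: "0 < T"
    and d: "\<And>t. t \<in> {0..T} \<Longrightarrow> (\<zeta> has_real_derivative \<zeta>' t) (at t within {0..T})"
    and c: "continuous_on {0..T} \<zeta>'" and zT: "\<zeta> T = 0"
  shows "(LINT t:{0<..<T}|lborel. (pot (x + h) t - pot x t) * \<zeta>' t)
     = V * h * \<zeta> 0 - (LINT t:{0<..<T}|lborel. (flux (x + h) t - flux x t) * \<zeta> t)"
    and "set_integrable lborel {0<..<T} (\<lambda>t. flux x t * \<zeta> t)"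
proof -
  have c\<zeta>: "continuous_on {0..T} \<zeta>" by (rule DERIV_continuous_on[OF d])
  have "bounded (\<zeta> ` {0..T})" by (intro compact_imp_bounded compact_continuous_image c\<zeta>) auto
  then obtain C where C: "\<And>t. t \<in> {0..T} \<Longrightarrow> \<bar>\<zeta> t\<bar> \<le> C"
    unfolding bounded_iff by (metis imageI real_norm_def)
  have fi: "set_integrable lborel {0<..<T} (\<lambda>t. flux y t * \<zeta> t)" if y: "0 < y" for y
    unfolding set_integrable_def
  proof (rule Bochner_Integration.integrable_bound)
    show "integrable lborel (\<lambda>t. (Q 0 * C) * (indicator {0<..<T} t *\<^sub>R (1 / sqrt t)))"
      using inverse_sqrt_integrable[of T] unfolding set_integrable_def by (intro integrable_mult_right)
    have "continuous_on {0<..<T} (\<lambda>t. flux y t * \<zeta> t)"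
      unfolding flux_def using y
      by (intro continuous_intros continuous_on_compose2[OF Q_cont] continuous_on_subset[OF c\<zeta>]) auto
    from borel_measurable_continuous_on_indicator[OF _ this]
    show "(\<lambda>t. indicator {0<..<T} t *\<^sub>R (flux y t * \<zeta> t)) \<in> borel_measurable lborel" by simp
    show "AE t in lborel. norm (indicator {0<..<T} t *\<^sub>R (flux y t * \<zeta> t))
        \<le> norm ((Q 0 * C) * (indicator {0<..<T} t *\<^sub>R (1 / sqrt t)))"
    proof (rule AE_I2)
      fix t
      show "norm (indicator {0<..<T} t *\<^sub>R (flux y t * \<zeta> t)) \<le> norm ((Q 0 * C) * (indicator {0<..<T} t *\<^sub>R (1 / sqrt t)))"
      proof (cases "t \<in> {0<..<T}")
        case True
        have "\<bar>flux y t\<bar> * \<bar>\<zeta> t\<bar> \<le> Q 0 / sqrt t * \<bar>C\<bar>"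
          using flux_bound[of y t] C[of t] True y Q_pos[of 0] by (intro mult_mono) auto
        then show ?thesis using True Q_pos[of 0] by (simp add: abs_mult)
      qed simp
    qed
  qed
  then show "set_integrable lborel {0<..<T} (\<lambda>t. flux x t * \<zeta> t)" using x by blast
  define G where "G t = pot (x + h) t - pot x t" for t
  have cG: "continuous_on {0..T} G" unfolding G_def using pot_cont_t x h by (intro continuous_intros) auto
  have i1: "set_integrable lborel {0<..<T} (\<lambda>t. G t * \<zeta>' t)"
  proof (rule set_integrable_subset)
    show "set_integrable lborel {0..T} (\<lambda>t. G t * \<zeta>' t)"
      by (rule borel_integrable_atLeastAtMost') (intro continuous_intros cG c)
  qed auto
  have i2: "set_integrable lborel {0<..<T} (\<lambda>t. (flux (x + h) t - flux x t) * \<zeta> t)"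
    using set_integral_diff(1)[OF fi fi, of "x + h" x] x h by (simp add: left_diff_distrib)
  have "((\<lambda>t. G t * \<zeta>' t + (flux (x + h) t - flux x t) * \<zeta> t) has_integral (G T * \<zeta> T - G 0 * \<zeta> 0)) {0..T}"
  \<comment> \<open>Continuity on the closed interval and derivatives in its interior suffice; at
    \<open>t = 0\<close> there is no derivative.\<close>
  proof (rule fundamental_theorem_of_calculus_interior)
    show "continuous_on {0..T} (\<lambda>t. G t * \<zeta> t)" by (intro continuous_intros cG c\<zeta>)
    fix t assume t: "t \<in> {0<..<T}"
    then have "(\<zeta> has_real_derivative \<zeta>' t) (at t)"
      using d[of t] at_within_Icc_at[of 0 t T] by auto
    moreover have "(G has_real_derivative flux (x + h) t - flux x t) (at t)"
      unfolding G_def using pot_deriv_t[of "x + h" t] pot_deriv_t[of x t] x h t by (intro DERIV_diff) auto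
    ultimately have "((\<lambda>t. G t * \<zeta> t) has_real_derivative G t * \<zeta>' t + (flux (x + h) t - flux x t) * \<zeta> t) (at t)"
      by (auto intro!: derivative_eq_intros)
    then show "((\<lambda>t. G t * \<zeta> t) has_vector_derivative G t * \<zeta>' t + (flux (x + h) t - flux x t) * \<zeta> t) (at t)"
      by (simp add: has_real_derivative_iff_has_vector_derivative)
  qed (use T in auto)
  then have "((\<lambda>t. G t * \<zeta>' t + (flux (x + h) t - flux x t) * \<zeta> t) has_integral (G T * \<zeta> T - G 0 * \<zeta> 0)) {0<..<T}"
    by (simp add: has_integral_Icc_iff_Ioo)
  then have "integral {0<..<T} (\<lambda>t. G t * \<zeta>' t + (flux (x + h) t - flux x t) * \<zeta> t) = G T * \<zeta> T - G 0 * \<zeta> 0"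
    by (rule integral_unique)
  then have "(LINT t:{0<..<T}|lborel. G t * \<zeta>' t + (flux (x + h) t - flux x t) * \<zeta> t) = G T * \<zeta> T - G 0 * \<zeta> 0"
    using set_borel_integral_eq_integral(2)[OF set_integral_add(1)[OF i1 i2]] by simp
  \<comment> \<open>The separate clause of \<open>pot\<close> at \<open>t = 0\<close> supplies the
    initial datum.\<close>
  moreover have "G 0 = - V * h" unfolding G_def pot_def by (simp add: algebra_simps)
  ultimately show "(LINT t:{0<..<T}|lborel. (pot (x + h) t - pot x t) * \<zeta>' t)
     = V * h * \<zeta> 0 - (LINT t:{0<..<T}|lborel. (flux (x + h) t - flux x t) * \<zeta> t)"
    using set_integral_add(2)[OF i1 i2] zT unfolding G_def by simp
qed

end

section \<open>Difference quotients, translations and bounds for test functions\<close>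

lemma DERIV_sequentially:
  assumes d: "(g has_real_derivative D) (at x)" and h: "h \<longlonglongrightarrow> 0" "\<And>n. h n \<noteq> 0"
  shows "(\<lambda>n. (g (x + h n) - g x) / h n) \<longlonglongrightarrow> D"
proof -
  have "filterlim h (at 0) sequentially" using h by (auto simp: filterlim_at)
  then show ?thesis using d unfolding DERIV_def by (rule filterlim_compose[rotated])
qed

text \<open>\<open>test_function\<close> requires continuity of the partial derivatives; joint
  continuity of the function itself is recovered from Lipschitz bounds in each variable.\<close>

lemma continuous_on_Times_lipschitz:
  fixes F :: "real \<Rightarrow> real \<Rightarrow> real"
  assumes A: "\<And>x y t. x \<in> X \<Longrightarrow> y \<in> X \<Longrightarrow> t \<in> Y \<Longrightarrow> \<bar>F x t - F y t\<bar> \<le> A * \<bar>x - y\<bar>"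
    and B: "\<And>x s t. x \<in> X \<Longrightarrow> s \<in> Y \<Longrightarrow> t \<in> Y \<Longrightarrow> \<bar>F x s - F x t\<bar> \<le> B * \<bar>s - t\<bar>"
    and nn: "0 \<le> A" "0 \<le> B"
  shows "continuous_on (X \<times> Y) (\<lambda>(x, t). F x t)"
proof (rule lipschitz_on_continuous_on[where L="A + B"], rule lipschitz_onI)
  fix p q assume "p \<in> X \<times> Y" "q \<in> X \<times> Y"
  then obtain x t y s where e: "p = (x, t)" "q = (y, s)" "x \<in> X" "y \<in> X" "t \<in> Y" "s \<in> Y" by auto
  have "\<bar>F x t - F y s\<bar> \<le> A * \<bar>x - y\<bar> + B * \<bar>t - s\<bar>"
    using A[of x y t] B[of y t s] e by linarith
  also have "\<dots> \<le> A * dist p q + B * dist p q"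
    using dist_fst_le[of p q] dist_snd_le[of p q] nn e by (intro add_mono mult_left_mono) (auto simp: dist_real_def)
  finally show "dist (case p of (x, t) \<Rightarrow> F x t) (case q of (x, t) \<Rightarrow> F x t) \<le> (A + B) * dist p q"
    using e by (simp add: dist_real_def distrib_right)
qed (use nn in auto)

lemma lborel_translate_fst:
  fixes F :: "real \<Rightarrow> real \<Rightarrow> real"
  assumes "integrable lborel (\<lambda>(x, t). F x t)"
  shows "integrable lborel (\<lambda>(x, t). F (x + h) t)"
    and "(LINT (x, t)|lborel. F (x + h) t) = (LINT (x, t)|lborel. F x t)"
proof -
  have d: "distr lborel borel ((+) (h, 0 :: real)) = lborel" by (rule lborel_distr_plus)
  have e: "(\<lambda>(x, t). F (x + h) t) = (\<lambda>z. (case (h, 0) + z of (x, t) \<Rightarrow> F x t))"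
    by (auto simp: fun_eq_iff add.commute)
  have m: "(\<lambda>(x, t). F x t) \<in> borel_measurable borel"
    using borel_measurable_integrable[OF assms] by simp
  have "integrable (distr lborel borel ((+) (h, 0 :: real))) (\<lambda>(x, t). F x t)" using assms d by simp
  then show "integrable lborel (\<lambda>(x, t). F (x + h) t)"
    unfolding e using integrable_distr_eq[of "(+) (h, 0 :: real)" lborel borel "\<lambda>(x, t). F x t"] m by simp
  show "(LINT (x, t)|lborel. F (x + h) t) = (LINT (x, t)|lborel. F x t)"
    unfolding e using integral_distr[of "(+) (h, 0 :: real)" lborel borel "\<lambda>(x, t). F x t"] m d by simp
qed

text \<open>Compactness bounds the derivatives for \<open>x \<le> J\<close>, and beyond
  \<open>J\<close> they vanish together with the function. A single constant \<open>M\<close> serves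
  all estimates.\<close>

lemma test_function_bounds:
  assumes tf: "test_function T \<xi> \<xi>x \<xi>t"
  obtains J M where "0 < J" "0 < M" "\<And>x t. J < x \<Longrightarrow> t \<in> {0..T} \<Longrightarrow> \<xi> x t = 0"
    "\<And>x t. J < x \<Longrightarrow> t \<in> {0<..<T} \<Longrightarrow> \<xi>t x t = 0"
    "\<And>x t. 0 \<le> x \<Longrightarrow> t \<in> {0<..<T} \<Longrightarrow> \<bar>\<xi>t x t\<bar> \<le> M"
    "\<And>x y t. 0 \<le> x \<Longrightarrow> 0 \<le> y \<Longrightarrow> t \<in> {0..T} \<Longrightarrow> \<bar>\<xi> x t - \<xi> y t\<bar> \<le> M * \<bar>x - y\<bar>"
    "continuous_on ({0..} \<times> {0..T}) (\<lambda>(x, t). \<xi> x t)"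
    "\<And>x t. 0 \<le> x \<Longrightarrow> t \<in> {0..T} \<Longrightarrow> \<bar>\<xi> x t\<bar> \<le> M"
proof -
  have dx: "((\<lambda>y. \<xi> y t) has_real_derivative \<xi>x x t) (at x within {0..})" if "0 \<le> x" "t \<in> {0..T}" for x t
    using tf that unfolding test_function_def by blast
  have dt: "((\<lambda>s. \<xi> x s) has_real_derivative \<xi>t x t) (at t within {0..T})" if "0 \<le> x" "t \<in> {0..T}" for x t
    using tf that unfolding test_function_def by blast
  obtain J where J: "0 < J" "\<And>x t. J < x \<Longrightarrow> t \<in> {0..T} \<Longrightarrow> \<xi> x t = 0"
    using tf unfolding test_function_def by blast
  have bdd: "\<exists>B. \<forall>x t. x \<in> {0..J} \<and> t \<in> {0..T} \<longrightarrow> \<bar>F x t\<bar> \<le> B"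
    if "continuous_on ({0..} \<times> {0..T}) (\<lambda>(x, t). F x t)" for F :: "real \<Rightarrow> real \<Rightarrow> real"
  proof -
    have "bounded ((\<lambda>(x, t). F x t) ` ({0..J} \<times> {0..T}))"
      by (intro compact_imp_bounded compact_continuous_image continuous_on_subset[OF that] compact_Times) auto
    then show ?thesis unfolding bounded_iff by fastforce
  qed
  have "continuous_on ({0..} \<times> {0..T}) (\<lambda>(x, t). \<xi>x x t)" "continuous_on ({0..} \<times> {0..T}) (\<lambda>(x, t). \<xi>t x t)"
    using tf unfolding test_function_def by auto
  from this[THEN bdd] obtain Bx Bt where Bx: "\<And>x t. x \<in> {0..J} \<Longrightarrow> t \<in> {0..T} \<Longrightarrow> \<bar>\<xi>x x t\<bar> \<le> Bx"
    and Bt: "\<And>x t. x \<in> {0..J} \<Longrightarrow> t \<in> {0..T} \<Longrightarrow> \<bar>\<xi>t x t\<bar> \<le> Bt"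
    by metis
  have zx: "\<xi>x x t = 0" if "J < x" "t \<in> {0..T}" for x t
  proof -
    have "((\<lambda>y. \<xi> y t) has_real_derivative 0) (at x)"
      by (rule has_field_derivative_transform_within_open[where S="{J<..}" and f="\<lambda>_. 0"]) (use J that in auto)
    moreover have "((\<lambda>y. \<xi> y t) has_real_derivative \<xi>x x t) (at x)"
      using dx[of x t] that J(1) at_within_interior[of x "{0..}"] by simp
    ultimately show ?thesis using DERIV_unique by blast
  qed
  have zt: "\<xi>t x t = 0" if "J < x" "t \<in> {0<..<T}" for x t
  proof -
    have "((\<lambda>s. \<xi> x s) has_real_derivative 0) (at t)"
      by (rule has_field_derivative_transform_within_open[where S="{0<..<T}" and f="\<lambda>_. 0"]) (use J that in auto)
    moreover have "((\<lambda>s. \<xi> x s) has_real_derivative \<xi>t x t) (at t)"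
      using dt[of x t] that J at_within_Icc_at[of 0 t T] by auto
    ultimately show ?thesis using DERIV_unique by blast
  qed
  define M0 where "M0 = max 1 (max Bx Bt)"
  have M0: "0 < M0" unfolding M0_def by simp
  have bx: "\<bar>\<xi>x x t\<bar> \<le> M0" if "0 \<le> x" "t \<in> {0..T}" for x t
    using Bx[of x t] zx[of x t] that M0 unfolding M0_def by (cases "x \<le> J") auto
  have bt: "\<bar>\<xi>t x t\<bar> \<le> M0" if "0 \<le> x" "t \<in> {0<..<T}" for x t
    using Bt[of x t] zt[of x t] that M0 unfolding M0_def by (cases "x \<le> J") auto
  have lx: "\<bar>\<xi> x t - \<xi> y t\<bar> \<le> M0 * \<bar>x - y\<bar>" if "0 \<le> x" "0 \<le> y" "t \<in> {0..T}" for x y t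
    using field_differentiable_bound[of "{0..}" "\<lambda>y. \<xi> y t" "\<lambda>y. \<xi>x y t" M0 x y] dx bx that by auto
  have lt: "\<bar>\<xi> x s - \<xi> x t\<bar> \<le> M0 * \<bar>s - t\<bar>" if "0 \<le> x" "s \<in> {0..T}" "t \<in> {0..T}" for x s t
  proof (cases "x \<le> J")
    case True
    have "norm (\<xi>t x r) \<le> M0" if "r \<in> {0..T}" for r
      using Bt[of x r] True \<open>0 \<le> x\<close> that unfolding M0_def by auto
    then show ?thesis
      using field_differentiable_bound[of "{0..T}" "\<lambda>s. \<xi> x s" "\<lambda>s. \<xi>t x s" M0 s t] dt that by auto
  next
    case False
    then show ?thesis using J that M0 by simp
  qed
  have c: "continuous_on ({0..} \<times> {0..T}) (\<lambda>(x, t). \<xi> x t)"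
    by (rule continuous_on_Times_lipschitz[where A=M0 and B=M0]) (use lx lt M0 in auto)
  obtain B where B: "\<And>x t. x \<in> {0..J} \<Longrightarrow> t \<in> {0..T} \<Longrightarrow> \<bar>\<xi> x t\<bar> \<le> B"
    using bdd[OF c] by metis
  define M where "M = max M0 B"
  have M: "M0 \<le> M" "B \<le> M" unfolding M_def by auto
  have b: "\<bar>\<xi> x t\<bar> \<le> M" if "0 \<le> x" "t \<in> {0..T}" for x t
    using B[of x t] J(2)[of x t] that M M0 by (cases "x \<le> J") auto
  show ?thesis
  proof (rule that[of J M])
    show "\<bar>\<xi> x t - \<xi> y t\<bar> \<le> M * \<bar>x - y\<bar>" if "0 \<le> x" "0 \<le> y" "t \<in> {0..T}" for x y t
      using lx[OF that] mult_right_mono[OF M(1), of "\<bar>x - y\<bar>"] by linarith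
    show "\<bar>\<xi>t x t\<bar> \<le> M" if "0 \<le> x" "t \<in> {0<..<T}" for x t using bt[OF that] M by linarith
  qed (use J zt c b M M0 in auto)
qed

section \<open>The integral identity for the self-similar function\<close>

context similarity_profile
begin

lemma pot_cont_strip:
  assumes "0 \<le> h"
  shows "continuous_on (strip T) (\<lambda>(x, t). pot (x + h) t)"
proof -
  have 1: "continuous_on (strip T) (\<lambda>z. F ((fst z + h) / sqrt (snd z)))"
    if "continuous_on {0..} F" for F :: "real \<Rightarrow> real"
    by (rule continuous_on_compose2[OF that])
       (use assms in \<open>auto simp: strip_def intro!: continuous_intros divide_nonneg_pos\<close>)
  have "continuous_on (strip T) (\<lambda>z. (fst z + h) * f ((fst z + h) / sqrt (snd z))
      - 2 * sqrt (snd z) * Q ((fst z + h) / sqrt (snd z)))"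
    by (intro continuous_intros 1 f_cont Q_cont)
  then show ?thesis
    by (rule continuous_on_cong[THEN iffD1, rotated 2]) (auto simp: strip_def pot_def)
qed

text \<open>The flux is \<open>sqrt t\<close> times \<open>Q / t\<close> in absolute value, so
  \<open>Q_strip_integrable\<close> dominates every bounded multiple of it. The pointwise form of
  the bound is kept for later use in dominated convergence.\<close>

lemma flux_integrable:
  assumes m: "(\<lambda>(x, t). indicator (strip T) (x, t) * (flux x t * F x t)) \<in> borel_measurable lborel"
    and b: "\<And>x t. (x, t) \<in> strip T \<Longrightarrow> \<bar>F x t\<bar> \<le> C"
  shows "integrable lborel (\<lambda>(x, t). indicator (strip T) (x, t) * (flux x t * F x t))"
    and "\<And>z. \<bar>case z of (x, t) \<Rightarrow> indicator (strip T) (x, t) * (flux x t * F x t)\<bar>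
      \<le> \<bar>C\<bar> * sqrt T * (case z of (x, t) \<Rightarrow> indicator (strip T) (x, t) * (Q (x / sqrt t) / t))"
proof -
  show bd: "\<bar>case z of (x, t) \<Rightarrow> indicator (strip T) (x, t) * (flux x t * F x t)\<bar>
      \<le> \<bar>C\<bar> * sqrt T * (case z of (x, t) \<Rightarrow> indicator (strip T) (x, t) * (Q (x / sqrt t) / t))" for z
  proof (cases z)
    case (Pair x t)
    show ?thesis
    proof (cases "(x, t) \<in> strip T")
      case True
      then have xt: "0 \<le> x" "0 < t" "t < T" unfolding strip_def by auto
      have q: "0 < Q (x / sqrt t)" using Q_pos xt by simp
      have "\<bar>flux x t\<bar> = sqrt t * (Q (x / sqrt t) / t)"
        unfolding flux_def using q xt by (simp add: abs_mult field_simps)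
      also have "\<dots> \<le> sqrt T * (Q (x / sqrt t) / t)" using xt q by (intro mult_right_mono) auto
      finally have "\<bar>flux x t\<bar> * \<bar>F x t\<bar> \<le> sqrt T * (Q (x / sqrt t) / t) * \<bar>C\<bar>"
        using b[OF True] xt q by (intro mult_mono) auto
      then show ?thesis using Pair True by (simp add: abs_mult mult.commute mult.left_commute)
    qed (use Pair in simp)
  qed
  show "integrable lborel (\<lambda>(x, t). indicator (strip T) (x, t) * (flux x t * F x t))"
  proof (rule Bochner_Integration.integrable_bound[OF integrable_mult_right[OF Q_strip_integrable] m, of "\<bar>C\<bar> * sqrt T"])
    show "AE z in lborel. norm (case z of (x, t) \<Rightarrow> indicator (strip T) (x, t) * (flux x t * F x t))
       \<le> norm (\<bar>C\<bar> * sqrt T * (case z of (x, t) \<Rightarrow> indicator (strip T) (x, t) * (Q (x / sqrt t) / t)))"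
      by (rule AE_I2) (simp only: real_norm_def order_trans[OF bd abs_ge_self])
  qed
qed

text \<open>The function \<open>sol\<close> is replaced by the x-difference quotient of its
  potential. Integration by parts in \<open>t\<close> at fixed \<open>x\<close> turns this into the
  difference quotient of the flux times \<open>\<xi>\<close>; a translation in \<open>x\<close>
  moves the quotient onto \<open>\<xi>\<close>, and then the step tends to 0. Neither
  \<open>sol\<close> in \<open>t\<close> nor the flux in \<open>x\<close> is ever
  differentiated.\<close>

lemma weak_identity:
  assumes T: "0 < T" and tf: "test_function T \<xi> \<xi>x \<xi>t"
  shows "(LINT x:{0<..}|lborel. (- V) * \<xi> x 0) + (LINT (x, t):strip T|lborel. sol x t * \<xi>t x t)
     = (LINT (x, t):strip T|lborel. flux x t * \<xi>x x t)"
proof -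
  obtain J M where J: "0 < J" and M: "0 < M" and z: "\<And>x t. J < x \<Longrightarrow> t \<in> {0..T} \<Longrightarrow> \<xi> x t = 0"
    and zt: "\<And>x t. J < x \<Longrightarrow> t \<in> {0<..<T} \<Longrightarrow> \<xi>t x t = 0"
    and bt: "\<And>x t. 0 \<le> x \<Longrightarrow> t \<in> {0<..<T} \<Longrightarrow> \<bar>\<xi>t x t\<bar> \<le> M"
    and lx: "\<And>x y t. 0 \<le> x \<Longrightarrow> 0 \<le> y \<Longrightarrow> t \<in> {0..T} \<Longrightarrow> \<bar>\<xi> x t - \<xi> y t\<bar> \<le> M * \<bar>x - y\<bar>"
    and c: "continuous_on ({0..} \<times> {0..T}) (\<lambda>(x, t). \<xi> x t)"
    and b: "\<And>x t. 0 \<le> x \<Longrightarrow> t \<in> {0..T} \<Longrightarrow> \<bar>\<xi> x t\<bar> \<le> M"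
    by (rule test_function_bounds[OF tf]) blast
  have dx: "((\<lambda>y. \<xi> y t) has_real_derivative \<xi>x x t) (at x)" if "0 < x" "t \<in> {0..T}" for x t
  proof -
    have "((\<lambda>y. \<xi> y t) has_real_derivative \<xi>x x t) (at x within {0..})"
      using tf that unfolding test_function_def by simp
    moreover have "at x within {0..} = at x" using that by (intro at_within_interior) simp
    ultimately show ?thesis by simp
  qed
  have dt: "((\<lambda>s. \<xi> x s) has_real_derivative \<xi>t x t) (at t within {0..T})" if "0 \<le> x" "t \<in> {0..T}" for x t
    using tf that unfolding test_function_def by blast
  have z0: "\<xi> 0 t = 0" if "t \<in> {0<..<T}" for t using tf that unfolding test_function_def by blast
  have zT: "\<xi> x T = 0" if "0 \<le> x" for x using tf that unfolding test_function_def by blast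
  have cx: "continuous_on (strip T) (\<lambda>(x, t). \<xi>x x t)" and ct: "continuous_on (strip T) (\<lambda>(x, t). \<xi>t x t)"
    and cs: "continuous_on (strip T) (\<lambda>(x, t). \<xi> x t)"
    using tf c unfolding test_function_def strip_def
    by (auto elim!: continuous_on_subset)
  have ctx: "continuous_on {0..T} (\<xi>t x)" if "0 \<le> x" for x
  proof -
    have "continuous_on ({0..} \<times> {0..T}) (\<lambda>(x, t). \<xi>t x t)" using tf unfolding test_function_def by blast
    then have "continuous_on {0..T} (\<lambda>t. (\<lambda>(x, t). \<xi>t x t) (x, t))"
      by (rule continuous_on_compose2) (use that in \<open>auto intro!: continuous_intros\<close>)
    then show ?thesis by simp
  qed
  define h where "h n = 1 / real (Suc n)" for n
  have h: "0 < h n" "h n \<noteq> 0" for n unfolding h_def by auto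
  have h0: "h \<longlonglongrightarrow> 0" unfolding h_def using LIMSEQ_inverse_real_of_nat by (simp add: inverse_eq_divide)
  let ?I = "\<lambda>x t. indicator (strip T) (x, t) :: real"
  define A where "A n x t = ?I x t * ((pot (x + h n) t - pot x t) / h n * \<xi>t x t)" for n x t
  define B where "B n x t = ?I x t * (flux (x + h n) t * \<xi> x t)" for n x t
  define B0 where "B0 x t = ?I x t * (flux x t * \<xi> x t)" for x t
  \<comment> \<open>This is \<open>B n\<close> translated by \<open>h n\<close>. The translate of
    the strip starts at \<open>x = h n\<close>, hence the value 0 to the left of it.\<close>
  define S where "S n x t = ?I x t * (flux x t * (if h n \<le> x then \<xi> (x - h n) t else 0))" for n x t
  have A_int: "integrable lborel (\<lambda>(x, t). A n x t)"
    and A_lim: "(\<lambda>n. LINT (x, t)|lborel. A n x t) \<longlonglongrightarrow> (LINT (x, t)|lborel. ?I x t * (sol x t * \<xi>t x t))" for n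
  proof -
    have m: "(\<lambda>(x, t). A n x t) \<in> borel_measurable lborel" for n
    proof -
      have "continuous_on (strip T) (\<lambda>(x, t). (pot (x + h n) t - pot x t) / h n * \<xi>t x t)"
        using pot_cont_strip[of "h n" T] pot_cont_strip[of 0 T] ct h[of n] unfolding case_prod_unfold
        by (intro continuous_intros) auto
      from strip_measurable_continuous[OF this] show ?thesis
        unfolding A_def set_borel_measurable_def case_prod_unfold by simp
    qed
    have m2: "(\<lambda>(x, t). ?I x t * (sol x t * \<xi>t x t)) \<in> borel_measurable lborel"
    proof -
      have "continuous_on (strip T) (\<lambda>(x, t). sol x t * \<xi>t x t)"
        using sol_cont[of T] ct unfolding case_prod_unfold by (intro continuous_intros)
      from strip_measurable_continuous[OF this] show ?thesis
        unfolding set_borel_measurable_def case_prod_unfold by simp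
    qed
    let ?w = "\<lambda>z. (U + V) * M * (case z of (x :: real, t :: real) \<Rightarrow> indicator {0..J} x * indicator {0<..<T} t)"
    have w: "integrable lborel ?w" by (intro integrable_mult_right integrable_on_strip_box)
    have dom: "AE z in lborel. norm (case z of (x, t) \<Rightarrow> A n x t) \<le> ?w z" for n
      using AE_fst_nonzero
    proof eventually_elim
      case (elim z)
      obtain x t where e: "z = (x, t)" by (cases z)
      show ?case
      proof (cases "(x, t) \<in> strip T \<and> x \<le> J")
        case True
        then have xt: "0 < x" "0 < t" "t < T" "x \<le> J" using elim e unfolding strip_def by auto
        have "\<bar>(pot (x + h n) t - pot x t) / h n\<bar> * \<bar>\<xi>t x t\<bar> \<le> (U + V) * M"
          using pot_diff_quot_bound[OF xt(1,2) h(1)] bt[of x t] xt U_pos V_pos by (intro mult_mono) auto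
        then show ?thesis using True xt e unfolding A_def by (simp add: abs_mult)
      next
        case False
        then have "\<not> (x, t) \<in> strip T \<or> \<xi>t x t = 0" using zt[of x t] by (auto simp: strip_def)
        then have "A n x t = 0" unfolding A_def by auto
        then show ?thesis using e U_pos V_pos M by (simp add: indicator_def)
      qed
    qed
    show "integrable lborel (\<lambda>(x, t). A n x t)"
    proof (rule Bochner_Integration.integrable_bound[OF w m])
      show "AE z in lborel. norm (case z of (x, t) \<Rightarrow> A n x t) \<le> norm (?w z)"
        using dom[of n]
      proof eventually_elim
        case (elim z)
        show ?case unfolding real_norm_def[of "?w z"] by (rule order_trans[OF elim abs_ge_self])
      qed
    qed
    show "(\<lambda>n. LINT (x, t)|lborel. A n x t) \<longlonglongrightarrow> (LINT (x, t)|lborel. ?I x t * (sol x t * \<xi>t x t))"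
    proof (rule integral_dominated_convergence[OF m2 m w _ dom])
      show "AE z in lborel. (\<lambda>n. case z of (x, t) \<Rightarrow> A n x t) \<longlonglongrightarrow> (case z of (x, t) \<Rightarrow> ?I x t * (sol x t * \<xi>t x t))"
        using AE_fst_nonzero
      proof eventually_elim
        case (elim z)
        obtain x t where e: "z = (x, t)" by (cases z)
        show ?case
        proof (cases "(x, t) \<in> strip T")
          case True
          then have xt: "0 < x" "0 < t" using elim e unfolding strip_def by auto
          have "(\<lambda>n. (pot (x + h n) t - pot x t) / h n) \<longlonglongrightarrow> sol x t"
            by (rule DERIV_sequentially[OF pot_deriv_x[OF xt] h0 h(2)])
          from tendsto_mult[OF this tendsto_const[of "\<xi>t x t"]]
          show ?thesis unfolding e A_def using True by simp
        qed (simp add: e A_def)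
      qed
    qed
  qed
  have B0_int: "integrable lborel (\<lambda>(x, t). B0 x t)"
    unfolding B0_def
  proof (rule flux_integrable(1)[where C=M])
    have "continuous_on (strip T) (\<lambda>(x, t). flux x t * \<xi> x t)"
      using flux_cont[of T] cs unfolding case_prod_unfold by (intro continuous_intros)
    from strip_measurable_continuous[OF this]
    show "(\<lambda>(x, t). ?I x t * (flux x t * \<xi> x t)) \<in> borel_measurable lborel"
      unfolding set_borel_measurable_def case_prod_unfold by simp
  qed (use b in \<open>auto simp: strip_def\<close>)
  have S_m: "(\<lambda>(x, t). S n x t) \<in> borel_measurable lborel" for n
  proof -
    have 1: "continuous_on ({h n..} \<times> {0<..<T}) (\<lambda>(x, t). flux x t)"
      by (rule continuous_on_subset[OF flux_cont[of T]]) (use h[of n] in \<open>auto simp: strip_def\<close>)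
    have "continuous_on ({h n..} \<times> {0<..<T}) (\<lambda>z. (\<lambda>(x, t). \<xi> x t) (fst z - h n, snd z))"
      by (rule continuous_on_compose2[OF cs]) (auto simp: strip_def intro!: continuous_intros)
    then have 2: "continuous_on ({h n..} \<times> {0<..<T}) (\<lambda>(x, t). flux x t * \<xi> (x - h n) t)"
      using 1 unfolding case_prod_unfold by (intro continuous_on_mult) auto
    have "(\<lambda>z. indicator ({h n..} \<times> {0<..<T}) z *\<^sub>R (case z of (x, t) \<Rightarrow> flux x t * \<xi> (x - h n) t)) \<in> borel_measurable borel"
      by (rule borel_measurable_continuous_on_indicator[OF _ 2]) (intro borel_Times, auto)
    moreover have "(\<lambda>z. indicator ({h n..} \<times> {0<..<T}) z *\<^sub>R (case z of (x, t) \<Rightarrow> flux x t * \<xi> (x - h n) t)) = (\<lambda>(x, t). S n x t)"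
      unfolding S_def using h(1)[of n] by (auto simp: fun_eq_iff indicator_def strip_def)
    ultimately show ?thesis by simp
  qed
  have S_int: "integrable lborel (\<lambda>(x, t). S n x t)" for n
    unfolding S_def
    by (rule flux_integrable(1)[where C=M, OF S_m[of n, unfolded S_def]]) (use b M in \<open>auto simp: strip_def\<close>)
  have BS: "B n x t = S n (x + h n) t" for n x t
    unfolding B_def S_def using h(1)[of n] by (auto simp: strip_def indicator_def)
  have B_int: "integrable lborel (\<lambda>(x, t). B n x t)"
    and B_S: "(LINT (x, t)|lborel. B n x t) = (LINT (x, t)|lborel. S n x t)" for n
    using lborel_translate_fst[OF S_int[of n], of "h n"] unfolding BS by auto
  have init_int: "integrable lborel (\<lambda>x. indicator {0..} x * (V * \<xi> x 0))"
  proof -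
    have "continuous_on {0..} (\<lambda>x. (\<lambda>(x, t). \<xi> x t) (x, 0))"
      by (rule continuous_on_compose2[OF c]) (use T in \<open>auto intro!: continuous_intros\<close>)
    then have "continuous_on {0..J} (\<lambda>x. V * \<xi> x 0)"
      by (intro continuous_intros) (auto elim: continuous_on_subset)
    from borel_integrable_atLeastAtMost'[OF this]
    have "integrable lborel (\<lambda>x. indicator {0..J} x *\<^sub>R (V * \<xi> x 0))" unfolding set_integrable_def .
    moreover have "indicator {0..J} x *\<^sub>R (V * \<xi> x 0) = indicator {0..} x * (V * \<xi> x 0)" for x
      using z[of x 0] T by (auto simp: indicator_def)
    ultimately show ?thesis by (simp only:)
  qed
  \<comment> \<open>Fubini with \<open>t\<close> inside, then \<open>pot_by_parts\<close> for every
    positive \<open>x\<close>; the point \<open>x = 0\<close> is null and for negative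
    \<open>x\<close> everything vanishes.\<close>
  have A_eq: "(LINT (x, t)|lborel. A n x t) = (LINT x|lborel. indicator {0..} x * (V * \<xi> x 0))
      - ((LINT (x, t)|lborel. S n x t) - (LINT (x, t)|lborel. B0 x t)) / h n" for n
  proof -
    have "(LINT (x, t)|lborel. A n x t) = (LINT x|lborel. LINT t|lborel. A n x t)"
      using integral_fst_lborel(1)[OF A_int] by simp
    also have "\<dots> = (LINT x|lborel. indicator {0..} x * (V * \<xi> x 0)
        - ((LINT t|lborel. B n x t) - (LINT t|lborel. B0 x t)) / h n)"
    proof (rule integral_cong_AE)
      show "(\<lambda>x. LINT t|lborel. A n x t) \<in> borel_measurable lborel"
        using integral_fst_lborel(2)[OF A_int[of n]] by (rule borel_measurable_integrable)
      show "(\<lambda>x. indicator {0..} x * (V * \<xi> x 0) - ((LINT t|lborel. B n x t) - (LINT t|lborel. B0 x t)) / h n)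
          \<in> borel_measurable lborel"
        using borel_measurable_integrable[OF init_int]
          borel_measurable_integrable[OF integral_fst_lborel(2)[OF B_int[of n]]]
          borel_measurable_integrable[OF integral_fst_lborel(2)[OF B0_int]] by measurable
      show "AE x in lborel. (LINT t|lborel. A n x t) = indicator {0..} x * (V * \<xi> x 0)
          - ((LINT t|lborel. B n x t) - (LINT t|lborel. B0 x t)) / h n"
        using AE_lborel_singleton[of 0]
      proof eventually_elim
        case (elim x)
        show ?case
        proof (cases "0 < x")
          case x: True
          have a: "(LINT t|lborel. A n x t) = (LINT t:{0<..<T}|lborel. (pot (x + h n) t - pot x t) * \<xi>t x t) / h n"
            unfolding A_def set_lebesgue_integral_def using x by (simp add: indicator_strip flip: integral_divide_zero)
          have i: "set_integrable lborel {0<..<T} (\<lambda>t. flux y t * \<xi> x t)" if "0 < y" for y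
            by (rule pot_by_parts(2)[OF that h(1)[of 0] T dt ctx zT]) (use x in auto)
          have "(LINT t|lborel. B n x t) - (LINT t|lborel. B0 x t) = (LINT t:{0<..<T}|lborel. (flux (x + h n) t - flux x t) * \<xi> x t)"
            using set_integral_diff(2)[OF i i, of "x + h n" x] x h(1)[of n]
            unfolding B_def B0_def set_lebesgue_integral_def by (simp add: indicator_strip left_diff_distrib)
          moreover have "(LINT t:{0<..<T}|lborel. (pot (x + h n) t - pot x t) * \<xi>t x t)
              = V * h n * \<xi> x 0 - (LINT t:{0<..<T}|lborel. (flux (x + h n) t - flux x t) * \<xi> x t)"
            by (rule pot_by_parts(1)[OF x h(1) T dt ctx zT]) (use x in auto)
          ultimately show ?thesis unfolding a using x h(1)[of n] by (simp add: field_simps)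
        next
          case False
          then have "x < 0" using elim by simp
          then show ?thesis unfolding A_def B_def B0_def by (simp add: indicator_strip)
        qed
      qed
    qed
    also have "\<dots> = (LINT x|lborel. indicator {0..} x * (V * \<xi> x 0))
        - ((LINT x|lborel. LINT t|lborel. B n x t) - (LINT x|lborel. LINT t|lborel. B0 x t)) / h n"
      using init_int integral_fst_lborel(2)[OF B_int[of n]] integral_fst_lborel(2)[OF B0_int] by simp
    finally show ?thesis
      unfolding integral_fst_lborel(1)[OF B_int] integral_fst_lborel(1)[OF B0_int] B_S .
  qed
  have S_lim: "(\<lambda>n. ((LINT (x, t)|lborel. S n x t) - (LINT (x, t)|lborel. B0 x t)) / h n)
      \<longlonglongrightarrow> (LINT (x, t)|lborel. ?I x t * (flux x t * - \<xi>x x t))"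
  proof -
    define R where "R n x t = ?I x t * (flux x t * (((if h n \<le> x then \<xi> (x - h n) t else 0) - \<xi> x t) / h n))" for n x t
    have R_eq: "R n x t = (S n x t - B0 x t) / h n" for n x t
      unfolding R_def S_def B0_def by (simp add: algebra_simps diff_divide_distrib)
    have R_m: "(\<lambda>(x, t). R n x t) \<in> borel_measurable lborel" for n
      using S_m[of n] borel_measurable_integrable[OF B0_int] unfolding R_eq case_prod_unfold by measurable
    \<comment> \<open>In the boundary layer \<open>x < h n\<close> the condition
      \<open>\<xi> 0 t = 0\<close> gives \<open>\<bar>\<xi> x t\<bar> \<le> M x\<close>, so the
      cut-off quotient stays bounded.\<close>
    have R_bd: "\<bar>((if h n \<le> x then \<xi> (x - h n) t else 0) - \<xi> x t) / h n\<bar> \<le> M" if "(x, t) \<in> strip T" for n x t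
    proof -
      have xt: "0 \<le> x" "t \<in> {0<..<T}" using that unfolding strip_def by auto
      have "\<bar>(if h n \<le> x then \<xi> (x - h n) t else 0) - \<xi> x t\<bar> \<le> M * h n"
      proof (cases "h n \<le> x")
        case True
        then show ?thesis using lx[of "x - h n" x t] xt h(1)[of n] by simp
      next
        case False
        have "\<bar>\<xi> x t\<bar> \<le> M * x" using lx[of x 0 t] xt z0[OF xt(2)] by simp
        also have "\<dots> \<le> M * h n" using False M by (intro mult_left_mono) auto
        finally show ?thesis using False by simp
      qed
      then show ?thesis using h(1)[of n] by (simp add: field_simps)
    qed
    have "(\<lambda>n. LINT (x, t)|lborel. R n x t) \<longlonglongrightarrow> (LINT (x, t)|lborel. ?I x t * (flux x t * - \<xi>x x t))"
    proof (rule integral_dominated_convergence[where w="\<lambda>z. \<bar>M\<bar> * sqrt T * (case z of (x, t) \<Rightarrow> ?I x t * (Q (x / sqrt t) / t))"])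
      have "continuous_on (strip T) (\<lambda>(x, t). flux x t * - \<xi>x x t)"
        using flux_cont[of T] cx unfolding case_prod_unfold by (intro continuous_intros)
      from strip_measurable_continuous[OF this]
      show "(\<lambda>(x, t). ?I x t * (flux x t * - \<xi>x x t)) \<in> borel_measurable lborel"
        unfolding set_borel_measurable_def case_prod_unfold by simp
      show "integrable lborel (\<lambda>z. \<bar>M\<bar> * sqrt T * (case z of (x, t) \<Rightarrow> ?I x t * (Q (x / sqrt t) / t)))"
        by (intro integrable_mult_right Q_strip_integrable)
      show "AE z in lborel. norm (case z of (x, t) \<Rightarrow> R n x t) \<le> \<bar>M\<bar> * sqrt T * (case z of (x, t) \<Rightarrow> ?I x t * (Q (x / sqrt t) / t))" for n
        using flux_integrable(2)[OF R_m[of n, unfolded R_def] R_bd] unfolding R_def by simp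
      show "AE z in lborel. (\<lambda>n. case z of (x, t) \<Rightarrow> R n x t) \<longlonglongrightarrow> (case z of (x, t) \<Rightarrow> ?I x t * (flux x t * - \<xi>x x t))"
        using AE_fst_nonzero
      proof eventually_elim
        case (elim zz)
        obtain x t where e: "zz = (x, t)" by (cases zz)
        show ?case
        proof (cases "(x, t) \<in> strip T")
          case True
          then have xt: "0 < x" "t \<in> {0..T}" using elim e unfolding strip_def by auto
          have "(\<lambda>n. (\<xi> (x + - h n) t - \<xi> x t) / - h n) \<longlonglongrightarrow> \<xi>x x t"
            by (rule DERIV_sequentially[OF dx[OF xt]]) (use h0 h in \<open>auto intro!: tendsto_eq_intros\<close>)
          then have "(\<lambda>n. - ((\<xi> (x + - h n) t - \<xi> x t) / - h n)) \<longlonglongrightarrow> - \<xi>x x t" by (rule tendsto_minus)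
          moreover have "\<forall>\<^sub>F n in sequentially. - ((\<xi> (x + - h n) t - \<xi> x t) / - h n)
              = ((if h n \<le> x then \<xi> (x - h n) t else 0) - \<xi> x t) / h n"
            using order_tendstoD(2)[OF h0 xt(1)] by eventually_elim simp
          ultimately have "(\<lambda>n. ((if h n \<le> x then \<xi> (x - h n) t else 0) - \<xi> x t) / h n) \<longlonglongrightarrow> - \<xi>x x t"
            by (rule Lim_transform_eventually)
          from tendsto_mult[OF tendsto_const[of "flux x t"] this]
          show ?thesis unfolding e R_def using True by simp
        qed (simp add: e R_def)
      qed
    qed (rule R_m)
    moreover have "(LINT (x, t)|lborel. R n x t) = ((LINT (x, t)|lborel. S n x t) - (LINT (x, t)|lborel. B0 x t)) / h n" for n
      unfolding R_eq using S_int[of n] B0_int by (simp add: case_prod_unfold)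
    ultimately show ?thesis by simp
  qed
  have "(LINT (x, t)|lborel. ?I x t * (sol x t * \<xi>t x t)) = (LINT x|lborel. indicator {0..} x * (V * \<xi> x 0))
      - (LINT (x, t)|lborel. ?I x t * (flux x t * - \<xi>x x t))"
    by (rule LIMSEQ_unique[OF A_lim]) (unfold A_eq, intro tendsto_diff tendsto_const S_lim)
  moreover have "(LINT x:{0<..}|lborel. (- V) * \<xi> x 0) = - (LINT x|lborel. indicator {0..} x * (V * \<xi> x 0))"
  proof -
    have "(LINT x:{0<..}|lborel. (- V) * \<xi> x 0) = (LINT x|lborel. - (indicator {0..} x * (V * \<xi> x 0)))"
      unfolding set_lebesgue_integral_def
    proof (rule integral_cong_AE)
      show "AE x in lborel. indicator {0<..} x *\<^sub>R ((- V) * \<xi> x 0) = - (indicator {0..} x * (V * \<xi> x 0))"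
        using AE_lborel_singleton[of 0] by eventually_elim (auto simp: indicator_def)
      show m: "(\<lambda>x. - (indicator {0..} x * (V * \<xi> x 0))) \<in> borel_measurable lborel"
        using borel_measurable_integrable[OF init_int] by measurable
      have "(\<lambda>x. indicator {0<..} x * - (indicator {0..} x * (V * \<xi> x 0))) \<in> borel_measurable lborel"
        using m by measurable
      then show "(\<lambda>x. indicator {0<..} x *\<^sub>R ((- V) * \<xi> x 0)) \<in> borel_measurable lborel"
        by (rule measurable_cong[THEN iffD1, rotated]) (auto simp: indicator_def)
    qed
    then show ?thesis by simp
  qed
  ultimately show ?thesis
    unfolding set_lebesgue_integral_def by (simp add: case_prod_unfold)
qed

section \<open>Square integrability and membership in the Bochner space\<close>

lemma square_bound:
  assumes x: "0 \<le> x" "0 < t" and b: "\<bar>F\<bar> \<le> c * Q (x / sqrt t) / sqrt t + B * indicator {0..1} x"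
  shows "F\<^sup>2 \<le> 2 * c\<^sup>2 * Q 0 * (Q (x / sqrt t) / t) + 2 * B\<^sup>2 * indicator {0..1} x"
proof -
  let ?p = "c * Q (x / sqrt t) / sqrt t" and ?r = "B * indicator {0..1} x :: real"
  have "F\<^sup>2 \<le> (?p + ?r)\<^sup>2" using power_mono[OF b abs_ge_zero, of 2] by simp
  also have "\<dots> \<le> 2 * ?p\<^sup>2 + 2 * ?r\<^sup>2"
    using zero_le_power2[of "?p - ?r"] unfolding power2_sum power2_diff by linarith
  also have "?r\<^sup>2 = B\<^sup>2 * indicator {0..1} x" by (simp add: indicator_def power_mult_distrib)
  also have "?p\<^sup>2 = c\<^sup>2 * (Q (x / sqrt t) * (Q (x / sqrt t) / t))"
    using x by (simp add: power_mult_distrib power_divide power2_eq_square)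
  \<comment> \<open>Trading one factor \<open>Q\<close> for \<open>Q 0\<close> leaves the function
    known to be integrable on the strip.\<close>
  also have "\<dots> \<le> c\<^sup>2 * (Q 0 * (Q (x / sqrt t) / t))"
    using Q_le[of "x / sqrt t"] Q_pos[of "x / sqrt t"] x
    by (intro mult_left_mono mult_right_mono) auto
  finally show ?thesis by (simp add: mult.assoc)
qed

lemma L2_strip_bound:
  assumes m: "set_borel_measurable lborel (strip T) (\<lambda>(x, t). F x t)"
    and b: "\<And>x t. (x, t) \<in> strip T \<Longrightarrow> \<bar>F x t\<bar> \<le> c * Q (x / sqrt t) / sqrt t + B * indicator {0..1} x"
  shows "L2_on (strip T) (\<lambda>(x, t). F x t)"
  unfolding L2_on_def set_integrable_def
proof (intro conjI m)
  let ?w = "\<lambda>z :: real \<times> real. 2 * c\<^sup>2 * Q 0 * (case z of (x, t) \<Rightarrow> indicator (strip T) (x, t) * (Q (x / sqrt t) / t))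
      + 2 * B\<^sup>2 * (case z of (x, t) \<Rightarrow> indicator {0..1} x * indicator {0<..<T} t)"
  show "integrable lborel (\<lambda>z. indicator (strip T) z *\<^sub>R (case z of (x, t) \<Rightarrow> F x t)\<^sup>2)"
  proof (rule Bochner_Integration.integrable_bound[where f="?w"])
    show "integrable lborel ?w"
      by (intro Bochner_Integration.integrable_add integrable_mult_right Q_strip_integrable integrable_on_strip_box)
    have "(\<lambda>z. (indicator (strip T) z *\<^sub>R (case z of (x, t) \<Rightarrow> F x t))\<^sup>2) \<in> borel_measurable lborel"
      using m unfolding set_borel_measurable_def by measurable
    moreover have "(indicator (strip T) z *\<^sub>R (case z of (x, t) \<Rightarrow> F x t))\<^sup>2
        = indicator (strip T) z *\<^sub>R (case z of (x, t) \<Rightarrow> F x t)\<^sup>2" for z by (simp add: indicator_def)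
    ultimately show "(\<lambda>z. indicator (strip T) z *\<^sub>R (case z of (x, t) \<Rightarrow> F x t)\<^sup>2) \<in> borel_measurable lborel"
      by simp
    show "AE z in lborel. norm (indicator (strip T) z *\<^sub>R (case z of (x, t) \<Rightarrow> F x t)\<^sup>2) \<le> norm (?w z)"
    proof (rule AE_I2)
      fix z :: "real \<times> real"
      obtain x t where e: "z = (x, t)" by (cases z)
      show "norm (indicator (strip T) z *\<^sub>R (case z of (x, t) \<Rightarrow> F x t)\<^sup>2) \<le> norm (?w z)"
      proof (cases "z \<in> strip T")
        case True
        then have xt: "0 \<le> x" "0 < t" "t \<in> {0<..<T}" using e unfolding strip_def by auto
        have w: "?w z = 2 * c\<^sup>2 * Q 0 * (Q (x / sqrt t) / t) + 2 * B\<^sup>2 * indicator {0..1} x"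
          using True e xt by simp
        have "norm (indicator (strip T) z *\<^sub>R (case z of (x, t) \<Rightarrow> F x t)\<^sup>2) = (F x t)\<^sup>2"
          using True e by simp
        also have "\<dots> \<le> ?w z" unfolding w by (rule square_bound[OF xt(1,2) b]) (use True e in simp)
        also have "\<dots> \<le> norm (?w z)" unfolding real_norm_def by (rule abs_ge_self)
        finally show ?thesis .
      qed simp
    qed
  qed
qed

lemma square_integrable_slice_bound:
  assumes c: "continuous_on {0<..} F" and t: "0 < t"
    and b: "\<And>x. 0 < x \<Longrightarrow> \<bar>F x\<bar> \<le> c * Q (x / sqrt t) / sqrt t + B * indicator {0..1} x"
  shows "set_integrable lborel {0<..} (\<lambda>x. (F x)\<^sup>2)"
  unfolding set_integrable_def
proof (rule Bochner_Integration.integrable_bound)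
  let ?w = "\<lambda>x. 2 * c\<^sup>2 * Q 0 / t * (indicator {0..} x *\<^sub>R Q (x / sqrt t)) + 2 * B\<^sup>2 * indicator {0..1} x"
  show "integrable lborel ?w"
    using Q_scaled(1)[OF t] unfolding set_integrable_def
    by (intro Bochner_Integration.integrable_add integrable_mult_right) auto
  have "continuous_on {0<..} (\<lambda>x. (F x)\<^sup>2)" by (intro continuous_intros c)
  from borel_measurable_continuous_on_indicator[OF _ this]
  show "(\<lambda>x. indicator {0<..} x *\<^sub>R (F x)\<^sup>2) \<in> borel_measurable lborel" by simp
  show "AE x in lborel. norm (indicator {0<..} x *\<^sub>R (F x)\<^sup>2) \<le> norm (?w x)"
  proof (rule AE_I2)
    fix x
    show "norm (indicator {0<..} x *\<^sub>R (F x)\<^sup>2) \<le> norm (?w x)"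
    proof (cases "0 < x")
      case True
      then show ?thesis using square_bound[OF _ t b[OF True]] by (simp add: abs_le_iff)
    qed simp
  qed
qed

lemma D_sol_deriv:
  assumes "0 < x" "0 < t"
  shows "((\<lambda>x. D (sol x t)) has_real_derivative flux x t) (at x)"
proof -
  have "((\<lambda>x. D (f (x / sqrt t))) has_real_derivative - Q (x / sqrt t) * (1 / sqrt t)) (at x)"
    by (rule DERIV_chain2[OF Df_deriv])
       (use assms in \<open>auto intro!: derivative_eq_intros simp: sqrt_divide_self_eq inverse_eq_divide\<close>)
  then show ?thesis unfolding sol_def flux_def by simp
qed

lemma flux_slice_cont: "0 < t \<Longrightarrow> continuous_on {0<..} (\<lambda>x. flux x t)"
  unfolding flux_def by (intro continuous_intros continuous_on_compose2[OF Q_cont]) auto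

lemma sol_Linf: "Linf_on (strip T) (\<lambda>(x, t). sol x t)"
  unfolding Linf_on_def
  by (intro conjI strip_measurable_continuous sol_cont exI[of _ "U + V"] AE_I2)
     (auto simp: strip_def intro: sol_bound)

lemma flux_measurable: "set_borel_measurable lborel (strip T) (\<lambda>(x, t). flux x t)"
  by (rule strip_measurable_continuous[OF flux_cont])

lemma sol_weak_dx: "weak_dx T (\<lambda>x t. D (sol x t)) flux"
  unfolding weak_dx_def
  by (intro conjI flux_measurable AE_I2 impI weak_derivative_C1 flux_slice_cont D_sol_deriv) auto

text \<open>Here \<open>e\<close> stands for \<open>D (what)\<close> and \<open>d\<close> for its
  derivative. Beyond \<open>x = 1\<close> only the self-similar part remains and \<open>Q\<close>
  controls it; up to 1 compactness bounds \<open>e\<close> and \<open>d\<close>. On a fixed slice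
  the mean value theorem gives the linear bound at \<open>0\<close>; its constant grows like
  \<open>1 / sqrt t\<close>, which does no harm as the slices are treated one by one.\<close>

lemma sol_L2_W12_0:
  assumes ec: "continuous_on {0..} e" and e: "\<And>x. 0 < x \<Longrightarrow> (e has_real_derivative d x) (at x)"
    and dc: "continuous_on {0..} d" and e0: "e 0 = D U"
    and e1: "\<And>x. 1 < x \<Longrightarrow> e x = D (- V)" and d1: "\<And>x. 1 < x \<Longrightarrow> d x = 0"
  shows "L2_W12_0 T (\<lambda>x t. D (sol x t) - e x)"
proof -
  have bdd: "\<exists>B. \<forall>x\<in>{0..1}. \<bar>F x\<bar> \<le> B" if "continuous_on {0..} F" for F :: "real \<Rightarrow> real"
  proof -
    have "bounded (F ` {0..1})"
      by (intro compact_imp_bounded compact_continuous_image continuous_on_subset[OF that]) auto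
    then show ?thesis unfolding bounded_iff by auto
  qed
  have "continuous_on {0..} (\<lambda>x. e x - D (- V))" by (intro continuous_intros ec)
  from bdd[OF this] bdd[OF dc] obtain Be Bd where "\<forall>x\<in>{0..1}. \<bar>e x - D (- V)\<bar> \<le> Be" "\<forall>x\<in>{0..1}. \<bar>d x\<bar> \<le> Bd"
    by blast
  then have Be: "\<bar>e x - D (- V)\<bar> \<le> Be * indicator {0..1} x" and Bd: "\<bar>d x\<bar> \<le> Bd * indicator {0..1} x"
    if "0 \<le> x" for x using that e1[of x] d1[of x] by (auto simp: indicator_def)
  obtain C where C: "0 < C" "\<And>\<eta>. 0 \<le> \<eta> \<Longrightarrow> \<bar>D (f \<eta>) - D (- V)\<bar> \<le> C * Q \<eta>"
    by (rule D_f_decay) blast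
  define u where "u x t = D (sol x t) - e x" for x t
  define u' where "u' x t = flux x t - d x" for x t
  have ub: "\<bar>u x t\<bar> \<le> C * sqrt T * Q (x / sqrt t) / sqrt t + Be * indicator {0..1} x"
    if "0 \<le> x" "0 < t" "t < T" for x t
  proof -
    have q: "0 < Q (x / sqrt t)" using Q_pos that by simp
    have "\<bar>D (sol x t) - D (- V)\<bar> \<le> C * Q (x / sqrt t)" unfolding sol_def using C(2) that by simp
    \<comment> \<open>A factor \<open>sqrt T / sqrt t \<ge> 1\<close> is inserted to give the bound
      the form required by \<open>square_bound\<close>.\<close>
    also have "\<dots> \<le> C * sqrt T * Q (x / sqrt t) / sqrt t"
      using that C(1) q by (simp add: field_simps)
    finally show ?thesis using Be[OF that(1)] unfolding u_def by linarith
  qed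
  have ub': "\<bar>u' x t\<bar> \<le> 1 * Q (x / sqrt t) / sqrt t + Bd * indicator {0..1} x" if "0 \<le> x" "0 < t" for x t
  proof -
    have "\<bar>flux x t\<bar> = Q (x / sqrt t) / sqrt t" unfolding flux_def using Q_pos[of "x / sqrt t"] that by simp
    then show ?thesis using Bd[OF that(1)] unfolding u'_def by linarith
  qed
  have ud: "((\<lambda>x. u x t) has_real_derivative u' x t) (at x)" if "0 < x" "0 < t" for x t
    unfolding u_def u'_def by (rule DERIV_diff[OF D_sol_deriv[OF that] e[OF that(1)]])
  have uc': "continuous_on {0<..} (\<lambda>x. u' x t)" if "0 < t" for t
    unfolding u'_def by (intro continuous_intros flux_slice_cont that continuous_on_subset[OF dc]) auto
  have uc: "continuous_on {0..} (\<lambda>x. u x t)" if "0 < t" for t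
    unfolding u_def sol_def using that
    by (intro continuous_intros ec continuous_on_compose2[OF D_cont[of UNIV]] continuous_on_compose2[OF f_cont]) auto
  have u0: "u 0 t = 0" for t unfolding u_def sol_def using e0 f_0 by simp
  have slice: "(\<lambda>x. u x t) \<in> W12_0_halfline" if t: "0 < t" "t < T" for t
  proof (rule W12_0_halflineI[OF ud[OF _ t(1)] uc'[OF t(1)]])
    fix x :: real assume x: "0 < x" "x \<le> 2"
    obtain z where z: "0 < z" "z < x" "u x t - u 0 t = (x - 0) * u' z t"
    proof (rule MVT_real[OF x(1), of "\<lambda>x. u x t" "\<lambda>x. u' x t"])
      show "continuous_on {0..x} (\<lambda>x. u x t)" by (rule continuous_on_subset[OF uc[OF t(1)]]) auto
    qed (use ud t in auto)
    have "\<bar>flux z t\<bar> \<le> Q 0 / sqrt t" using flux_bound z t by simp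
    moreover have "Bd * indicator {0..1} z \<le> \<bar>Bd\<bar>" by (auto simp: indicator_def)
    ultimately have "\<bar>u' z t\<bar> \<le> Q 0 / sqrt t + \<bar>Bd\<bar>"
      using Bd[of z] z unfolding u'_def by linarith
    then have "x * \<bar>u' z t\<bar> \<le> x * (Q 0 / sqrt t + \<bar>Bd\<bar>)" using x by (intro mult_left_mono) auto
    then show "\<bar>u x t\<bar> \<le> (Q 0 / sqrt t + \<bar>Bd\<bar>) * x" using z(3) u0 x by (simp add: abs_mult mult.commute)
  next
    show "set_integrable lborel {0<..} (\<lambda>x. (u x t)\<^sup>2)"
      by (rule square_integrable_slice_bound[OF continuous_on_subset[OF uc[OF t(1)]] t(1) ub]) (use t in auto)
    show "set_integrable lborel {0<..} (\<lambda>x. (u' x t)\<^sup>2)"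
      by (rule square_integrable_slice_bound[OF uc'[OF t(1)] t(1) ub']) (use t in auto)
  qed auto
  have um: "set_borel_measurable lborel (strip T) (\<lambda>(x, t). u x t)"
  proof (rule strip_measurable_continuous)
    show "continuous_on (strip T) (\<lambda>(x, t). u x t)"
      unfolding u_def case_prod_unfold using sol_cont[of T] unfolding case_prod_unfold
      by (intro continuous_intros continuous_on_compose2[OF D_cont[of UNIV]] continuous_on_compose2[OF ec])
         (auto simp: strip_def)
  qed
  have um': "set_borel_measurable lborel (strip T) (\<lambda>(x, t). u' x t)"
  proof (rule strip_measurable_continuous)
    show "continuous_on (strip T) (\<lambda>(x, t). u' x t)"
      unfolding u'_def case_prod_unfold using flux_cont[of T] unfolding case_prod_unfold
      by (intro continuous_intros continuous_on_compose2[OF dc]) (auto simp: strip_def)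
  qed
  have "weak_dx T u u'"
    unfolding weak_dx_def
    by (intro conjI um' AE_I2 impI weak_derivative_C1 uc' ud) auto
  moreover have "L2_on (strip T) (\<lambda>(x, t). u' x t)"
    by (rule L2_strip_bound[OF um' ub']) (auto simp: strip_def)
  moreover have "L2_on (strip T) (\<lambda>(x, t). u x t)"
    by (rule L2_strip_bound[OF um ub]) (auto simp: strip_def)
  ultimately have "L2_W12_0 T u" unfolding L2_W12_0_def using slice by auto
  then show ?thesis unfolding u_def .
qed

end

section \<open>Uniqueness of weak solutions\<close>

lemma integrable_indicator_bounded:
  fixes A :: "real set"
  assumes "bounded A" "A \<in> sets borel"
  shows "integrable lborel (indicator A :: real \<Rightarrow> real)"
  using emeasure_bounded_finite[OF assms(1)] assms(2) by (intro integrable_real_indicator) auto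

lemma L2_mult_integrable:
  fixes f g :: "'a \<Rightarrow> real"
  assumes m: "f \<in> borel_measurable M" "g \<in> borel_measurable M"
    and i: "integrable M (\<lambda>x. (f x)\<^sup>2)" "integrable M (\<lambda>x. (g x)\<^sup>2)"
  shows "integrable M (\<lambda>x. f x * g x)"
proof (rule Bochner_Integration.integrable_bound)
  show "integrable M (\<lambda>x. (f x)\<^sup>2 + (g x)\<^sup>2)" using i by simp
  show "(\<lambda>x. f x * g x) \<in> borel_measurable M" using m by measurable
  show "AE x in M. norm (f x * g x) \<le> norm ((f x)\<^sup>2 + (g x)\<^sup>2)"
  proof (rule AE_I2)
    fix x
    have "2 * (\<bar>f x\<bar> * \<bar>g x\<bar>) \<le> (f x)\<^sup>2 + (g x)\<^sup>2"
      using zero_le_power2[of "\<bar>f x\<bar> - \<bar>g x\<bar>"] by (simp add: power2_diff)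
    moreover have "0 \<le> \<bar>f x\<bar> * \<bar>g x\<bar>" by simp
    ultimately show "norm (f x * g x) \<le> norm ((f x)\<^sup>2 + (g x)\<^sup>2)"
      unfolding real_norm_def abs_mult using abs_ge_self[of "(f x)\<^sup>2 + (g x)\<^sup>2"] by linarith
  qed
qed

lemma L2_diff_integrable:
  fixes f g :: "'a \<Rightarrow> real"
  assumes m: "f \<in> borel_measurable M" "g \<in> borel_measurable M"
    and i: "integrable M (\<lambda>x. (f x)\<^sup>2)" "integrable M (\<lambda>x. (g x)\<^sup>2)"
  shows "integrable M (\<lambda>x. (f x - g x)\<^sup>2)"
proof -
  have "integrable M (\<lambda>x. (f x)\<^sup>2 + (g x)\<^sup>2 - 2 * (f x * g x))"
    using i L2_mult_integrable[OF m i] by simp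
  then show ?thesis by (simp add: power2_diff mult.assoc)
qed

text \<open>Young's inequality with weight \<open>d\<close> replaces Cauchy-Schwarz: with
  \<open>d = e / K\<close>, both halves of the resulting bound are below \<open>e / 2\<close>. The 1
  in \<open>K\<close> keeps it positive and the inequality strict.\<close>

lemma L2_tendsto_zero:
  fixes W :: "'a \<Rightarrow> real" and F :: "nat \<Rightarrow> 'a \<Rightarrow> real"
  assumes m: "W \<in> borel_measurable M" "\<And>n. F n \<in> borel_measurable M"
    and i: "integrable M (\<lambda>x. (W x)\<^sup>2)" "\<And>n. integrable M (\<lambda>x. (F n x)\<^sup>2)"
    and lim: "(\<lambda>n. LINT x|M. (F n x)\<^sup>2) \<longlonglongrightarrow> 0"
  shows "(\<lambda>n. LINT x|M. W x * F n x) \<longlonglongrightarrow> 0"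
proof (rule LIMSEQ_I)
  fix e :: real assume e: "0 < e"
  define K where "K = (LINT x|M. (W x)\<^sup>2) + 1"
  have K: "1 \<le> K" unfolding K_def by simp
  define d where "d = e / K"
  have d: "0 < d" unfolding d_def using e K by simp
  have "\<forall>\<^sub>F n in sequentially. (LINT x|M. (F n x)\<^sup>2) < e * d"
    using order_tendstoD(2)[OF lim, of "e * d"] e d by simp
  then obtain N where N: "\<And>n. N \<le> n \<Longrightarrow> (LINT x|M. (F n x)\<^sup>2) < e * d"
    unfolding eventually_sequentially by blast
  have "norm ((LINT x|M. W x * F n x) - 0) < e" if n: "N \<le> n" for n
  proof -
    have "norm (LINT x|M. W x * F n x) \<le> (LINT x|M. d / 2 * (W x)\<^sup>2 + 1 / (2 * d) * (F n x)\<^sup>2)"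
    proof (rule order_trans[OF integral_norm_bound integral_mono])
      show "integrable M (\<lambda>x. norm (W x * F n x))"
        by (intro integrable_norm L2_mult_integrable m i)
      show "integrable M (\<lambda>x. d / 2 * (W x)\<^sup>2 + 1 / (2 * d) * (F n x)\<^sup>2)" using i by simp
      fix x
      have "0 \<le> (d * \<bar>W x\<bar> - \<bar>F n x\<bar>)\<^sup>2 / (2 * d)" using d by simp
      also have "\<dots> = d / 2 * (W x)\<^sup>2 + 1 / (2 * d) * (F n x)\<^sup>2 - \<bar>W x\<bar> * \<bar>F n x\<bar>"
        using d by (simp add: power2_diff power_mult_distrib field_simps power2_eq_square)
      finally show "norm (W x * F n x) \<le> d / 2 * (W x)\<^sup>2 + 1 / (2 * d) * (F n x)\<^sup>2"
        by (simp add: abs_mult)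
    qed
    also have "\<dots> = d / 2 * (LINT x|M. (W x)\<^sup>2) + 1 / (2 * d) * (LINT x|M. (F n x)\<^sup>2)"
      using i by simp
    also have "\<dots> < d / 2 * K + 1 / (2 * d) * (e * d)"
    proof (rule add_strict_mono)
      show "d / 2 * (LINT x|M. (W x)\<^sup>2) < d / 2 * K" unfolding K_def using d by simp
      show "1 / (2 * d) * (LINT x|M. (F n x)\<^sup>2) < 1 / (2 * d) * (e * d)"
        using N[OF n] d by (intro mult_strict_left_mono) auto
    qed
    also have "\<dots> = e" unfolding d_def using K e by (simp add: field_simps)
    finally show ?thesis by simp
  qed
  then show "\<exists>N. \<forall>n\<ge>N. norm ((LINT x|M. W x * F n x) - 0) < e" by blast
qed

text \<open>Membership in \<open>C1c_halfline\<close> says nothing about values at nonpositive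
  arguments. The extension is continuous on the whole line, so integrals may be taken over
  \<open>lborel\<close>.\<close>

definition extend_zero :: "(real \<Rightarrow> real) \<Rightarrow> real \<Rightarrow> real" where
  "extend_zero \<psi> x = (if 0 < x then \<psi> x else 0)"

lemma extend_zero_cont:
  assumes c: "continuous_on {0<..} \<psi>" and a: "0 < a" and z: "\<And>x. 0 < x \<Longrightarrow> x \<notin> {a..b} \<Longrightarrow> \<psi> x = 0"
  shows "continuous_on UNIV (extend_zero \<psi>)"
proof -
  have "continuous_on {0<..} (extend_zero \<psi>)"
    by (rule continuous_on_cong[THEN iffD2, OF refl _ c]) (simp add: extend_zero_def)
  moreover have "continuous_on {..<a} (extend_zero \<psi>)"
    by (rule continuous_on_cong[THEN iffD2, OF refl _ continuous_on_const[of _ 0]])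
       (use z in \<open>auto simp: extend_zero_def\<close>)
  ultimately have "continuous_on ({0<..} \<union> {..<a}) (extend_zero \<psi>)"
    by (intro continuous_on_open_Un) auto
  moreover have "{0<..} \<union> {..<a} = (UNIV :: real set)" using a by auto
  ultimately show ?thesis by simp
qed

lemma C1c_extend_zero:
  assumes "C1c_halfline \<psi>"
  obtains a b C where "0 < a" "a < b" "continuous_on UNIV (extend_zero \<psi>)" "continuous_on UNIV (extend_zero (deriv \<psi>))"
    "\<And>x. \<bar>extend_zero \<psi> x\<bar> \<le> C * indicator {a..b} x" "\<And>x. \<bar>extend_zero (deriv \<psi>) x\<bar> \<le> C * indicator {a..b} x"
proof -
  obtain a b where ab: "0 < a" "a < b" and c: "continuous_on {0<..} \<psi>" "continuous_on {0<..} (deriv \<psi>)"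
    and z: "\<And>x. 0 < x \<Longrightarrow> x \<notin> {a..b} \<Longrightarrow> \<psi> x = 0" "\<And>x. 0 < x \<Longrightarrow> x \<notin> {a..b} \<Longrightarrow> deriv \<psi> x = 0"
    by (rule C1c_halflineE[OF assms]) blast
  have e: "continuous_on UNIV (extend_zero \<psi>)" "continuous_on UNIV (extend_zero (deriv \<psi>))"
    using extend_zero_cont[OF c(1) ab(1) z(1)] extend_zero_cont[OF c(2) ab(1) z(2)] by auto
  have bdd: "\<exists>B. \<forall>x\<in>{a..b}. \<bar>F x\<bar> \<le> B" if "continuous_on UNIV F" for F :: "real \<Rightarrow> real"
  proof -
    have "bounded (F ` {a..b})"
      by (intro compact_imp_bounded compact_continuous_image continuous_on_subset[OF that]) auto
    then show ?thesis unfolding bounded_iff by auto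
  qed
  obtain B1 B2 where "\<forall>x\<in>{a..b}. \<bar>extend_zero \<psi> x\<bar> \<le> B1" "\<forall>x\<in>{a..b}. \<bar>extend_zero (deriv \<psi>) x\<bar> \<le> B2"
    using bdd[OF e(1)] bdd[OF e(2)] by blast
  then have "\<bar>extend_zero \<psi> x\<bar> \<le> max B1 B2 * indicator {a..b} x"
    "\<bar>extend_zero (deriv \<psi>) x\<bar> \<le> max B1 B2 * indicator {a..b} x" for x
    using z[of x] by (cases "x \<in> {a..b}", force simp: extend_zero_def, simp add: extend_zero_def)+
  then show ?thesis using that[of a b "max B1 B2"] ab e by blast
qed

lemma bounded_support_square_integrable:
  fixes F :: "real \<Rightarrow> real"
  assumes m: "F \<in> borel_measurable borel" and b: "\<And>x. \<bar>F x\<bar> \<le> C * indicator {a..b} x"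
  shows "integrable lborel (\<lambda>x. (F x)\<^sup>2)"
proof (rule Bochner_Integration.integrable_bound[where f="\<lambda>x. C\<^sup>2 * indicator {a..b} x :: real"])
  show "AE x in lborel. norm ((F x)\<^sup>2) \<le> norm (C\<^sup>2 * indicator {a..b} x :: real)"
  proof (rule AE_I2)
    fix x
    have "(F x)\<^sup>2 \<le> (C * indicator {a..b} x)\<^sup>2" using power_mono[OF b[of x] abs_ge_zero, of 2] by simp
    then show "norm ((F x)\<^sup>2) \<le> norm (C\<^sup>2 * indicator {a..b} x :: real)"
      by (cases "x \<in> {a..b}") auto
  qed
  show "integrable lborel (\<lambda>x. C\<^sup>2 * indicator {a..b} x :: real)"
    by (intro integrable_mult_right integrable_indicator_bounded) auto
qed (use m in auto)

lemma bounded_support_square_integrable_plane: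
  fixes F :: "real \<Rightarrow> real \<Rightarrow> real"
  assumes m: "(\<lambda>(x, t). F x t) \<in> borel_measurable borel"
    and b: "\<And>x t. \<bar>F x t\<bar> \<le> C * (indicator {0..b} x * indicator {0<..<T} t)"
  shows "integrable lborel (\<lambda>(x, t). (F x t)\<^sup>2)"
proof (rule Bochner_Integration.integrable_bound[OF integrable_mult_right[OF integrable_on_strip_box[of b T], of "C\<^sup>2"]])
  show "(\<lambda>(x, t). (F x t)\<^sup>2) \<in> borel_measurable lborel" using m unfolding case_prod_unfold by measurable
  show "AE z in lborel. norm (case z of (x, t) \<Rightarrow> (F x t)\<^sup>2)
      \<le> norm (C\<^sup>2 * (case z of (x, t) \<Rightarrow> indicator {0..b} x * indicator {0<..<T} t))"
  proof (rule AE_I2)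
    fix z :: "real \<times> real"
    obtain x t where e: "z = (x, t)" by (cases z)
    have "(F x t)\<^sup>2 \<le> (C * (indicator {0..b} x * indicator {0<..<T} t))\<^sup>2"
      using power_mono[OF b[of x t] abs_ge_zero, of 2] by simp
    then show "norm (case z of (x, t) \<Rightarrow> (F x t)\<^sup>2)
      \<le> norm (C\<^sup>2 * (case z of (x, t) \<Rightarrow> indicator {0..b} x * indicator {0<..<T} t))"
      unfolding e by (cases "x \<in> {0..b}"; cases "t \<in> {0<..<T}") auto
  qed
qed

text \<open>Oleinik's argument for \<open>W\<^sub>t = \<gamma>\<^sub>x\<close>, split into two steps: product test functions give
  \<open>W = G\<^sub>x\<close> for almost every \<open>t\<close>, where \<open>G = \<integral>\<^sub>0\<^sup>t \<gamma>\<close>; then \<open>\<integral> W z = - \<integral> G \<gamma>\<close> whenever \<open>z\<^sub>x = \<gamma>\<close>, and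
  \<open>G \<gamma> = (G\<^sup>2 / 2)\<^sub>t\<close>.\<close>
locale integrated_gradient =
  fixes T :: real and W \<gamma> :: "real \<Rightarrow> real \<Rightarrow> real"
  assumes T_pos: "0 < T"
    and W_meas: "(\<lambda>(x, t). W x t) \<in> borel_measurable borel"
    and \<gamma>_meas: "(\<lambda>(x, t). \<gamma> x t) \<in> borel_measurable borel"
    and W_L2: "integrable lborel (\<lambda>(x, t). (W x t)\<^sup>2)"
    and \<gamma>_L2: "integrable lborel (\<lambda>(x, t). (\<gamma> x t)\<^sup>2)"
    and W_supp: "\<And>x t. (x, t) \<notin> strip T \<Longrightarrow> W x t = 0"
    and \<gamma>_supp: "\<And>x t. (x, t) \<notin> strip T \<Longrightarrow> \<gamma> x t = 0"
    and identity: "\<And>\<psi> h. C1c_halfline \<psi> \<Longrightarrow> continuous_on UNIV h \<Longrightarrow>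
      (LINT (x, t)|lborel. W x t * (extend_zero \<psi> x * h t))
      = - (LINT (x, t)|lborel. \<gamma> x t * (extend_zero (deriv \<psi>) x * (LINT s:{t<..T}|lborel. h s)))"
begin

definition G :: "real \<Rightarrow> real \<Rightarrow> real" where
  "G x t = (LINT r:{0<..<t}|lborel. \<gamma> x r)"

lemma W_slice_meas: "(\<lambda>x. W x t) \<in> borel_measurable borel"
  using measurable_compose[OF _ W_meas, of "\<lambda>x. (x, t)" borel] by simp

lemma \<gamma>_slice_meas: "\<gamma> x \<in> borel_measurable borel"
  using measurable_compose[OF _ \<gamma>_meas, of "\<lambda>t. (x, t)" borel] by simp

lemma \<gamma>_slice_meas': "(\<lambda>x. \<gamma> x t) \<in> borel_measurable borel"
  using measurable_compose[OF _ \<gamma>_meas, of "\<lambda>x. (x, t)" borel] by simp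

lemma G_meas: "(\<lambda>(x, t). G x t) \<in> borel_measurable borel"
proof -
  have \<gamma>_pair: "(\<lambda>p. \<gamma> (fst p) (snd p)) \<in> borel_measurable (borel \<Otimes>\<^sub>M borel)"
    using \<gamma>_meas unfolding case_prod_unfold borel_prod by simp
  \<comment> \<open>The domain of integration depends on \<open>t\<close>; as a condition on the
    triple it is visibly measurable, and the integral with parameters is measurable too.\<close>
  have "(\<lambda>p. indicator {0<..<snd (fst p)} (snd p) *\<^sub>R \<gamma> (fst (fst p)) (snd p))
     = (\<lambda>p. (if 0 < snd p \<and> snd p < snd (fst p) then \<gamma> (fst (fst p)) (snd p) else 0 :: real))"
    by (auto simp: fun_eq_iff indicator_def)
  moreover have "(\<lambda>p. (if 0 < snd p \<and> snd p < snd (fst p) then \<gamma> (fst (fst p)) (snd p) else 0 :: real))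
     \<in> borel_measurable ((borel \<Otimes>\<^sub>M borel) \<Otimes>\<^sub>M lborel)"
  proof -
    have "(\<lambda>p :: (real \<times> real) \<times> real. (fst (fst p), snd p)) \<in> (borel \<Otimes>\<^sub>M borel) \<Otimes>\<^sub>M borel \<rightarrow>\<^sub>M borel \<Otimes>\<^sub>M borel"
      by measurable
    from measurable_compose[OF this \<gamma>_pair]
    have [measurable]: "(\<lambda>p :: (real \<times> real) \<times> real. \<gamma> (fst (fst p)) (snd p)) \<in> borel_measurable ((borel \<Otimes>\<^sub>M borel) \<Otimes>\<^sub>M borel)"
      by simp
    have "(\<lambda>p :: (real \<times> real) \<times> real. (if 0 < snd p \<and> snd p < snd (fst p) then \<gamma> (fst (fst p)) (snd p) else 0 :: real))
      \<in> borel_measurable ((borel \<Otimes>\<^sub>M borel) \<Otimes>\<^sub>M borel)"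
      by measurable
    then show ?thesis
      using measurable_cong_sets[OF sets_pair_measure_cong[OF refl sets_lborel] refl] by blast
  qed
  ultimately have "(\<lambda>z. LINT r|lborel. indicator {0<..<snd z} r *\<^sub>R \<gamma> (fst z) r) \<in> borel_measurable (borel \<Otimes>\<^sub>M borel)"
    using lborel.borel_measurable_lebesgue_integral[of "\<lambda>z r. indicator {0<..<snd z} r *\<^sub>R \<gamma> (fst z) r" "borel \<Otimes>\<^sub>M borel"]
    by (simp add: case_prod_unfold)
  then show ?thesis
    unfolding G_def set_lebesgue_integral_def borel_prod case_prod_unfold .
qed

lemma G_slice_meas: "G x \<in> borel_measurable borel"
  using measurable_compose[OF _ G_meas, of "\<lambda>t. (x, t)" borel] by simp

lemma G_slice_meas': "(\<lambda>x. G x t) \<in> borel_measurable borel"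
  using measurable_compose[OF _ G_meas, of "\<lambda>x. (x, t)" borel] by simp

lemma \<gamma>_row: "AE x in lborel. integrable lborel (\<lambda>r. (\<gamma> x r)\<^sup>2) \<and> integrable lborel (\<gamma> x)"
  using integral_fst_lborel(3)[OF \<gamma>_L2]
proof eventually_elim
  case (elim x)
  have "integrable lborel (\<lambda>r. \<gamma> x r * indicator {0..T} r)"
  proof (rule L2_mult_integrable)
    have "integrable lborel (indicator {0..T} :: real \<Rightarrow> real)" by (rule integrable_indicator_bounded) auto
    moreover have "(indicator {0..T} r)\<^sup>2 = (indicator {0..T} r :: real)" for r by (cases "r \<in> {0..T}") auto
    ultimately show "integrable lborel (\<lambda>r. (indicator {0..T} r)\<^sup>2 :: real)" by (simp only:)
  qed (use elim \<gamma>_slice_meas in auto)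
  moreover have "\<gamma> x r * indicator {0..T} r = \<gamma> x r" for r
    using \<gamma>_supp[of x r] by (cases "r \<in> {0..T}") (auto simp: strip_def)
  ultimately show ?case using elim by simp
qed

lemma G_bound: "AE x in lborel. \<forall>t\<in>{0<..<T}. (G x t)\<^sup>2 \<le> T * (LINT r|lborel. (\<gamma> x r)\<^sup>2)"
  using \<gamma>_row
proof eventually_elim
  case (elim x)
  show ?case
  proof
    fix t assume t: "t \<in> {0<..<T}"
    let ?I = "indicator {0<..<t} :: real \<Rightarrow> real"
    \<comment> \<open>The mean of \<open>\<gamma> x\<close> over (0,t). Nonnegativity of the
      variance about it is the Cauchy-Schwarz inequality wanted here.\<close>
    define m where "m = G x t / t"
    have i1: "integrable lborel (\<lambda>r. ?I r * (\<gamma> x r)\<^sup>2)" and i2: "integrable lborel (\<lambda>r. ?I r * \<gamma> x r)"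
      using integrable_mult_indicator[of "{0<..<t}" lborel "\<lambda>r. (\<gamma> x r)\<^sup>2"] integrable_mult_indicator[of "{0<..<t}" lborel "\<gamma> x"] elim
      by auto
    have i3: "integrable lborel ?I" by (rule integrable_indicator_bounded) auto
    have "0 \<le> (LINT r|lborel. ?I r * (\<gamma> x r - m)\<^sup>2)" by simp
    also have "\<dots> = (LINT r|lborel. ?I r * (\<gamma> x r)\<^sup>2 - 2 * m * (?I r * \<gamma> x r) + m\<^sup>2 * ?I r)"
      by (intro Bochner_Integration.integral_cong) (auto simp: power2_diff algebra_simps)
    also have "\<dots> = (LINT r|lborel. ?I r * (\<gamma> x r)\<^sup>2) - 2 * m * G x t + m\<^sup>2 * t"
      using i1 i2 i3 t unfolding G_def set_lebesgue_integral_def by simp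
    also have "\<dots> = (LINT r|lborel. ?I r * (\<gamma> x r)\<^sup>2) - (G x t)\<^sup>2 / t"
      unfolding m_def using t by (simp add: field_simps power2_eq_square)
    finally have "(G x t)\<^sup>2 \<le> t * (LINT r|lborel. ?I r * (\<gamma> x r)\<^sup>2)" using t by (simp add: field_simps)
    also have "\<dots> \<le> T * (LINT r|lborel. (\<gamma> x r)\<^sup>2)"
    proof (rule mult_mono)
      show "(LINT r|lborel. ?I r * (\<gamma> x r)\<^sup>2) \<le> (LINT r|lborel. (\<gamma> x r)\<^sup>2)"
        using i1 elim by (intro integral_mono) (auto simp: indicator_def)
    qed (use t in auto)
    finally show "(G x t)\<^sup>2 \<le> T * (LINT r|lborel. (\<gamma> x r)\<^sup>2)" .
  qed
qed

lemma G_slice_L2: "t \<in> {0<..<T} \<Longrightarrow> integrable lborel (\<lambda>x. (G x t)\<^sup>2)"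
proof (rule Bochner_Integration.integrable_bound[OF integrable_mult_right[OF integral_fst_lborel(2)[OF \<gamma>_L2], of T]])
  assume t: "t \<in> {0<..<T}"
  show "(\<lambda>x. (G x t)\<^sup>2) \<in> borel_measurable lborel" using G_slice_meas'[of t] by measurable
  show "AE x in lborel. norm ((G x t)\<^sup>2) \<le> norm (T * (LINT r|lborel. (\<gamma> x r)\<^sup>2))"
    using G_bound by eventually_elim (use t in \<open>auto simp: abs_le_iff intro: order_trans\<close>)
qed

lemma G_L2: "integrable lborel (\<lambda>(x, t). (indicator {0<..<T} t * G x t)\<^sup>2)"
proof -
  have "integrable (lborel \<Otimes>\<^sub>M lborel) (\<lambda>(x, t). (indicator {0<..<T} t * G x t)\<^sup>2)"
  proof (rule lborel_pair.Fubini_integrable)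
    have m: "(\<lambda>(x, t). (indicator {0<..<T} t * G x t)\<^sup>2) \<in> borel_measurable (borel \<Otimes>\<^sub>M borel)"
      using G_meas unfolding borel_prod[symmetric] case_prod_unfold by measurable
    then show "(\<lambda>(x, t). (indicator {0<..<T} t * G x t)\<^sup>2) \<in> borel_measurable (lborel \<Otimes>\<^sub>M lborel)"
      by (simp add: borel_prod lborel_prod)
    \<comment> \<open>One factor \<open>T\<close> comes from \<open>G_bound\<close>, the other from
      integrating over the time interval.\<close>
    have row: "AE x in lborel. integrable lborel (\<lambda>t. (indicator {0<..<T} t * G x t)\<^sup>2)
        \<and> (LINT t|lborel. (indicator {0<..<T} t * G x t)\<^sup>2) \<le> T * (T * (LINT r|lborel. (\<gamma> x r)\<^sup>2))"
      using G_bound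
    proof eventually_elim
      case (elim x)
      let ?b = "T * (LINT r|lborel. (\<gamma> x r)\<^sup>2)"
      have b: "(indicator {0<..<T} t * G x t)\<^sup>2 \<le> ?b * indicator {0<..<T} t" for t
        using elim by (auto simp: indicator_def)
      have i: "integrable lborel (\<lambda>t. (indicator {0<..<T} t * G x t)\<^sup>2)"
      proof (rule Bochner_Integration.integrable_bound)
        show "integrable lborel (\<lambda>t. ?b * indicator {0<..<T} t)"
          by (intro integrable_mult_right integrable_indicator_bounded) auto
        show "(\<lambda>t. (indicator {0<..<T} t * G x t)\<^sup>2) \<in> borel_measurable lborel"
          using G_slice_meas[of x] by measurable
        show "AE t in lborel. norm ((indicator {0<..<T} t * G x t)\<^sup>2) \<le> norm (?b * indicator {0<..<T} t)"
          using b by (intro AE_I2) (metis abs_of_nonneg abs_ge_self order_trans real_norm_def zero_le_power2)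
      qed
      moreover have "(LINT t|lborel. (indicator {0<..<T} t * G x t)\<^sup>2) \<le> (LINT t|lborel. ?b * indicator {0<..<T} t)"
        by (rule integral_mono[OF i _ b]) (intro integrable_mult_right integrable_indicator_bounded, auto)
      ultimately show ?case using T_pos by (simp add: mult.commute)
    qed
    show "AE x in lborel. integrable lborel (\<lambda>y. case (x, y) of (x, t) \<Rightarrow> (indicator {0<..<T} t * G x t)\<^sup>2)"
      using row by eventually_elim simp
    show "integrable lborel (\<lambda>x. LINT y|lborel. norm (case (x, y) of (x, t) \<Rightarrow> (indicator {0<..<T} t * G x t)\<^sup>2))"
    proof (rule Bochner_Integration.integrable_bound[OF integrable_mult_right[OF integral_fst_lborel(2)[OF \<gamma>_L2], of "T * T"]])
      show "(\<lambda>x. LINT y|lborel. norm (case (x, y) of (x, t) \<Rightarrow> (indicator {0<..<T} t * G x t)\<^sup>2)) \<in> borel_measurable lborel"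
        using lborel.borel_measurable_lebesgue_integral[of "\<lambda>x t. (indicator {0<..<T} t * G x t)\<^sup>2" borel] m
        by (simp add: measurable_lborel1)
      show "AE x in lborel. norm (LINT y|lborel. norm (case (x, y) of (x, t) \<Rightarrow> (indicator {0<..<T} t * G x t)\<^sup>2))
          \<le> norm (T * T * (LINT r|lborel. (\<gamma> x r)\<^sup>2))"
        using row
      proof eventually_elim
        case (elim x)
        then have "norm (LINT y|lborel. norm (case (x, y) of (x, t) \<Rightarrow> (indicator {0<..<T} t * G x t)\<^sup>2))
            \<le> T * T * (LINT r|lborel. (\<gamma> x r)\<^sup>2)" by (simp add: mult.assoc)
        also have "\<dots> \<le> norm (T * T * (LINT r|lborel. (\<gamma> x r)\<^sup>2))" unfolding real_norm_def by (rule abs_ge_self)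
        finally show ?case .
      qed
    qed
  qed
  then show ?thesis unfolding lborel_prod .
qed

end

section \<open>Product integrands and a countable family of test functions\<close>

lemma C1c_halfline_deriv:
  "C1c_halfline \<psi> \<Longrightarrow> 0 < x \<Longrightarrow> (\<psi> has_real_derivative deriv \<psi> x) (at x)"
  by (erule C1c_halflineE) blast

lemma integrable_times_lborel:
  fixes f g :: "real \<Rightarrow> real"
  assumes f: "integrable lborel f" and g: "integrable lborel g"
  shows "integrable lborel (\<lambda>(x, y). f x * g y)"
proof -
  have [measurable]: "f \<in> borel_measurable borel" "g \<in> borel_measurable borel"
    using borel_measurable_integrable[OF f] borel_measurable_integrable[OF g] by auto
  have "integrable (lborel \<Otimes>\<^sub>M lborel) (\<lambda>(x, y). f x * g y)"
  proof (rule lborel_pair.Fubini_integrable)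
    have "(\<lambda>(x, y). f x * g y) \<in> borel_measurable (borel \<Otimes>\<^sub>M borel)" by measurable
    then show "(\<lambda>(x, y). f x * g y) \<in> borel_measurable (lborel \<Otimes>\<^sub>M lborel)"
      unfolding lborel_prod by (simp add: borel_prod)
    have "integrable lborel (\<lambda>x. \<bar>f x\<bar> * (LINT y|lborel. \<bar>g y\<bar>))"
      using f by (intro integrable_mult_left integrable_abs)
    then show "integrable lborel (\<lambda>x. LINT y|lborel. norm (case (x, y) of (x, y) \<Rightarrow> f x * g y))"
      by (simp add: abs_mult)
    show "AE x in lborel. integrable lborel (\<lambda>y. case (x, y) of (x, y) \<Rightarrow> f x * g y)"
      using g by simp
  qed
  then show ?thesis unfolding lborel_prod .
qed

lemma strip_mult_integrable:
  fixes Z :: "real \<Rightarrow> real \<Rightarrow> real"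
  assumes Zm: "(\<lambda>(x, t). Z x t) \<in> borel_measurable borel"
    and Z2: "integrable lborel (\<lambda>(x, t). (Z x t)\<^sup>2)"
    and supp: "\<And>x t. (x, t) \<notin> strip T \<Longrightarrow> Z x t = 0"
    and p: "p \<in> borel_measurable borel" "0 < a" "\<And>x. \<bar>p x\<bar> \<le> C * indicator {a..b} x"
    and k: "k \<in> borel_measurable borel" "\<And>t. t \<in> {0<..<T} \<Longrightarrow> \<bar>k t\<bar> \<le> K"
  shows "integrable lborel (\<lambda>(x, t). Z x t * (p x * k t))"
proof -
  \<comment> \<open>As \<open>k\<close> is bounded on the time interval only, it is cut off where
    \<open>Z\<close> vanishes anyway.\<close>
  have eq: "Z x t * (p x * k t) = Z x t * (p x * (indicator {0<..<T} t * k t))" for x t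
    using supp[of x t] by (cases "t \<in> {0<..<T}") (auto simp: strip_def)
  have m: "(\<lambda>(x, t). p x * (indicator {0<..<T} t * k t)) \<in> borel_measurable borel"
    using p(1) k(1) unfolding borel_prod[symmetric] case_prod_unfold by measurable
  have "integrable lborel (\<lambda>(x, t). (p x * (indicator {0<..<T} t * k t))\<^sup>2)"
  proof (rule bounded_support_square_integrable_plane[OF m])
    fix x t
    show "\<bar>p x * (indicator {0<..<T} t * k t)\<bar> \<le> (\<bar>C\<bar> * \<bar>K\<bar>) * (indicator {0..b} x * indicator {0<..<T} t)"
    proof (cases "x \<in> {a..b} \<and> t \<in> {0<..<T}")
      case True
      then have "\<bar>p x\<bar> * \<bar>k t\<bar> \<le> \<bar>C\<bar> * \<bar>K\<bar>" using p(3)[of x] k(2)[of t] by (intro mult_mono) auto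
      then show ?thesis using True p(2) by (simp add: abs_mult)
    next
      case False
      then have "p x * (indicator {0<..<T} t * k t) = 0" using p(3)[of x] by auto
      then show ?thesis by (simp only: abs_zero) simp
    qed
  qed
  then have "integrable lborel (\<lambda>z. (case z of (x, t) \<Rightarrow> Z x t) * (case z of (x, t) \<Rightarrow> p x * (indicator {0<..<T} t * k t)))"
    using Z2 Zm m by (intro L2_mult_integrable) (auto simp: case_prod_unfold)
  then show ?thesis unfolding eq by (simp add: case_prod_unfold)
qed

text \<open>Countably many test functions suffice: by the Weierstrass theorem every \<open>C\<^sup>1\<close> function with
  compact support in \<open>(0, \<infinity>)\<close> is a \<open>C\<^sup>1\<close> limit of polynomials times a fixed cutoff.\<close>
definition cutoff :: "nat \<Rightarrow> real \<Rightarrow> real" where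
  "cutoff N x = smoothstep (2 * real N * x - 1) * smoothstep (2 - x / real N)"

definition cutoff' :: "nat \<Rightarrow> real \<Rightarrow> real" where
  "cutoff' N x = smoothstep' (2 * real N * x - 1) * (2 * real N) * smoothstep (2 - x / real N)
     - smoothstep (2 * real N * x - 1) * smoothstep' (2 - x / real N) / real N"

lemma cutoff_deriv: "1 \<le> N \<Longrightarrow> (cutoff N has_real_derivative cutoff' N x) (at x)"
  unfolding cutoff_def[abs_def] cutoff'_def
  by (auto intro!: derivative_eq_intros DERIV_chain2[OF smoothstep_deriv])

lemma cutoff_cont:
  assumes "1 \<le> N"
  shows "continuous_on S (cutoff N)" "continuous_on S (cutoff' N)"
proof -
  have s: "continuous_on S (\<lambda>x. smoothstep (F x))" "continuous_on S (\<lambda>x. smoothstep' (F x))"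
    if "continuous_on S F" for F :: "real \<Rightarrow> real"
    using continuous_on_compose2[OF smoothstep_cont[of UNIV] that] continuous_on_compose2[OF smoothstep'_cont that]
    by auto
  show "continuous_on S (cutoff N)" "continuous_on S (cutoff' N)"
    unfolding cutoff_def cutoff'_def using assms by (auto intro!: continuous_intros s)
qed

lemma cutoff_zero:
  assumes "1 \<le> N" "x \<notin> {1 / (2 * real N)..2 * real N}"
  shows "cutoff N x = 0" "cutoff' N x = 0"
proof -
  have "2 * real N * x - 1 \<le> 0 \<or> 2 - x / real N \<le> 0"
    using assms by (auto simp: field_simps)
  then show "cutoff N x = 0" "cutoff' N x = 0"
    unfolding cutoff_def cutoff'_def using smoothstep_0 smoothstep'_outside by auto
qed

lemma cutoff_one:
  assumes "1 \<le> N" "x \<in> {1 / real N..real N}"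
  shows "cutoff N x = 1" "cutoff' N x = 0"
proof -
  have "1 \<le> 2 * real N * x - 1 \<and> 1 \<le> 2 - x / real N" using assms by (auto simp: field_simps)
  then show "cutoff N x = 1" "cutoff' N x = 0"
    unfolding cutoff_def cutoff'_def using smoothstep_1 smoothstep'_outside by auto
qed

lemma cutoff_power:
  assumes "1 \<le> N"
  shows "C1c_halfline (\<lambda>x. cutoff N x * x ^ j)"
    and "extend_zero (\<lambda>x. cutoff N x * x ^ j) x = cutoff N x * x ^ j"
    and "extend_zero (deriv (\<lambda>x. cutoff N x * x ^ j)) x = cutoff' N x * x ^ j + cutoff N x * (real j * x ^ (j - 1))"
proof -
  have d: "((\<lambda>x. cutoff N x * x ^ j) has_real_derivative cutoff' N x * x ^ j + cutoff N x * (real j * x ^ (j - 1))) (at x)" for x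
    using cutoff_deriv[OF assms, of x] by (auto intro!: derivative_eq_intros)
  have pos: "0 < 1 / (2 * real N)" using assms by simp
  show "C1c_halfline (\<lambda>x. cutoff N x * x ^ j)"
    by (rule C1c_halflineI[OF d _ pos, where b="2 * real N"])
       (use cutoff_zero[OF assms] in \<open>auto intro!: continuous_intros cutoff_cont[OF assms]\<close>)
  have "x \<notin> {1 / (2 * real N)..2 * real N}" if "x \<le> 0"
    using that pos unfolding atLeastAtMost_iff by linarith
  then show "extend_zero (\<lambda>x. cutoff N x * x ^ j) x = cutoff N x * x ^ j"
    "extend_zero (deriv (\<lambda>x. cutoff N x * x ^ j)) x = cutoff' N x * x ^ j + cutoff N x * (real j * x ^ (j - 1))"
    unfolding extend_zero_def using cutoff_zero[OF assms, of x] DERIV_imp_deriv[OF d] by auto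
qed

text \<open>\<open>Lam\<close> is the defect of the identity for \<open>\<psi>\<close>. It does not
  change when a combination of the given family is subtracted, and it is small when the remainder is
  small in C^1. A polynomial close to the derivative is integrated, which makes function and
  derivative close at once, and multiplied by a cutoff that equals 1 on the support of
  \<open>\<psi>\<close>.\<close>

lemma weak_identity_from_cutoff_powers:
  fixes w g :: "real \<Rightarrow> real"
  assumes m: "w \<in> borel_measurable borel" "g \<in> borel_measurable borel"
    and i: "integrable lborel (\<lambda>x. (w x)\<^sup>2)" "integrable lborel (\<lambda>x. (g x)\<^sup>2)"
    and pow: "\<And>N j. 1 \<le> N \<Longrightarrow> (LINT x|lborel. w x * (cutoff N x * x ^ j))
        = - (LINT x|lborel. g x * (cutoff' N x * x ^ j + cutoff N x * (real j * x ^ (j - 1))))"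
    and C: "C1c_halfline \<psi>"
  shows "(LINT x|lborel. w x * extend_zero \<psi> x) = - (LINT x|lborel. g x * extend_zero (deriv \<psi>) x)"
proof -
  obtain a b B where ab: "0 < a" "a < b" and Ec: "continuous_on UNIV (extend_zero \<psi>)" "continuous_on UNIV (extend_zero (deriv \<psi>))"
    and Eb: "\<And>x. \<bar>extend_zero \<psi> x\<bar> \<le> B * indicator {a..b} x" "\<And>x. \<bar>extend_zero (deriv \<psi>) x\<bar> \<le> B * indicator {a..b} x"
    by (rule C1c_extend_zero[OF C]) blast
  define E where "E = extend_zero \<psi>"
  define E' where "E' = extend_zero (deriv \<psi>)"
  have Ez: "E x = 0" "E' x = 0" if "x \<notin> {a..b}" for x using Eb[of x] that unfolding E_def E'_def by auto
  have Ed: "(E has_real_derivative E' x) (at x)" if x: "0 < x" for x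
  proof (rule has_field_derivative_transform_within_open[where S="{0<..}" and f=\<psi>])
    show "(\<psi> has_real_derivative E' x) (at x)"
      using C1c_halfline_deriv[OF C x] x unfolding E'_def extend_zero_def by simp
  qed (use x in \<open>auto simp: E_def extend_zero_def\<close>)
  obtain N where "max b (1 / a) < real N" using reals_Archimedean2 by blast
  then have N: "1 / a < real N" "b < real N" by auto
  have N0: "0 < real N" using N(2) ab by linarith
  have N1: "1 \<le> N" using N0 by simp
  have Na: "1 / real N < a" using N(1) ab N0 by (simp add: field_simps)
  \<comment> \<open>The left end of the support of the cutoff; it lies below \<open>a\<close>, so
    \<open>E\<close> vanishes there.\<close>
  define l where "l = 1 / (2 * real N)"
  define I where "I = {l..2 * real N}"
  have l: "0 < l" "l < a" "l \<le> 2 * real N"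
  proof -
    show "0 < l" unfolding l_def using N0 by simp
    have "l \<le> 1 / real N" unfolding l_def using N0 by (simp add: frac_le)
    then show "l < a" using Na by simp
    then show "l \<le> 2 * real N" using ab N by linarith
  qed
  have cb: "\<exists>K. \<forall>x\<in>I. \<bar>F x\<bar> \<le> K" if "continuous_on UNIV F" for F :: "real \<Rightarrow> real"
  proof -
    have "bounded (F ` I)" unfolding I_def
      by (intro compact_imp_bounded compact_continuous_image continuous_on_subset[OF that]) auto
    then show ?thesis unfolding bounded_iff by auto
  qed
  obtain K where K: "\<And>x. x \<in> I \<Longrightarrow> \<bar>cutoff' N x\<bar> \<le> K" using cb[OF cutoff_cont(2)[OF N1]] by blast
  have l_I: "l \<in> I" unfolding I_def using l by auto
  have K0: "0 \<le> K" using K[OF l_I] by (meson abs_ge_zero order_trans)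
  have c01: "0 \<le> cutoff N x" "cutoff N x \<le> 1" for x
    unfolding cutoff_def using smoothstep_nonneg smoothstep_le_1 by (auto intro: mult_le_one)
  \<comment> \<open>The cutoff is 1 on the support of \<open>E\<close>. With this, \<open>F\<close>
    is the cutoff times \<open>E - p\<close>, and its smallness follows from that of
    \<open>E - p\<close> and \<open>E' - r\<close>.\<close>
  have Ecut: "E x = cutoff N x * E x" "E' x = cutoff' N x * E x + cutoff N x * E' x" for x
    using Ez[of x] cutoff_one[OF N1, of x] Na N by (cases "x \<in> {a..b}"; auto)+
  have prod_int: "integrable lborel (\<lambda>x. h x * F x)"
    if hF: "h \<in> borel_measurable borel" "integrable lborel (\<lambda>x. (h x)\<^sup>2)" "continuous_on UNIV F" "\<And>x. x \<notin> I \<Longrightarrow> F x = 0"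
    for h F :: "real \<Rightarrow> real"
  proof (rule L2_mult_integrable)
    obtain k where k: "\<And>x. x \<in> I \<Longrightarrow> \<bar>F x\<bar> \<le> k" using cb[OF hF(3)] by blast
    have Fm: "F \<in> borel_measurable borel" using hF(3) by (rule borel_measurable_continuous_onI)
    show "integrable lborel (\<lambda>x. (F x)\<^sup>2)"
      by (rule bounded_support_square_integrable[OF Fm, where C=k and a=l and b="2 * real N"])
         (use k hF(4) in \<open>auto simp: I_def indicator_def\<close>)
    show "F \<in> borel_measurable lborel" using Fm by simp
  qed (use hF in auto)
  have absint: "integrable lborel (\<lambda>x. \<bar>w x\<bar> * indicator I x)" "integrable lborel (\<lambda>x. \<bar>g x\<bar> * indicator I x)"
  proof -
    have "integrable lborel (\<lambda>x. (indicator I x)\<^sup>2 :: real)"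
      by (rule bounded_support_square_integrable[where C=1 and a=l and b="2 * real N"]) (auto simp: I_def indicator_def)
    then show "integrable lborel (\<lambda>x. \<bar>w x\<bar> * indicator I x)" "integrable lborel (\<lambda>x. \<bar>g x\<bar> * indicator I x)"
      using m i by (auto intro!: L2_mult_integrable simp: I_def)
  qed
  define J where "J = (LINT x|lborel. \<bar>w x\<bar> * indicator I x) + (LINT x|lborel. \<bar>g x\<bar> * indicator I x)"
  define Lam where "Lam = (LINT x|lborel. w x * E x) + (LINT x|lborel. g x * E' x)"
  have bound: "\<bar>Lam\<bar> \<le> e * ((2 * real N + K * (2 * real N) + 1) * J)" if e: "0 < e" for e
  proof -
    obtain r where r: "real_polynomial_function r" "\<And>x. x \<in> I \<Longrightarrow> \<bar>E' x - r x\<bar> < e"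
      using Stone_Weierstrass_real_polynomial_function[of I E' e] e continuous_on_subset[OF Ec(2)]
      unfolding I_def E'_def by (metis compact_Icc subset_UNIV)
    obtain c n where rc: "r = (\<lambda>x. \<Sum>i\<le>n. c i * x ^ i)"
      using r(1) unfolding real_polynomial_function_iff_sum by blast
    \<comment> \<open>Normalises the antiderivative to vanish at \<open>l\<close>, as
      \<open>E\<close> does, so closeness of the derivatives integrates to closeness of the
      functions.\<close>
    define c0 where "c0 = (\<Sum>i\<le>n. c i * l ^ Suc i / real (Suc i))"
    define p where "p x = (\<Sum>i\<le>n. c i * x ^ Suc i / real (Suc i)) - c0" for x
    have pd: "(p has_real_derivative r x) (at x)" for x
    proof -
      have "((\<lambda>x. c i * x ^ Suc i / real (Suc i)) has_real_derivative c i * x ^ i) (at x)" for i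
        by (auto intro!: derivative_eq_intros simp del: power_Suc)
      then have "((\<lambda>x. \<Sum>i\<le>n. c i * x ^ Suc i / real (Suc i)) has_real_derivative (\<Sum>i\<le>n. c i * x ^ i)) (at x)"
        by (intro DERIV_sum)
      from DERIV_diff[OF this DERIV_const[of c0]] show ?thesis unfolding p_def rc by simp
    qed
    have pl: "p l = 0" unfolding p_def c0_def by simp
    have pc: "continuous_on S p" for S
      by (rule DERIV_continuous_on[OF has_field_derivative_at_within[OF pd]])
    have rcont: "continuous_on S r" for S unfolding rc by (intro continuous_intros)
    have Ep: "\<bar>E x - p x\<bar> \<le> e * (2 * real N)" if x: "x \<in> I" for x
    proof -
      have "norm ((E x - p x) - (E l - p l)) \<le> e * norm (x - l)"
      proof (rule field_differentiable_bound[of I "\<lambda>x. E x - p x" "\<lambda>x. E' x - r x"])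
        show "convex I" unfolding I_def by simp
        show "((\<lambda>x. E x - p x) has_real_derivative E' y - r y) (at y within I)" if "y \<in> I" for y
          by (rule has_field_derivative_at_within, rule DERIV_diff[OF Ed pd]) (use that l in \<open>auto simp: I_def\<close>)
        show "norm (E' y - r y) \<le> e" if "y \<in> I" for y using r(2)[OF that] by simp
      qed (use x l_I in auto)
      also have "\<dots> \<le> e * (2 * real N)" using x l e unfolding I_def by (intro mult_left_mono) auto
      finally show ?thesis using Ez(1)[of l] pl l by simp
    qed
    define F where "F x = E x - cutoff N x * p x" for x
    define F' where "F' x = E' x - (cutoff' N x * p x + cutoff N x * r x)" for x
    have Fz: "F x = 0" "F' x = 0" if "x \<notin> I" for x
    proof -
      have "x \<notin> {a..b}" using that l ab N unfolding I_def by auto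
      then show "F x = 0" "F' x = 0" unfolding F_def F'_def
        using Ez cutoff_zero[OF N1, of x] that unfolding I_def l_def by auto
    qed
    have Fb: "\<bar>F x\<bar> \<le> e * (2 * real N) * indicator I x" for x
    proof (cases "x \<in> I")
      case True
      have "F x = cutoff N x * (E x - p x)" unfolding F_def using Ecut(1)[of x] by (simp add: algebra_simps)
      then have "\<bar>F x\<bar> = cutoff N x * \<bar>E x - p x\<bar>" using c01 by (simp add: abs_mult)
      also have "\<dots> \<le> 1 * (e * (2 * real N))" using c01 Ep[OF True] by (intro mult_mono) auto
      finally show ?thesis using True by simp
    qed (use Fz in simp)
    have Fb': "\<bar>F' x\<bar> \<le> e * (K * (2 * real N) + 1) * indicator I x" for x
    proof (cases "x \<in> I")
      case True
      have "F' x = cutoff' N x * (E x - p x) + cutoff N x * (E' x - r x)"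
        unfolding F'_def using Ecut(2)[of x] by (simp add: algebra_simps)
      then have "\<bar>F' x\<bar> \<le> \<bar>cutoff' N x\<bar> * \<bar>E x - p x\<bar> + cutoff N x * \<bar>E' x - r x\<bar>"
        using c01(1)[of x] abs_triangle_ineq[of "cutoff' N x * (E x - p x)" "cutoff N x * (E' x - r x)"]
        by (simp add: abs_mult)
      also have "\<dots> \<le> K * (e * (2 * real N)) + 1 * e"
        using c01 Ep[OF True] K[OF True] K0 r(2)[OF True] by (intro add_mono mult_mono) auto
      finally show ?thesis using True by (simp add: algebra_simps)
    qed (use Fz in simp)
    have Fc: "continuous_on UNIV F" "continuous_on UNIV F'"
      unfolding F_def F'_def E_def E'_def by (intro continuous_intros Ec cutoff_cont[OF N1] pc rcont)+
    have wi: "integrable lborel (\<lambda>x. w x * (cutoff N x * x ^ j))"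
      "integrable lborel (\<lambda>x. g x * (cutoff' N x * x ^ j + cutoff N x * (real j * x ^ (j - 1))))" for j
      by (rule prod_int; use m i cutoff_zero[OF N1] in \<open>auto intro!: continuous_intros cutoff_cont[OF N1] simp: I_def l_def\<close>)+
    have poly: "(LINT x|lborel. w x * (cutoff N x * p x)) + (LINT x|lborel. g x * (cutoff' N x * p x + cutoff N x * r x)) = 0"
    proof -
      \<comment> \<open>The constant is written as a multiple of \<open>x ^ 0\<close> to match the
        member \<open>j = 0\<close> of the family. There \<open>x ^ (j - 1)\<close> is
        \<open>x ^ 0\<close> by truncated subtraction, but its factor \<open>real j\<close> is
        0.\<close>
      have p_sum: "p x = (\<Sum>i\<le>n. c i / real (Suc i) * x ^ Suc i) + - c0 * x ^ 0" for x
        unfolding p_def by simp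
      have 1: "w x * (cutoff N x * p x) = (\<Sum>i\<le>n. c i / real (Suc i) * (w x * (cutoff N x * x ^ Suc i)))
          + - c0 * (w x * (cutoff N x * x ^ 0))" for x
        unfolding p_sum by (simp only: distrib_left sum_distrib_left mult.assoc mult.left_commute)
      have 2: "g x * (cutoff' N x * p x + cutoff N x * r x)
          = (\<Sum>i\<le>n. c i / real (Suc i) * (g x * (cutoff' N x * x ^ Suc i + cutoff N x * (real (Suc i) * x ^ (Suc i - 1)))))
          + - c0 * (g x * (cutoff' N x * x ^ 0 + cutoff N x * (real 0 * x ^ (0 - 1))))" for x
      proof -
        have "cutoff' N x * p x + cutoff N x * r x = (\<Sum>i\<le>n. c i / real (Suc i) * (cutoff' N x * x ^ Suc i + cutoff N x * (real (Suc i) * x ^ i)))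
            + - c0 * cutoff' N x"
        proof -
          have "(\<Sum>i\<le>n. c i / real (Suc i) * (cutoff' N x * x ^ Suc i + cutoff N x * (real (Suc i) * x ^ i)))
             = (\<Sum>i\<le>n. cutoff' N x * (c i / real (Suc i) * x ^ Suc i) + cutoff N x * (c i * x ^ i))"
            by (rule sum.cong) (auto simp: field_simps simp del: of_nat_Suc)
          also have "\<dots> = cutoff' N x * (\<Sum>i\<le>n. c i / real (Suc i) * x ^ Suc i) + cutoff N x * r x"
            unfolding rc by (simp only: sum.distrib sum_distrib_left)
          finally show ?thesis unfolding p_sum by (simp add: algebra_simps)
        qed
        then show ?thesis by (simp add: right_diff_distrib distrib_left sum_distrib_left mult.left_commute del: power_Suc of_nat_Suc)
      qed
      have lin: "(LINT x|lborel. (\<Sum>i\<le>n. b i * H (Suc i) x) + b0 * H 0 x)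
          = (\<Sum>i\<le>n. b i * (LINT x|lborel. H (Suc i) x)) + b0 * (LINT x|lborel. H 0 x)"
        if "\<And>j. integrable lborel (H j)" for H :: "nat \<Rightarrow> real \<Rightarrow> real" and b b0
        using that by simp
      have "(LINT x|lborel. w x * (cutoff N x * p x)) = (\<Sum>i\<le>n. c i / real (Suc i) * (LINT x|lborel. w x * (cutoff N x * x ^ Suc i)))
          + - c0 * (LINT x|lborel. w x * (cutoff N x * x ^ 0))"
        unfolding 1 by (rule lin[of "\<lambda>j x. w x * (cutoff N x * x ^ j)", OF wi(1)])
      moreover have "(LINT x|lborel. g x * (cutoff' N x * p x + cutoff N x * r x))
          = (\<Sum>i\<le>n. c i / real (Suc i) * (LINT x|lborel. g x * (cutoff' N x * x ^ Suc i + cutoff N x * (real (Suc i) * x ^ (Suc i - 1)))))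
          + - c0 * (LINT x|lborel. g x * (cutoff' N x * x ^ 0 + cutoff N x * (real 0 * x ^ (0 - 1))))"
        unfolding 2
        by (rule lin[of "\<lambda>j x. g x * (cutoff' N x * x ^ j + cutoff N x * (real j * x ^ (j - 1)))", OF wi(2)])
      ultimately show ?thesis unfolding pow[OF N1] by (simp add: sum_negf)
    qed
    have w3: "integrable lborel (\<lambda>x. w x * F x)" "integrable lborel (\<lambda>x. g x * F' x)"
      by (rule prod_int[OF _ _ Fc(1) Fz(1)] prod_int[OF _ _ Fc(2) Fz(2)]; use m i in simp)+
    have w4: "integrable lborel (\<lambda>x. w x * (cutoff N x * p x))" "integrable lborel (\<lambda>x. g x * (cutoff' N x * p x + cutoff N x * r x))"
      by (rule prod_int; use m i cutoff_zero[OF N1] in \<open>auto intro!: continuous_intros cutoff_cont[OF N1] pc rcont simp: I_def l_def\<close>)+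
    have Lam_eq: "Lam = (LINT x|lborel. w x * F x) + (LINT x|lborel. g x * F' x)"
    proof -
      have "(LINT x|lborel. w x * E x) = (LINT x|lborel. w x * F x + w x * (cutoff N x * p x))"
        unfolding F_def by (simp add: algebra_simps)
      moreover have "(LINT x|lborel. g x * E' x) = (LINT x|lborel. g x * F' x + g x * (cutoff' N x * p x + cutoff N x * r x))"
        unfolding F'_def by (simp add: algebra_simps)
      ultimately show ?thesis unfolding Lam_def using w3 w4 poly by simp
    qed
    have "\<bar>Lam\<bar> \<le> (LINT x|lborel. e * (2 * real N) * (\<bar>w x\<bar> * indicator I x))
        + (LINT x|lborel. e * (K * (2 * real N) + 1) * (\<bar>g x\<bar> * indicator I x))"
      unfolding Lam_eq
    proof (rule order_trans[OF abs_triangle_ineq add_mono])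
      show "\<bar>LINT x|lborel. w x * F x\<bar> \<le> (LINT x|lborel. e * (2 * real N) * (\<bar>w x\<bar> * indicator I x))"
      proof (rule order_trans[OF integral_abs_bound integral_mono])
        show "\<bar>w x * F x\<bar> \<le> e * (2 * real N) * (\<bar>w x\<bar> * indicator I x)" for x
          using mult_left_mono[OF Fb[of x] abs_ge_zero[of "w x"]] by (simp add: abs_mult mult.left_commute)
      qed (use w3 absint in auto)
      show "\<bar>LINT x|lborel. g x * F' x\<bar> \<le> (LINT x|lborel. e * (K * (2 * real N) + 1) * (\<bar>g x\<bar> * indicator I x))"
      proof (rule order_trans[OF integral_abs_bound integral_mono])
        show "\<bar>g x * F' x\<bar> \<le> e * (K * (2 * real N) + 1) * (\<bar>g x\<bar> * indicator I x)" for x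
          using mult_left_mono[OF Fb'[of x] abs_ge_zero[of "g x"]] by (simp add: abs_mult mult.left_commute)
      qed (use w3 absint in auto)
    qed
    also have "\<dots> \<le> e * ((2 * real N + K * (2 * real N) + 1) * J)"
    proof -
      define X Y where "X = (LINT x|lborel. \<bar>w x\<bar> * indicator I x)" and "Y = (LINT x|lborel. \<bar>g x\<bar> * indicator I x)"
      have n: "0 \<le> X" "0 \<le> Y"
        unfolding X_def Y_def by (rule Bochner_Integration.integral_nonneg; simp)+
      have "0 \<le> (K * (2 * real N) + 1) * X" "0 \<le> 2 * real N * Y" using n K0 by auto
      then have "2 * real N * X + (K * (2 * real N) + 1) * Y \<le> (2 * real N + K * (2 * real N) + 1) * J"
      proof -
        have "(2 * real N + K * (2 * real N) + 1) * (X + Y)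
          = (2 * real N * X + (K * (2 * real N) + 1) * Y) + ((K * (2 * real N) + 1) * X + 2 * real N * Y)"
          by (simp add: algebra_simps)
        moreover have J: "J = X + Y" unfolding J_def X_def Y_def ..
        ultimately show ?thesis unfolding J using \<open>0 \<le> (K * (2 * real N) + 1) * X\<close> \<open>0 \<le> 2 * real N * Y\<close> by linarith
      qed
      then have "e * (2 * real N * X + (K * (2 * real N) + 1) * Y) \<le> e * ((2 * real N + K * (2 * real N) + 1) * J)"
        using e by (intro mult_left_mono) auto
      moreover have "(LINT x|lborel. e * (2 * real N) * (\<bar>w x\<bar> * indicator I x))
        + (LINT x|lborel. e * (K * (2 * real N) + 1) * (\<bar>g x\<bar> * indicator I x)) = e * (2 * real N * X + (K * (2 * real N) + 1) * Y)"
        unfolding X_def Y_def using absint by (simp add: distrib_left mult.assoc)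
      ultimately show ?thesis by simp
    qed
    finally show ?thesis .
  qed
  define c where "c = \<bar>(2 * real N + K * (2 * real N) + 1) * J\<bar> + 1"
  have c: "0 < c" unfolding c_def by (simp add: add_nonneg_pos)
  have "\<bar>Lam\<bar> \<le> 0"
  proof (rule field_le_epsilon)
    fix d :: real assume d: "0 < d"
    have "\<bar>Lam\<bar> \<le> d / c * ((2 * real N + K * (2 * real N) + 1) * J)" using bound[of "d / c"] c d by simp
    also have "\<dots> \<le> d / c * c" using c d unfolding c_def by (intro mult_left_mono) auto
    finally show "\<bar>Lam\<bar> \<le> 0 + d" using c by simp
  qed
  then show ?thesis unfolding Lam_def E_def E'_def by simp
qed

section \<open>The identity on time slices and the sign of its right-hand side\<close>

context integrated_gradient
begin

text \<open>The time factor \<open>h\<close> is arbitrary. Fubini moves the tail integral off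
  \<open>h\<close> and onto \<open>\<gamma>\<close>, where it becomes integration from 0 to the
  current time, that is \<open>G\<close>; then \<open>h\<close> is removed by the fundamental
  lemma.\<close>

lemma slice_identity:
  assumes C: "C1c_halfline \<psi>"
  shows "AE t in lborel. t \<in> {0<..<T} \<longrightarrow> (LINT x|lborel. W x t * extend_zero \<psi> x)
      = - (LINT x|lborel. G x t * extend_zero (deriv \<psi>) x)"
proof -
  obtain a b B where ab: "0 < a" "a < b" and Ec: "continuous_on UNIV (extend_zero \<psi>)" "continuous_on UNIV (extend_zero (deriv \<psi>))"
    and Eb: "\<And>x. \<bar>extend_zero \<psi> x\<bar> \<le> B * indicator {a..b} x" "\<And>x. \<bar>extend_zero (deriv \<psi>) x\<bar> \<le> B * indicator {a..b} x"
    by (rule C1c_extend_zero[OF C]) blast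
  define P where "P = extend_zero \<psi>"
  define P' where "P' = extend_zero (deriv \<psi>)"
  have Pm: "P \<in> borel_measurable borel" "P' \<in> borel_measurable borel"
    unfolding P_def P'_def using Ec by (auto intro: borel_measurable_continuous_onI)
  note Pb = Eb(1)[folded P_def] and Pb' = Eb(2)[folded P'_def]
  have W_int: "integrable lborel (\<lambda>(x, t). W x t * (P x * k t))"
    if "k \<in> borel_measurable borel" "\<And>t. t \<in> {0<..<T} \<Longrightarrow> \<bar>k t\<bar> \<le> K" for k K
    by (rule strip_mult_integrable[OF W_meas W_L2 W_supp Pm(1) ab(1) Pb that])
  have \<gamma>_int: "integrable lborel (\<lambda>(x, t). \<gamma> x t * (P' x * k t))"
    if "k \<in> borel_measurable borel" "\<And>t. t \<in> {0<..<T} \<Longrightarrow> \<bar>k t\<bar> \<le> K" for k K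
    by (rule strip_mult_integrable[OF \<gamma>_meas \<gamma>_L2 \<gamma>_supp Pm(2) ab(1) Pb' that])
  define A where "A t = (LINT x|lborel. W x t * P x)" for t
  define Bt where "Bt t = (LINT x|lborel. \<gamma> x t * P' x)" for t
  have A_int: "integrable lborel A" and B_int: "integrable lborel Bt"
    using integral_snd_lborel(2)[OF W_int[of "\<lambda>_. 1" 1]] integral_snd_lborel(2)[OF \<gamma>_int[of "\<lambda>_. 1" 1]]
    unfolding A_def Bt_def by auto
  have B_supp: "Bt t = 0" if "t \<notin> {0<..<T}" for t
    using that \<gamma>_supp unfolding Bt_def strip_def by auto
  \<comment> \<open>For \<open>s \<le> T\<close> this is the integral of \<open>Bt\<close> up to
    time \<open>s\<close>; the indicator is kept in the form in which it occurs in the tail integral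
    of \<open>h\<close>.\<close>
  define E where "E s = (LINT t|lborel. Bt t * indicator {t<..T} s)" for s
  have K_int: "integrable lborel (\<lambda>(t, s). Bt t * (indicator {t<..T} s * h s))"
    if h: "continuous_on UNIV h" for h :: "real \<Rightarrow> real"
  proof -
    have hi: "integrable lborel (\<lambda>s. indicator {0..T} s * h s)"
      using borel_integrable_atLeastAtMost'[OF continuous_on_subset[OF h, of "{0..T}"]] unfolding set_integrable_def by simp
    have m: "(\<lambda>(t, s). Bt t * (indicator {t<..T} s * h s)) \<in> borel_measurable (borel \<Otimes>\<^sub>M borel)"
    proof -
      have [measurable]: "Bt \<in> borel_measurable borel" "h \<in> borel_measurable borel"
        using borel_measurable_integrable[OF B_int] h by (auto intro: borel_measurable_continuous_onI)
      have "(\<lambda>p. if fst p < snd p \<and> snd p \<le> T then Bt (fst p) * h (snd p) else 0) \<in> borel_measurable (borel \<Otimes>\<^sub>M borel)"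
        by measurable
      moreover have "(\<lambda>p. if fst p < snd p \<and> snd p \<le> T then Bt (fst p) * h (snd p) else 0)
          = (\<lambda>(t, s). Bt t * (indicator {t<..T} s * h s))" by (auto simp: fun_eq_iff indicator_def)
      ultimately show ?thesis by simp
    qed
    show ?thesis
    proof (rule Bochner_Integration.integrable_bound[OF integrable_times_lborel[OF B_int hi]])
      show "(\<lambda>(t, s). Bt t * (indicator {t<..T} s * h s)) \<in> borel_measurable lborel" using m by (simp add: borel_prod)
      show "AE z in lborel. norm (case z of (t, s) \<Rightarrow> Bt t * (indicator {t<..T} s * h s))
          \<le> norm (case z of (x, y) \<Rightarrow> Bt x * (indicator {0..T} y * h y))"
      proof (rule AE_I2)
        fix z :: "real \<times> real"
        obtain t s where e: "z = (t, s)" by (cases z)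
        show "norm (case z of (t, s) \<Rightarrow> Bt t * (indicator {t<..T} s * h s))
          \<le> norm (case z of (x, y) \<Rightarrow> Bt x * (indicator {0..T} y * h y))"
          using B_supp[of t] unfolding e by (cases "t \<in> {0<..<T}") (auto simp: indicator_def abs_mult)
      qed
    qed
  qed
  have E_int: "integrable lborel E"
    using integral_snd_lborel(2)[OF K_int[of "\<lambda>_. 1"]] unfolding E_def by simp
  \<comment> \<open>The fundamental lemma of the half-line is applied in the time variable.\<close>
  have key: "AE t in lborel. 0 < t \<longrightarrow> A t + E t = 0"
  proof (rule fundamental_lemma)
    have AE_int: "integrable lborel (\<lambda>t. A t + E t)" using A_int E_int by simp
    show "loc_integrable_halfline (\<lambda>t. A t + E t)"
      unfolding loc_integrable_halfline_def set_integrable_def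
      by (intro allI impI integrable_mult_indicator AE_int) (auto intro: borel_compact)
    fix \<theta> assume "C1c_halfline \<theta>"
    then obtain c d M where hc: "continuous_on UNIV (extend_zero \<theta>)" and hM: "\<And>x. \<bar>extend_zero \<theta> x\<bar> \<le> M * indicator {c..d} x"
      by (rule C1c_extend_zero) blast
    \<comment> \<open>\<open>identity\<close> asks for continuity on the whole line.\<close>
    define h where "h = extend_zero \<theta>"
    have hm: "h \<in> borel_measurable borel" unfolding h_def using hc by (rule borel_measurable_continuous_onI)
    have hb: "\<bar>h x\<bar> \<le> \<bar>M\<bar>" for x
      using hM[of x] unfolding h_def by (cases "x \<in> {c..d}") auto
    have hint: "integrable lborel (\<lambda>t. F t * h t)" if "integrable lborel F" for F :: "real \<Rightarrow> real"
    proof (rule Bochner_Integration.integrable_bound[OF integrable_mult_right[OF that, of "\<bar>M\<bar>"]])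
      show "(\<lambda>t. F t * h t) \<in> borel_measurable lborel" using borel_measurable_integrable[OF that] hm by measurable
      show "AE t in lborel. norm (F t * h t) \<le> norm (\<bar>M\<bar> * F t)"
      proof (rule AE_I2)
        fix t
        show "norm (F t * h t) \<le> norm (\<bar>M\<bar> * F t)"
          using mult_right_mono[OF hb[of t] abs_ge_zero[of "F t"]] by (simp add: abs_mult mult.commute)
      qed
    qed
    define \<Theta> where "\<Theta> t = (LINT s:{t<..T}|lborel. h s)" for t
    have \<Theta>_K: "Bt t * \<Theta> t = (LINT s|lborel. Bt t * (indicator {t<..T} s * h s))" for t
      unfolding \<Theta>_def set_lebesgue_integral_def by simp
    have \<Theta>m: "\<Theta> \<in> borel_measurable borel"
    proof -
      have "(\<lambda>p. if fst p < snd p \<and> snd p \<le> T then h (snd p) else 0) \<in> borel_measurable (borel \<Otimes>\<^sub>M borel)"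
        using hm by measurable
      moreover have "(\<lambda>p. if fst p < snd p \<and> snd p \<le> T then h (snd p) else 0)
          = (\<lambda>(t, s). indicator {t<..T} s *\<^sub>R h s)" by (auto simp: fun_eq_iff indicator_def)
      ultimately have "(\<lambda>(t, s). indicator {t<..T} s *\<^sub>R h s) \<in> borel_measurable (borel \<Otimes>\<^sub>M lborel)"
        using measurable_cong_sets[OF sets_pair_measure_cong[OF refl sets_lborel] refl] by auto
      then show ?thesis unfolding \<Theta>_def[abs_def] set_lebesgue_integral_def
        by (rule lborel.borel_measurable_lebesgue_integral)
    qed
    have \<Theta>b: "\<bar>\<Theta> t\<bar> \<le> T * \<bar>M\<bar>" if t: "t \<in> {0<..<T}" for t
    proof -
      have "\<bar>\<Theta> t\<bar> \<le> (LINT s|lborel. indicator {0..T} s * \<bar>M\<bar>)"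
        unfolding \<Theta>_def set_lebesgue_integral_def
      proof (rule order_trans[OF integral_abs_bound integral_mono'])
        show "integrable lborel (\<lambda>s. indicator {0..T} s * \<bar>M\<bar>)"
          by (intro integrable_mult_left integrable_indicator_bounded) auto
        show "\<bar>indicator {t<..T} s *\<^sub>R h s\<bar> \<le> indicator {0..T} s * \<bar>M\<bar>" for s
          using hb[of s] t by (auto simp: indicator_def)
      qed auto
      then show ?thesis using T_pos by simp
    qed
    have 1: "(LINT t|lborel. A t * h t) = - (LINT t|lborel. Bt t * \<Theta> t)"
    proof -
      have "(LINT t|lborel. A t * h t) = (LINT t|lborel. LINT x|lborel. W x t * (P x * h t))"
        unfolding A_def by (simp flip: mult.assoc)
      also have "\<dots> = (LINT (x, t)|lborel. W x t * (P x * h t))"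
        by (rule integral_snd_lborel(1)[OF W_int[OF hm hb]])
      also have "\<dots> = - (LINT (x, t)|lborel. \<gamma> x t * (P' x * \<Theta> t))"
        unfolding P_def P'_def \<Theta>_def using identity[OF C hc] unfolding h_def .
      also have "(LINT (x, t)|lborel. \<gamma> x t * (P' x * \<Theta> t)) = (LINT t|lborel. LINT x|lborel. \<gamma> x t * (P' x * \<Theta> t))"
        by (rule integral_snd_lborel(1)[OF \<gamma>_int[OF \<Theta>m \<Theta>b], symmetric])
      also have "\<dots> = (LINT t|lborel. Bt t * \<Theta> t)"
        unfolding Bt_def by (simp flip: mult.assoc)
      finally show ?thesis .
    qed
    have 2: "(LINT t|lborel. Bt t * \<Theta> t) = (LINT s|lborel. E s * h s)"
    proof -
      have hc': "continuous_on UNIV h" using hc unfolding h_def .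
      have "(LINT t|lborel. Bt t * \<Theta> t) = (LINT (t, s)|lborel. Bt t * (indicator {t<..T} s * h s))"
        unfolding \<Theta>_K by (rule integral_fst_lborel(1)[OF K_int[OF hc']])
      also have "\<dots> = (LINT s|lborel. LINT t|lborel. Bt t * (indicator {t<..T} s * h s))"
        by (rule integral_snd_lborel(1)[OF K_int[OF hc'], symmetric])
      also have "\<dots> = (LINT s|lborel. E s * h s)"
        unfolding E_def by (simp flip: mult.assoc)
      finally show ?thesis .
    qed
    have "(LINT t|lborel. (A t + E t) * h t) = 0"
      using 1 2 hint[OF A_int] hint[OF E_int] by (simp add: distrib_right)
    moreover have "(LINT t:{0<..}|lborel. (A t + E t) * \<theta> t) = (LINT t|lborel. (A t + E t) * h t)"
      unfolding set_lebesgue_integral_def h_def extend_zero_def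
      by (intro Bochner_Integration.integral_cong) auto
    ultimately show "(LINT t:{0<..}|lborel. (A t + E t) * \<theta> t) = 0" by simp
  qed
  have E_G: "E s = (LINT x|lborel. G x s * P' x)" if s: "s \<in> {0<..<T}" for s
  proof -
    have km: "(\<lambda>t. indicator {..<s} t :: real) \<in> borel_measurable borel" by measurable
    have kb: "\<bar>indicator {..<s} t :: real\<bar> \<le> 1" for t by simp
    have "E s = (LINT t|lborel. LINT x|lborel. \<gamma> x t * (P' x * indicator {..<s} t))"
      unfolding E_def Bt_def using s
      by (intro Bochner_Integration.integral_cong) (auto simp: indicator_def mult.assoc[symmetric])
    also have "\<dots> = (LINT (x, t)|lborel. \<gamma> x t * (P' x * indicator {..<s} t))"
      by (rule integral_snd_lborel(1)[OF \<gamma>_int[OF km kb]])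
    also have "\<dots> = (LINT x|lborel. LINT t|lborel. \<gamma> x t * (P' x * indicator {..<s} t))"
      by (rule integral_fst_lborel(1)[OF \<gamma>_int[OF km kb], symmetric])
    also have "\<dots> = (LINT x|lborel. G x s * P' x)"
    proof (rule Bochner_Integration.integral_cong[OF refl])
      fix x
      have "(LINT t|lborel. \<gamma> x t * (P' x * indicator {..<s} t)) = (LINT t|lborel. (indicator {0<..<s} t *\<^sub>R \<gamma> x t) * P' x)"
      proof (rule Bochner_Integration.integral_cong[OF refl])
        fix t
        show "\<gamma> x t * (P' x * indicator {..<s} t) = (indicator {0<..<s} t *\<^sub>R \<gamma> x t) * P' x"
          using \<gamma>_supp[of x t] by (cases "0 < t") (auto simp: indicator_def strip_def)
      qed
      also have "\<dots> = G x s * P' x" unfolding G_def set_lebesgue_integral_def by simp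
      finally show "(LINT t|lborel. \<gamma> x t * (P' x * indicator {..<s} t)) = G x s * P' x" .
    qed
    finally show ?thesis .
  qed
  show ?thesis
    using key
  proof eventually_elim
    case (elim t)
    show ?case
    proof
      assume t: "t \<in> {0<..<T}"
      then show "(LINT x|lborel. W x t * extend_zero \<psi> x) = - (LINT x|lborel. G x t * extend_zero (deriv \<psi>) x)"
        using elim E_G[OF t] unfolding A_def P_def P'_def by simp
    qed
  qed
qed

text \<open>The null set in \<open>slice_identity\<close> depends on \<open>\<psi>\<close>, whereas
  the approximating functions will be chosen after \<open>t\<close>. So one null set has to serve
  all \<open>\<psi>\<close>; it is the union over the countable family.\<close>

lemma slice_identity_all:
  "AE t in lborel. t \<in> {0<..<T} \<longrightarrow> (\<forall>\<psi>. C1c_halfline \<psi> \<longrightarrow> (LINT x|lborel. W x t * extend_zero \<psi> x)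
      = - (LINT x|lborel. G x t * extend_zero (deriv \<psi>) x))"
proof -
  have "AE t in lborel. \<forall>N j. 1 \<le> N \<longrightarrow> t \<in> {0<..<T} \<longrightarrow> (LINT x|lborel. W x t * (cutoff N x * x ^ j))
        = - (LINT x|lborel. G x t * (cutoff' N x * x ^ j + cutoff N x * (real j * x ^ (j - 1))))"
    unfolding AE_all_countable
  proof (intro allI)
    fix N j :: nat
    show "AE t in lborel. 1 \<le> N \<longrightarrow> t \<in> {0<..<T} \<longrightarrow> (LINT x|lborel. W x t * (cutoff N x * x ^ j))
        = - (LINT x|lborel. G x t * (cutoff' N x * x ^ j + cutoff N x * (real j * x ^ (j - 1))))"
    proof (cases "1 \<le> N")
      case True
      show ?thesis using slice_identity[OF cutoff_power(1)[OF True, of j]] True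
        unfolding cutoff_power(2,3)[OF True] by simp
    qed simp
  qed
  moreover have "AE t in lborel. integrable lborel (\<lambda>x. (W x t)\<^sup>2)" by (rule integral_snd_lborel(3)[OF W_L2])
  ultimately show ?thesis
  proof eventually_elim
    case (elim t)
    show ?case
    proof (intro impI allI)
      fix \<psi> assume t: "t \<in> {0<..<T}" and C: "C1c_halfline \<psi>"
      show "(LINT x|lborel. W x t * extend_zero \<psi> x) = - (LINT x|lborel. G x t * extend_zero (deriv \<psi>) x)"
        by (rule weak_identity_from_cutoff_powers[OF W_slice_meas G_slice_meas' elim(2) G_slice_L2[OF t] _ C])
           (use elim(1) t in blast)
    qed
  qed
qed

text \<open>The integral is that of \<open>\<gamma> x r * \<gamma> x t\<close> over the triangle
  \<open>r < t\<close>. By symmetry, the diagonal being null, it is half of the square of the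
  integral of \<open>\<gamma> x\<close>. No derivative of \<open>G\<close> in time is used.\<close>

lemma G_\<gamma>_nonneg: "AE x in lborel. 0 \<le> (LINT t|lborel. G x t * \<gamma> x t)"
  using \<gamma>_row
proof eventually_elim
  case (elim x)
  define g where "g = \<gamma> x"
  have g: "integrable lborel g" using elim unfolding g_def by simp
  have [measurable]: "g \<in> borel_measurable borel" using borel_measurable_integrable[OF g] by simp
  have gg: "integrable lborel (\<lambda>(r, t). g r * g t)" by (rule integrable_times_lborel[OF g g])
  define K where "K r t = (if r < t then g r * g t else 0)" for r t
  have K: "integrable lborel (\<lambda>(r, t). K r t)" "integrable lborel (\<lambda>(r, t). K t r)"
  proof -
    have "(\<lambda>(r, t). K r t) \<in> borel_measurable (borel \<Otimes>\<^sub>M borel)" "(\<lambda>(r, t). K t r) \<in> borel_measurable (borel \<Otimes>\<^sub>M borel)"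
      unfolding K_def case_prod_unfold by measurable
    then have m: "(\<lambda>(r, t). K r t) \<in> borel_measurable lborel" "(\<lambda>(r, t). K t r) \<in> borel_measurable lborel"
      by (simp_all add: borel_prod)
    show "integrable lborel (\<lambda>(r, t). K r t)"
      by (rule Bochner_Integration.integrable_bound[OF gg m(1)], rule AE_I2) (auto simp: K_def)
    show "integrable lborel (\<lambda>(r, t). K t r)"
      by (rule Bochner_Integration.integrable_bound[OF gg m(2)], rule AE_I2) (auto simp: K_def abs_mult mult.commute)
  qed
  have GK: "(LINT t|lborel. G x t * \<gamma> x t) = (LINT t|lborel. LINT r|lborel. K r t)"
  proof (rule Bochner_Integration.integral_cong[OF refl])
    fix t
    have "(LINT r|lborel. K r t) = (LINT r|lborel. (indicator {0<..<t} r *\<^sub>R \<gamma> x r) * g t)"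
    proof (rule Bochner_Integration.integral_cong[OF refl])
      fix r
      show "K r t = (indicator {0<..<t} r *\<^sub>R \<gamma> x r) * g t"
        using \<gamma>_supp[of x r] unfolding K_def g_def by (cases "0 < r") (auto simp: indicator_def strip_def)
    qed
    then show "G x t * \<gamma> x t = (LINT r|lborel. K r t)"
      unfolding G_def set_lebesgue_integral_def g_def by simp
  qed
  have "(LINT t|lborel. LINT r|lborel. K r t) = (LINT (r, t)|lborel. K r t)"
    by (rule integral_snd_lborel(1)[OF K(1)])
  moreover have "(LINT t|lborel. LINT r|lborel. K r t) = (LINT (r, t)|lborel. K t r)"
    using integral_fst_lborel(1)[OF K(2)] by simp
  moreover have "(LINT (r, t)|lborel. K r t) + (LINT (r, t)|lborel. K t r) = (LINT t|lborel. LINT r|lborel. K r t + K t r)"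
    using integral_snd_lborel(1)[of "\<lambda>r t. K r t + K t r"] K by (simp add: case_prod_unfold)
  moreover have "(LINT t|lborel. LINT r|lborel. K r t + K t r) = (LINT t|lborel. LINT r|lborel. g r * g t)"
  proof (rule Bochner_Integration.integral_cong[OF refl])
    fix t
    show "(LINT r|lborel. K r t + K t r) = (LINT r|lborel. g r * g t)"
    proof (rule integral_cong_AE)
      show "AE r in lborel. K r t + K t r = g r * g t"
        using AE_lborel_singleton[of t] by eventually_elim (auto simp: K_def)
    qed (auto simp: K_def)
  qed
  moreover have "(LINT t|lborel. LINT r|lborel. g r * g t) = (LINT r|lborel. g r)\<^sup>2"
    by (simp add: power2_eq_square)
  ultimately have "2 * (LINT t|lborel. G x t * \<gamma> x t) = (LINT r|lborel. g r)\<^sup>2" unfolding GK by linarith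
  then show ?case using zero_le_power2[of "LINT r|lborel. g r"] by linarith
qed

text \<open>For almost every \<open>t\<close> the identity for \<open>C1c_halfline\<close> functions
  passes to the limit along the approximations of \<open>z\<close>, whose derivatives tend to
  \<open>\<gamma>\<close> in the mean square. It then expresses the integral of \<open>W z\<close>
  as minus that of \<open>G \<gamma>\<close>, and Fubini brings in
  \<open>G_\<gamma>_nonneg\<close>.\<close>

theorem integral_mult_nonpos:
  fixes z :: "real \<Rightarrow> real \<Rightarrow> real"
  assumes zm: "(\<lambda>(x, t). z x t) \<in> borel_measurable borel"
    and z2: "integrable lborel (\<lambda>(x, t). (z x t)\<^sup>2)"
    and approx: "AE t in lborel. t \<in> {0<..<T} \<longrightarrow> (\<exists>\<psi>. (\<forall>n. C1c_halfline (\<psi> n)) \<and>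
       (\<lambda>n::nat. LINT x:{0<..}|lborel. (\<psi> n x - z x t)\<^sup>2 + (deriv (\<psi> n) x - \<gamma> x t)\<^sup>2) \<longlonglongrightarrow> 0)"
  shows "integrable lborel (\<lambda>(x, t). W x t * z x t)" "(LINT (x, t)|lborel. W x t * z x t) \<le> 0"
proof -
  show Wz: "integrable lborel (\<lambda>(x, t). W x t * z x t)"
  proof -
    have "integrable lborel (\<lambda>p. (case p of (x, t) \<Rightarrow> W x t) * (case p of (x, t) \<Rightarrow> z x t))"
      using W_meas zm W_L2 z2 by (intro L2_mult_integrable) (auto simp: case_prod_unfold)
    then show ?thesis by (simp add: case_prod_unfold)
  qed
  have G\<gamma>: "integrable lborel (\<lambda>(x, t). G x t * \<gamma> x t)"
  proof -
    have m: "(\<lambda>(x, t). indicator {0<..<T} t * G x t) \<in> borel_measurable borel"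
      using G_meas unfolding borel_prod[symmetric] case_prod_unfold by measurable
    have "integrable lborel (\<lambda>p. (case p of (x, t) \<Rightarrow> indicator {0<..<T} t * G x t) * (case p of (x, t) \<Rightarrow> \<gamma> x t))"
      using m \<gamma>_meas G_L2 \<gamma>_L2 by (intro L2_mult_integrable) (auto simp: case_prod_unfold)
    moreover have "(indicator {0<..<T} t * G x t) * \<gamma> x t = G x t * \<gamma> x t" for x t
      using \<gamma>_supp[of x t] by (cases "t \<in> {0<..<T}") (auto simp: strip_def)
    ultimately show ?thesis by (simp add: case_prod_unfold)
  qed
  have slice: "AE t in lborel. (LINT x|lborel. W x t * z x t) = - (LINT x|lborel. G x t * \<gamma> x t)"
    using approx slice_identity_all integral_snd_lborel(3)[OF W_L2] integral_snd_lborel(3)[OF z2]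
      integral_snd_lborel(3)[OF \<gamma>_L2]
  proof eventually_elim
    case (elim t)
    show ?case
    proof (cases "t \<in> {0<..<T}")
      case False
      then have "W x t = 0" "\<gamma> x t = 0" for x using W_supp[of x t] \<gamma>_supp[of x t] by (auto simp: strip_def)
      then show ?thesis by simp
    next
      case t: True
      obtain \<psi> where C: "\<And>n. C1c_halfline (\<psi> n)"
        and lim: "(\<lambda>n::nat. LINT x:{0<..}|lborel. (\<psi> n x - z x t)\<^sup>2 + (deriv (\<psi> n) x - \<gamma> x t)\<^sup>2) \<longlonglongrightarrow> 0"
        using elim(1) t by blast
      define P where "P n = extend_zero (\<psi> n)" for n
      define P' where "P' n = extend_zero (deriv (\<psi> n))" for n
      \<comment> \<open>The approximation concerns positive \<open>x\<close> only; restricting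
        \<open>z\<close> and \<open>\<gamma>\<close> accordingly changes the final integrals at most
        at \<open>x = 0\<close>.\<close>
      define Z where "Z x = indicator {0<..} x * z x t" for x
      define g where "g x = indicator {0<..} x * \<gamma> x t" for x
      have zsm: "(\<lambda>x. z x t) \<in> borel_measurable borel"
        using measurable_compose[OF _ zm, of "\<lambda>x. (x, t)" borel] by simp
      have m: "Z \<in> borel_measurable borel" "g \<in> borel_measurable borel"
        unfolding Z_def g_def using zsm \<gamma>_slice_meas'[of t] by measurable
      have ind_sq: "(indicator {0<..} x * c)\<^sup>2 = indicator {0<..} x *\<^sub>R c\<^sup>2" for x c :: real
        by (cases "0 < x") auto
      have Z2: "integrable lborel (\<lambda>x. (Z x)\<^sup>2)" "integrable lborel (\<lambda>x. (g x)\<^sup>2)"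
        using integrable_mult_indicator[OF _ elim(4), of "{0<..}"] integrable_mult_indicator[OF _ elim(5), of "{0<..}"]
        unfolding Z_def g_def ind_sq by auto
      have Pm: "P n \<in> borel_measurable borel" "P' n \<in> borel_measurable borel"
        and P2: "integrable lborel (\<lambda>x. (P n x)\<^sup>2)" "integrable lborel (\<lambda>x. (P' n x)\<^sup>2)" for n
      proof -
        obtain a b B where Ec: "continuous_on UNIV (P n)" "continuous_on UNIV (P' n)"
          and Eb: "\<And>x. \<bar>P n x\<bar> \<le> B * indicator {a..b} x" "\<And>x. \<bar>P' n x\<bar> \<le> B * indicator {a..b} x"
          unfolding P_def P'_def by (rule C1c_extend_zero[OF C[of n]]) blast
        show Pm: "P n \<in> borel_measurable borel" "P' n \<in> borel_measurable borel"
          using Ec by (auto intro: borel_measurable_continuous_onI)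
        show "integrable lborel (\<lambda>x. (P n x)\<^sup>2)" "integrable lborel (\<lambda>x. (P' n x)\<^sup>2)"
          by (rule bounded_support_square_integrable[OF Pm(1) Eb(1)] bounded_support_square_integrable[OF Pm(2) Eb(2)])+
      qed
      have D2: "integrable lborel (\<lambda>x. (P n x - Z x)\<^sup>2)" "integrable lborel (\<lambda>x. (P' n x - g x)\<^sup>2)" for n
        using L2_diff_integrable[of "P n" lborel Z] L2_diff_integrable[of "P' n" lborel g] Pm P2 m Z2 by auto
      have sum: "(LINT x|lborel. (P n x - Z x)\<^sup>2) + (LINT x|lborel. (P' n x - g x)\<^sup>2)
          = (LINT x:{0<..}|lborel. (\<psi> n x - z x t)\<^sup>2 + (deriv (\<psi> n) x - \<gamma> x t)\<^sup>2)" for n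
      proof -
        have "(LINT x|lborel. (P n x - Z x)\<^sup>2) + (LINT x|lborel. (P' n x - g x)\<^sup>2)
           = (LINT x|lborel. (P n x - Z x)\<^sup>2 + (P' n x - g x)\<^sup>2)" using D2 by simp
        also have "\<dots> = (LINT x:{0<..}|lborel. (\<psi> n x - z x t)\<^sup>2 + (deriv (\<psi> n) x - \<gamma> x t)\<^sup>2)"
          unfolding set_lebesgue_integral_def P_def P'_def Z_def g_def extend_zero_def
          by (intro Bochner_Integration.integral_cong) (auto simp: indicator_def)
        finally show ?thesis .
      qed
      have lim1: "(\<lambda>n. LINT x|lborel. (P n x - Z x)\<^sup>2) \<longlonglongrightarrow> 0" and lim2: "(\<lambda>n. LINT x|lborel. (P' n x - g x)\<^sup>2) \<longlonglongrightarrow> 0"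
      proof -
        have nn: "0 \<le> (LINT x|lborel. (P n x - Z x)\<^sup>2)" "0 \<le> (LINT x|lborel. (P' n x - g x)\<^sup>2)" for n
          by (rule Bochner_Integration.integral_nonneg; simp)+
        show "(\<lambda>n. LINT x|lborel. (P n x - Z x)\<^sup>2) \<longlonglongrightarrow> 0"
          by (rule tendsto_sandwich[OF _ _ tendsto_const lim[folded sum]]) (use nn in auto)
        show "(\<lambda>n. LINT x|lborel. (P' n x - g x)\<^sup>2) \<longlonglongrightarrow> 0"
          by (rule tendsto_sandwich[OF _ _ tendsto_const lim[folded sum]]) (use nn in auto)
      qed
      have w: "(\<lambda>n. LINT x|lborel. W x t * (P n x - Z x)) \<longlonglongrightarrow> 0"
        by (rule L2_tendsto_zero) (use W_slice_meas Pm m elim(3) D2 lim1 in auto)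
      have gg: "(\<lambda>n. LINT x|lborel. G x t * (P' n x - g x)) \<longlonglongrightarrow> 0"
        by (rule L2_tendsto_zero) (use G_slice_meas' Pm m G_slice_L2[OF t] D2 lim2 in auto)
      have "(LINT x|lborel. W x t * (P n x - Z x)) + (LINT x|lborel. G x t * (P' n x - g x))
          = - ((LINT x|lborel. W x t * Z x) + (LINT x|lborel. G x t * g x))" for n
      proof -
        have i: "integrable lborel (\<lambda>x. W x t * P n x)" "integrable lborel (\<lambda>x. W x t * Z x)"
          "integrable lborel (\<lambda>x. G x t * P' n x)" "integrable lborel (\<lambda>x. G x t * g x)"
          using W_slice_meas G_slice_meas' Pm m elim(3) P2 Z2 G_slice_L2[OF t] by (auto intro!: L2_mult_integrable)
        have "(LINT x|lborel. W x t * P n x) = - (LINT x|lborel. G x t * P' n x)"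
          using elim(2) t C unfolding P_def P'_def by blast
        then show ?thesis using i by (simp add: right_diff_distrib)
      qed
      then have "(\<lambda>n. - ((LINT x|lborel. W x t * Z x) + (LINT x|lborel. G x t * g x))) \<longlonglongrightarrow> 0 + 0"
        using tendsto_add[OF w gg] by simp
      then have "(LINT x|lborel. W x t * Z x) = - (LINT x|lborel. G x t * g x)"
        by (simp add: LIMSEQ_const_iff)
      moreover have "(LINT x|lborel. W x t * Z x) = (LINT x|lborel. W x t * z x t)"
      proof (rule integral_cong_AE)
        show "AE x in lborel. W x t * Z x = W x t * z x t"
          using AE_lborel_singleton[of 0]
          by eventually_elim (use W_supp[of _ t] in \<open>auto simp: Z_def indicator_def strip_def\<close>)
      qed (use W_slice_meas[of t] m zsm in auto)
      moreover have "(LINT x|lborel. G x t * g x) = (LINT x|lborel. G x t * \<gamma> x t)"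
      proof (rule integral_cong_AE)
        show "AE x in lborel. G x t * g x = G x t * \<gamma> x t"
          using AE_lborel_singleton[of 0]
          by eventually_elim (use \<gamma>_supp[of _ t] in \<open>auto simp: g_def indicator_def strip_def\<close>)
      qed (use G_slice_meas'[of t] m \<gamma>_slice_meas'[of t] in auto)
      ultimately show ?thesis by simp
    qed
  qed
  have "(LINT (x, t)|lborel. W x t * z x t) = (LINT t|lborel. LINT x|lborel. W x t * z x t)"
    by (rule integral_snd_lborel(1)[OF Wz, symmetric])
  also have "\<dots> = (LINT t|lborel. - (LINT x|lborel. G x t * \<gamma> x t))"
    by (rule integral_cong_AE)
       (use slice borel_measurable_integrable[OF integral_snd_lborel(2)[OF Wz]]
          borel_measurable_integrable[OF integral_snd_lborel(2)[OF G\<gamma>]] in auto)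
  also have "\<dots> = - (LINT (x, t)|lborel. G x t * \<gamma> x t)"
    using integral_snd_lborel(1)[OF G\<gamma>] by simp
  also have "(LINT (x, t)|lborel. G x t * \<gamma> x t) = (LINT x|lborel. LINT t|lborel. G x t * \<gamma> x t)"
    by (rule integral_fst_lborel(1)[OF G\<gamma>, symmetric])
  finally have "(LINT (x, t)|lborel. W x t * z x t) = - (LINT x|lborel. LINT t|lborel. G x t * \<gamma> x t)" .
  moreover have "0 \<le> (LINT x|lborel. LINT t|lborel. G x t * \<gamma> x t)"
    by (rule integral_nonneg_AE[OF G_\<gamma>_nonneg])
  ultimately show "(LINT (x, t)|lborel. W x t * z x t) \<le> 0" by simp
qed

end

section \<open>Product test functions and measurability of slices\<close>

lemma extend_zero_deriv:
  assumes C: "C1c_halfline \<psi>"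
  shows "(extend_zero \<psi> has_real_derivative extend_zero (deriv \<psi>) x) (at x)"
proof (cases "0 < x")
  case True
  have "(extend_zero \<psi> has_real_derivative deriv \<psi> x) (at x)"
    by (rule has_field_derivative_transform_within_open[OF C1c_halfline_deriv[OF C True], of "{0<..}"])
       (use True in \<open>auto simp: extend_zero_def\<close>)
  then show ?thesis using True by (simp add: extend_zero_def)
next
  case False
  obtain a b where a: "0 < a" and z: "\<And>x. 0 < x \<Longrightarrow> x \<notin> {a..b} \<Longrightarrow> \<psi> x = 0"
    by (rule C1c_halflineE[OF C]) blast
  have "(extend_zero \<psi> has_real_derivative 0) (at x)"
    by (rule has_field_derivative_transform_within_open[where S="{..<a}" and f="\<lambda>_. 0"])
       (use False a z in \<open>auto simp: extend_zero_def\<close>)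
  then show ?thesis using False by (simp add: extend_zero_def)
qed

lemma tail_integral_deriv:
  fixes h :: "real \<Rightarrow> real"
  assumes h: "continuous_on UNIV h" and t: "t \<in> {0..T}"
  shows "((\<lambda>t. LINT s:{t<..T}|lborel. h s) has_real_derivative - h t) (at t within {0..T})"
proof -
  have eq: "(LINT s:{r<..T}|lborel. h s) = integral {r..T} h" if "r \<in> {0..T}" for r
  proof -
    have "set_integrable lborel {r<..T} h"
      by (rule set_integrable_subset[OF borel_integrable_atLeastAtMost'[OF continuous_on_subset[OF h]], of r T]) auto
    then have "(LINT s:{r<..T}|lborel. h s) = integral {r<..T} h"
      by (rule set_borel_integral_eq_integral(2))
    also have "\<dots> = integral {r..T} h"
      by (rule integral_spike_set) (auto intro: negligible_subset[of "{r}"])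
    finally show ?thesis .
  qed
  show ?thesis
    by (rule DERIV_transform_on[OF t eq integral_has_real_derivative'[OF continuous_on_subset[OF h] t]]) auto
qed

text \<open>Integrating \<open>h\<close> from \<open>t\<close> to \<open>T\<close> builds in the
  condition at \<open>t = T\<close>, and the time derivative is minus an arbitrary continuous
  function.\<close>

lemma product_test_function:
  assumes T: "0 < T" and C: "C1c_halfline \<psi>" and h: "continuous_on UNIV h"
  shows "test_function T (\<lambda>x t. extend_zero \<psi> x * (LINT s:{t<..T}|lborel. h s))
     (\<lambda>x t. extend_zero (deriv \<psi>) x * (LINT s:{t<..T}|lborel. h s)) (\<lambda>x t. extend_zero \<psi> x * - h t)"
proof -
  define \<Theta> where "\<Theta> t = (LINT s:{t<..T}|lborel. h s)" for t
  have \<Theta>d: "(\<Theta> has_real_derivative - h t) (at t within {0..T})" if "t \<in> {0..T}" for t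
    using tail_integral_deriv[OF h that] unfolding \<Theta>_def[abs_def] .
  have \<Theta>c: "continuous_on {0..T} \<Theta>" by (rule DERIV_continuous_on[OF \<Theta>d])
  obtain a b B where ab: "0 < a" "a < b" and Ec: "continuous_on UNIV (extend_zero \<psi>)" "continuous_on UNIV (extend_zero (deriv \<psi>))"
    and Eb: "\<And>x. \<bar>extend_zero \<psi> x\<bar> \<le> B * indicator {a..b} x"
    by (rule C1c_extend_zero[OF C]) blast
  have Ez: "extend_zero \<psi> x = 0" if "b < x" for x using Eb[of x] that by simp
  show ?thesis
    unfolding test_function_def \<Theta>_def[symmetric]
  proof (intro conjI allI impI ballI)
    fix x t :: real assume t: "t \<in> {0..T}"
    show "((\<lambda>y. extend_zero \<psi> y * \<Theta> t) has_real_derivative extend_zero (deriv \<psi>) x * \<Theta> t) (at x within {0..})"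
      by (rule has_field_derivative_at_within, rule DERIV_cmult_right[OF extend_zero_deriv[OF C]])
    show "((\<lambda>s. extend_zero \<psi> x * \<Theta> s) has_real_derivative extend_zero \<psi> x * - h t) (at t within {0..T})"
      by (rule DERIV_cmult[OF \<Theta>d[OF t]])
  next
    show "continuous_on ({0..} \<times> {0..T}) (\<lambda>(x, t). extend_zero (deriv \<psi>) x * \<Theta> t)"
      "continuous_on ({0..} \<times> {0..T}) (\<lambda>(x, t). extend_zero \<psi> x * - h t)"
      unfolding case_prod_unfold
      by (intro continuous_intros continuous_on_compose2[OF Ec(1)] continuous_on_compose2[OF Ec(2)]
            continuous_on_compose2[OF \<Theta>c] continuous_on_compose2[OF h]; force)+
    show "\<exists>J>0. \<forall>x>J. \<forall>t\<in>{0..T}. extend_zero \<psi> x * \<Theta> t = 0"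
      using ab Ez by (intro exI[of _ b]) auto
  qed (auto simp: extend_zero_def \<Theta>_def set_lebesgue_integral_def)
qed

lemma AE_plane_from_slices:
  fixes F :: "real \<Rightarrow> real \<Rightarrow> real"
  assumes m: "(\<lambda>(x, t). F x t) \<in> borel_measurable borel"
    and ae: "AE t in lborel. AE x in lborel. F x t = 0"
  shows "AE (x, t) in lborel. F x t = 0"
proof -
  have m': "(\<lambda>p. F (fst p) (snd p)) \<in> borel_measurable (lborel \<Otimes>\<^sub>M lborel)"
    using m unfolding lborel_prod case_prod_unfold by simp
  have S: "{p \<in> space (lborel \<Otimes>\<^sub>M lborel). F (fst p) (snd p) = 0} \<in> sets (lborel \<Otimes>\<^sub>M lborel)"
    using measurable_sets[OF m', of "{0}"] by (simp add: vimage_def Int_def conj_commute)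
  have "AE x in lborel. AE t in lborel. F x t = 0"
    using lborel_pair.AE_commute[OF S] ae by simp
  then have "AE p in lborel \<Otimes>\<^sub>M lborel. F (fst p) (snd p) = 0"
    using lborel_pair.AE_pair_measure[OF S] by simp
  then show ?thesis unfolding lborel_prod by (simp add: case_prod_unfold)
qed

lemma strip_slice_measurable:
  assumes "(\<lambda>(x, t). indicator (strip T) (x, t) * F x t) \<in> borel_measurable borel" and t: "t \<in> {0<..<T}"
  shows "(\<lambda>x. indicator {0<..} x * F x t :: real) \<in> borel_measurable borel"
proof -
  have "(\<lambda>x. indicator (strip T) (x, t) * F x t) \<in> borel_measurable borel"
    using measurable_compose[OF _ assms(1), of "\<lambda>x. (x, t)" borel] by simp
  then have "(\<lambda>x. indicator {0<..} x * (indicator (strip T) (x, t) * F x t)) \<in> borel_measurable borel" by measurable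
  moreover have "indicator {0<..} x * (indicator (strip T) (x, t) * F x t) = indicator {0<..} x * F x t" for x
    using t by (auto simp: strip_def split: split_indicator)
  ultimately show ?thesis by simp
qed

text \<open>Integrability has to accompany convergence of the distances to 0, because a
  non-integrable function has Bochner integral 0.\<close>

lemma H1_distance_measurable:
  assumes C: "C1c_halfline \<psi>"
    and m: "(\<lambda>x. indicator {0<..} x * u x) \<in> borel_measurable borel" "(\<lambda>x. indicator {0<..} x * g x) \<in> borel_measurable borel"
  shows "(\<lambda>x. indicator {0<..} x *\<^sub>R ((\<psi> x - u x)\<^sup>2 + (deriv \<psi> x - g x)\<^sup>2) :: real) \<in> borel_measurable lborel"
    and "integrable lborel (\<lambda>x. (indicator {0<..} x * u x)\<^sup>2) \<Longrightarrow> integrable lborel (\<lambda>x. (indicator {0<..} x * g x)\<^sup>2) \<Longrightarrow>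
      set_integrable lborel {0<..} (\<lambda>x. (\<psi> x - u x)\<^sup>2 + (deriv \<psi> x - g x)\<^sup>2)"
proof -
  obtain a b B where Ec: "continuous_on UNIV (extend_zero \<psi>)" "continuous_on UNIV (extend_zero (deriv \<psi>))"
    and Eb: "\<And>x. \<bar>extend_zero \<psi> x\<bar> \<le> B * indicator {a..b} x" "\<And>x. \<bar>extend_zero (deriv \<psi>) x\<bar> \<le> B * indicator {a..b} x"
    by (rule C1c_extend_zero[OF C]) blast
  have Pm: "extend_zero \<psi> \<in> borel_measurable borel" "extend_zero (deriv \<psi>) \<in> borel_measurable borel"
    using Ec by (auto intro: borel_measurable_continuous_onI)
  have eq: "indicator {0<..} x *\<^sub>R ((\<psi> x - u x)\<^sup>2 + (deriv \<psi> x - g x)\<^sup>2)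
      = (extend_zero \<psi> x - indicator {0<..} x * u x)\<^sup>2 + (extend_zero (deriv \<psi>) x - indicator {0<..} x * g x)\<^sup>2" for x
    by (auto simp: extend_zero_def indicator_def)
  show "(\<lambda>x. indicator {0<..} x *\<^sub>R ((\<psi> x - u x)\<^sup>2 + (deriv \<psi> x - g x)\<^sup>2)) \<in> borel_measurable lborel"
    unfolding eq using m Pm by measurable
  assume i: "integrable lborel (\<lambda>x. (indicator {0<..} x * u x)\<^sup>2)" "integrable lborel (\<lambda>x. (indicator {0<..} x * g x)\<^sup>2)"
  show "set_integrable lborel {0<..} (\<lambda>x. (\<psi> x - u x)\<^sup>2 + (deriv \<psi> x - g x)\<^sup>2)"
    unfolding set_integrable_def eq
    using Pm m i bounded_support_square_integrable[OF Pm(1) Eb(1)] bounded_support_square_integrable[OF Pm(2) Eb(2)]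
    by (intro Bochner_Integration.integrable_add L2_diff_integrable) auto
qed

section \<open>Comparison of two weak solutions\<close>

context two_phase
begin

lemma D_strict_mono: "x < y \<Longrightarrow> D x < D y"
proof -
  have 1: "D x < D y" if "x < y" "0 \<le> x \<or> y \<le> 0" for x y
  proof (rule DERIV_pos_imp_increasing_open[OF that(1) _ D_cont])
    fix s assume "x < s" "s < y"
    then show "\<exists>d. (D has_real_derivative d) (at s) \<and> 0 < d"
      using D_deriv[of s] D'_pos[of s] that(2) by (intro exI[of _ "D' s"]) auto
  qed
  assume "x < y"
  then show "D x < D y" using 1[of x y] 1[of x 0] 1[of 0 y] by (cases "0 \<le> x \<or> y \<le> 0") auto
qed

text \<open>\<open>D'\<close> vanishes at \<open>0\<close>, so its minimum on all of [-K,K] is of no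
  use. To the left of \<open>- V / 2\<close> it has a positive minimum; to the right,
  \<open>D s - D (- V)\<close> exceeds a fixed positive number by monotonicity, while
  \<open>\<bar>s + V\<bar>\<close> is bounded.\<close>

lemma D_lower_bound:
  obtains c where "0 < c" "\<And>s. \<bar>s\<bar> \<le> K \<Longrightarrow> c * \<bar>s + V\<bar> \<le> \<bar>D s - D (- V)\<bar>"
proof -
  define S where "S = {min (- K) (- V)..- V/2}"
  have ne: "S \<noteq> {}" unfolding S_def using V_pos by auto
  obtain s0 where s0: "s0 \<in> S" "\<And>s. s \<in> S \<Longrightarrow> D' s0 \<le> D' s"
    using continuous_attains_inf[OF _ ne continuous_on_subset[OF D'_cont]] unfolding S_def by (metis compact_Icc subset_UNIV)
  define c1 where "c1 = D' s0"
  have "s0 \<le> - V/2" using s0(1) unfolding S_def by simp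
  then have c1: "0 < c1" unfolding c1_def using V_pos by (intro D'_pos) auto
  define m where "m = D (- V/2) - D (- V)"
  have m: "0 < m" unfolding m_def using D_strict_mono[of "- V" "- V/2"] V_pos by simp
  define M where "M = \<bar>K\<bar> + V + 1"
  have M: "0 < M" unfolding M_def using V_pos by simp
  define c where "c = min c1 (m / M)"
  have c: "0 < c" "c \<le> c1" "c \<le> m / M" unfolding c_def using c1 m M by auto
  have "c * \<bar>s + V\<bar> \<le> \<bar>D s - D (- V)\<bar>" if s: "\<bar>s\<bar> \<le> K" for s
  proof (cases "s \<le> - V/2")
    case True
    have inc: "c1 * (y - x) \<le> D y - D x" if xy: "x < y" "x \<in> S" "y \<in> S" for x y
    proof -
      obtain z where z: "x < z" "z < y" "D y - D x = (y - x) * D' z"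
        by (rule MVT_real[OF xy(1) D_cont D_deriv]) blast
      have "z \<in> S" using z xy unfolding S_def by auto
      then show ?thesis using s0(2)[of z] z xy unfolding c1_def by (simp add: mult.commute mult_left_mono)
    qed
    have sS: "s \<in> S" "- V \<in> S" using s True V_pos unfolding S_def by auto
    have "c1 * \<bar>s + V\<bar> \<le> \<bar>D s - D (- V)\<bar>"
    proof (cases s "- V" rule: linorder_cases)
      case less
      then show ?thesis using inc[of s "- V"] sS D_strict_mono[OF less] by (simp add: abs_if algebra_simps)
    next
      case greater
      then show ?thesis using inc[of "- V" s] sS D_strict_mono[OF greater] by (simp add: abs_if algebra_simps)
    qed simp
    then show ?thesis using mult_right_mono[OF c(2), of "\<bar>s + V\<bar>"] by linarith
  next
    case False
    have "\<bar>s + V\<bar> \<le> M" using s V_pos unfolding M_def by linarith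
    then have "c * \<bar>s + V\<bar> \<le> m / M * M"
      using c m M by (intro mult_mono) auto
    also have "\<dots> = m" using M by simp
    also have "\<dots> \<le> \<bar>D s - D (- V)\<bar>"
      using D_strict_mono[of "- V/2" s] False unfolding m_def by (simp add: abs_if)
    finally show ?thesis .
  qed
  then show ?thesis using that c(1) by blast
qed

text \<open>The definition of a weak solution quantifies over three gradients separately:
  \<open>g\<close> in the integral identity, \<open>\<gamma>\<close> in the Bochner space, and one
  for each slice in \<open>W12_0_halfline\<close>. Uniqueness of weak derivatives merges them almost
  everywhere: the slice gradient is \<open>\<gamma>\<close>, and \<open>g\<close> is
  \<open>\<gamma> + d\<close>.\<close>

lemma weak_solution_gradient:
  fixes v :: "real \<Rightarrow> real \<Rightarrow> real"
  assumes Dd: "diffusivity \<phi> \<epsilon> = D" and ws: "weak_solution \<phi> \<epsilon> T V what v"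
    and ed: "\<And>x. 0 < x \<Longrightarrow> ((\<lambda>x. D (what x)) has_real_derivative d x) (at x)"
    and dc: "continuous_on {0..} d"
  obtains \<gamma> where "(\<lambda>(x, t). indicator (strip T) (x, t) * \<gamma> x t) \<in> borel_measurable borel"
    "integrable lborel (\<lambda>(x, t). (indicator (strip T) (x, t) * \<gamma> x t)\<^sup>2)"
    "AE t in lborel. t \<in> {0<..<T} \<longrightarrow> (\<exists>\<psi>. (\<forall>n. C1c_halfline (\<psi> n)) \<and>
       (\<forall>n. set_integrable lborel {0<..} (\<lambda>x. (\<psi> n x - (D (v x t) - D (what x)))\<^sup>2 + (deriv (\<psi> n) x - \<gamma> x t)\<^sup>2)) \<and>
       (\<lambda>n::nat. LINT x:{0<..}|lborel. (\<psi> n x - (D (v x t) - D (what x)))\<^sup>2 + (deriv (\<psi> n) x - \<gamma> x t)\<^sup>2) \<longlonglongrightarrow> 0)"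
    "\<And>\<xi> \<xi>x \<xi>t. test_function T \<xi> \<xi>x \<xi>t \<Longrightarrow>
       (LINT x:{0<..}|lborel. (- V) * \<xi> x 0) + (LINT (x, t):strip T|lborel. v x t * \<xi>t x t)
       = (LINT (x, t):strip T|lborel. (\<gamma> x t + d x) * \<xi>x x t)"
proof -
  define u where "u x t = D (v x t) - D (what x)" for x t
  have L2u: "L2_W12_0 T u" using ws unfolding weak_solution_def Dd u_def by blast
  obtain g where g: "weak_dx T (\<lambda>x t. D (v x t)) g"
    and ident: "\<And>\<xi> \<xi>x \<xi>t. test_function T \<xi> \<xi>x \<xi>t \<Longrightarrow>
       (LINT x:{0<..}|lborel. (- V) * \<xi> x 0) + (LINT (x, t):strip T|lborel. v x t * \<xi>t x t)
       = (LINT (x, t):strip T|lborel. g x t * \<xi>x x t)"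
    using ws unfolding weak_solution_def Dd by blast
  obtain \<gamma> where \<gamma>: "weak_dx T u \<gamma>" "L2_on (strip T) (\<lambda>(x, t). \<gamma> x t)"
    using L2u unfolding L2_W12_0_def by blast
  have m: "(\<lambda>(x, t). indicator (strip T) (x, t) * \<gamma> x t) \<in> borel_measurable borel"
    using \<gamma>(1) unfolding weak_dx_def set_borel_measurable_def by (simp add: case_prod_unfold)
  have gm: "(\<lambda>(x, t). indicator (strip T) (x, t) * g x t) \<in> borel_measurable borel"
    using g unfolding weak_dx_def set_borel_measurable_def by (simp add: case_prod_unfold)
  have dm: "(\<lambda>(x, t). indicator (strip T) (x, t) * d x) \<in> borel_measurable borel"
  proof -
    have "continuous_on (strip T) (\<lambda>(x, t). d x)" unfolding case_prod_unfold
      by (rule continuous_on_compose2[OF dc]) (auto simp: strip_def intro!: continuous_intros)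
    from strip_measurable_continuous[OF this] show ?thesis
      unfolding set_borel_measurable_def by (simp add: case_prod_unfold)
  qed
  have sq: "(indicator A z * c)\<^sup>2 = indicator A z *\<^sub>R c\<^sup>2" for A and z :: "'z" and c :: real
    by (simp add: indicator_def)
  have i: "integrable lborel (\<lambda>(x, t). (indicator (strip T) (x, t) * \<gamma> x t)\<^sup>2)"
    using \<gamma>(2) unfolding L2_on_def set_integrable_def by (simp add: sq case_prod_unfold)
  have slice: "AE t in lborel. t \<in> {0<..<T} \<longrightarrow> (\<exists>\<psi>. (\<forall>n. C1c_halfline (\<psi> n)) \<and>
       (\<forall>n. set_integrable lborel {0<..} (\<lambda>x. (\<psi> n x - u x t)\<^sup>2 + (deriv (\<psi> n) x - \<gamma> x t)\<^sup>2)) \<and>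
       (\<lambda>n::nat. LINT x:{0<..}|lborel. (\<psi> n x - u x t)\<^sup>2 + (deriv (\<psi> n) x - \<gamma> x t)\<^sup>2) \<longlonglongrightarrow> 0)"
  proof -
    have 1: "AE t in lborel. t \<in> {0<..<T} \<longrightarrow> (\<lambda>x. u x t) \<in> W12_0_halfline"
      using L2u unfolding L2_W12_0_def by blast
    have 2: "AE t in lborel. t \<in> {0<..<T} \<longrightarrow> weak_deriv_halfline (\<lambda>x. u x t) (\<lambda>x. \<gamma> x t)"
      using \<gamma>(1) unfolding weak_dx_def by blast
    show ?thesis using 1 2
    proof eventually_elim
      case (elim t)
      show ?case
      proof
        assume t: "t \<in> {0<..<T}"
        then obtain gs \<psi> where L: "L2_on {0<..} (\<lambda>x. u x t)" "L2_on {0<..} gs"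
          and wd: "weak_deriv_halfline (\<lambda>x. u x t) gs" and C: "\<And>n. C1c_halfline (\<psi> n)"
          and lim: "(\<lambda>n::nat. LINT x:{0<..}|lborel. (\<psi> n x - u x t)\<^sup>2 + (deriv (\<psi> n) x - gs x)\<^sup>2) \<longlonglongrightarrow> 0"
          using elim(1) unfolding W12_0_halfline_def by blast
        have ae: "AE x in lborel. 0 < x \<longrightarrow> gs x = \<gamma> x t"
          by (rule weak_deriv_unique[OF wd]) (use elim(2) t in blast)
        have um: "(\<lambda>x. indicator {0<..} x * u x t) \<in> borel_measurable borel"
          and gsm: "(\<lambda>x. indicator {0<..} x * gs x) \<in> borel_measurable borel"
          and u2: "integrable lborel (\<lambda>x. (indicator {0<..} x * u x t)\<^sup>2)"
          and gs2: "integrable lborel (\<lambda>x. (indicator {0<..} x * gs x)\<^sup>2)"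
          using L unfolding L2_on_def set_borel_measurable_def set_integrable_def by (simp_all add: sq)
        have \<gamma>m: "(\<lambda>x. indicator {0<..} x * \<gamma> x t) \<in> borel_measurable borel"
          by (rule strip_slice_measurable[OF m t])
        have cong: "AE x in lborel. indicator {0<..} x *\<^sub>R ((\<psi> n x - u x t)\<^sup>2 + (deriv (\<psi> n) x - gs x)\<^sup>2)
            = indicator {0<..} x *\<^sub>R ((\<psi> n x - u x t)\<^sup>2 + (deriv (\<psi> n) x - \<gamma> x t)\<^sup>2)" for n
          using ae by eventually_elim (auto simp: indicator_def)
        have meas: "(\<lambda>x. indicator {0<..} x *\<^sub>R ((\<psi> n x - u x t)\<^sup>2 + (deriv (\<psi> n) x - gs x)\<^sup>2)) \<in> borel_measurable lborel"
          "(\<lambda>x. indicator {0<..} x *\<^sub>R ((\<psi> n x - u x t)\<^sup>2 + (deriv (\<psi> n) x - \<gamma> x t)\<^sup>2)) \<in> borel_measurable lborel" for n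
          by (rule H1_distance_measurable(1)[OF C um gsm] H1_distance_measurable(1)[OF C um \<gamma>m])+
        have "set_integrable lborel {0<..} (\<lambda>x. (\<psi> n x - u x t)\<^sup>2 + (deriv (\<psi> n) x - \<gamma> x t)\<^sup>2)" for n
          using H1_distance_measurable(2)[OF C um gsm u2 gs2, of n] integrable_cong_AE[OF meas cong]
          unfolding set_integrable_def by blast
        moreover have "(LINT x:{0<..}|lborel. (\<psi> n x - u x t)\<^sup>2 + (deriv (\<psi> n) x - gs x)\<^sup>2)
            = (LINT x:{0<..}|lborel. (\<psi> n x - u x t)\<^sup>2 + (deriv (\<psi> n) x - \<gamma> x t)\<^sup>2)" for n
          unfolding set_lebesgue_integral_def by (rule integral_cong_AE[OF meas cong])
        ultimately show "\<exists>\<psi>. (\<forall>n. C1c_halfline (\<psi> n)) \<and>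
          (\<forall>n. set_integrable lborel {0<..} (\<lambda>x. (\<psi> n x - u x t)\<^sup>2 + (deriv (\<psi> n) x - \<gamma> x t)\<^sup>2)) \<and>
          (\<lambda>n::nat. LINT x:{0<..}|lborel. (\<psi> n x - u x t)\<^sup>2 + (deriv (\<psi> n) x - \<gamma> x t)\<^sup>2) \<longlonglongrightarrow> 0"
          using C lim by (intro exI[of _ \<psi>]) simp
      qed
    qed
  qed
  have g_eq: "AE z in lborel. case z of (x, t) \<Rightarrow> indicator (strip T) (x, t) * (g x t - \<gamma> x t - d x) = 0"
  proof -
    have "AE (x, t) in lborel. indicator (strip T) (x, t) * (g x t - \<gamma> x t - d x) = 0"
    proof (rule AE_plane_from_slices)
      show "(\<lambda>(x, t). indicator (strip T) (x, t) * (g x t - \<gamma> x t - d x)) \<in> borel_measurable borel"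
      proof -
        have "(\<lambda>z. (case z of (x, t) \<Rightarrow> indicator (strip T) (x, t) * g x t) - (case z of (x, t) \<Rightarrow> indicator (strip T) (x, t) * \<gamma> x t)
            - (case z of (x, t) \<Rightarrow> indicator (strip T) (x, t) * d x)) \<in> borel_measurable borel"
          using gm m dm by measurable
        then show ?thesis by (simp add: case_prod_unfold right_diff_distrib)
      qed
      have 1: "AE t in lborel. t \<in> {0<..<T} \<longrightarrow> weak_deriv_halfline (\<lambda>x. D (v x t)) (\<lambda>x. g x t)"
        using g unfolding weak_dx_def by blast
      have 2: "AE t in lborel. t \<in> {0<..<T} \<longrightarrow> weak_deriv_halfline (\<lambda>x. u x t) (\<lambda>x. \<gamma> x t)"
        using \<gamma>(1) unfolding weak_dx_def by blast
      show "AE t in lborel. AE x in lborel. indicator (strip T) (x, t) * (g x t - \<gamma> x t - d x) = 0"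
        using 1 2
      proof eventually_elim
        case (elim t)
        show ?case
        proof (cases "t \<in> {0<..<T}")
          case True
          have wd: "weak_deriv_halfline (\<lambda>x. D (what x)) d"
            by (rule weak_derivative_C1[OF ed continuous_on_subset[OF dc]]) auto
          have "weak_deriv_halfline (\<lambda>x. u x t) (\<lambda>x. g x t - d x)"
            unfolding u_def by (rule weak_deriv_diff[OF _ wd]) (use elim(1) True in blast)
          then have "AE x in lborel. 0 < x \<longrightarrow> g x t - d x = \<gamma> x t"
            by (rule weak_deriv_unique) (use elim(2) True in blast)
          then show ?thesis using AE_lborel_singleton[of 0]
            by eventually_elim (auto simp: strip_def split: split_indicator)
        qed (simp add: indicator_strip)
      qed
    qed
    then show ?thesis by (simp add: case_prod_unfold)
  qed
  show ?thesis
  proof (rule that[OF m i])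
    show "AE t in lborel. t \<in> {0<..<T} \<longrightarrow> (\<exists>\<psi>. (\<forall>n. C1c_halfline (\<psi> n)) \<and>
       (\<forall>n. set_integrable lborel {0<..} (\<lambda>x. (\<psi> n x - (D (v x t) - D (what x)))\<^sup>2 + (deriv (\<psi> n) x - \<gamma> x t)\<^sup>2)) \<and>
       (\<lambda>n::nat. LINT x:{0<..}|lborel. (\<psi> n x - (D (v x t) - D (what x)))\<^sup>2 + (deriv (\<psi> n) x - \<gamma> x t)\<^sup>2) \<longlonglongrightarrow> 0)"
      using slice unfolding u_def .
    fix \<xi> \<xi>x \<xi>t assume tf: "test_function T \<xi> \<xi>x \<xi>t"
    have cx: "continuous_on (strip T) (\<lambda>(x, t). \<xi>x x t)"
      using tf unfolding test_function_def strip_def by (auto elim!: continuous_on_subset)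
    have xm: "(\<lambda>(x, t). indicator (strip T) (x, t) * \<xi>x x t) \<in> borel_measurable borel"
      using strip_measurable_continuous[OF cx] unfolding set_borel_measurable_def by (simp add: case_prod_unfold)
    have "(LINT (x, t):strip T|lborel. g x t * \<xi>x x t) = (LINT (x, t):strip T|lborel. (\<gamma> x t + d x) * \<xi>x x t)"
      unfolding set_lebesgue_integral_def
    proof (rule integral_cong_AE)
      have e1: "indicator (strip T) z *\<^sub>R (case z of (x, t) \<Rightarrow> g x t * \<xi>x x t)
          = (case z of (x, t) \<Rightarrow> indicator (strip T) (x, t) * g x t) * (case z of (x, t) \<Rightarrow> indicator (strip T) (x, t) * \<xi>x x t)" for z
        by (cases z) (simp add: indicator_def)
      have e2: "indicator (strip T) z *\<^sub>R (case z of (x, t) \<Rightarrow> (\<gamma> x t + d x) * \<xi>x x t)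
          = ((case z of (x, t) \<Rightarrow> indicator (strip T) (x, t) * \<gamma> x t) + (case z of (x, t) \<Rightarrow> indicator (strip T) (x, t) * d x))
            * (case z of (x, t) \<Rightarrow> indicator (strip T) (x, t) * \<xi>x x t)" for z
        by (cases z) (simp add: indicator_def)
      show "(\<lambda>z. indicator (strip T) z *\<^sub>R (case z of (x, t) \<Rightarrow> g x t * \<xi>x x t)) \<in> borel_measurable lborel"
        unfolding e1 using gm xm by measurable
      show "(\<lambda>z. indicator (strip T) z *\<^sub>R (case z of (x, t) \<Rightarrow> (\<gamma> x t + d x) * \<xi>x x t)) \<in> borel_measurable lborel"
        unfolding e2 using m dm xm by measurable
      show "AE z in lborel. indicator (strip T) z *\<^sub>R (case z of (x, t) \<Rightarrow> g x t * \<xi>x x t)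
          = indicator (strip T) z *\<^sub>R (case z of (x, t) \<Rightarrow> (\<gamma> x t + d x) * \<xi>x x t)"
        using g_eq
      proof eventually_elim
        case (elim z)
        obtain x t where e: "z = (x, t)" by (cases z)
        show ?case using elim unfolding e by (cases "(x, t) \<in> strip T") auto
      qed
    qed
    then show "(LINT x:{0<..}|lborel. (- V) * \<xi> x 0) + (LINT (x, t):strip T|lborel. v x t * \<xi>t x t)
       = (LINT (x, t):strip T|lborel. (\<gamma> x t + d x) * \<xi>x x t)" using ident[OF tf] by simp
  qed
qed

end

text \<open>The counterpart of \<open>strip_mult_integrable\<close> for factors that are bounded on
  the relevant part of the strip, such as a weak solution itself or the function
  \<open>d\<close>.\<close>

lemma strip_bounded_mult_integrable:
  fixes F :: "real \<Rightarrow> real \<Rightarrow> real"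
  assumes Fm: "(\<lambda>(x, t). indicator (strip T) (x, t) * F x t) \<in> borel_measurable borel"
    and Fb: "AE (x, t) in lborel. (x, t) \<in> strip T \<longrightarrow> x \<le> b \<longrightarrow> \<bar>F x t\<bar> \<le> K"
    and p: "p \<in> borel_measurable borel" "0 < a" "\<And>x. \<bar>p x\<bar> \<le> C * indicator {a..b} x"
    and k: "k \<in> borel_measurable borel" "\<And>t. t \<in> {0<..<T} \<Longrightarrow> \<bar>k t\<bar> \<le> H"
  shows "set_integrable lborel (strip T) (\<lambda>(x, t). F x t * (p x * k t))"
  unfolding set_integrable_def
proof (rule Bochner_Integration.integrable_bound[OF integrable_mult_right[OF integrable_on_strip_box[of b T], of "\<bar>K\<bar> * (\<bar>C\<bar> * \<bar>H\<bar>)"]])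
  have m: "(\<lambda>z. p (fst z) * k (snd z)) \<in> borel_measurable borel"
    using p(1) k(1) unfolding borel_prod[symmetric] by measurable
  have "(\<lambda>z. (case z of (x, t) \<Rightarrow> indicator (strip T) (x, t) * F x t) * (p (fst z) * k (snd z))) \<in> borel_measurable borel"
    using Fm m by measurable
  then show "(\<lambda>z. indicator (strip T) z *\<^sub>R (case z of (x, t) \<Rightarrow> F x t * (p x * k t))) \<in> borel_measurable lborel"
    by (simp add: case_prod_unfold mult.assoc)
  show "AE z in lborel. norm (indicator (strip T) z *\<^sub>R (case z of (x, t) \<Rightarrow> F x t * (p x * k t)))
      \<le> norm (\<bar>K\<bar> * (\<bar>C\<bar> * \<bar>H\<bar>) * (case z of (x, t) \<Rightarrow> indicator {0..b} x * indicator {0<..<T} t))"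
    using Fb
  proof eventually_elim
    case (elim z)
    obtain x t where e: "z = (x, t)" by (cases z)
    show ?case
    proof (cases "(x, t) \<in> strip T \<and> x \<in> {a..b}")
      case True
      then have st: "(x, t) \<in> strip T" and xt: "x \<in> {a..b}" "x \<in> {0..b}" "t \<in> {0<..<T}" using p(2) by (auto simp: strip_def)
      have "\<bar>F x t\<bar> \<le> \<bar>K\<bar>" using elim st xt e by auto
      moreover have "\<bar>p x\<bar> \<le> \<bar>C\<bar>" using p(3)[of x] xt by simp
      moreover have "\<bar>k t\<bar> \<le> \<bar>H\<bar>" using k(2)[OF xt(3)] by simp
      ultimately have "\<bar>F x t\<bar> * (\<bar>p x\<bar> * \<bar>k t\<bar>) \<le> \<bar>K\<bar> * (\<bar>C\<bar> * \<bar>H\<bar>)" by (intro mult_mono) auto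
      then show ?thesis using st xt unfolding e by (simp add: abs_mult)
    next
      case False
      then have "(x, t) \<notin> strip T \<or> p x = 0" using p(3)[of x] by auto
      then show ?thesis unfolding e by auto
    qed
  qed
qed

context two_phase
begin

text \<open>For \<open>x > 1\<close> the function \<open>what\<close> equals \<open>- V\<close>, and
  \<open>D_lower_bound\<close> controls \<open>v + V\<close> by \<open>D (v) - D (what)\<close>,
  which is square integrable by definition of a weak solution. The part \<open>x \<le> 1\<close> of
  the strip has finite measure, and \<open>v\<close> is bounded.\<close>

lemma weak_solution_L2:
  fixes v :: "real \<Rightarrow> real \<Rightarrow> real"
  assumes Dd: "diffusivity \<phi> \<epsilon> = D" and ws: "weak_solution \<phi> \<epsilon> T V what v"
    and w1: "\<And>x. 1 < x \<Longrightarrow> what x = - V"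
  obtains K where "(\<lambda>(x, t). indicator (strip T) (x, t) * v x t) \<in> borel_measurable borel"
    "AE (x, t) in lborel. (x, t) \<in> strip T \<longrightarrow> \<bar>v x t\<bar> \<le> K"
    "integrable lborel (\<lambda>(x, t). (indicator (strip T) (x, t) * (v x t + V))\<^sup>2)"
    "(\<lambda>(x, t). indicator (strip T) (x, t) * (D (v x t) - D (what x))) \<in> borel_measurable borel"
    "integrable lborel (\<lambda>(x, t). (indicator (strip T) (x, t) * (D (v x t) - D (what x)))\<^sup>2)"
proof -
  have sq: "(indicator A z * c)\<^sup>2 = indicator A z *\<^sub>R c\<^sup>2" for A and z :: "'z" and c :: real
    by (simp add: indicator_def)
  have "Linf_on (strip T) (\<lambda>(x, t). v x t)" using ws unfolding weak_solution_def by blast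
  then obtain K where vm: "(\<lambda>(x, t). indicator (strip T) (x, t) * v x t) \<in> borel_measurable borel"
    and K: "AE (x, t) in lborel. (x, t) \<in> strip T \<longrightarrow> \<bar>v x t\<bar> \<le> K"
    unfolding Linf_on_def set_borel_measurable_def by (auto simp: case_prod_unfold)
  have "L2_on (strip T) (\<lambda>(x, t). D (v x t) - D (what x))"
    using ws unfolding weak_solution_def L2_W12_0_def Dd by blast
  then have um: "(\<lambda>(x, t). indicator (strip T) (x, t) * (D (v x t) - D (what x))) \<in> borel_measurable borel"
    and ui: "integrable lborel (\<lambda>(x, t). (indicator (strip T) (x, t) * (D (v x t) - D (what x)))\<^sup>2)"
    unfolding L2_on_def set_borel_measurable_def set_integrable_def by (simp_all add: sq case_prod_unfold)
  obtain c where c: "0 < c" "\<And>s. \<bar>s\<bar> \<le> K \<Longrightarrow> c * \<bar>s + V\<bar> \<le> \<bar>D s - D (- V)\<bar>"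
    by (rule D_lower_bound[of K]) blast
  have "integrable lborel (\<lambda>(x, t). (indicator (strip T) (x, t) * (v x t + V))\<^sup>2)"
  proof (rule Bochner_Integration.integrable_bound)
    let ?w = "\<lambda>z. 1 / c\<^sup>2 * (case z of (x, t) \<Rightarrow> (indicator (strip T) (x, t) * (D (v x t) - D (what x)))\<^sup>2)
       + (\<bar>K\<bar> + V)\<^sup>2 * (case z of (x :: real, t :: real) \<Rightarrow> indicator {0..1} x * indicator {0<..<T} t)"
    show "integrable lborel ?w"
      by (intro Bochner_Integration.integrable_add integrable_mult_right ui integrable_on_strip_box)
    have "(\<lambda>z. ((case z of (x, t) \<Rightarrow> indicator (strip T) (x, t) * v x t) + indicator (strip T) z * V)\<^sup>2) \<in> borel_measurable borel"
      using vm by measurable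
    then show "(\<lambda>(x, t). (indicator (strip T) (x, t) * (v x t + V))\<^sup>2) \<in> borel_measurable lborel"
      by (simp add: case_prod_unfold distrib_left)
    show "AE z in lborel. norm (case z of (x, t) \<Rightarrow> (indicator (strip T) (x, t) * (v x t + V))\<^sup>2) \<le> norm (?w z)"
      using K
    proof eventually_elim
      case (elim z)
      obtain x t where e: "z = (x, t)" by (cases z)
      have w0: "0 \<le> ?w z" by (auto simp: case_prod_unfold intro!: add_nonneg_nonneg mult_nonneg_nonneg)
      have "(case z of (x, t) \<Rightarrow> (indicator (strip T) (x, t) * (v x t + V))\<^sup>2) \<le> ?w z"
      proof (cases "(x, t) \<in> strip T")
        case True
        then have vK: "\<bar>v x t\<bar> \<le> K" and xt: "0 \<le> x" "t \<in> {0<..<T}" using elim e by (auto simp: strip_def)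
        show ?thesis
        proof (cases "1 < x")
          case x1: True
          have "(c * \<bar>v x t + V\<bar>)\<^sup>2 \<le> \<bar>D (v x t) - D (- V)\<bar>\<^sup>2"
            by (rule power_mono[OF c(2)[OF vK]]) (use c in simp)
          then have "(v x t + V)\<^sup>2 \<le> 1 / c\<^sup>2 * (D (v x t) - D (what x))\<^sup>2"
            using c(1) w1[OF x1] by (simp add: power_mult_distrib field_simps)
          then show ?thesis using True x1 unfolding e by simp
        next
          case False
          have "\<bar>v x t + V\<bar> \<le> \<bar>K\<bar> + V" using vK V_pos by linarith
          from power_mono[OF this abs_ge_zero, of 2] have "(v x t + V)\<^sup>2 \<le> (\<bar>K\<bar> + V)\<^sup>2" by simp
          moreover have "0 \<le> 1 / c\<^sup>2 * (D (v x t) - D (what x))\<^sup>2" by simp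
          ultimately have "(v x t + V)\<^sup>2 \<le> 1 / c\<^sup>2 * (D (v x t) - D (what x))\<^sup>2 + (\<bar>K\<bar> + V)\<^sup>2" by linarith
          then show ?thesis using True False xt unfolding e by simp
        qed
      qed (use w0 e in simp)
      then show ?case using w0 by (simp add: case_prod_unfold)
    qed
  qed
  then show ?thesis using that vm K um ui by blast
qed

text \<open>In the difference of the two identities the initial term and the contribution of
  \<open>d\<close> cancel, which gives \<open>W\<^sub>t = \<gamma>\<^sub>x\<close> in the form of
  \<open>integrated_gradient\<close>. As \<open>D\<close> is strictly increasing, \<open>W z\<close>
  is nonnegative and vanishes only where the solutions agree, while its integral is at most
  0.\<close>

theorem weak_solution_unique:
  fixes v w :: "real \<Rightarrow> real \<Rightarrow> real"
  assumes T: "0 < T" and Dd: "diffusivity \<phi> \<epsilon> = D"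
    and ws: "weak_solution \<phi> \<epsilon> T V what v" "weak_solution \<phi> \<epsilon> T V what w"
    and w1: "\<And>x. 1 < x \<Longrightarrow> what x = - V"
    and ed: "\<And>x. 0 < x \<Longrightarrow> ((\<lambda>x. D (what x)) has_real_derivative d x) (at x)"
    and dc: "continuous_on {0..} d"
  shows "AE (x, t) in lborel. (x, t) \<in> strip T \<longrightarrow> v x t = w x t"
proof -
  let ?I = "\<lambda>x t. indicator (strip T) (x, t) :: real"
  obtain K1 where v: "(\<lambda>(x, t). ?I x t * v x t) \<in> borel_measurable borel"
    "AE (x, t) in lborel. (x, t) \<in> strip T \<longrightarrow> \<bar>v x t\<bar> \<le> K1"
    "integrable lborel (\<lambda>(x, t). (?I x t * (v x t + V))\<^sup>2)"
    "(\<lambda>(x, t). ?I x t * (D (v x t) - D (what x))) \<in> borel_measurable borel"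
    "integrable lborel (\<lambda>(x, t). (?I x t * (D (v x t) - D (what x)))\<^sup>2)"
    by (rule weak_solution_L2[OF Dd ws(1) w1]) blast
  obtain K2 where w: "(\<lambda>(x, t). ?I x t * w x t) \<in> borel_measurable borel"
    "AE (x, t) in lborel. (x, t) \<in> strip T \<longrightarrow> \<bar>w x t\<bar> \<le> K2"
    "integrable lborel (\<lambda>(x, t). (?I x t * (w x t + V))\<^sup>2)"
    "(\<lambda>(x, t). ?I x t * (D (w x t) - D (what x))) \<in> borel_measurable borel"
    "integrable lborel (\<lambda>(x, t). (?I x t * (D (w x t) - D (what x)))\<^sup>2)"
    by (rule weak_solution_L2[OF Dd ws(2) w1]) blast
  obtain g1 where g1: "(\<lambda>(x, t). ?I x t * g1 x t) \<in> borel_measurable borel"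
    "integrable lborel (\<lambda>(x, t). (?I x t * g1 x t)\<^sup>2)"
    "AE t in lborel. t \<in> {0<..<T} \<longrightarrow> (\<exists>\<psi>. (\<forall>n. C1c_halfline (\<psi> n)) \<and>
       (\<forall>n. set_integrable lborel {0<..} (\<lambda>x. (\<psi> n x - (D (v x t) - D (what x)))\<^sup>2 + (deriv (\<psi> n) x - g1 x t)\<^sup>2)) \<and>
       (\<lambda>n::nat. LINT x:{0<..}|lborel. (\<psi> n x - (D (v x t) - D (what x)))\<^sup>2 + (deriv (\<psi> n) x - g1 x t)\<^sup>2) \<longlonglongrightarrow> 0)"
    and id1: "\<And>\<xi> \<xi>x \<xi>t. test_function T \<xi> \<xi>x \<xi>t \<Longrightarrow>
       (LINT x:{0<..}|lborel. (- V) * \<xi> x 0) + (LINT (x, t):strip T|lborel. v x t * \<xi>t x t)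
       = (LINT (x, t):strip T|lborel. (g1 x t + d x) * \<xi>x x t)"
    by (rule weak_solution_gradient[OF Dd ws(1) _ dc]) (erule ed, rule that)
  obtain g2 where g2: "(\<lambda>(x, t). ?I x t * g2 x t) \<in> borel_measurable borel"
    "integrable lborel (\<lambda>(x, t). (?I x t * g2 x t)\<^sup>2)"
    "AE t in lborel. t \<in> {0<..<T} \<longrightarrow> (\<exists>\<psi>. (\<forall>n. C1c_halfline (\<psi> n)) \<and>
       (\<forall>n. set_integrable lborel {0<..} (\<lambda>x. (\<psi> n x - (D (w x t) - D (what x)))\<^sup>2 + (deriv (\<psi> n) x - g2 x t)\<^sup>2)) \<and>
       (\<lambda>n::nat. LINT x:{0<..}|lborel. (\<psi> n x - (D (w x t) - D (what x)))\<^sup>2 + (deriv (\<psi> n) x - g2 x t)\<^sup>2) \<longlonglongrightarrow> 0)"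
    and id2: "\<And>\<xi> \<xi>x \<xi>t. test_function T \<xi> \<xi>x \<xi>t \<Longrightarrow>
       (LINT x:{0<..}|lborel. (- V) * \<xi> x 0) + (LINT (x, t):strip T|lborel. w x t * \<xi>t x t)
       = (LINT (x, t):strip T|lborel. (g2 x t + d x) * \<xi>x x t)"
    by (rule weak_solution_gradient[OF Dd ws(2) _ dc]) (erule ed, rule that)
  define W where "W x t = ?I x t * (v x t - w x t)" for x t
  define \<gamma> where "\<gamma> x t = ?I x t * (g1 x t - g2 x t)" for x t
  define z where "z x t = ?I x t * (D (v x t) - D (w x t))" for x t
  have diff: "(\<lambda>(x, t). ?I x t * (F x t - G x t)) \<in> borel_measurable borel"
    if "(\<lambda>(x, t). ?I x t * F x t) \<in> borel_measurable borel" "(\<lambda>(x, t). ?I x t * G x t) \<in> borel_measurable borel"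
    for F G :: "real \<Rightarrow> real \<Rightarrow> real"
    using borel_measurable_diff[OF that] by (simp add: case_prod_unfold right_diff_distrib)
  have diff2: "integrable lborel (\<lambda>(x, t). (?I x t * (F x t - G x t))\<^sup>2)"
    if "(\<lambda>(x, t). ?I x t * F x t) \<in> borel_measurable borel" "(\<lambda>(x, t). ?I x t * G x t) \<in> borel_measurable borel"
      "integrable lborel (\<lambda>(x, t). (?I x t * F x t)\<^sup>2)" "integrable lborel (\<lambda>(x, t). (?I x t * G x t)\<^sup>2)"
    for F G :: "real \<Rightarrow> real \<Rightarrow> real"
    using L2_diff_integrable[of "\<lambda>(x, t). ?I x t * F x t" lborel "\<lambda>(x, t). ?I x t * G x t"] that
    by (simp add: case_prod_unfold right_diff_distrib)
  have addV: "(\<lambda>(x, t). ?I x t * (F x t + V)) \<in> borel_measurable borel"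
    if "(\<lambda>(x, t). ?I x t * F x t) \<in> borel_measurable borel" for F :: "real \<Rightarrow> real \<Rightarrow> real"
  proof -
    have "(\<lambda>p. (case p of (x, t) \<Rightarrow> ?I x t * F x t) + indicator (strip T) p * V) \<in> borel_measurable borel"
      using that by measurable
    then show ?thesis by (simp add: case_prod_unfold distrib_left)
  qed
  have Wm: "(\<lambda>(x, t). W x t) \<in> borel_measurable borel" unfolding W_def by (rule diff[OF v(1) w(1)])
  have W2: "integrable lborel (\<lambda>(x, t). (W x t)\<^sup>2)"
    using diff2[OF addV[OF v(1)] addV[OF w(1)] v(3) w(3)] unfolding W_def by simp
  have \<gamma>m: "(\<lambda>(x, t). \<gamma> x t) \<in> borel_measurable borel" unfolding \<gamma>_def by (rule diff[OF g1(1) g2(1)])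
  have \<gamma>2: "integrable lborel (\<lambda>(x, t). (\<gamma> x t)\<^sup>2)" unfolding \<gamma>_def by (rule diff2[OF g1(1) g2(1) g1(2) g2(2)])
  \<comment> \<open>Square integrability is known only for the differences from
    \<open>D (what)\<close>.\<close>
  have z_alt: "z x t = ?I x t * ((D (v x t) - D (what x)) - (D (w x t) - D (what x)))" for x t
    unfolding z_def by simp
  have zm: "(\<lambda>(x, t). z x t) \<in> borel_measurable borel" unfolding z_alt by (rule diff[OF v(4) w(4)])
  have z2: "integrable lborel (\<lambda>(x, t). (z x t)\<^sup>2)" unfolding z_alt by (rule diff2[OF v(4) w(4) v(5) w(5)])
  interpret integrated_gradient T W \<gamma>
  proof
    show "W x t = 0" "\<gamma> x t = 0" if "(x, t) \<notin> strip T" for x t using that unfolding W_def \<gamma>_def by auto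
    fix \<psi> h :: "real \<Rightarrow> real"
    assume C: "C1c_halfline \<psi>" and h: "continuous_on UNIV h"
    define \<Theta> where "\<Theta> t = (LINT s:{t<..T}|lborel. h s)" for t
    obtain a b B where ab: "0 < a" "a < b" and Ec: "continuous_on UNIV (extend_zero \<psi>)" "continuous_on UNIV (extend_zero (deriv \<psi>))"
      and Eb: "\<And>x. \<bar>extend_zero \<psi> x\<bar> \<le> B * indicator {a..b} x" "\<And>x. \<bar>extend_zero (deriv \<psi>) x\<bar> \<le> B * indicator {a..b} x"
      by (rule C1c_extend_zero[OF C]) blast
    have Pm: "extend_zero \<psi> \<in> borel_measurable borel" "extend_zero (deriv \<psi>) \<in> borel_measurable borel"
      using Ec by (auto intro: borel_measurable_continuous_onI)
    have bdd: "\<exists>H. \<forall>t\<in>{0..c}. \<bar>F t\<bar> \<le> H" if "continuous_on {0..c} F" for F :: "real \<Rightarrow> real" and c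
    proof -
      have "bounded (F ` {0..c})" by (intro compact_imp_bounded compact_continuous_image that) auto
      then show ?thesis unfolding bounded_iff by auto
    qed
    obtain H where H: "\<And>t. t \<in> {0..T} \<Longrightarrow> \<bar>h t\<bar> \<le> H" using bdd[OF continuous_on_subset[OF h]] by blast
    have hm: "h \<in> borel_measurable borel" using h by (rule borel_measurable_continuous_onI)
    have \<Theta>c: "continuous_on {0..T} \<Theta>"
      unfolding \<Theta>_def by (rule DERIV_continuous_on[OF tail_integral_deriv[OF h]])
    obtain H' where H': "\<And>t. t \<in> {0..T} \<Longrightarrow> \<bar>\<Theta> t\<bar> \<le> H'" using bdd[OF \<Theta>c] by blast
    \<comment> \<open>Cutting off outside the time interval makes measurability on the whole line a
      consequence of continuity on \<open>{0..T}\<close>.\<close>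
    define \<Theta>' where "\<Theta>' t = indicator {0..T} t * \<Theta> t" for t
    have \<Theta>m: "\<Theta>' \<in> borel_measurable borel"
      using borel_measurable_continuous_on_indicator[OF _ \<Theta>c] unfolding \<Theta>'_def by simp
    have \<Theta>b: "\<bar>\<Theta>' t\<bar> \<le> H'" if "t \<in> {0<..<T}" for t using H'[of t] that unfolding \<Theta>'_def by simp
    have "continuous_on {0..b} d" by (rule continuous_on_subset[OF dc]) auto
    from bdd[OF this] obtain Hd where Hd: "\<And>x. x \<in> {0..b} \<Longrightarrow> \<bar>d x\<bar> \<le> Hd" by blast
    have tf: "test_function T (\<lambda>x t. extend_zero \<psi> x * \<Theta> t) (\<lambda>x t. extend_zero (deriv \<psi>) x * \<Theta> t) (\<lambda>x t. extend_zero \<psi> x * - h t)"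
      unfolding \<Theta>_def by (rule product_test_function[OF T C h])
    have iv: "set_integrable lborel (strip T) (\<lambda>(x, t). F x t * (extend_zero \<psi> x * - h t))"
      if "(\<lambda>(x, t). ?I x t * F x t) \<in> borel_measurable borel" "AE (x, t) in lborel. (x, t) \<in> strip T \<longrightarrow> \<bar>F x t\<bar> \<le> K" for F K
    proof (rule strip_bounded_mult_integrable[OF that(1) _ Pm(1) ab(1) Eb(1), where K=K and H=H])
      show "AE (x, t) in lborel. (x, t) \<in> strip T \<longrightarrow> x \<le> b \<longrightarrow> \<bar>F x t\<bar> \<le> K"
        using that(2) by eventually_elim auto
    qed (use hm H in auto)
    have \<Theta>_cong: "(\<lambda>(x, t). ?I x t *\<^sub>R (F x t * (p x * \<Theta> t))) = (\<lambda>(x, t). ?I x t *\<^sub>R (F x t * (p x * \<Theta>' t)))" for F and p :: "real \<Rightarrow> real"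
      by (auto simp: fun_eq_iff \<Theta>'_def strip_def split: split_indicator)
    have dm: "(\<lambda>(x, t). ?I x t * d x) \<in> borel_measurable borel"
    proof -
      have "continuous_on (strip T) (\<lambda>(x, t). d x)" unfolding case_prod_unfold
        by (rule continuous_on_compose2[OF dc]) (auto simp: strip_def intro!: continuous_intros)
      from strip_measurable_continuous[OF this] show ?thesis
        unfolding set_borel_measurable_def by (simp add: case_prod_unfold)
    qed
    have id: "set_integrable lborel (strip T) (\<lambda>(x, t). d x * (extend_zero (deriv \<psi>) x * \<Theta>' t))"
      by (rule strip_bounded_mult_integrable[OF dm _ Pm(2) ab(1) Eb(2) \<Theta>m \<Theta>b, where K=Hd])
         (use Hd in \<open>auto simp: strip_def intro!: AE_I2\<close>)
    have ig: "set_integrable lborel (strip T) (\<lambda>(x, t). (F x t + d x) * (extend_zero (deriv \<psi>) x * \<Theta> t))"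
      if "(\<lambda>(x, t). ?I x t * F x t) \<in> borel_measurable borel" "integrable lborel (\<lambda>(x, t). (?I x t * F x t)\<^sup>2)" for F
    proof -
      have "integrable lborel (\<lambda>(x, t). (?I x t * F x t) * (extend_zero (deriv \<psi>) x * \<Theta>' t))"
        by (rule strip_mult_integrable[OF that _ Pm(2) ab(1) Eb(2) \<Theta>m \<Theta>b]) auto
      then have "set_integrable lborel (strip T) (\<lambda>(x, t). F x t * (extend_zero (deriv \<psi>) x * \<Theta>' t))"
        unfolding set_integrable_def by (simp add: case_prod_unfold mult.assoc)
      from set_integral_add(1)[OF this id]
      have "set_integrable lborel (strip T) (\<lambda>(x, t). (F x t + d x) * (extend_zero (deriv \<psi>) x * \<Theta>' t))"
        by (simp add: case_prod_unfold distrib_right)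
      then show ?thesis unfolding set_integrable_def using \<Theta>_cong[of "\<lambda>x t. F x t + d x" "extend_zero (deriv \<psi>)"]
        by (simp add: case_prod_unfold)
    qed
    have "(LINT (x, t):strip T|lborel. v x t * (extend_zero \<psi> x * - h t)) - (LINT (x, t):strip T|lborel. w x t * (extend_zero \<psi> x * - h t))
      = (LINT (x, t):strip T|lborel. (g1 x t + d x) * (extend_zero (deriv \<psi>) x * \<Theta> t))
        - (LINT (x, t):strip T|lborel. (g2 x t + d x) * (extend_zero (deriv \<psi>) x * \<Theta> t))"
      using id1[OF tf] id2[OF tf] by linarith
    moreover have "(LINT (x, t):strip T|lborel. v x t * (extend_zero \<psi> x * - h t)) - (LINT (x, t):strip T|lborel. w x t * (extend_zero \<psi> x * - h t))
       = (LINT z|lborel. - (case z of (x, t) \<Rightarrow> W x t * (extend_zero \<psi> x * h t)))"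
      by (rule trans[OF set_integral_diff(2)[OF iv[OF v(1,2)] iv[OF w(1,2)], symmetric]],
          unfold set_lebesgue_integral_def, rule Bochner_Integration.integral_cong) (auto simp: W_def algebra_simps)
    moreover have "(LINT (x, t):strip T|lborel. (g1 x t + d x) * (extend_zero (deriv \<psi>) x * \<Theta> t))
        - (LINT (x, t):strip T|lborel. (g2 x t + d x) * (extend_zero (deriv \<psi>) x * \<Theta> t))
       = (LINT (x, t)|lborel. \<gamma> x t * (extend_zero (deriv \<psi>) x * \<Theta> t))"
      by (rule trans[OF set_integral_diff(2)[OF ig[OF g1(1,2)] ig[OF g2(1,2)], symmetric]],
          unfold set_lebesgue_integral_def, rule Bochner_Integration.integral_cong) (auto simp: \<gamma>_def algebra_simps)
    ultimately show "(LINT (x, t)|lborel. W x t * (extend_zero \<psi> x * h t))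
      = - (LINT (x, t)|lborel. \<gamma> x t * (extend_zero (deriv \<psi>) x * (LINT s:{t<..T}|lborel. h s)))"
      unfolding \<Theta>_def by simp
  qed (fact T Wm \<gamma>m W2 \<gamma>2)+
  have approx: "AE t in lborel. t \<in> {0<..<T} \<longrightarrow> (\<exists>\<psi>. (\<forall>n. C1c_halfline (\<psi> n)) \<and>
       (\<lambda>n::nat. LINT x:{0<..}|lborel. (\<psi> n x - z x t)\<^sup>2 + (deriv (\<psi> n) x - \<gamma> x t)\<^sup>2) \<longlonglongrightarrow> 0)"
    using g1(3) g2(3)
  proof eventually_elim
    case (elim t)
    show ?case
    proof
      assume t: "t \<in> {0<..<T}"
      define u1 where "u1 x = D (v x t) - D (what x)" for x
      define u2 where "u2 x = D (w x t) - D (what x)" for x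
      obtain \<psi>1 where 1: "\<And>n. C1c_halfline (\<psi>1 n)"
        "\<And>n. set_integrable lborel {0<..} (\<lambda>x. (\<psi>1 n x - u1 x)\<^sup>2 + (deriv (\<psi>1 n) x - g1 x t)\<^sup>2)"
        "(\<lambda>n::nat. LINT x:{0<..}|lborel. (\<psi>1 n x - u1 x)\<^sup>2 + (deriv (\<psi>1 n) x - g1 x t)\<^sup>2) \<longlonglongrightarrow> 0"
        using elim(1) t unfolding u1_def by blast
      obtain \<psi>2 where 2: "\<And>n. C1c_halfline (\<psi>2 n)"
        "\<And>n. set_integrable lborel {0<..} (\<lambda>x. (\<psi>2 n x - u2 x)\<^sup>2 + (deriv (\<psi>2 n) x - g2 x t)\<^sup>2)"
        "(\<lambda>n::nat. LINT x:{0<..}|lborel. (\<psi>2 n x - u2 x)\<^sup>2 + (deriv (\<psi>2 n) x - g2 x t)\<^sup>2) \<longlonglongrightarrow> 0"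
        using elim(2) t unfolding u2_def by blast
      define \<psi> where "\<psi> n x = \<psi>1 n x - \<psi>2 n x" for n x
      have C: "C1c_halfline (\<psi> n)" and dd: "0 < x \<Longrightarrow> deriv (\<psi> n) x = deriv (\<psi>1 n) x - deriv (\<psi>2 n) x" for n x
        using C1c_halfline_diff(1)[OF 1(1)[of n] 2(1)[of n]] C1c_halfline_diff(2)[OF 1(1)[of n] 2(1)[of n], of x]
        unfolding \<psi>_def[abs_def] by auto
      have le: "(LINT x:{0<..}|lborel. (\<psi> n x - z x t)\<^sup>2 + (deriv (\<psi> n) x - \<gamma> x t)\<^sup>2)
          \<le> 2 * (LINT x:{0<..}|lborel. (\<psi>1 n x - u1 x)\<^sup>2 + (deriv (\<psi>1 n) x - g1 x t)\<^sup>2)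
            + 2 * (LINT x:{0<..}|lborel. (\<psi>2 n x - u2 x)\<^sup>2 + (deriv (\<psi>2 n) x - g2 x t)\<^sup>2)" for n
      proof -
        let ?a = "\<lambda>x. indicator {0<..} x *\<^sub>R ((\<psi>1 n x - u1 x)\<^sup>2 + (deriv (\<psi>1 n) x - g1 x t)\<^sup>2)"
        let ?b = "\<lambda>x. indicator {0<..} x *\<^sub>R ((\<psi>2 n x - u2 x)\<^sup>2 + (deriv (\<psi>2 n) x - g2 x t)\<^sup>2)"
        have i: "integrable lborel ?a" "integrable lborel ?b" using 1(2)[of n] 2(2)[of n] unfolding set_integrable_def by auto
        have "(LINT x:{0<..}|lborel. (\<psi> n x - z x t)\<^sup>2 + (deriv (\<psi> n) x - \<gamma> x t)\<^sup>2)
            \<le> (LINT x|lborel. 2 * ?a x + 2 * ?b x)"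
          unfolding set_lebesgue_integral_def
        \<comment> \<open>A nonnegative integrable majorant is enough: were the left integrand not
          integrable, its integral would be 0.\<close>
        proof (rule integral_mono')
          show "integrable lborel (\<lambda>x. 2 * ?a x + 2 * ?b x)" using i by simp
          fix x :: real
          show "0 \<le> 2 * ?a x + 2 * ?b x" by (simp add: indicator_def)
          show "indicator {0<..} x *\<^sub>R ((\<psi> n x - z x t)\<^sup>2 + (deriv (\<psi> n) x - \<gamma> x t)\<^sup>2) \<le> 2 * ?a x + 2 * ?b x"
          proof (cases "0 < x")
            case True
            then have st: "?I x t = 1" using t by (simp add: strip_def)
            have zz: "\<psi> n x - z x t = (\<psi>1 n x - u1 x) - (\<psi>2 n x - u2 x)"
              unfolding \<psi>_def z_def u1_def u2_def st by simp
            have gg: "deriv (\<psi> n) x - \<gamma> x t = (deriv (\<psi>1 n) x - g1 x t) - (deriv (\<psi>2 n) x - g2 x t)"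
              unfolding dd[OF True] \<gamma>_def st by simp
            have sq: "(p - q)\<^sup>2 \<le> 2 * p\<^sup>2 + 2 * q\<^sup>2" for p q :: real
              using zero_le_power2[of "p + q"] unfolding power2_sum power2_diff by linarith
            show ?thesis using True sq[of "\<psi>1 n x - u1 x" "\<psi>2 n x - u2 x"]
              sq[of "deriv (\<psi>1 n) x - g1 x t" "deriv (\<psi>2 n) x - g2 x t"] unfolding zz gg by simp
          qed simp
        qed
        also have "\<dots> = 2 * (LINT x|lborel. ?a x) + 2 * (LINT x|lborel. ?b x)" using i by simp
        finally show ?thesis unfolding set_lebesgue_integral_def .
      qed
      have "(\<lambda>n. LINT x:{0<..}|lborel. (\<psi> n x - z x t)\<^sup>2 + (deriv (\<psi> n) x - \<gamma> x t)\<^sup>2) \<longlonglongrightarrow> 0"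
      proof (rule tendsto_sandwich[OF _ _ tendsto_const])
        show "(\<lambda>n. 2 * (LINT x:{0<..}|lborel. (\<psi>1 n x - u1 x)\<^sup>2 + (deriv (\<psi>1 n) x - g1 x t)\<^sup>2)
            + 2 * (LINT x:{0<..}|lborel. (\<psi>2 n x - u2 x)\<^sup>2 + (deriv (\<psi>2 n) x - g2 x t)\<^sup>2)) \<longlonglongrightarrow> 0"
          using tendsto_add[OF tendsto_mult[OF tendsto_const[of 2] 1(3)] tendsto_mult[OF tendsto_const[of 2] 2(3)]] by simp
        show "\<forall>\<^sub>F n in sequentially. 0 \<le> (LINT x:{0<..}|lborel. (\<psi> n x - z x t)\<^sup>2 + (deriv (\<psi> n) x - \<gamma> x t)\<^sup>2)"
          unfolding set_lebesgue_integral_def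
          by (intro always_eventually allI Bochner_Integration.integral_nonneg) (simp add: indicator_def)
      qed (use le in auto)
      then show "\<exists>\<psi>. (\<forall>n. C1c_halfline (\<psi> n)) \<and>
       (\<lambda>n::nat. LINT x:{0<..}|lborel. (\<psi> n x - z x t)\<^sup>2 + (deriv (\<psi> n) x - \<gamma> x t)\<^sup>2) \<longlonglongrightarrow> 0"
        using C by blast
    qed
  qed
  note fin = integral_mult_nonpos[OF zm z2 approx]
  have nn: "0 \<le> (case p of (x, t) \<Rightarrow> W x t * z x t)" for p
  proof (cases p)
    case (Pair x t)
    have "0 \<le> (v x t - w x t) * (D (v x t) - D (w x t))"
      using D_strict_mono[of "v x t" "w x t"] D_strict_mono[of "w x t" "v x t"]
      by (cases "v x t" "w x t" rule: linorder_cases) (auto intro: mult_nonneg_nonneg mult_nonpos_nonpos)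
    then show ?thesis using Pair unfolding W_def z_def by (simp add: indicator_def)
  qed
  have "0 \<le> (LINT (x, t)|lborel. W x t * z x t)" by (rule Bochner_Integration.integral_nonneg) (rule nn)
  then have "(LINT (x, t)|lborel. W x t * z x t) = 0" using fin(2) by simp
  then have "AE p in lborel. (case p of (x, t) \<Rightarrow> W x t * z x t) = 0"
    using integral_nonneg_eq_0_iff_AE[OF fin(1)] nn by simp
  then show ?thesis
  proof eventually_elim
    case (elim p)
    obtain x t where e: "p = (x, t)" by (cases p)
    show ?case
    proof (cases "(x, t) \<in> strip T")
      case True
      then have "(v x t - w x t) * (D (v x t) - D (w x t)) = 0" using elim unfolding e W_def z_def by simp
      then have "v x t = w x t"
        using D_strict_mono[of "v x t" "w x t"] D_strict_mono[of "w x t" "v x t"]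
        by (cases "v x t" "w x t" rule: linorder_cases) auto
      then show ?thesis unfolding e by simp
    qed (simp add: e)
  qed
qed

end

section \<open>The main theorem\<close>

text \<open>The two branches join differentiably at \<open>0\<close> because
  \<open>deriv \<phi> 0 = 0\<close>. Off \<open>0\<close> positivity of the derivative is strict
  monotonicity of \<open>deriv \<phi>\<close> starting from that value.\<close>

lemma two_phase_diffusivity:
  fixes \<phi> :: "real \<Rightarrow> real"
  assumes "Ck_on 2 UNIV \<phi>" and mono: "strict_mono_on {0..} (deriv \<phi>)"
    and "\<phi> 0 = 0" and d0: "deriv \<phi> 0 = 0" and "\<epsilon> > 0" "U > 0" "V > 0"
  obtains D'' where "two_phase (diffusivity \<phi> \<epsilon>) (\<lambda>s. if 0 \<le> s then deriv \<phi> s else \<epsilon> * deriv \<phi> (- s)) D'' U V"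
proof -
  obtain F :: "nat \<Rightarrow> real \<Rightarrow> real" where F': "\<forall>x. F 0 x = \<phi> x"
    "\<forall>i<2. \<forall>x. (F i has_real_derivative F (Suc i) x) (at x)" "\<forall>i\<le>2. continuous_on UNIV (F i)"
    using assms(1) unfolding Ck_on_def by auto
  have F: "F 0 x = \<phi> x" "(F 0 has_real_derivative F 1 x) (at x)"
    "(F 1 has_real_derivative F 2 x) (at x)" "continuous_on UNIV (F 2)" for x
    using F'(1) F'(2)[rule_format, of 0 x] F'(2)[rule_format, of 1 x] F'(3) by (simp_all add: numeral_2_eq_2)
  have F0: "F 0 = \<phi>" using F(1) by auto
  have d: "(\<phi> has_real_derivative F 1 x) (at x)" for x using F(2) unfolding F0 .
  have dd: "deriv \<phi> = F 1" using DERIV_imp_deriv[OF d] by auto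
  have F1c: "continuous_on S (F 1)" for S
    by (rule DERIV_continuous_on[OF has_field_derivative_at_within[OF F(3)]])
  have pos: "0 < F 1 s" if "0 < s" for s
    using strict_mono_onD[OF mono, of 0 s] that d0 unfolding dd by simp
  define D where "D = diffusivity \<phi> \<epsilon>"
  define D' where "D' s = (if 0 \<le> s then F 1 s else \<epsilon> * F 1 (- s))" for s
  define D'' where "D'' s = (if 0 < s then F 2 s else - \<epsilon> * F 2 (- s))" for s
  have neg: "((\<lambda>s. G (- s)) has_real_derivative - g) (at s)"
    if "(G has_real_derivative g) (at (- s))" for G g and s :: real
    using DERIV_chain2[where f=G and g="\<lambda>s. - s" and x=s, OF that DERIV_minus[OF DERIV_ident]] by simp
  have "two_phase D D' D'' U V"
  proof
    fix s :: real
    show "(D has_real_derivative D' s) (at s)"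
    proof (cases s "0 :: real" rule: linorder_cases)
      case less
      have "((\<lambda>s. - \<epsilon> * \<phi> (- s)) has_real_derivative - \<epsilon> * - F 1 (- s)) (at s)"
        by (rule DERIV_cmult[OF neg[OF d]])
      then have "(D has_real_derivative - \<epsilon> * - F 1 (- s)) (at s)"
        by (rule has_field_derivative_transform_within_open[where S="{..<0}"])
           (use less in \<open>auto simp: D_def diffusivity_def\<close>)
      then show ?thesis using less unfolding D'_def by simp
    next
      case greater
      have "(D has_real_derivative F 1 s) (at s)"
        by (rule has_field_derivative_transform_within_open[OF d, where S="{0<..}"])
           (use greater in \<open>auto simp: D_def diffusivity_def\<close>)
      then show ?thesis using greater unfolding D'_def by simp
    next
      case equal
      have "((\<lambda>h. (\<phi> (0 + h) - \<phi> 0) / h) \<longlongrightarrow> 0) (at 0)"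
        using d[of 0] d0 unfolding dd DERIV_def by simp
      then have q: "((\<lambda>h. \<phi> h / h) \<longlongrightarrow> 0) (at 0)" using assms(3) by simp
      \<comment> \<open>Passing to \<open>\<bar>h\<bar>\<close> treats both branches at once:
        \<open>\<bar>D h\<bar>\<close> is at most \<open>1 + \<epsilon>\<close> times
        \<open>\<bar>\<phi> \<bar>h\<bar>\<bar>\<close>.\<close>
      have "filterlim (\<lambda>h::real. \<bar>h\<bar>) (at 0) (at 0)"
        unfolding filterlim_at by (auto intro!: tendsto_eq_intros simp: eventually_at_filter)
      from filterlim_compose[OF q this] have q': "((\<lambda>h. \<phi> \<bar>h\<bar> / \<bar>h\<bar>) \<longlongrightarrow> 0) (at 0)" .
      have "((\<lambda>h. (D (0 + h) - D 0) / h) \<longlongrightarrow> 0) (at 0)"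
      proof (rule Lim_null_comparison)
        show "((\<lambda>h. (1 + \<epsilon>) * \<bar>\<phi> \<bar>h\<bar> / \<bar>h\<bar>\<bar>) \<longlongrightarrow> 0) (at 0)"
          using tendsto_mult[OF tendsto_const[of "1 + \<epsilon>"] tendsto_rabs_zero[OF q']] by simp
        have "norm ((D (0 + h) - D 0) / h) \<le> (1 + \<epsilon>) * \<bar>\<phi> \<bar>h\<bar> / \<bar>h\<bar>\<bar>" for h
        proof -
          have "\<bar>D h\<bar> \<le> (1 + \<epsilon>) * \<bar>\<phi> \<bar>h\<bar>\<bar>"
            using assms(5) unfolding D_def diffusivity_def by (auto simp: abs_mult mult_right_mono algebra_simps)
          then have "\<bar>D h\<bar> / \<bar>h\<bar> \<le> (1 + \<epsilon>) * \<bar>\<phi> \<bar>h\<bar>\<bar> / \<bar>h\<bar>" by (rule divide_right_mono) simp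
          moreover have "D 0 = 0" unfolding D_def diffusivity_def using assms(3) by simp
          ultimately show ?thesis by simp
        qed
        then show "\<forall>\<^sub>F h in at 0. norm ((D (0 + h) - D 0) / h) \<le> (1 + \<epsilon>) * \<bar>\<phi> \<bar>h\<bar> / \<bar>h\<bar>\<bar>"
          by (intro always_eventually allI)
      qed
      then show ?thesis using equal d0 unfolding DERIV_def D'_def dd by simp
    qed
    show "0 < D' s" if "s \<noteq> 0" using that pos[of s] pos[of "- s"] assms(5) unfolding D'_def by auto
    show "(D' has_real_derivative D'' s) (at s)" if "s \<noteq> 0"
    proof (cases "0 < s")
      case True
      have "(D' has_real_derivative F 2 s) (at s)"
        by (rule has_field_derivative_transform_within_open[OF F(3), where S="{0<..}"])
           (use True in \<open>auto simp: D'_def\<close>)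
      then show ?thesis using True unfolding D''_def by simp
    next
      case False
      then have s: "s < 0" using that by simp
      have "((\<lambda>s. \<epsilon> * F 1 (- s)) has_real_derivative \<epsilon> * - F 2 (- s)) (at s)"
        by (rule DERIV_cmult[OF neg[OF F(3)]])
      then have "(D' has_real_derivative \<epsilon> * - F 2 (- s)) (at s)"
        by (rule has_field_derivative_transform_within_open[where S="{..<0}"])
           (use s in \<open>auto simp: D'_def\<close>)
      then show ?thesis using s unfolding D''_def by simp
    qed
    show "continuous_on UNIV D'"
    proof -
      \<comment> \<open>Correct because \<open>F 1 0 = 0\<close>: the inactive branch contributes
        nothing, and continuity needs no gluing.\<close>
      have "D' = (\<lambda>s. F 1 (max s 0) + \<epsilon> * F 1 (max (- s) 0))"
        using d0 unfolding dd D'_def by (auto simp: fun_eq_iff max_def)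
      moreover have "continuous_on UNIV (\<lambda>s. F 1 (max s 0) + \<epsilon> * F 1 (max (- s) 0))"
        by (intro continuous_intros continuous_on_compose2[OF F1c[of UNIV]]) auto
      ultimately show ?thesis by simp
    qed
    show "continuous_on (- {0}) D''"
    proof -
      have "continuous_on {0<..} D''"
        by (rule continuous_on_cong[THEN iffD2, OF refl _ continuous_on_subset[OF F(4)]]) (auto simp: D''_def)
      moreover have "continuous_on {..<0} (\<lambda>s. - \<epsilon> * F 2 (- s))"
        by (intro continuous_intros continuous_on_compose2[OF F(4)]) auto
      then have "continuous_on {..<0} D''"
        by (rule continuous_on_cong[THEN iffD2, OF refl, rotated]) (auto simp: D''_def)
      ultimately have "continuous_on ({0<..} \<union> {..<0}) D''" by (intro continuous_on_open_Un) auto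
      moreover have "{0<..} \<union> {..<0} = - {0 :: real}" by auto
      ultimately show ?thesis by simp
    qed
  qed (use d0 assms in \<open>auto simp: D'_def dd D_def diffusivity_def\<close>)
  moreover have "D' = (\<lambda>s. if 0 \<le> s then deriv \<phi> s else \<epsilon> * deriv \<phi> (- s))" unfolding D'_def dd ..
  ultimately show ?thesis using that[of D''] unfolding D_def by simp
qed

context two_phase
begin

text \<open>Away from zeros of \<open>f\<close> the formula \<open>- Q / D' (f)\<close> is a
  quotient of differentiable functions, so the first-order relations for \<open>f\<close> and
  \<open>Q\<close> already yield a continuous second derivative.\<close>

lemma profile_Ck2:
  assumes S: "open S" and fnz: "\<And>\<eta>. \<eta> \<in> S \<Longrightarrow> f \<eta> \<noteq> 0"
    and fd: "\<And>\<eta>. \<eta> \<in> S \<Longrightarrow> (f has_real_derivative - Q \<eta> / D' (f \<eta>)) (at \<eta>)"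
    and Qd: "\<And>\<eta>. \<eta> \<in> S \<Longrightarrow> (Q has_real_derivative - \<eta> * Q \<eta> / (2 * D' (f \<eta>))) (at \<eta>)"
  shows "Ck_on 2 S f"
proof -
  have fc: "continuous_on S f" by (rule DERIV_continuous_on[OF has_field_derivative_at_within[OF fd]])
  have Qc: "continuous_on S Q" by (rule DERIV_continuous_on[OF has_field_derivative_at_within[OF Qd]])
  have D'nz: "D' (f \<eta>) \<noteq> 0" if "\<eta> \<in> S" for \<eta> using D'_pos[OF fnz[OF that]] by simp
  have c1: "continuous_on S (\<lambda>\<eta>. D' (f \<eta>))" by (rule continuous_on_compose2[OF D'_cont fc]) auto
  have c2: "continuous_on S (\<lambda>\<eta>. D'' (f \<eta>))" by (rule continuous_on_compose2[OF D''_cont fc]) (use fnz in auto)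
  define f1 where "f1 \<eta> = - Q \<eta> / D' (f \<eta>)" for \<eta>
  define f2 where "f2 \<eta> = (- (- \<eta> * Q \<eta> / (2 * D' (f \<eta>))) * D' (f \<eta>) - (- Q \<eta>) * (D'' (f \<eta>) * f1 \<eta>)) / (D' (f \<eta>) * D' (f \<eta>))" for \<eta>
  have d1: "(f1 has_real_derivative f2 \<eta>) (at \<eta>)" if \<eta>: "\<eta> \<in> S" for \<eta>
    unfolding f2_def f1_def[abs_def]
    by (rule DERIV_divide[OF DERIV_minus[OF Qd[OF \<eta>]] DERIV_chain2[OF D'_deriv[OF fnz[OF \<eta>]] fd[OF \<eta>]] D'nz[OF \<eta>]])
  have f1c: "continuous_on S f1" by (rule DERIV_continuous_on[OF has_field_derivative_at_within[OF d1]])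
  have f2c: "continuous_on S f2" unfolding f2_def
    by (intro continuous_intros Qc c1 c2 f1c) (use D'nz in auto)
  show ?thesis
    unfolding Ck_on_def
  proof (intro exI[of _ "\<lambda>i. if i = 0 then f else if i = 1 then f1 else f2"] conjI allI ballI impI)
    fix i \<eta> assume i: "i < (2::nat)" and \<eta>: "\<eta> \<in> S"
    then consider "i = 0" | "i = 1" by linarith
    then show "((if i = 0 then f else if i = 1 then f1 else f2) has_real_derivative
        (if Suc i = 0 then f else if Suc i = 1 then f1 else f2) \<eta>) (at \<eta> within S)"
      using has_field_derivative_at_within[OF fd[OF \<eta>]] has_field_derivative_at_within[OF d1[OF \<eta>]]
      by cases (auto simp: f1_def)
  qed (use fc f1c f2c in auto)
qed

end

theorem theorem2p4:
  fixes \<phi> what :: "real \<Rightarrow> real" and \<epsilon> T U\<^sub>0 V\<^sub>0 :: real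
  assumes "Ck_on 2 UNIV \<phi>"
    and "strict_mono_on {0..} \<phi>"
    and "strict_mono_on {0..} (deriv \<phi>)"
    and "\<And>s. s > 0 \<Longrightarrow> \<phi> s > 0"
    and "\<phi> 0 = 0" and "deriv \<phi> 0 = 0"
    and "(\<integral>\<^sup>+s\<in>{0<..1}. ennreal (deriv \<phi> s / s) \<partial>lborel) < \<infinity>"
    and "(\<integral>\<^sup>+s\<in>{1..}. ennreal (deriv \<phi> s / s) \<partial>lborel) = \<infinity>"
    and "\<epsilon> > 0" and "T > 0" and "U\<^sub>0 > 0" and "V\<^sub>0 > 0"
    and "smooth_on {0..} what" and "what 0 = U\<^sub>0" and "\<And>x. x > 1 \<Longrightarrow> what x = - V\<^sub>0"
  shows "\<exists>w. weak_solution \<phi> \<epsilon> T V\<^sub>0 what w \<and>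
           (\<forall>v. weak_solution \<phi> \<epsilon> T V\<^sub>0 what v \<longrightarrow>
              (AE (x, t) in lborel. (x, t) \<in> strip T \<longrightarrow> v x t = w x t)) \<and>
           (\<exists>f a. a > 0 \<and>
              (\<forall>(x, t)\<in>strip T. w x t = f (x / sqrt t)) \<and>
              free_boundary T w (\<lambda>t. a * sqrt t) \<and>
              profile_solution \<phi> \<epsilon> U\<^sub>0 V\<^sub>0 a f)"
proof -
  define D where "D = diffusivity \<phi> \<epsilon>"
  define D' where "D' = (\<lambda>s. if 0 \<le> s then deriv \<phi> s else \<epsilon> * deriv \<phi> (- s))"
  obtain D'' where tp: "two_phase D D' D'' U\<^sub>0 V\<^sub>0"
    unfolding D_def D'_def
    by (rule two_phase_diffusivity[OF assms(1,3,5,6,9,11,12)]) blast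
  interpret two_phase D D' D'' U\<^sub>0 V\<^sub>0 by (rule tp)
  obtain f Q a where a: "0 < a" and f0: "f 0 = U\<^sub>0" and fc: "continuous_on {0..} f" and Qc: "continuous_on {0..} Q"
    and lim: "(f \<longlongrightarrow> - V\<^sub>0) at_top" and fpos: "\<And>\<eta>. 0 \<le> \<eta> \<Longrightarrow> \<eta> < a \<Longrightarrow> 0 < f \<eta>" and fa: "f a = 0"
    and fneg: "\<And>\<eta>. a < \<eta> \<Longrightarrow> f \<eta> < 0"
    and fgt: "\<And>\<eta>. 0 \<le> \<eta> \<Longrightarrow> - V\<^sub>0 < f \<eta>" and fle: "\<And>\<eta>. 0 \<le> \<eta> \<Longrightarrow> f \<eta> \<le> U\<^sub>0"
    and Qpos: "\<And>\<eta>. 0 \<le> \<eta> \<Longrightarrow> 0 < Q \<eta>" and Qle: "\<And>\<eta>. 0 \<le> \<eta> \<Longrightarrow> Q \<eta> \<le> Q 0"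
    and tail: "\<And>\<eta>. 0 \<le> \<eta> \<Longrightarrow> \<eta> * (f \<eta> + V\<^sub>0) / 2 \<le> Q \<eta>"
    and fd: "\<And>\<eta>. 0 < \<eta> \<Longrightarrow> \<eta> \<noteq> a \<Longrightarrow> (f has_real_derivative - Q \<eta> / D' (f \<eta>)) (at \<eta>)"
    and Qd: "\<And>\<eta>. 0 < \<eta> \<Longrightarrow> \<eta> \<noteq> a \<Longrightarrow> (Q has_real_derivative - \<eta> * Q \<eta> / (2 * D' (f \<eta>))) (at \<eta>)"
    and Dfd: "\<And>\<eta>. 0 < \<eta> \<Longrightarrow> ((\<lambda>\<eta>. D (f \<eta>)) has_real_derivative - Q \<eta>) (at \<eta>)"
    and Md: "\<And>\<eta>. 0 < \<eta> \<Longrightarrow> ((\<lambda>\<eta>. Q \<eta> - \<eta> * f \<eta> / 2) has_real_derivative - f \<eta> / 2) (at \<eta>)"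
    by (rule profile_exists) blast
  interpret similarity_profile D D' D'' U\<^sub>0 V\<^sub>0 f Q
    by unfold_locales (fact f0 fc Qc lim fgt fle Qpos Qle tail Dfd Md)+
  have "Ck_on 1 {0..} what" using assms(13) unfolding smooth_on_def by blast
  then obtain F where F: "\<forall>x\<in>{0..}. F 0 x = what x"
    "\<forall>x\<in>{0..}. (F 0 has_real_derivative F (Suc 0) x) (at x within {0..})" "continuous_on {0..} (F 0)" "continuous_on {0..} (F (Suc 0))"
    unfolding Ck_on_def by (metis One_nat_def le_refl less_one zero_le)
  have whatc: "continuous_on {0..} what" using F(1,3) by (metis (no_types, lifting) continuous_on_cong)
  have whatd: "(what has_real_derivative F (Suc 0) x) (at x)" if x: "0 < x" for x
  proof (rule has_field_derivative_transform_within_open[where S="{0<..}" and f="F 0"])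
    show "(F 0 has_real_derivative F (Suc 0) x) (at x)"
      using bspec[OF F(2), of x] x at_within_interior[of x "{0..}"] by simp
  qed (use x F(1) in auto)
  \<comment> \<open>Hence \<open>d\<close> vanishes beyond 1, as \<open>sol_L2_W12_0\<close>
    requires.\<close>
  have what1: "F (Suc 0) x = 0" if x: "1 < x" for x
  proof -
    have "(what has_real_derivative 0) (at x)"
      by (rule has_field_derivative_transform_within_open[where S="{1<..}" and f="\<lambda>_. - V\<^sub>0"]) (use x assms(15) in auto)
    then show ?thesis using DERIV_unique[OF whatd] x by simp
  qed
  define e where "e x = D (what x)" for x
  define d where "d x = D' (what x) * F (Suc 0) x" for x
  have ec: "continuous_on {0..} e" unfolding e_def by (rule continuous_on_compose2[OF D_cont[of UNIV] whatc]) auto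
  have ed: "(e has_real_derivative d x) (at x)" if "0 < x" for x
    unfolding e_def[abs_def] d_def by (rule DERIV_chain2[OF D_deriv whatd[OF that]])
  have dc: "continuous_on {0..} d" unfolding d_def
    by (intro continuous_intros continuous_on_compose2[OF D'_cont whatc] F(4)) auto
  have Dd: "diffusivity \<phi> \<epsilon> = D" unfolding D_def ..
  have weak: "weak_solution \<phi> \<epsilon> T V\<^sub>0 what sol"
    unfolding weak_solution_def Dd
  proof (intro conjI exI[of _ flux] allI impI)
    show "Linf_on (strip T) (\<lambda>(x, t). sol x t)" by (rule sol_Linf)
    show "weak_dx T (\<lambda>x t. D (sol x t)) flux" by (rule sol_weak_dx)
    have "L2_W12_0 T (\<lambda>x t. D (sol x t) - e x)"
      by (rule sol_L2_W12_0[OF ec ed dc]) (use assms(14,15) what1 in \<open>auto simp: e_def d_def\<close>)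
    then show "L2_W12_0 T (\<lambda>x t. D (sol x t) - D (what x))" unfolding e_def .
  qed (rule weak_identity[OF assms(10)])
  have unique: "AE (x, t) in lborel. (x, t) \<in> strip T \<longrightarrow> v x t = sol x t"
    if "weak_solution \<phi> \<epsilon> T V\<^sub>0 what v" for v
    by (rule weak_solution_unique[OF assms(10) Dd that weak assms(15) ed[unfolded e_def[abs_def]] dc])
  have fb: "free_boundary T sol (\<lambda>t. a * sqrt t)"
    unfolding free_boundary_def
  proof (intro ballI, clarify, intro conjI impI)
    fix x t assume xt: "(x, t) \<in> strip T"
    then have x: "0 \<le> x" "0 < sqrt t" unfolding strip_def by auto
    show "0 < sol x t" if "x < a * sqrt t"
      unfolding sol_def using that x by (intro fpos) (auto simp: divide_less_eq)
    show "sol x t < 0" if "a * sqrt t < x"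
      unfolding sol_def using that x by (intro fneg) (auto simp: less_divide_eq)
  qed
  have fz: "f \<eta> \<noteq> 0" if "0 < \<eta>" "\<eta> \<noteq> a" for \<eta>
    using fpos[of \<eta>] fneg[of \<eta>] that by (cases \<eta> a rule: linorder_cases) auto
  have df: "deriv f \<eta> = - Q \<eta> / D' (f \<eta>)" if "0 < \<eta>" "\<eta> \<noteq> a" for \<eta>
    by (rule DERIV_imp_deriv[OF fd[OF that]])
  have Dnz: "D' (f \<eta>) \<noteq> 0" if "0 < \<eta>" "\<eta> \<noteq> a" for \<eta> using D'_pos[OF fz[OF that]] by simp
  \<comment> \<open>In both phases the bracket of the system is \<open>- Q\<close>. The two
    equations thus reduce to the derivative of \<open>Q\<close>, and the flux condition to its
    continuity at \<open>a\<close>.\<close>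
  have flux_l: "deriv \<phi> (f \<eta>) * deriv f \<eta> = - Q \<eta>" if "0 < \<eta>" "\<eta> < a" for \<eta>
    using df[of \<eta>] Dnz[of \<eta>] fpos[of \<eta>] that unfolding D'_def by simp
  have flux_r: "\<epsilon> * deriv \<phi> (- f \<eta>) * deriv f \<eta> = - Q \<eta>" if "a < \<eta>" for \<eta>
    using df[of \<eta>] Dnz[of \<eta>] fneg[of \<eta>] that a unfolding D'_def by simp
  have Qd': "((\<lambda>y. - Q y) has_real_derivative - (1/2) * \<eta> * deriv f \<eta>) (at \<eta>)" if "0 < \<eta>" "\<eta> \<noteq> a" for \<eta>
    by (rule DERIV_cong[OF DERIV_minus[OF Qd[OF that]]]) (simp add: df[OF that])
  have cont_a: "isCont f a" "isCont Q a"
    using continuous_on_interior[OF fc, of a] continuous_on_interior[OF Qc, of a] a by simp_all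
  have prof: "profile_solution \<phi> \<epsilon> U\<^sub>0 V\<^sub>0 a f"
    unfolding profile_solution_def
  proof (intro conjI ballI)
    show "Ck_on 2 {0<..<a} f" by (rule profile_Ck2[OF _ fz fd Qd]) auto
    show "Ck_on 2 {a<..} f" by (rule profile_Ck2[OF _ fz fd Qd]) (use a in auto)
    show "((\<lambda>y. deriv \<phi> (f y) * deriv f y) has_real_derivative - (1/2) * \<eta> * deriv f \<eta>) (at \<eta>)" if "\<eta> \<in> {0<..<a}" for \<eta>
      by (rule has_field_derivative_transform_within_open[OF Qd', where S="{0<..<a}"]) (use that flux_l in auto)
    show "((\<lambda>y. \<epsilon> * deriv \<phi> (- f y) * deriv f y) has_real_derivative - (1/2) * \<eta> * deriv f \<eta>) (at \<eta>)" if "\<eta> \<in> {a<..}" for \<eta>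
      by (rule has_field_derivative_transform_within_open[OF Qd', where S="{a<..}"]) (use that flux_r a in auto)
    have fa': "(f \<longlongrightarrow> 0) (at a)" using cont_a(1) fa unfolding isCont_def by simp
    show "(f \<longlongrightarrow> 0) (at_left a)" "(f \<longlongrightarrow> 0) (at_right a)"
      using fa' by (auto intro: tendsto_within_subset)
    have Qa: "((\<lambda>\<eta>. - Q \<eta>) \<longlongrightarrow> - Q a) (at a)" using cont_a(2) unfolding isCont_def by (rule tendsto_minus)
    have Ql: "((\<lambda>\<eta>. - Q \<eta>) \<longlongrightarrow> - Q a) (at_left a)" by (rule tendsto_within_subset[OF Qa subset_UNIV])
    have "((\<lambda>\<eta>. - Q \<eta> / \<epsilon>) \<longlongrightarrow> - Q a / \<epsilon>) (at a)" using tendsto_divide[OF Qa tendsto_const] assms(9) by simp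
    then have Qr: "((\<lambda>\<eta>. - Q \<eta> / \<epsilon>) \<longlongrightarrow> - Q a / \<epsilon>) (at_right a)" by (rule tendsto_within_subset) simp
    have l: "((\<lambda>\<eta>. deriv \<phi> (f \<eta>) * deriv f \<eta>) \<longlongrightarrow> - Q a) (at_left a)"
    proof (rule Lim_transform_eventually[OF Ql])
      show "\<forall>\<^sub>F \<eta> in at_left a. - Q \<eta> = deriv \<phi> (f \<eta>) * deriv f \<eta>"
        using eventually_at_left_real[OF a] by eventually_elim (simp add: flux_l)
    qed
    have r: "((\<lambda>\<eta>. deriv \<phi> (- f \<eta>) * deriv f \<eta>) \<longlongrightarrow> - Q a / \<epsilon>) (at_right a)"
    proof (rule Lim_transform_eventually[OF Qr])
      show "\<forall>\<^sub>F \<eta> in at_right a. - Q \<eta> / \<epsilon> = deriv \<phi> (- f \<eta>) * deriv f \<eta>"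
        using eventually_at_right_less[of a]
      proof eventually_elim
        case (elim \<eta>)
        show ?case using flux_r[OF elim] assms(9) by (simp add: field_simps)
      qed
    qed
    show "\<exists>l r. ((\<lambda>\<eta>. deriv \<phi> (f \<eta>) * deriv f \<eta>) \<longlongrightarrow> l) (at_left a) \<and>
            ((\<lambda>\<eta>. deriv \<phi> (- f \<eta>) * deriv f \<eta>) \<longlongrightarrow> r) (at_right a) \<and> l = \<epsilon> * r"
      using l r assms(9) by (intro exI[of _ "- Q a"] exI[of _ "- Q a / \<epsilon>"]) simp
  qed (use fc fpos fneg f0 lim in auto)
  show ?thesis
  proof (intro exI[of _ sol] conjI allI impI exI[of _ f] exI[of _ a])
    show "\<forall>(x, t)\<in>strip T. sol x t = f (x / sqrt t)" unfolding sol_def by auto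
  qed (fact weak unique a fb prof)+
qed

end
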